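(* Let $d\geq2$, $m\geq2$, $p>1$. Suppose that $D_1,D_2\subset D\subseteq\mathbb R^d$ are as described in the context, and that the functions $h_1,h_2$ satisfy the conditions (H1)–(H3) stated there with constants $\kappa_1,\dots,\kappa_4>0$. Let $\tilde c_0,R_{0,1},R_{0,2},R_{0,3}$ be the constants defined in the context; in particular $$R_{0,3}=\Big(\tfrac{12}{13}\tilde c_0\mu_0^{j_0}\Big)^{\frac1{m-1}}\kappa_2^{-1/m},\qquad j_0=\Big[\tfrac{6d}{\min\{p,2\}}\Big]+1,$$ with $\mu_0$ given by the formula in the context. Let $u\in W^{1,p}(\Omega_{2R_0})$ be the solution of $$-\mathrm{div}(|\nabla u|^{p-2}\nabla u)=0\ \text{ in }\Omega_{2R_0},\qquad \frac{\partial u}{\partial\nu}=0\ \text{ on }\Gamma^\pm_{2R_0}.$$ If $0<R_0\leq\min\{R_{0,1},R_{0,2},R_{0,3}\}$, then for a sufficiently small $\varepsilon>0$ and $x\in\Omega_{R_0}$, $$|\nabla u(x)|\leq C(\varepsilon+|x'|^m)^{-1/m}\mathop{\mathrm{osc}}_{\Omega_{x',\varrho}}u,\qquad \varrho=\frac{\tilde c_0}{3}\,\delta^{1/m},\quad \delta=\delta(x'),$$ where $C=C(d,m,p,\kappa_1,\kappa_3,\kappa_4)$.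
   Context: Notation: $x=(x',x_d)\in\mathbb R^{d-1}\times\mathbb R$; $B_r(x)$ is the ball of radius $r$ centered at $x$, $B_r=B_r(0)$; $B'_t$ is the ball of radius $t$ centered at $0'$ in $\mathbb R^{d-1}$; $[s]$ is the integer part of $s$; $C^m:=C^{[m],m-[m]}$; $\mathrm{osc}_Su=\sup_Su-\inf_Su$; $\nu$ is the unit outer normal to the domain; ⨍$_S$ denotes the average over $S$ and $(f)_S$ the average of $f$ over $S$. Geometry: $D\subseteq\mathbb R^d$ is a bounded domain with $C^{1,1}$ boundary containing two $C^{1,1}$ inclusions $D_1=D_1^*+(0',\varepsilon/2)$, $D_2=D_2^*+(0',-\varepsilon/2)$, where $D_i^*\subset\{(-1)^{i+1}x_d>0\}$, $\partial D_1^*\cap\partial D_2^*=\{0\}$, $\varepsilon>0$ is a sufficiently small constant, and $D_1,D_2$ are far from $\partial D$. Set $\Omega=D\setminus\overline{D_1\cup D_2}$ and $\Omega_r(x)=\Omega\cap B_r(x)$. For some $R_0>0$ independent of $\varepsilon$, the portions of $\partial D_1,\partial D_2$ near the origin are the graphs of two $C^m$ functions $\varepsilon/2+h_1(x')$ and $-\varepsilon/2+h_2(x')$, where, with positive constants $\kappa_1,\dots,\kappa_4$ independent of $\varepsilon$: (H1) $\kappa_1|x'|^m\leq h_1(x')-h_2(x')\leq\kappa_2|x'|^m$ for $x'\in B'_{2R_0}$; (H2) $|\nabla_{x'}h_i(x')|\leq\kappa_3|x'|^{m-1}$ for $x'\in B'_{2R_0}$, $i=1,2$; (H3) $\|h_1\|_{C^m(B'_{2R_0})}+\|h_2\|_{C^m(B'_{2R_0})}\leq\kappa_4$.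 For $z'\in B'_{R_0}$, $0<t\leq2R_0$: $\Omega_{z',t}=\{x:|x'-z'|<t,\ -\varepsilon/2+h_2(x')<x_d<\varepsilon/2+h_1(x')\}$, $\Omega_t=\Omega_{0',t}$, $\Gamma_t^+=\{x_d=\varepsilon/2+h_1(x'),\ |x'|<t\}$, $\Gamma_t^-=\{x_d=-\varepsilon/2+h_2(x'),\ |x'|<t\}$. For $x'\in B'_{2R_0}$, $\delta(x')=\varepsilon+h_1(x')-h_2(x')$. Explicit constants: $c_0=\kappa_1^{-1/m}\min\{1,2^{-(m+1)}\kappa_1\kappa_3^{-1}\}$, $\tilde c_0=\kappa_1^{-1/m}\min\{1,\kappa_1\kappa_3^{-1}(51840+4^{m+1})^{-1/2}\}$, $R_{0,1}=2^{-\frac m{m-1}}(\kappa_2\kappa_3)^{-\frac1{2m-2}}\min\Big\{1,\dfrac{(\kappa_1^{1/m}c_0)^{\frac1{2m-2}}}{2^{\frac1{m-1}}},\dfrac{(\kappa_1\kappa_3^{-1})^{\frac1{2m-2}}}{2^{\frac{2m-1}{2m-2}}}\Big\}$, $R_{0,2}=\min\{2^{-\frac{2m+1}{2m-1}}\kappa_3^{-\frac1{m-1}},(\sqrt2\kappa_2\kappa_4(d-1)^2)^{-\frac1m}\}$, $\overline R_0=(\tfrac{12}{13}\tilde c_0)^{\frac1{m-1}}\kappa_2^{-1/m}$ (auxiliary), $\theta=\min\{1,2/p\}$. The constant $\mu_0$: set $$\mu^*=\min\Big\{\tfrac23\min_{1\leq i\leq3}\mu_i,\ (2\overline C_1)^{-\frac1\alpha},\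 \Big(\tfrac{1-6^{-\theta}}{4\overline C_2}\Big)^{\frac1{j_0\theta-6d/p}},\ \Big(\tfrac{\overline C_1-1}{4\overline C_1\overline C_2}\Big)^{\frac1{j_0\theta-6d/p}}\Big\},$$ and $\mu_0=\min\{\mu^*,\overline C_1^{\frac1{\theta-\alpha}}\}$ if $\theta\neq\alpha$, $\mu_0=\mu^*$ if $\theta=\alpha$. Here $\mu_1=\min\{(2C_0)^{-1/\alpha},1\}$, $\mu_2=\min\{(2C_1)^{-1/\alpha},\tfrac14\}$, $\mu_3=\min\{(2\widetilde C_1)^{-1/\alpha},1\}$, and the constants entering are those of the following mean oscillation estimates for solutions $u$ of the problem in the claim (with $x_0\in\Omega_{R_0}$, $\delta_0=\delta(x_0')$): (a) $C_0=C_0(d,p)>1$, $\alpha=\alpha(d,p)\in(0,1)$: for $B_r(x_0)\subset\Omega_{2R_0}$ and $\rho\in(0,r]$, $\phi(x_0,\rho)\leq C_0(\rho/r)^\alpha\phi(x_0,r)$, where $\phi(x_0,r)=($⨍$_{B_r(x_0)}|\nabla u-(\nabla u)_{B_r(x_0)}|^p)^{1/p}$. (b) $C_1=C_1(d,p)$, $C_2=C_2(d,p,\kappa_4)$: if $R_0\leq\min\{R_{0,1},R_{0,2}\}$ and $\hat x_0$ is the point of $\Gamma^-_{2R_0}$ (or $\Gamma^+_{2R_0}$) nearest to $x_0$, then for $r\in(0,\delta_0/8]$ and $\mu\in(0,\tfrac14)$, $\psi(\hat x_0,\mu r)\leq C_1\mu^\alpha\psi(\hat x_0,r)+C_2\mu^{-d/p}r^\theta($⨍$_{\Omega_r(\hat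 x_0)}|\nabla u|^p)^{1/p}$, where $\psi(\hat x_0,r)=($⨍$_{\Omega_r(\hat x_0)}|\nabla_{y'}u-(\nabla_{y'}u)_{\Omega_r(\hat x_0)}|^p+|\partial_{y_d}u|^p)^{1/p}$ in orthonormal coordinates $y$ centered at $\hat x_0$ with $y_d$-axis along the normal at $\hat x_0$. (c) $\widetilde C_1=\widetilde C_1(d,p)$, $\widetilde C_2=\widetilde C_2(d,p,m,\kappa_1,\kappa_3)$: if $R_0\leq\min\{R_{0,1},R_{0,2},\overline R_0\}$, let $\tilde u_1$ be $u$ written in the flattened variables $\tilde z'=x'-x_0'$, $\tilde z_d=\delta_0\big(\frac{x_d-h_2(x')+\varepsilon/2}{\delta(x')}-\frac12\big)$, extended evenly across $\tilde z_d=\delta_0/2$ and then $2\delta_0$-periodically in $\tilde z_d$. For $r\in[\delta_0/24,\tilde c_0\delta_0^{1/m}]$ and $\mu\in(0,1)$, $\tilde\psi(\mu r)\leq\widetilde C_1\mu^\alpha\tilde\psi(r)+\widetilde C_2\mu^{-d/p}(r\delta_0^{-1/m})^\theta($⨍$_{B_r}|\nabla\tilde u_1|^p)^{1/p}$, where $\tilde\psi(r)=($⨍$_{B_r}|\nabla\tilde u_1-(\nabla\tilde u_1)_{B_r}|^p)^{1/p}$. (d) $\overline C_1=\overline C_1(d,p)>1$, $\overline C_2=\overline C_2(d,p,m,\kappa_1,\kappa_3,\kappa_4)$: for $0<\mu\leq\frac23\min_i\mu_i$, put $r_j=\frac{\tilde c_0}{13}\mu^j\delta_0^{1/m}$ and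 let $j_1\geq0$ be the integer with $r_{j_1}\geq\delta_0/24>r_{j_1+1}$. For $0\leq j\leq j_1$ let $T_j=($⨍$_{B_{13r_j}}|\nabla\tilde u_1|^p)^{1/p}$, $\omega_j=(\nabla\tilde u_1)_{B_{13r_j}}$, $\phi_j=($⨍$_{B_{13r_j}}|\nabla\tilde u_1-\omega_j|^p)^{1/p}$; for $j\geq j_1+1$ let $T_j=($⨍$_{\Omega_{3r_j}(x_0)}|\nabla u|^p)^{1/p}$, $\omega_j=(\nabla u)_{\Omega_{r_j}(x_0)}$, $\phi_j=($⨍$_{\Omega_{r_j}(x_0)}|\nabla u-\omega_j|^p)^{1/p}$. Then, whenever $0\leq j_0\leq j_1$ and $j>j_0$, with $\Sigma_j=\sum_{k=j_0+1}^{j}\sum_{i=j_0}^{k-1}(\overline C_1\mu^\alpha)^{k-1-i}\mu^{i\theta}T_i$ and dimensional constants $C(d)$, $|\omega_j|+\sum_{k=j_0}^j\phi_k\leq\mu^{-5d/p}(C(d)T_{j_0}+\overline C_2\Sigma_j)$ and $T_{j+1}\leq C(d)\mu^{-6d/p}T_{j_0}+\overline C_2\mu^{-6d/p}\Sigma_j$. *)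

theory Defs
  imports "HOL-Analysis.Analysis" "HOL-Probability.Essential_Supremum"
begin

text \<open>
  The space \<open>\<real>\<^sup>d\<close> is the type \<open>'a \<times> real\<close>, where the arbitrary Euclidean space \<open>'a\<close> plays the
  role of \<open>\<real>\<^sup>d\<^sup>-\<^sup>1\<close>; thus \<open>x' = fst x\<close>, \<open>x\<^sub>d = snd x\<close>, and \<open>d = DIM('a \<times> real) \<ge> 2\<close> holds
  automatically.
\<close>


section \<open>Classes of functions and domains\<close>

primrec iter_partial :: "'b::euclidean_space list \<Rightarrow> ('b \<Rightarrow> real) \<Rightarrow> 'b \<Rightarrow> real" where
  "iter_partial [] f = f"
| "iter_partial (b # bs) f = (\<lambda>x. frechet_derivative (iter_partial bs f) (at x) b)"

definition multi_indices :: "nat \<Rightarrow> 'b::euclidean_space list set" where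
  "multi_indices k = {bs. set bs \<subseteq> Basis \<and> length bs = k}"

definition Ck_on :: "nat \<Rightarrow> 'b::euclidean_space set \<Rightarrow> ('b \<Rightarrow> real) \<Rightarrow> bool" where
  "Ck_on k S f \<longleftrightarrow>
     (\<forall>j\<le>k. \<forall>bs\<in>multi_indices j. continuous_on S (iter_partial bs f) \<and>
        (j < k \<longrightarrow> (\<forall>x\<in>S. iter_partial bs f differentiable (at x))))"

text \<open>
  The norm of \<open>C\<^sup>s = C\<^bsup>k,\<gamma>\<^esup>\<close> with \<open>k\<close> the integer part of \<open>s\<close> and \<open>\<gamma> = s - k\<close>: the sum over
  the orders \<open>j \<le> k\<close> of the maximal sup norm of a derivative of order \<open>j\<close>, plus the
  \<open>\<gamma>\<close>-Hoelder seminorm of the derivatives of order \<open>k\<close> (no seminorm when \<open>\<gamma> = 0\<close>).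
\<close>

definition Cs_norm :: "real \<Rightarrow> 'b::euclidean_space set \<Rightarrow> ('b \<Rightarrow> real) \<Rightarrow> ennreal" where
  "Cs_norm s S f = (let k = nat \<lfloor>s\<rfloor>; \<gamma> = s - of_nat k in
     (\<Sum>j\<le>k. SUP bs\<in>multi_indices j. SUP x\<in>S. ennreal \<bar>iter_partial bs f x\<bar>) +
     (if \<gamma> = 0 then 0
      else SUP bs\<in>multi_indices k. SUP x\<in>S. SUP y\<in>S - {x}.
        ennreal (\<bar>iter_partial bs f x - iter_partial bs f y\<bar> / norm (x - y) powr \<gamma>)))"

definition grad :: "('b::euclidean_space \<Rightarrow> real) \<Rightarrow> 'b \<Rightarrow> 'b" where
  "grad f x = (\<Sum>b\<in>Basis. frechet_derivative f (at x) b *\<^sub>R b)"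

text \<open>A bounded domain with \<open>C\<^bsup>1,1\<^esup>\<close> boundary: near each boundary point it is, after a rigid
  motion, the strict epigraph of a function with Lipschitz gradient.\<close>

definition bounded_C11_domain :: "('a::euclidean_space \<times> real) set \<Rightarrow> bool" where
  "bounded_C11_domain S \<longleftrightarrow> open S \<and> connected S \<and> bounded S \<and> S \<noteq> {} \<and>
     (\<forall>x\<in>frontier S. \<exists>r>0. \<exists>(T :: 'a \<times> real \<Rightarrow> 'a \<times> real) (\<eta> :: 'a \<Rightarrow> real).
        orthogonal_transformation T \<and>
        (\<forall>z\<in>ball 0 r. \<eta> differentiable (at z)) \<and>
        (\<exists>L. \<forall>z\<in>ball 0 r. \<forall>w\<in>ball 0 r. norm (grad \<eta> z - grad \<eta> w) \<le> L * norm (z - w)) \<and>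
        S \<inter> ball x r = {y \<in> ball x r. snd (T (y - x)) > \<eta> (fst (T (y - x)))})"

definition Lp_on :: "real \<Rightarrow> 'b::euclidean_space set \<Rightarrow> ('b \<Rightarrow> 'c::euclidean_space) \<Rightarrow> bool" where
  "Lp_on p S f \<longleftrightarrow> set_borel_measurable lborel S f \<and>
     set_integrable lborel S (\<lambda>x. norm (f x) powr p)"

text \<open>\<open>G\<close> is a weak gradient of \<open>u\<close> in the open set \<open>S\<close> (test functions are \<open>C\<^sup>1\<close> with compact
  support in \<open>S\<close>).\<close>

definition weak_gradient ::
    "'b::euclidean_space set \<Rightarrow> ('b \<Rightarrow> real) \<Rightarrow> ('b \<Rightarrow> 'b) \<Rightarrow> bool" where
  "weak_gradient S u G \<longleftrightarrow>
     (\<forall>K. compact K \<and> K \<subseteq> S \<longrightarrow> set_integrable lborel K u \<and> set_integrable lborel K G) \<and>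
     (\<forall>\<phi>. Ck_on 1 UNIV \<phi> \<and> compact (closure {x. \<phi> x \<noteq> 0}) \<and> closure {x. \<phi> x \<noteq> 0} \<subseteq> S \<longrightarrow>
        (\<forall>b\<in>Basis. set_lebesgue_integral lborel S (\<lambda>x. u x * frechet_derivative \<phi> (at x) b)
                  = - set_lebesgue_integral lborel S (\<lambda>x. (G x \<bullet> b) * \<phi> x)))"

text \<open>\<open>u \<in> W\<^bsup>1,p\<^esup>(S)\<close> with \<open>\<nabla>u = G\<close>; both \<open>u\<close> and \<open>G\<close> are only relevant up to null sets.\<close>

definition W1p :: "real \<Rightarrow> 'b::euclidean_space set \<Rightarrow> ('b \<Rightarrow> real) \<Rightarrow> ('b \<Rightarrow> 'b) \<Rightarrow> bool" where
  "W1p p S u G \<longleftrightarrow> Lp_on p S u \<and> Lp_on p S G \<and> weak_gradient S u G"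

text \<open>Oscillation \<open>sup\<^sub>S u - inf\<^sub>S u\<close>. As \<open>u\<close> is a Sobolev function, the supremum and the infimum
  are the essential ones.\<close>

definition osc_on :: "'b::euclidean_space set \<Rightarrow> ('b \<Rightarrow> real) \<Rightarrow> ereal" where
  "osc_on S u = esssup (restrict_space lborel S) (\<lambda>x. ereal (u x))
              - (- esssup (restrict_space lborel S) (\<lambda>x. - ereal (u x)))"

definition avg :: "'b::euclidean_space set \<Rightarrow> ('b \<Rightarrow> 'c::euclidean_space) \<Rightarrow> 'c" where
  "avg S f = (1 / measure lborel S) *\<^sub>R set_lebesgue_integral lborel S f"

definition Lp_mean :: "real \<Rightarrow> 'b::euclidean_space set \<Rightarrow> ('b \<Rightarrow> 'c::euclidean_space) \<Rightarrow> real" where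
  "Lp_mean p S f = avg S (\<lambda>x. norm (f x) powr p) powr (1 / p)"

definition mean_osc :: "real \<Rightarrow> 'b::euclidean_space set \<Rightarrow> ('b \<Rightarrow> 'c::euclidean_space) \<Rightarrow> real" where
  "mean_osc p S f = Lp_mean p S (\<lambda>x. f x - avg S f)"


section \<open>The geometry\<close>

text \<open>\<open>incl1\<close> and \<open>incl2\<close> are the touching inclusions \<open>D\<^sub>1\<^sup>*\<close> and \<open>D\<^sub>2\<^sup>*\<close>.\<close>

record 'a geometry =
  dom_D :: "('a \<times> real) set"
  incl1 :: "('a \<times> real) set"
  incl2 :: "('a \<times> real) set"
  h1 :: "'a \<Rightarrow> real"
  h2 :: "'a \<Rightarrow> real"

definition cyl :: "real \<Rightarrow> ('a::euclidean_space \<times> real) set" where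
  "cyl r = {x. norm (fst x) < r \<and> \<bar>snd x\<bar> < r}"

text \<open>
  The portions of the boundaries near the origin are those in the cylinder of radius and
  half-height \<open>2 R\<^sub>0\<close>. All conditions concern the configuration at \<open>\<epsilon> = 0\<close>. In particular
  the closures of \<open>D\<^sub>1\<^sup>*\<close>, \<open>D\<^sub>2\<^sup>*\<close> and the cylinder lie in \<open>D\<close>, so that for all small \<open>\<epsilon>\<close> the shifted
  inclusions stay away from the boundary of \<open>D\<close> by a distance independent of \<open>\<epsilon>\<close>.
\<close>

definition admissible ::
    "real \<Rightarrow> real \<Rightarrow> real \<Rightarrow> real \<Rightarrow> real \<Rightarrow> real \<Rightarrow> 'a::euclidean_space geometry \<Rightarrow> bool" where
  "admissible m \<kappa>1 \<kappa>2 \<kappa>3 \<kappa>4 R0 g \<longleftrightarrow>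
     bounded_C11_domain (dom_D g) \<and> bounded_C11_domain (incl1 g) \<and> bounded_C11_domain (incl2 g) \<and>
     incl1 g \<subseteq> {x. snd x > 0} \<and> incl2 g \<subseteq> {x. snd x < 0} \<and>
     frontier (incl1 g) \<inter> frontier (incl2 g) = {0} \<and>
     closure (incl1 g) \<subseteq> dom_D g \<and> closure (incl2 g) \<subseteq> dom_D g \<and> cyl (2 * R0) \<subseteq> dom_D g \<and>
     frontier (incl1 g) \<inter> cyl (2 * R0) = {x \<in> cyl (2 * R0). snd x = h1 g (fst x)} \<and>
     frontier (incl2 g) \<inter> cyl (2 * R0) = {x \<in> cyl (2 * R0). snd x = h2 g (fst x)} \<and>
     Ck_on (nat \<lfloor>m\<rfloor>) (ball 0 (2 * R0)) (h1 g) \<and> Ck_on (nat \<lfloor>m\<rfloor>) (ball 0 (2 * R0)) (h2 g) \<and>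
     (\<forall>x'\<in>ball 0 (2 * R0). \<kappa>1 * norm x' powr m \<le> h1 g x' - h2 g x' \<and>
                           h1 g x' - h2 g x' \<le> \<kappa>2 * norm x' powr m) \<and>
     (\<forall>x'\<in>ball 0 (2 * R0). norm (grad (h1 g) x') \<le> \<kappa>3 * norm x' powr (m - 1) \<and>
                           norm (grad (h2 g) x') \<le> \<kappa>3 * norm x' powr (m - 1)) \<and>
     Cs_norm m (ball 0 (2 * R0)) (h1 g) + Cs_norm m (ball 0 (2 * R0)) (h2 g) \<le> ennreal \<kappa>4"

definition D1 :: "'a::euclidean_space geometry \<Rightarrow> real \<Rightarrow> ('a \<times> real) set" where
  "D1 g \<epsilon> = (\<lambda>x. x + (0, \<epsilon> / 2)) ` incl1 g"

definition D2 :: "'a::euclidean_space geometry \<Rightarrow> real \<Rightarrow> ('a \<times> real) set" where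
  "D2 g \<epsilon> = (\<lambda>x. x + (0, - \<epsilon> / 2)) ` incl2 g"

definition Omega :: "'a::euclidean_space geometry \<Rightarrow> real \<Rightarrow> ('a \<times> real) set" where
  "Omega g \<epsilon> = dom_D g - closure (D1 g \<epsilon> \<union> D2 g \<epsilon>)"

definition Omega_ball ::
    "'a::euclidean_space geometry \<Rightarrow> real \<Rightarrow> 'a \<times> real \<Rightarrow> real \<Rightarrow> ('a \<times> real) set" where
  "Omega_ball g \<epsilon> x r = Omega g \<epsilon> \<inter> ball x r"

definition upper :: "'a geometry \<Rightarrow> real \<Rightarrow> 'a \<Rightarrow> real" where
  "upper g \<epsilon> x' = \<epsilon> / 2 + h1 g x'"

definition lower :: "'a geometry \<Rightarrow> real \<Rightarrow> 'a \<Rightarrow> real" where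
  "lower g \<epsilon> x' = - \<epsilon> / 2 + h2 g x'"

definition delta :: "'a geometry \<Rightarrow> real \<Rightarrow> 'a \<Rightarrow> real" where
  "delta g \<epsilon> x' = \<epsilon> + h1 g x' - h2 g x'"

text \<open>\<open>\<Omega>\<^bsub>z',t\<^esub>\<close>; in particular \<open>\<Omega>\<^sub>t\<close> is \<open>neck g \<epsilon> 0 t\<close>.\<close>

definition neck :: "'a::euclidean_space geometry \<Rightarrow> real \<Rightarrow> 'a \<Rightarrow> real \<Rightarrow> ('a \<times> real) set" where
  "neck g \<epsilon> z' t = {x. norm (fst x - z') < t \<and> lower g \<epsilon> (fst x) < snd x \<and> snd x < upper g \<epsilon> (fst x)}"

definition graph_on :: "('a::euclidean_space \<Rightarrow> real) \<Rightarrow> real \<Rightarrow> ('a \<times> real) set" where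
  "graph_on f t = {x. norm (fst x) < t \<and> snd x = f (fst x)}"

text \<open>
  Weak form of \<open>- div (|\<nabla>u|\<^bsup>p-2\<^esup> \<nabla>u) = 0\<close> in \<open>\<Omega>\<^bsub>2R0\<^esub>\<close> with \<open>\<partial>u/\<partial>\<nu> = 0\<close> on \<open>\<Gamma>\<^sup>+\<close> and \<open>\<Gamma>\<^sup>-\<close>: the test functions
  vanish near the lateral boundary \<open>|x'| = 2 R\<^sub>0\<close> but are unrestricted on \<open>\<Gamma>\<^sup>+\<close> and \<open>\<Gamma>\<^sup>-\<close>.
\<close>

definition p_laplace_solution ::
    "real \<Rightarrow> real \<Rightarrow> 'a::euclidean_space geometry \<Rightarrow> real \<Rightarrow>
     ('a \<times> real \<Rightarrow> real) \<Rightarrow> ('a \<times> real \<Rightarrow> 'a \<times> real) \<Rightarrow> bool" where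
  "p_laplace_solution p R0 g \<epsilon> u G \<longleftrightarrow>
     W1p p (neck g \<epsilon> 0 (2 * R0)) u G \<and>
     (\<forall>\<phi> H. W1p p (neck g \<epsilon> 0 (2 * R0)) \<phi> H \<and>
        (\<exists>t<2 * R0. AE x in lborel. x \<in> neck g \<epsilon> 0 (2 * R0) \<longrightarrow> t \<le> norm (fst x) \<longrightarrow> \<phi> x = 0) \<longrightarrow>
        set_lebesgue_integral lborel (neck g \<epsilon> 0 (2 * R0))
          (\<lambda>x. norm (G x) powr (p - 2) * (G x \<bullet> H x)) = 0)"


section \<open>Explicit constants\<close>

definition c0 :: "real \<Rightarrow> real \<Rightarrow> real \<Rightarrow> real" where
  "c0 m \<kappa>1 \<kappa>3 = \<kappa>1 powr (-1 / m) * min 1 (2 powr (-(m + 1)) * \<kappa>1 * \<kappa>3 powr (-1))"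

definition ct0 :: "real \<Rightarrow> real \<Rightarrow> real \<Rightarrow> real" where
  "ct0 m \<kappa>1 \<kappa>3 = \<kappa>1 powr (-1 / m) *
     min 1 (\<kappa>1 * \<kappa>3 powr (-1) * (51840 + 4 powr (m + 1)) powr (-1 / 2))"

definition R01 :: "real \<Rightarrow> real \<Rightarrow> real \<Rightarrow> real \<Rightarrow> real" where
  "R01 m \<kappa>1 \<kappa>2 \<kappa>3 =
     2 powr (- m / (m - 1)) * (\<kappa>2 * \<kappa>3) powr (-1 / (2 * m - 2)) *
     min 1 (min ((\<kappa>1 powr (1 / m) * c0 m \<kappa>1 \<kappa>3) powr (1 / (2 * m - 2)) / 2 powr (1 / (m - 1)))
                ((\<kappa>1 * \<kappa>3 powr (-1)) powr (1 / (2 * m - 2)) / 2 powr ((2 * m - 1) / (2 * m - 2))))"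

definition R02 :: "nat \<Rightarrow> real \<Rightarrow> real \<Rightarrow> real \<Rightarrow> real \<Rightarrow> real" where
  "R02 d m \<kappa>2 \<kappa>3 \<kappa>4 =
     min (2 powr (- (2 * m + 1) / (2 * m - 1)) * \<kappa>3 powr (-1 / (m - 1)))
         ((sqrt 2 * \<kappa>2 * \<kappa>4 * (real d - 1)\<^sup>2) powr (-1 / m))"

definition R0bar :: "real \<Rightarrow> real \<Rightarrow> real \<Rightarrow> real \<Rightarrow> real" where
  "R0bar m \<kappa>1 \<kappa>2 \<kappa>3 = (12 / 13 * ct0 m \<kappa>1 \<kappa>3) powr (1 / (m - 1)) * \<kappa>2 powr (-1 / m)"

definition theta :: "real \<Rightarrow> real" where
  "theta p = min 1 (2 / p)"

definition j0 :: "nat \<Rightarrow> real \<Rightarrow> nat" where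
  "j0 d p = nat \<lfloor>6 * real d / min p 2\<rfloor> + 1"

text \<open>The constants of the mean oscillation estimates (a)--(d) below: \<open>Ct\<close> and \<open>Cb\<close> stand for
  \<open>C\<close> with a tilde and with a bar. A single \<open>Cdim\<close> is used for the two dimensional constants in (d).\<close>

record osc_consts =
  al :: real
  C0 :: real
  C1 :: real
  C2 :: real
  Ct1 :: real
  Ct2 :: real
  Cb1 :: real
  Cb2 :: real
  Cdim :: real

definition mu_min :: "osc_consts \<Rightarrow> real" where
  "mu_min K = min (min ((2 * C0 K) powr (-1 / al K)) 1)
                  (min (min ((2 * C1 K) powr (-1 / al K)) (1 / 4))
                       (min ((2 * Ct1 K) powr (-1 / al K)) 1))"

definition mu_star :: "nat \<Rightarrow> real \<Rightarrow> osc_consts \<Rightarrow> real" where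
  "mu_star d p K = (let \<theta> = theta p; s = 1 / (real (j0 d p) * \<theta> - 6 * real d / p) in
     Min {2 / 3 * mu_min K,
          (2 * Cb1 K) powr (-1 / al K),
          ((1 - 6 powr (- \<theta>)) / (4 * Cb2 K)) powr s,
          ((Cb1 K - 1) / (4 * Cb1 K * Cb2 K)) powr s})"

definition mu0 :: "nat \<Rightarrow> real \<Rightarrow> osc_consts \<Rightarrow> real" where
  "mu0 d p K =
     (if theta p = al K then mu_star d p K
      else min (mu_star d p K) (Cb1 K powr (1 / (theta p - al K))))"

definition R03 :: "nat \<Rightarrow> real \<Rightarrow> real \<Rightarrow> real \<Rightarrow> real \<Rightarrow> real \<Rightarrow> osc_consts \<Rightarrow> real" where
  "R03 d m p \<kappa>1 \<kappa>2 \<kappa>3 K =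
     (12 / 13 * ct0 m \<kappa>1 \<kappa>3 * mu0 d p K ^ j0 d p) powr (1 / (m - 1)) * \<kappa>2 powr (-1 / m)"


section \<open>The mean oscillation estimates defining the constants\<close>

definition estimate_a ::
    "osc_consts \<Rightarrow> real \<Rightarrow> real \<Rightarrow> 'a::euclidean_space geometry \<Rightarrow> real \<Rightarrow>
     ('a \<times> real \<Rightarrow> 'a \<times> real) \<Rightarrow> bool" where
  "estimate_a K p R0 g \<epsilon> G \<longleftrightarrow>
     (\<forall>x0\<in>neck g \<epsilon> 0 R0. \<forall>r>0. ball x0 r \<subseteq> neck g \<epsilon> 0 (2 * R0) \<longrightarrow>
        (\<forall>\<rho>\<in>{0<..r}. mean_osc p (ball x0 \<rho>) G \<le> C0 K * (\<rho> / r) powr al K * mean_osc p (ball x0 r) G))"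

text \<open>\<open>\<psi>\<close> for the set \<open>S\<close> and the unit normal \<open>n\<close>: in orthonormal coordinates \<open>y\<close> with \<open>y\<^sub>d\<close>-axis along
  \<open>n\<close>, \<open>\<partial>\<^bsub>yd\<^esub>u\<close> is \<open>\<nabla>u \<bullet> n\<close> and \<open>\<nabla>\<^bsub>y'\<^esub>u\<close> represents the tangential part of \<open>\<nabla>u\<close>.\<close>

definition psi_bdry ::
    "real \<Rightarrow> 'b::euclidean_space set \<Rightarrow> 'b \<Rightarrow> ('b \<Rightarrow> 'b) \<Rightarrow> real" where
  "psi_bdry p S n G = (let Gt = (\<lambda>x. G x - (G x \<bullet> n) *\<^sub>R n) in
     avg S (\<lambda>x. norm (Gt x - avg S Gt) powr p + \<bar>G x \<bullet> n\<bar> powr p) powr (1 / p))"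

definition estimate_b ::
    "osc_consts \<Rightarrow> real \<Rightarrow> real \<Rightarrow> 'a::euclidean_space geometry \<Rightarrow> real \<Rightarrow>
     ('a \<times> real \<Rightarrow> 'a \<times> real) \<Rightarrow> bool" where
  "estimate_b K p R0 g \<epsilon> G \<longleftrightarrow>
     (\<forall>x0\<in>neck g \<epsilon> 0 R0. \<forall>h\<in>{upper g \<epsilon>, lower g \<epsilon>}. \<forall>xh\<in>graph_on h (2 * R0).
        (\<forall>y\<in>graph_on h (2 * R0). dist x0 xh \<le> dist x0 y) \<longrightarrow>
        (\<forall>r\<in>{0<..delta g \<epsilon> (fst x0) / 8}. \<forall>\<mu>\<in>{0<..<1 / 4}.
           let n = sgn (grad h (fst xh), -1) in
           psi_bdry p (Omega_ball g \<epsilon> xh (\<mu> * r)) n G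
             \<le> C1 K * \<mu> powr al K * psi_bdry p (Omega_ball g \<epsilon> xh r) n G
               + C2 K * \<mu> powr (- real DIM('a \<times> real) / p) * r powr theta p
                 * Lp_mean p (Omega_ball g \<epsilon> xh r) G))"

text \<open>Reflection of \<open>t\<close> into \<open>[-\<delta>/2, \<delta>/2]\<close>: composing with it extends a function evenly
  across \<open>\<delta>/2\<close> and then \<open>2\<delta>\<close>-periodically.\<close>

definition fold_strip :: "real \<Rightarrow> real \<Rightarrow> real" where
  "fold_strip \<delta> t = (let s = t - 2 * \<delta> * of_int \<lfloor>(t + \<delta> / 2) / (2 * \<delta>)\<rfloor> in
     if s \<le> \<delta> / 2 then s else \<delta> - s)"

text \<open>The inverse of the flattening map
  \<open>x \<mapsto> (x' - x\<^sub>0', \<delta>\<^sub>0 ((x\<^sub>d - h\<^sub>2(x') + \<epsilon>/2) / \<delta>(x') - 1/2))\<close>.\<close>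

definition unflatten ::
    "'a::euclidean_space geometry \<Rightarrow> real \<Rightarrow> 'a \<Rightarrow> 'a \<times> real \<Rightarrow> 'a \<times> real" where
  "unflatten g \<epsilon> x0' z = (let x' = x0' + fst z in
     (x', lower g \<epsilon> x' + delta g \<epsilon> x' * (snd z / delta g \<epsilon> x0' + 1 / 2)))"

definition u_tilde ::
    "'a::euclidean_space geometry \<Rightarrow> real \<Rightarrow> 'a \<Rightarrow> ('a \<times> real \<Rightarrow> real) \<Rightarrow> 'a \<times> real \<Rightarrow> real" where
  "u_tilde g \<epsilon> x0' u z = u (unflatten g \<epsilon> x0' (fst z, fold_strip (delta g \<epsilon> x0') (snd z)))"

text \<open>\<open>Gt = \<nabla>u\<^sub>1\<close> where \<open>u\<^sub>1\<close> is the extended function \<^const>\<open>u_tilde\<close>.\<close>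

definition is_grad_u_tilde ::
    "real \<Rightarrow> 'a::euclidean_space geometry \<Rightarrow> real \<Rightarrow> 'a \<Rightarrow> ('a \<times> real \<Rightarrow> real) \<Rightarrow>
     ('a \<times> real \<Rightarrow> 'a \<times> real) \<Rightarrow> bool" where
  "is_grad_u_tilde R0 g \<epsilon> x0' u Gt \<longleftrightarrow>
     weak_gradient {z. norm (x0' + fst z) < 2 * R0} (u_tilde g \<epsilon> x0' u) Gt"

definition estimate_c ::
    "osc_consts \<Rightarrow> real \<Rightarrow> real \<Rightarrow> real \<Rightarrow> real \<Rightarrow> real \<Rightarrow> 'a::euclidean_space geometry \<Rightarrow> real \<Rightarrow>
     ('a \<times> real \<Rightarrow> real) \<Rightarrow> bool" where
  "estimate_c K m p \<kappa>1 \<kappa>3 R0 g \<epsilon> u \<longleftrightarrow>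
     (\<forall>x0\<in>neck g \<epsilon> 0 R0. \<forall>Gt. is_grad_u_tilde R0 g \<epsilon> (fst x0) u Gt \<longrightarrow>
        (let \<delta>0 = delta g \<epsilon> (fst x0) in
         \<forall>r\<in>{\<delta>0 / 24..ct0 m \<kappa>1 \<kappa>3 * \<delta>0 powr (1 / m)}. \<forall>\<mu>\<in>{0<..<1}.
           mean_osc p (ball 0 (\<mu> * r)) Gt
             \<le> Ct1 K * \<mu> powr al K * mean_osc p (ball 0 r) Gt
               + Ct2 K * \<mu> powr (- real DIM('a \<times> real) / p) * (r * \<delta>0 powr (-1 / m)) powr theta p
                 * Lp_mean p (ball 0 r) Gt))"

definition rad :: "real \<Rightarrow> real \<Rightarrow> real \<Rightarrow> real \<Rightarrow> real \<Rightarrow> nat \<Rightarrow> real" where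
  "rad m \<kappa>1 \<kappa>3 \<mu> \<delta>0 j = ct0 m \<kappa>1 \<kappa>3 / 13 * \<mu> ^ j * \<delta>0 powr (1 / m)"

definition estimate_d ::
    "osc_consts \<Rightarrow> real \<Rightarrow> real \<Rightarrow> real \<Rightarrow> real \<Rightarrow> real \<Rightarrow> 'a::euclidean_space geometry \<Rightarrow> real \<Rightarrow>
     ('a \<times> real \<Rightarrow> real) \<Rightarrow> ('a \<times> real \<Rightarrow> 'a \<times> real) \<Rightarrow> bool" where
  "estimate_d K m p \<kappa>1 \<kappa>3 R0 g \<epsilon> u G \<longleftrightarrow>
     (\<forall>x0\<in>neck g \<epsilon> 0 R0. \<forall>Gt. is_grad_u_tilde R0 g \<epsilon> (fst x0) u Gt \<longrightarrow>
      (\<forall>\<mu>\<in>{0<..2 / 3 * mu_min K}. \<forall>j1 i0 j.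
        let \<delta>0 = delta g \<epsilon> (fst x0);
            r = rad m \<kappa>1 \<kappa>3 \<mu> \<delta>0;
            T = (\<lambda>k. if k \<le> j1 then Lp_mean p (ball 0 (13 * r k)) Gt
                     else Lp_mean p (Omega_ball g \<epsilon> x0 (3 * r k)) G);
            \<omega> = (\<lambda>k. if k \<le> j1 then avg (ball 0 (13 * r k)) Gt
                     else avg (Omega_ball g \<epsilon> x0 (r k)) G);
            \<phi> = (\<lambda>k. if k \<le> j1 then mean_osc p (ball 0 (13 * r k)) Gt
                     else mean_osc p (Omega_ball g \<epsilon> x0 (r k)) G);
            \<Sigma> = (\<Sum>k = i0 + 1..j. \<Sum>i = i0..k - 1.
                   (Cb1 K * \<mu> powr al K) ^ (k - 1 - i) * \<mu> powr (real i * theta p) * T i);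
            d = real DIM('a \<times> real)
        in r j1 \<ge> \<delta>0 / 24 \<and> \<delta>0 / 24 > r (j1 + 1) \<and> i0 \<le> j1 \<and> i0 < j \<longrightarrow>
             norm (\<omega> j) + (\<Sum>k = i0..j. \<phi> k) \<le> \<mu> powr (-5 * d / p) * (Cdim K * T i0 + Cb2 K * \<Sigma>) \<and>
             T (j + 1) \<le> Cdim K * \<mu> powr (-6 * d / p) * T i0 + Cb2 K * \<mu> powr (-6 * d / p) * \<Sigma>))"

text \<open>
  \<open>K\<close> consists of constants with which (a)--(d) are valid for every solution of the
  problem, in every admissible geometry with the given \<open>m, \<kappa>\<^sub>1, \<kappa>\<^sub>3, \<kappa>\<^sub>4\<close> and all
  sufficiently small \<open>\<epsilon>\<close>. They may not depend on \<open>\<kappa>\<^sub>2\<close>, \<open>R\<^sub>0\<close>, \<open>\<epsilon>\<close>, the domains or \<open>u\<close>.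
\<close>

definition oscillation_constants ::
    "'a::euclidean_space itself \<Rightarrow> real \<Rightarrow> real \<Rightarrow> real \<Rightarrow> real \<Rightarrow> real \<Rightarrow> osc_consts \<Rightarrow> bool" where
  "oscillation_constants (_ :: 'a itself) m p \<kappa>1 \<kappa>3 \<kappa>4 K \<longleftrightarrow>
     0 < al K \<and> al K < 1 \<and> C0 K > 1 \<and> C1 K > 0 \<and> C2 K > 0 \<and> Ct1 K > 0 \<and> Ct2 K > 0 \<and>
     Cb1 K > 1 \<and> Cb2 K > 0 \<and> Cdim K > 0 \<and>
     (\<forall>\<kappa>2>0. \<forall>R0>0. \<forall>g :: 'a geometry. admissible m \<kappa>1 \<kappa>2 \<kappa>3 \<kappa>4 R0 g \<longrightarrow>
        (\<exists>\<epsilon>1>0. \<forall>\<epsilon>. 0 < \<epsilon> \<and> \<epsilon> < \<epsilon>1 \<longrightarrow> (\<forall>u G. p_laplace_solution p R0 g \<epsilon> u G \<longrightarrow>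
           (let d = DIM('a \<times> real); R12 = min (R01 m \<kappa>1 \<kappa>2 \<kappa>3) (R02 d m \<kappa>2 \<kappa>3 \<kappa>4) in
              estimate_a K p R0 g \<epsilon> G \<and>
              (R0 \<le> R12 \<longrightarrow> estimate_b K p R0 g \<epsilon> G) \<and>
              (R0 \<le> min R12 (R0bar m \<kappa>1 \<kappa>2 \<kappa>3) \<longrightarrow>
                 estimate_c K m p \<kappa>1 \<kappa>3 R0 g \<epsilon> u \<and> estimate_d K m p \<kappa>1 \<kappa>3 R0 g \<epsilon> u G)))))"

end

theory Submission imports Defs begin

text \<open>
  Fix a point \<open>x\<close> of the neck and put \<open>\<delta> = \<delta>(x')\<close> and \<open>\<rho> = (c/3) \<delta>\<^bsup>1/m\<^esup>\<close>, where \<open>c\<close> is the constant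
  \<open>ct0\<close>. On the scale \<open>\<rho>\<close> the neck looks like a layer of thickness comparable to \<open>\<delta>\<close>: its thickness changes
  by at most the factor 2 (\<open>delta_comparable\<close>). Up to a constant this is the largest scale with that property, and since
  \<open>\<rho>\<close> is comparable to \<open>(\<epsilon> + |x'|\<^sup>m)\<^bsup>1/m\<^esup>\<close>, the theorem says that \<open>|\<nabla>u(x)|\<close> is bounded by the oscillation
  on the scale \<open>\<rho>\<close> divided by \<open>\<rho>\<close>.

  The \<open>L\<^sup>p\<close> form of this bound on the scale \<open>\<rho>\<close> itself is the Caccioppoli inequality (\<open>caccioppoli\<close>): one tests
  the equation with \<open>u - c\<close> times a cutoff in \<open>x'\<close> only, which the Neumann condition permits. To pass from
  the scale \<open>\<rho>\<close> to the point, estimate (d) is iterated. It also speaks about balls that are too large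
  to fit into the neck; there the averages are those of the gradient of the function \<open>u_tilde\<close>, obtained by straightening the neck to the flat layer \<open>|z\<^sub>d| < \<delta>/2\<close>, reflecting evenly and
  extending periodically. For (d) to say anything, this function must have a weak gradient across the
  seams of the reflection. That is the main analytic work: \<open>weak_gradient_flatten\<close> (change of
  variables for weak gradients under a \<open>C\<^sup>2\<close> map, by a Piola transform of the test functions) and
  \<open>weak_gradient_fold\<close> (even reflection, by symmetrised test functions and a cutoff near the
  seams). The resulting gradient is bounded pointwise by a multiple of that of \<open>u\<close>, so a ball of radius \<open>R \<ge> \<delta>/2\<close>
  carries at most a multiple of \<open>R/\<delta>\<close> copies of the Caccioppoli integral (\<open>extended_gradient\<close>). The volume of
  the neck of radius \<open>\<rho>\<close> is at most a multiple of \<open>\<delta> \<rho>\<^bsup>d-1\<^esup>\<close>, so the \<open>L\<^sup>p\<close> average over balls of radius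
  comparable to \<open>\<rho>\<close> is at most a multiple of \<open>M/\<rho>\<close>, with \<open>M\<close> the oscillation (\<open>first_scale_bound\<close>).

  The scales are \<open>13 r\<^sub>j = 3 \<rho> \<mu>\<^sup>j\<close> with \<open>\<mu> = \<mu>\<^sub>0\<close>. The bound on \<open>R\<^sub>0\<close> and the smallness of \<open>\<epsilon>\<close> make
  \<open>r\<^sub>j \<ge> \<delta>/24\<close> for \<open>j = j\<^sub>0\<close> (\<open>first_scale_large\<close>), so the first scales of the iteration are in the range where
  Caccioppoli applies. The choice of \<open>\<mu>\<^sub>0\<close> makes the coefficient of the double sum in (d) at most 1/2 when that
  sum starts at \<open>j\<^sub>0\<close> (\<open>mu0_bounds\<close>); the sum is then absorbed and all averages \<open>\<omega>\<^sub>j\<close> are bounded by a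
  multiple of \<open>M/\<rho>\<close> (\<open>iteration_bound\<close>). Finally, (a) and a theorem of Campanato
  (\<open>campanato_continuous_representative\<close>) give a continuous representative of \<open>\<nabla>u\<close>. Once \<open>r\<^sub>j\<close> is so small that
  the ball lies in \<open>\<Omega>\<close>, \<open>\<omega>\<^sub>j\<close> is an average of \<open>\<nabla>u\<close> over that ball, and \<open>\<omega>\<^sub>j\<close> tends to the value of the
  representative at \<open>x\<close> (\<open>gradient_bound\<close>).

  The constant produced in this way is built from \<open>d\<close>, \<open>p\<close>, \<open>m\<close>, \<open>\<kappa>\<^sub>1\<close>, \<open>\<kappa>\<^sub>3\<close> and the constants of the mean
  oscillation estimates; the smallness of \<open>\<epsilon>\<close> that is required depends also on \<open>\<kappa>\<^sub>2\<close>, \<open>R\<^sub>0\<close> and the domains.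
\<close>

section \<open>Functions with a continuous gradient\<close>

text \<open>
  The gradient is a parameter, because the gradients of the functions below are given by formulas
  that are needed explicitly, and it is only required on \<open>S\<close>, where the functions are defined.
\<close>

definition C1_grad :: "('b::euclidean_space \<Rightarrow> real) \<Rightarrow> ('b \<Rightarrow> 'b) \<Rightarrow> 'b set \<Rightarrow> bool" where
  "C1_grad f D S \<longleftrightarrow> (\<forall>x\<in>S. (f has_derivative (\<lambda>h. D x \<bullet> h)) (at x)) \<and> continuous_on S D"

lemma C1_gradD:
  assumes "C1_grad f D S" "x \<in> S"
  shows "(f has_derivative (\<lambda>h. D x \<bullet> h)) (at x)"
  using assms by (auto simp: C1_grad_def)

lemma C1_grad_continuous_D: "C1_grad f D S \<Longrightarrow> continuous_on S D"
  by (auto simp: C1_grad_def)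

lemma C1_grad_continuous: "C1_grad f D S \<Longrightarrow> continuous_on S f"
  unfolding C1_grad_def
  by (auto intro!: has_derivative_continuous_on intro: has_derivative_at_withinI)

lemma C1_grad_subset: "C1_grad f D S \<Longrightarrow> T \<subseteq> S \<Longrightarrow> C1_grad f D T"
  by (auto simp: C1_grad_def intro: continuous_on_subset)

lemma multi_indices_0: "multi_indices 0 = {[]}"
  by (auto simp: multi_indices_def)

lemma multi_indices_Suc0: "multi_indices (Suc 0) = (\<lambda>b. [b]) ` Basis"
  by (auto simp: multi_indices_def length_Suc_conv)

lemma grad_inner:
  assumes "f differentiable (at x)"
  shows "grad f x \<bullet> h = frechet_derivative f (at x) h"
proof -
  have lin: "linear (frechet_derivative f (at x))"
    using assms frechet_derivative_works has_derivative_linear by blast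
  have "frechet_derivative f (at x) h = frechet_derivative f (at x) (\<Sum>b\<in>Basis. (h \<bullet> b) *\<^sub>R b)"
    by (simp add: euclidean_representation)
  also have "\<dots> = (\<Sum>b\<in>Basis. (h \<bullet> b) *\<^sub>R frechet_derivative f (at x) b)"
    by (simp add: linear_sum[OF lin] linear_scale[OF lin])
  also have "\<dots> = grad f x \<bullet> h"
    by (simp add: grad_def inner_sum_left inner_commute[of h] mult.commute)
  finally show ?thesis by simp
qed

lemma has_derivative_grad:
  assumes "f differentiable (at x)"
  shows "(f has_derivative (\<lambda>h. grad f x \<bullet> h)) (at x)"
  using assms frechet_derivative_works grad_inner[OF assms] by (metis (no_types, lifting) ext)

lemma Ck_on_one_C1_grad:
  assumes "Ck_on k S f" "k \<ge> 1"
  shows "C1_grad f (grad f) S"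
proof -
  have "\<forall>bs\<in>multi_indices 0. \<forall>x\<in>S. iter_partial bs f differentiable (at x)"
    using assms unfolding Ck_on_def by auto
  then have d: "\<And>x. x \<in> S \<Longrightarrow> f differentiable (at x)"
    by (auto simp: multi_indices_0)
  have "\<forall>bs\<in>multi_indices (Suc 0). continuous_on S (iter_partial bs f)"
    using assms unfolding Ck_on_def by auto
  then have "\<And>b. b \<in> Basis \<Longrightarrow> continuous_on S (\<lambda>x. frechet_derivative f (at x) b)"
    by (auto simp: multi_indices_Suc0)
  then have "continuous_on S (grad f)"
    unfolding grad_def by (intro continuous_intros) auto
  with d show ?thesis by (auto simp: C1_grad_def has_derivative_grad)
qed

lemma C1_grad_frechet:
  assumes "C1_grad f D S" "x \<in> S"
  shows "frechet_derivative f (at x) h = D x \<bullet> h"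
  using frechet_derivative_at[OF C1_gradD[OF assms]] by (metis)

lemma C1_grad_Ck_on_one:
  assumes "C1_grad f D UNIV"
  shows "Ck_on 1 UNIV f"
proof -
  have 1: "f differentiable (at x)" for x
    using C1_gradD[OF assms, of x] differentiable_def by blast
  have 2: "continuous_on UNIV (\<lambda>x. frechet_derivative f (at x) b)" for b
    using C1_grad_continuous_D[OF assms] C1_grad_frechet[OF assms]
    by (simp add: continuous_intros)
  show ?thesis
    unfolding Ck_on_def using 1 2 C1_grad_continuous[OF assms]
    by (auto simp: le_Suc_eq multi_indices_0 multi_indices_Suc0)
qed

text \<open>
  The open sets \<open>S\<close> and \<open>- K\<close> cover the space, and the extended function is \<open>C\<^sup>1\<close> on each of them. This is
  what turns functions on an open set into admissible test functions.
\<close>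

lemma C1_grad_extend_zero:
  assumes S: "open S" and f: "C1_grad f D S" and K: "closed K" "K \<subseteq> S"
    and 0: "\<And>x. x \<in> S - K \<Longrightarrow> f x = 0"
  shows "C1_grad (\<lambda>x. if x \<in> S then f x else 0) (\<lambda>x. if x \<in> S then D x else 0) UNIV"
    and "\<And>x. x \<in> S - K \<Longrightarrow> D x = 0"
proof -
  have D0: "D x = 0" if x: "x \<in> S - K" for x
  proof -
    have o: "open (S - K)" using S K by auto
    have "((\<lambda>x. 0) has_derivative (\<lambda>h. D x \<bullet> h)) (at x)"
      by (rule has_derivative_transform_within_open[OF C1_gradD[OF f] o x]) (use x 0 in auto)
    then have "(\<lambda>h. D x \<bullet> h) = (\<lambda>h. 0)"
      using has_derivative_unique[OF _ has_derivative_const] by blast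
    then show ?thesis by (metis inner_eq_zero_iff)
  qed
  show "\<And>x. x \<in> S - K \<Longrightarrow> D x = 0" by (rule D0)
  have un: "S \<union> (- K) = UNIV" using K by auto
  have oK: "open (- K)" using K by auto
  have "((\<lambda>x. if x \<in> S then f x else 0) has_derivative (\<lambda>h. (if x \<in> S then D x else 0) \<bullet> h)) (at x)" for x
  proof (cases "x \<in> S")
    case True
    have "((\<lambda>x. if x \<in> S then f x else 0) has_derivative (\<lambda>h. D x \<bullet> h)) (at x)"
      by (rule has_derivative_transform_within_open[OF C1_gradD[OF f True] S True]) auto
    then show ?thesis using True by simp
  next
    case False
    have "((\<lambda>x. if x \<in> S then f x else 0) has_derivative (\<lambda>h. 0)) (at x)"
      by (rule has_derivative_transform_within_open[OF has_derivative_const[of 0] oK])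
        (use False K 0 in auto)
    then show ?thesis using False by simp
  qed
  moreover have "continuous_on (S \<union> (- K)) (\<lambda>x. if x \<in> S then D x else 0)"
  proof (rule continuous_on_open_Un[OF S oK])
    show "continuous_on S (\<lambda>x. if x \<in> S then D x else 0)"
      using C1_grad_continuous_D[OF f] by (simp cong: continuous_on_cong)
    show "continuous_on (- K) (\<lambda>x. if x \<in> S then D x else 0)"
      by (rule continuous_on_eq[OF continuous_on_const[of _ 0]]) (auto simp: D0)
  qed
  ultimately show "C1_grad (\<lambda>x. if x \<in> S then f x else 0) (\<lambda>x. if x \<in> S then D x else 0) UNIV"
    unfolding C1_grad_def un by auto
qed

lemma C1_grad_const: "C1_grad (\<lambda>x. c) (\<lambda>x. 0) S"
  by (auto simp: C1_grad_def)

lemma C1_grad_snd: "C1_grad (\<lambda>x. snd x) (\<lambda>x. (0, 1)) (S :: ('a::euclidean_space \<times> real) set)"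
  by (auto simp: C1_grad_def intro!: derivative_eq_intros continuous_intros)

lemma C1_grad_add:
  assumes "C1_grad f Df S" "C1_grad g Dg S"
  shows "C1_grad (\<lambda>x. f x + g x) (\<lambda>x. Df x + Dg x) S"
  using assms by (auto simp: C1_grad_def inner_add_left intro!: has_derivative_add continuous_intros)

lemma C1_grad_diff:
  assumes "C1_grad f Df S" "C1_grad g Dg S"
  shows "C1_grad (\<lambda>x. f x - g x) (\<lambda>x. Df x - Dg x) S"
  using assms by (auto simp: C1_grad_def inner_diff_left intro!: has_derivative_diff continuous_intros)

lemma C1_grad_mult:
  assumes "C1_grad f Df S" "C1_grad g Dg S"
  shows "C1_grad (\<lambda>x. f x * g x) (\<lambda>x. f x *\<^sub>R Dg x + g x *\<^sub>R Df x) S"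
proof -
  have "((\<lambda>x. f x * g x) has_derivative (\<lambda>h. (f x *\<^sub>R Dg x + g x *\<^sub>R Df x) \<bullet> h)) (at x)" if "x \<in> S" for x
    using has_derivative_mult[OF C1_gradD[OF assms(1) that] C1_gradD[OF assms(2) that]]
    by (simp add: inner_add_left algebra_simps)
  moreover have "continuous_on S (\<lambda>x. f x *\<^sub>R Dg x + g x *\<^sub>R Df x)"
    using assms[THEN C1_grad_continuous] assms[THEN C1_grad_continuous_D]
    by (intro continuous_intros)
  ultimately show ?thesis by (simp add: C1_grad_def)
qed

lemma C1_grad_compose_real:
  assumes f: "C1_grad f Df S" and r: "\<And>x. x \<in> S \<Longrightarrow> f x \<in> R"
    and "\<And>y. y \<in> R \<Longrightarrow> (\<phi> has_real_derivative \<phi>' y) (at y)" "continuous_on R \<phi>'"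
  shows "C1_grad (\<lambda>x. \<phi> (f x)) (\<lambda>x. \<phi>' (f x) *\<^sub>R Df x) S"
proof -
  have "((\<lambda>x. \<phi> (f x)) has_derivative (\<lambda>h. (\<phi>' (f x) *\<^sub>R Df x) \<bullet> h)) (at x)" if "x \<in> S" for x
    using has_derivative_compose[OF C1_gradD[OF f that], of \<phi> "(*) (\<phi>' (f x))"] assms(3)[OF r[OF that]]
    by (simp add: has_field_derivative_def)
  moreover have "continuous_on S (\<lambda>x. \<phi>' (f x) *\<^sub>R Df x)"
    by (intro continuous_intros continuous_on_compose2[OF assms(4) C1_grad_continuous[OF f]]
        C1_grad_continuous_D[OF f]) (use r in auto)
  ultimately show ?thesis by (simp add: C1_grad_def)
qed

lemma C1_grad_inverse:
  assumes f: "C1_grad f Df S" and r: "\<And>x. x \<in> S \<Longrightarrow> f x \<noteq> 0"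
  shows "C1_grad (\<lambda>x. inverse (f x)) (\<lambda>x. - (inverse (f x) ^ 2) *\<^sub>R Df x) S"
  by (rule C1_grad_compose_real[OF f, where R = "- {0}" and \<phi>' = "\<lambda>y. - (inverse y ^ 2)"])
    (auto intro!: derivative_eq_intros continuous_intros simp: r power2_eq_square)

text \<open>
  Powers of positive parts provide all the \<open>C\<^sup>1\<close> cutoff functions below.
\<close>

lemma has_real_derivative_pos_part_power:
  assumes k: "k \<ge> 2"
  shows "((\<lambda>x::real. max 0 x ^ k) has_real_derivative real k * max 0 x ^ (k - 1)) (at x)"
proof -
  consider "x < 0" | "x > 0" | "x = 0" by linarith
  then show ?thesis
  proof cases
    case 1
    have "((\<lambda>x::real. 0) has_real_derivative real k * max 0 x ^ (k - 1)) (at x)"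
      using 1 k by (simp add: max_def power_0_left)
    then show ?thesis
      by (rule has_field_derivative_transform_within_open[where S = "{..<0}"]) (use 1 k in \<open>auto simp: max_def\<close>)
  next
    case 2
    have "((\<lambda>x::real. x ^ k) has_real_derivative real k * max 0 x ^ (k - 1)) (at x)"
      using 2 by (auto simp: max_def intro!: derivative_eq_intros)
    then show ?thesis
      by (rule has_field_derivative_transform_within_open[where S = "{0<..}"]) (use 2 in \<open>auto simp: max_def\<close>)
  next
    case 3
    have "(\<lambda>h. (max 0 (0 + h) ^ k - max 0 0 ^ k) / h) \<midarrow>0\<rightarrow> (0::real)"
    proof (rule Lim_null_comparison)
      show "\<forall>\<^sub>F h in at 0. norm ((max 0 (0 + h) ^ k - max 0 0 ^ k) / h) \<le> \<bar>h\<bar> ^ (k - 1)"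
      proof (rule always_eventually, intro allI)
        fix h :: real
        obtain l where l: "k = Suc l" using k by (cases k) auto
        show "norm ((max 0 (0 + h) ^ k - max 0 0 ^ k) / h) \<le> \<bar>h\<bar> ^ (k - 1)"
          using k by (auto simp: max_def l)
      qed
      show "((\<lambda>h::real. \<bar>h\<bar> ^ (k - 1)) \<longlongrightarrow> 0) (at 0)"
        by (intro tendsto_null_power tendsto_rabs_zero tendsto_ident_at) (use k in auto)
    qed
    then show ?thesis using 3 k by (simp add: DERIV_def power_0_left)
  qed
qed

lemma C1_grad_fst:
  assumes "C1_grad f D V"
  shows "C1_grad (\<lambda>x. f (fst x)) (\<lambda>x. (D (fst x), 0)) {x :: 'a::euclidean_space \<times> real. fst x \<in> V}"
proof -
  have "((\<lambda>x. f (fst x)) has_derivative (\<lambda>h. (D (fst x), 0) \<bullet> h)) (at x)" if "fst x \<in> V" for x :: "'a \<times> real"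
    using has_derivative_compose[OF has_derivative_fst[OF has_derivative_ident] C1_gradD[OF assms that]]
    by (simp add: inner_prod_def)
  moreover have "continuous_on {x :: 'a \<times> real. fst x \<in> V} (\<lambda>x. (D (fst x), 0::real))"
    by (intro continuous_intros continuous_on_compose2[OF C1_grad_continuous_D[OF assms]]) auto
  ultimately show ?thesis by (simp add: C1_grad_def)
qed

lemma C1_grad_compose_shift_fst:
  fixes f s :: "'a::euclidean_space \<times> real \<Rightarrow> real"
  assumes f: "C1_grad f D UNIV" and s: "C1_grad s Ds S"
  shows "C1_grad (\<lambda>x. f (fst x - c, s x))
     (\<lambda>x. (fst (D (fst x - c, s x)), 0) + snd (D (fst x - c, s x)) *\<^sub>R Ds x) S"
proof -
  have "((\<lambda>x. f (fst x - c, s x)) has_derivative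
      (\<lambda>h. ((fst (D (fst x - c, s x)), 0) + snd (D (fst x - c, s x)) *\<^sub>R Ds x) \<bullet> h)) (at x)"
    if x: "x \<in> S" for x
  proof -
    have "((\<lambda>x. (fst x - c, s x)) has_derivative (\<lambda>h. (fst h, Ds x \<bullet> h))) (at x)"
      by (auto intro!: derivative_eq_intros C1_gradD[OF s x])
    from has_derivative_compose[OF this C1_gradD[OF f UNIV_I]] show ?thesis
      by (simp add: inner_prod_def inner_add_left algebra_simps)
  qed
  moreover have "continuous_on S (\<lambda>x. (fst (D (fst x - c, s x)), 0::real) + snd (D (fst x - c, s x)) *\<^sub>R Ds x)"
    by (intro continuous_intros continuous_on_compose2[OF C1_grad_continuous_D[OF f]] C1_grad_continuous_D[OF s] C1_grad_continuous[OF s]) auto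
  ultimately show ?thesis by (simp add: C1_grad_def)
qed

section \<open>Testing weak gradients\<close>

text \<open>
  A test function needs to be \<open>C\<^sup>1\<close> only on \<open>S\<close>, if it vanishes off a compact subset of \<open>S\<close>: its extension
  by zero is \<open>C\<^sup>1\<close> everywhere.
\<close>

lemma weak_gradient_test:
  assumes w: "weak_gradient S u G" and S: "open S" and f: "C1_grad f D S"
    and K: "compact K" "K \<subseteq> S" and 0: "\<And>x. x \<in> S - K \<Longrightarrow> f x = 0"
    and b: "b \<in> Basis"
  shows "set_lebesgue_integral lborel S (\<lambda>x. u x * (D x \<bullet> b))
       = - set_lebesgue_integral lborel S (\<lambda>x. (G x \<bullet> b) * f x)"
proof -
  let ?f = "\<lambda>x. if x \<in> S then f x else 0" and ?D = "\<lambda>x. if x \<in> S then D x else 0"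
  have K': "closed K" using K compact_imp_closed by auto
  have C: "C1_grad ?f ?D UNIV" by (rule C1_grad_extend_zero(1)[OF S f K' K(2) 0])
  have cl: "closure {x. ?f x \<noteq> 0} \<subseteq> K"
    by (rule closure_minimal) (use 0 K' in auto)
  moreover have "compact (closure {x. ?f x \<noteq> 0})"
    using cl K(1) by (metis closed_closure compact_Int_closed inf.absorb_iff2)
  ultimately have "set_lebesgue_integral lborel S (\<lambda>x. u x * frechet_derivative ?f (at x) b)
       = - set_lebesgue_integral lborel S (\<lambda>x. (G x \<bullet> b) * ?f x)"
    using w b C1_grad_Ck_on_one[OF C] K(2) unfolding weak_gradient_def by blast
  then have e: "set_lebesgue_integral lborel S (\<lambda>x. u x * (?D x \<bullet> b))
       = - set_lebesgue_integral lborel S (\<lambda>x. (G x \<bullet> b) * ?f x)"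
    by (simp only: C1_grad_frechet[OF C UNIV_I])
  have "set_lebesgue_integral lborel S (\<lambda>x. u x * (?D x \<bullet> b)) = set_lebesgue_integral lborel S (\<lambda>x. u x * (D x \<bullet> b))"
    by (rule set_lebesgue_integral_cong) (use S in auto)
  moreover have "set_lebesgue_integral lborel S (\<lambda>x. (G x \<bullet> b) * ?f x) = set_lebesgue_integral lborel S (\<lambda>x. (G x \<bullet> b) * f x)"
    by (rule set_lebesgue_integral_cong) (use S in auto)
  ultimately show ?thesis using e by simp
qed

lemma weak_gradientI:
  assumes S: "open S"
    and loc: "\<And>K. compact K \<Longrightarrow> K \<subseteq> S \<Longrightarrow> set_integrable lborel K u \<and> set_integrable lborel K G"
    and ibp: "\<And>f D K b. C1_grad f D UNIV \<Longrightarrow> compact K \<Longrightarrow> K \<subseteq> S \<Longrightarrow> (\<And>x. x \<notin> K \<Longrightarrow> f x = 0) \<Longrightarrow> 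
       (\<And>x. x \<notin> K \<Longrightarrow> D x = 0) \<Longrightarrow> b \<in> Basis \<Longrightarrow>
       set_lebesgue_integral lborel S (\<lambda>x. u x * (D x \<bullet> b))
       = - set_lebesgue_integral lborel S (\<lambda>x. (G x \<bullet> b) * f x)"
  shows "weak_gradient S u G"
  unfolding weak_gradient_def
proof (intro conjI allI impI ballI)
  fix K assume "compact K \<and> K \<subseteq> S"
  then show "set_integrable lborel K u" "set_integrable lborel K G" using loc by auto
next
  fix f :: "'a \<Rightarrow> real" and b :: 'a
  assume f: "Ck_on 1 UNIV f \<and> compact (closure {x. f x \<noteq> 0}) \<and> closure {x. f x \<noteq> 0} \<subseteq> S"
    and b: "b \<in> Basis"
  define K where "K = closure {x. f x \<noteq> 0}"
  have C: "C1_grad f (grad f) UNIV" using f Ck_on_one_C1_grad[of 1 UNIV f] by auto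
  have K: "compact K" "K \<subseteq> S" "\<And>x. x \<notin> K \<Longrightarrow> f x = 0"
    using f closure_subset[of "{x. f x \<noteq> 0}"] by (auto simp: K_def)
  have "\<And>x. x \<in> UNIV - K \<Longrightarrow> grad f x = 0"
    by (rule C1_grad_extend_zero(2)[OF open_UNIV C]) (use K compact_imp_closed in auto)
  then have "set_lebesgue_integral lborel S (\<lambda>x. u x * (grad f x \<bullet> b))
       = - set_lebesgue_integral lborel S (\<lambda>x. (G x \<bullet> b) * f x)"
    by (intro ibp[OF C K(1,2) K(3) _ b]) auto
  then show "set_lebesgue_integral lborel S (\<lambda>x. u x * frechet_derivative f (at x) b)
      = - set_lebesgue_integral lborel S (\<lambda>x. (G x \<bullet> b) * f x)"
    by (simp only: C1_grad_frechet[OF C UNIV_I])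
qed

text \<open>
  A continuous factor is bounded on the compact set that carries it, so local integrability
  suffices. All integrals against test functions are of this kind, with the product of reals, the
  action of scalars on vectors, or the latter with its arguments exchanged.
\<close>

lemma set_integrable_bilinear_continuous_compact:
  fixes u :: "'b::euclidean_space \<Rightarrow> 'c::euclidean_space" and c :: "'b \<Rightarrow> 'd::euclidean_space"
    and pr :: "'d \<Rightarrow> 'c \<Rightarrow> 'e::euclidean_space"
  assumes pr: "bounded_bilinear pr"
    and u: "set_integrable lborel K u" and K: "compact K" "K \<subseteq> S"
    and c: "continuous_on K c" and 0: "\<And>x. x \<in> S - K \<Longrightarrow> c x = 0"
  shows "set_integrable lborel S (\<lambda>x. pr (c x) (u x))"
proof -
  interpret pr: bounded_bilinear pr by (rule pr)
  have eq: "(\<lambda>x. indicat_real S x *\<^sub>R (pr (c x) (u x))) = (\<lambda>x. pr (indicat_real K x *\<^sub>R c x) (indicat_real K x *\<^sub>R u x))"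
    using K(2) 0 by (auto simp: indicator_def fun_eq_iff pr.zero_left)
  have "compact (c ` K)" using compact_continuous_image[OF c K(1)] .
  then obtain B where B: "\<And>x. x \<in> K \<Longrightarrow> norm (c x) \<le> B" 
    by (metis (no_types, opaque_lifting) bounded_iff compact_imp_bounded image_eqI)
  obtain C where C: "C > 0" "\<And>a b. norm (pr a b) \<le> norm a * norm b * C"
    using pr.pos_bounded by blast
  have mc: "(\<lambda>x. indicat_real K x *\<^sub>R c x) \<in> borel_measurable borel"
    using borel_measurable_continuous_on_indicator[OF borel_compact[OF K(1)] c] .
  have "integrable lborel (\<lambda>x. pr (indicat_real K x *\<^sub>R c x) (indicat_real K x *\<^sub>R u x))"
  proof (rule Bochner_Integration.integrable_bound)
    show "integrable lborel (\<lambda>x. (\<bar>B\<bar> * C) *\<^sub>R (indicat_real K x *\<^sub>R u x))"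
      using u unfolding set_integrable_def by (intro integrable_scaleR_right)
    have H: "continuous_on UNIV (\<lambda>x. pr (fst x) (snd x))"
      by (intro pr.continuous_on continuous_intros)
    have m: "(\<lambda>x. indicat_real K x *\<^sub>R c x) \<in> borel_measurable lborel"
        "(\<lambda>x. indicat_real K x *\<^sub>R u x) \<in> borel_measurable lborel"
      using mc u by (auto simp: set_integrable_def)
    show "(\<lambda>x. pr (indicat_real K x *\<^sub>R c x) (indicat_real K x *\<^sub>R u x)) \<in> borel_measurable lborel"
      by (rule borel_measurable_continuous_Pair[where H = pr, OF m H])
    show "AE x in lborel. norm (pr (indicat_real K x *\<^sub>R c x) (indicat_real K x *\<^sub>R u x)) \<le> norm ((\<bar>B\<bar> * C) *\<^sub>R (indicat_real K x *\<^sub>R u x))"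
    proof (intro AE_I2)
      fix x show "norm (pr (indicat_real K x *\<^sub>R c x) (indicat_real K x *\<^sub>R u x)) \<le> norm ((\<bar>B\<bar> * C) *\<^sub>R (indicat_real K x *\<^sub>R u x))"
      proof (cases "x \<in> K")
        case True
        have "norm (c x) * norm (u x) * C \<le> \<bar>B\<bar> * norm (u x) * C"
          using B[OF True] C(1) by (intro mult_right_mono) auto
        with C(2)[of "c x" "u x"] have "norm (pr (c x) (u x)) \<le> \<bar>B\<bar> * norm (u x) * C" by linarith
        with True C(1) show ?thesis by (simp add: abs_mult ac_simps)
      qed (simp add: pr.zero_left)
    qed
  qed
  then show ?thesis unfolding set_integrable_def eq .
qed

lemmas set_integrable_scaleR_continuous_compact =
  set_integrable_bilinear_continuous_compact[OF bounded_bilinear_scaleR]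

lemmas set_integrable_mult_continuous_compact =
  set_integrable_bilinear_continuous_compact[OF bounded_bilinear_mult[where 'a = real]]

lemma set_integrable_Pair:
  fixes f :: "'a \<Rightarrow> 'b::euclidean_space" and g :: "'a \<Rightarrow> 'c::euclidean_space"
  assumes "set_integrable M A f" "set_integrable M A g"
  shows "set_integrable M A (\<lambda>x. (f x, g x))"
proof -
  have "bounded_linear (\<lambda>a::'b. (a, 0::'c))" "bounded_linear (\<lambda>a::'c. (0::'b, a))"
    by (auto intro!: bounded_linear_Pair bounded_linear_ident bounded_linear_zero)
  then have "integrable M (\<lambda>x. (indicator A x *\<^sub>R f x, 0::'c) + (0::'b, indicator A x *\<^sub>R g x))"
    using assms unfolding set_integrable_def
    by (intro Bochner_Integration.integrable_add) (rule integrable_bounded_linear, assumption+)+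
  then show ?thesis by (simp add: set_integrable_def)
qed

lemma set_integrable_bounded_linear:
  assumes "bounded_linear T" "set_integrable M A f"
  shows "set_integrable M A (\<lambda>x. T (f x))"
  using integrable_bounded_linear[OF assms(1), of M "\<lambda>x. indicator A x *\<^sub>R f x"] assms
  by (simp add: set_integrable_def linear_simps)

section \<open>Weak gradients under the flattening map\<close>

lemma nn_integral_lborel_translate:
  fixes c :: "'a::euclidean_space"
  assumes "f \<in> borel_measurable borel"
  shows "(\<integral>\<^sup>+x. f x \<partial>lborel) = (\<integral>\<^sup>+x. f (c + x) \<partial>lborel)"
  using assms by (subst lborel_distr_plus[symmetric, of c]) (simp add: nn_integral_distr)

lemma nn_integral_lborel_prod_real:
  fixes f :: "'a::euclidean_space \<times> real \<Rightarrow> ennreal"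
  assumes "f \<in> borel_measurable borel"
  shows "(\<integral>\<^sup>+x. f x \<partial>lborel) = (\<integral>\<^sup>+x. \<integral>\<^sup>+t. f (x, t) \<partial>lborel \<partial>lborel)"
  using lborel.nn_integral_fst[of f "lborel :: 'a measure"] assms
  by (simp add: lborel_prod borel_prod)

text \<open>
  The map \<open>T\<close> sends the flat layer \<open>P\<close> of thickness \<open>\<delta>0\<close> onto the region \<open>N\<close> between the graphs of \<open>lo\<close> and
  \<open>lo + dl\<close>; \<open>F\<close> is its inverse. It translates horizontally by \<open>x0\<close> and is affine in the vertical
  direction, so its Jacobian determinant is \<open>dl / \<delta>0\<close>.
\<close>

locale flattening =
  fixes V :: "'a::euclidean_space set" and lo dl :: "'a \<Rightarrow> real" and Dlo Ddl :: "'a \<Rightarrow> 'a"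
    and x0 :: 'a and \<delta>0 :: real
  assumes V: "open V" and lo: "C1_grad lo Dlo V" and dl: "C1_grad dl Ddl V"
    and dl_pos: "\<And>x. x \<in> V \<Longrightarrow> dl x > 0" and \<delta>0: "\<delta>0 > 0"
begin

definition N where "N = {x. fst x \<in> V \<and> lo (fst x) < snd x \<and> snd x < lo (fst x) + dl (fst x)}"

definition P where "P = {z :: 'a \<times> real. x0 + fst z \<in> V \<and> \<bar>snd z\<bar> < \<delta>0 / 2}"

definition T where "T z = (x0 + fst z, lo (x0 + fst z) + dl (x0 + fst z) * (snd z / \<delta>0 + 1 / 2))" for z

definition s where "s x = \<delta>0 * ((snd x - lo (fst x)) * inverse (dl (fst x)) - 1 / 2)" for x

definition F where "F x = (fst x - x0, s x)" for x

lemma FT: "z \<in> P \<Longrightarrow> F (T z) = z"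
  using dl_pos[of "x0 + fst z"] \<delta>0 by (auto simp: F_def T_def s_def P_def prod_eq_iff field_simps)

lemma TF: "x \<in> N \<Longrightarrow> T (F x) = x"
  using dl_pos[of "fst x"] \<delta>0 by (auto simp: F_def T_def s_def N_def prod_eq_iff field_simps)

lemma T_in_iff: 
  assumes "x0 + fst z \<in> V"
  shows "T z \<in> N \<longleftrightarrow> \<bar>snd z\<bar> < \<delta>0 / 2"
proof -
  let ?d = "dl (x0 + fst z)"
  have d: "?d > 0" using dl_pos assms by auto
  have "T z \<in> N \<longleftrightarrow> 0 < ?d * (snd z / \<delta>0 + 1 / 2) \<and> ?d * (snd z / \<delta>0 + 1 / 2) < ?d * 1"
    using assms by (auto simp: N_def T_def)
  also have "\<dots> \<longleftrightarrow> 0 < snd z / \<delta>0 + 1 / 2 \<and> snd z / \<delta>0 + 1 / 2 < 1"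
    using d by (simp add: zero_less_mult_iff mult_less_cancel_left_disj del: mult_1_right)
  also have "\<dots> \<longleftrightarrow> \<bar>snd z\<bar> < \<delta>0 / 2"
    using \<delta>0 by (auto simp: field_simps abs_if)
  finally show ?thesis .
qed

lemma T_in: "z \<in> P \<Longrightarrow> T z \<in> N"
  using T_in_iff[of z] by (auto simp: P_def)

lemma cont_lo: "continuous_on V lo" and cont_dl: "continuous_on V dl"
  and cont_Dlo: "continuous_on V Dlo" and cont_Ddl: "continuous_on V Ddl"
  using lo dl C1_grad_continuous C1_grad_continuous_D by auto

lemma open_cyl: "open {z :: 'a \<times> real. x0 + fst z \<in> V}" "open {z :: 'a \<times> real. fst z \<in> V}"
  using open_vimage[OF V, of "\<lambda>z :: 'a \<times> real. x0 + fst z"] open_vimage[OF V, of "fst :: 'a \<times> real \<Rightarrow> 'a"]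
  by (auto simp: vimage_def continuous_on_fst continuous_on_add continuous_on_const continuous_on_id)

lemma open_P: "open P"
proof -
  have "P = {z :: 'a \<times> real. x0 + fst z \<in> V} \<inter> {z. \<bar>snd z\<bar> < \<delta>0 / 2}" by (auto simp: P_def)
  moreover have "open {z :: 'a \<times> real. \<bar>snd z\<bar> < \<delta>0 / 2}"
    by (intro open_Collect_less continuous_intros)
  ultimately show ?thesis using open_cyl by auto
qed

lemma cont_comp: 
  assumes "continuous_on V f"
  shows "continuous_on {z :: 'a \<times> real. x0 + fst z \<in> V} (\<lambda>z. f (x0 + fst z))"
    "continuous_on {z :: 'a \<times> real. fst z \<in> V} (\<lambda>z. f (fst z))"
  by (rule continuous_on_compose2[OF assms]; force intro!: continuous_intros)+

lemma cont_T: "continuous_on {z. x0 + fst z \<in> V} T"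
  unfolding T_def using \<delta>0 by (intro continuous_intros cont_comp cont_lo cont_dl) auto

lemma open_N: "open N"
proof -
  let ?U = "{z :: 'a \<times> real. fst z \<in> V}"
  have "open (?U \<inter> (\<lambda>z. snd z - lo (fst z)) -` {0<..})"
    by (intro continuous_open_preimage open_cyl continuous_intros cont_comp cont_lo)
  moreover have "open (?U \<inter> (\<lambda>z. lo (fst z) + dl (fst z) - snd z) -` {0<..})"
    by (intro continuous_open_preimage open_cyl continuous_intros cont_comp cont_lo cont_dl)
  moreover have "N = (?U \<inter> (\<lambda>z. snd z - lo (fst z)) -` {0<..}) \<inter> (?U \<inter> (\<lambda>z. lo (fst z) + dl (fst z) - snd z) -` {0<..})"
    by (auto simp: N_def)
  ultimately show ?thesis by auto
qed

lemma meas_T [measurable]: "(\<lambda>z. if z \<in> P then T z else 0) \<in> borel \<rightarrow>\<^sub>M borel"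
  using open_P by (intro borel_measurable_continuous_on_if continuous_on_subset[OF cont_T] continuous_intros)
    (auto simp: P_def)

lemma meas_dl [measurable]: "(\<lambda>z. if z \<in> P then dl (x0 + fst z) / \<delta>0 else 0) \<in> borel_measurable borel"
  using open_P \<delta>0 by (intro borel_measurable_continuous_on_if continuous_intros continuous_on_subset[OF cont_comp(1)[OF cont_dl]])
    (auto simp: P_def)

text \<open>
  By Fubini, since on every vertical line \<open>T\<close> is an affine map of the real line. The integrands are
  set to 0 off \<open>P\<close> because \<open>lo\<close> and \<open>dl\<close> are measurable on \<open>V\<close> only.
\<close>

lemma nn_integral_flatten:
  assumes [measurable]: "f \<in> borel_measurable borel"
  shows "(\<integral>\<^sup>+x. f x * indicator N x \<partial>lborel) = 
    (\<integral>\<^sup>+z. ennreal (if z \<in> P then dl (x0 + fst z) / \<delta>0 else 0) * f (if z \<in> P then T z else 0) \<partial>lborel)"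
proof -
  have [measurable]: "N \<in> sets borel" using open_N by auto
  have "(\<integral>\<^sup>+x. f x * indicator N x \<partial>lborel) = (\<integral>\<^sup>+x. \<integral>\<^sup>+t. f (x, t) * indicator N (x, t) \<partial>lborel \<partial>lborel)"
    by (rule nn_integral_lborel_prod_real) measurable
  also have "\<dots> = (\<integral>\<^sup>+x. \<integral>\<^sup>+t. f (x0 + x, t) * indicator N (x0 + x, t) \<partial>lborel \<partial>lborel)"
    by (rule nn_integral_lborel_translate) (measurable; simp add: borel_prod)
  also have "\<dots> = (\<integral>\<^sup>+x. \<integral>\<^sup>+t. ennreal (if (x, t) \<in> P then dl (x0 + fst (x, t)) / \<delta>0 else 0) * f (if (x, t) \<in> P then T (x, t) else 0) \<partial>lborel \<partial>lborel)"
  proof (rule nn_integral_cong)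
    fix x :: 'a
    show "(\<integral>\<^sup>+t. f (x0 + x, t) * indicator N (x0 + x, t) \<partial>lborel) =
      (\<integral>\<^sup>+t. ennreal (if (x, t) \<in> P then dl (x0 + fst (x, t)) / \<delta>0 else 0) * f (if (x, t) \<in> P then T (x, t) else 0) \<partial>lborel)"
    proof (cases "x0 + x \<in> V")
      case True
      let ?d = "dl (x0 + x)"
      have d: "?d > 0" using True dl_pos by auto
      have Pair1: "(\<lambda>t. (x0 + x, t)) \<in> borel \<rightarrow>\<^sub>M borel" "(\<lambda>t. (x, t)) \<in> borel \<rightarrow>\<^sub>M borel"
        by (auto intro!: borel_measurable_continuous_onI continuous_intros)
      have m: "(\<lambda>t. f (x0 + x, t) * indicator N (x0 + x, t)) \<in> borel_measurable borel"
        using Pair1(1) by (intro borel_measurable_times_ennreal measurable_compose[OF Pair1(1)]) auto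
      have T': "(x0 + x, lo (x0 + x) + ?d / 2 + ?d / \<delta>0 * t) = T (x, t)" for t
        by (auto simp: T_def algebra_simps)
      have "(\<integral>\<^sup>+t. f (x0 + x, t) * indicator N (x0 + x, t) \<partial>lborel) =
         ennreal (?d / \<delta>0) * (\<integral>\<^sup>+t. f (T (x, t)) * indicator N (T (x, t)) \<partial>lborel)"
        using nn_integral_real_affine[OF m, of "?d / \<delta>0" "lo (x0 + x) + ?d / 2"] d \<delta>0
        by (simp add: T' del: times_divide_eq_left)
      also have "\<dots> = (\<integral>\<^sup>+t. ennreal (?d / \<delta>0) * (f (T (x, t)) * indicator N (T (x, t))) \<partial>lborel)"
        using m by (subst nn_integral_cmult) (auto simp: T'[symmetric])
      also have "\<dots> = (\<integral>\<^sup>+t. ennreal (if (x, t) \<in> P then dl (x0 + fst (x, t)) / \<delta>0 else 0) * f (if (x, t) \<in> P then T (x, t) else 0) \<partial>lborel)"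
        using T_in_iff[of "(x, _)"] True by (intro nn_integral_cong) (auto simp: P_def indicator_def)
      finally show ?thesis .
    next
      case False
      then show ?thesis by (auto simp: N_def P_def)
    qed
  qed
  also have "\<dots> = (\<integral>\<^sup>+z. ennreal (if z \<in> P then dl (x0 + fst z) / \<delta>0 else 0) * f (if z \<in> P then T z else 0) \<partial>lborel)"
    by (rule nn_integral_lborel_prod_real[symmetric]) measurable
  finally show ?thesis .
qed

lemma measure_flatten:
  "density lborel (\<lambda>x. ennreal (indicat_real N x)) =
   distr (density lborel (\<lambda>z. ennreal (if z \<in> P then dl (x0 + fst z) / \<delta>0 else 0))) borel (\<lambda>z. if z \<in> P then T z else 0)"
  (is "?A = ?B")
proof (rule measure_eqI)
  have [measurable]: "N \<in> sets borel" using open_N by auto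
  show "sets ?A = sets ?B" by simp
  fix X assume "X \<in> sets ?A"
  then have [measurable]: "X \<in> sets borel" by simp
  have "emeasure ?A X = (\<integral>\<^sup>+x. indicator X x * indicator N x \<partial>lborel)"
    by (subst emeasure_density) (auto intro!: nn_integral_cong simp: indicator_def)
  also have "\<dots> = (\<integral>\<^sup>+z. ennreal (if z \<in> P then dl (x0 + fst z) / \<delta>0 else 0) * indicator X (if z \<in> P then T z else 0) \<partial>lborel)"
    by (rule nn_integral_flatten) measurable
  also have "\<dots> = emeasure ?B X"
    using measurable_sets_borel[OF meas_T, of X]
    by (subst emeasure_distr) (auto simp: emeasure_density intro!: nn_integral_cong simp: indicator_def)
  finally show "emeasure ?A X = emeasure ?B X" .
qed

lemma integral_flatten:
  fixes h :: "'a \<times> real \<Rightarrow> 'c::euclidean_space"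
  assumes h: "set_integrable lborel N h"
  shows "set_integrable lborel P (\<lambda>z. (dl (x0 + fst z) / \<delta>0) *\<^sub>R h (T z))"
    and "set_lebesgue_integral lborel N h = set_lebesgue_integral lborel P (\<lambda>z. (dl (x0 + fst z) / \<delta>0) *\<^sub>R h (T z))"
proof -
  have [measurable]: "N \<in> sets borel" using open_N by auto
  let ?h = "\<lambda>x. indicat_real N x *\<^sub>R h x"
  let ?T = "\<lambda>z. if z \<in> P then T z else 0" and ?d = "\<lambda>z. if z \<in> P then dl (x0 + fst z) / \<delta>0 else 0"
  have d0: "?d z \<ge> 0" for z using dl_pos[of "x0 + fst z"] \<delta>0 by (auto simp: P_def)
  have [measurable]: "?h \<in> borel_measurable borel" using h by (auto simp: set_integrable_def)
  have ii: "indicat_real N x *\<^sub>R ?h x = ?h x" for x by (auto simp: indicator_def)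
  have e: "?d z *\<^sub>R ?h (?T z) = indicat_real P z *\<^sub>R ((dl (x0 + fst z) / \<delta>0) *\<^sub>R h (T z))" for z
    using T_in[of z] by (auto simp: indicator_def)
  have "integrable (density lborel (\<lambda>x. ennreal (indicat_real N x))) ?h"
    using h by (subst integrable_density) (auto simp: set_integrable_def ii simp del: scaleR_scaleR)
  then have "integrable lborel (\<lambda>z. ?d z *\<^sub>R ?h (?T z))"
    unfolding measure_flatten
    by (subst (asm) integrable_distr_eq, measurable, subst (asm) integrable_density) (auto simp: d0)
  then show "set_integrable lborel P (\<lambda>z. (dl (x0 + fst z) / \<delta>0) *\<^sub>R h (T z))"
    unfolding set_integrable_def e .
  have "set_lebesgue_integral lborel N h = integral\<^sup>L (density lborel (\<lambda>x. ennreal (indicat_real N x))) ?h"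
    by (subst integral_density) (auto simp: set_lebesgue_integral_def ii simp del: scaleR_scaleR)
  also have "\<dots> = integral\<^sup>L lborel (\<lambda>z. ?d z *\<^sub>R ?h (?T z))"
    unfolding measure_flatten
    by (subst integral_distr, measurable, subst integral_density) (auto simp: d0)
  finally show "set_lebesgue_integral lborel N h = set_lebesgue_integral lborel P (\<lambda>z. (dl (x0 + fst z) / \<delta>0) *\<^sub>R h (T z))"
    unfolding set_lebesgue_integral_def e .
qed

text \<open>
  The transposed derivative of \<open>T\<close> applied to \<open>G \<circ> T\<close>, hence the gradient of \<open>u \<circ> T\<close> if \<open>G\<close> is the gradient of
  \<open>u\<close>.
\<close>

definition pull where
  "pull G z = (fst (G (T z)) + snd (G (T z)) *\<^sub>R (Dlo (x0 + fst z) + (snd z / \<delta>0 + 1 / 2) *\<^sub>R Ddl (x0 + fst z)),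
     dl (x0 + fst z) / \<delta>0 * snd (G (T z)))" for G :: "'a \<times> real \<Rightarrow> 'a \<times> real"

lemma set_integrable_remove_jacobian:
  fixes h :: "'a \<times> real \<Rightarrow> 'c::euclidean_space"
  assumes K: "compact K" "K \<subseteq> {z. x0 + fst z \<in> V}"
    and i: "set_integrable lborel K (\<lambda>z. (dl (x0 + fst z) / \<delta>0) *\<^sub>R h (T z))"
  shows "set_integrable lborel K (\<lambda>z. h (T z))"
proof -
  have dl0: "dl (x0 + fst z) \<noteq> 0" if "z \<in> K" for z
    using that K(2) dl_pos[of "x0 + fst z"] by auto
  have c: "continuous_on K (\<lambda>z. \<delta>0 / dl (x0 + fst z))"
    by (intro continuous_intros continuous_on_subset[OF cont_comp(1)[OF cont_dl] K(2)] ballI dl0)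
  have "set_integrable lborel K (\<lambda>z. (\<delta>0 / dl (x0 + fst z)) *\<^sub>R (dl (x0 + fst z) / \<delta>0) *\<^sub>R h (T z))"
    by (rule set_integrable_scaleR_continuous_compact[OF i K(1) order_refl c]) auto
  moreover have "set_integrable lborel K (\<lambda>z. (\<delta>0 / dl (x0 + fst z)) *\<^sub>R (dl (x0 + fst z) / \<delta>0) *\<^sub>R h (T z))
      = set_integrable lborel K (\<lambda>z. h (T z))"
    by (rule set_integrable_cong[OF refl refl]) (use dl0 \<delta>0 in simp)
  ultimately show ?thesis by (simp only:)
qed

lemma set_integrable_T:
  fixes h :: "'a \<times> real \<Rightarrow> 'c::euclidean_space"
  assumes K: "compact K" "K \<subseteq> P" and h: "set_integrable lborel (T ` K) h"
  shows "set_integrable lborel K (\<lambda>z. h (T z))"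
proof -
  have TK: "T ` K \<subseteq> N" using K T_in by auto
  have KK: "compact (T ` K)"
    using K by (intro compact_continuous_image continuous_on_subset[OF cont_T]) (auto simp: P_def)
  have "set_integrable lborel N (\<lambda>x. indicat_real (T ` K) x *\<^sub>R h x)"
    by (rule set_integrable_scaleR_continuous_compact[OF h KK TK])
      (auto intro!: continuous_on_eq[OF continuous_on_const[of _ 1]])
  from integral_flatten(1)[OF this]
  have "set_integrable lborel P (\<lambda>z. (dl (x0 + fst z) / \<delta>0) *\<^sub>R indicat_real (T ` K) (T z) *\<^sub>R h (T z))" .
  then have "set_integrable lborel K (\<lambda>z. (dl (x0 + fst z) / \<delta>0) *\<^sub>R indicat_real (T ` K) (T z) *\<^sub>R h (T z))"
    by (rule set_integrable_subset) (use K borel_compact in auto)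
  moreover have KV: "K \<subseteq> {z. x0 + fst z \<in> V}" using K(2) by (auto simp: P_def)
  ultimately have "set_integrable lborel K (\<lambda>z. indicat_real (T ` K) (T z) *\<^sub>R h (T z))"
    by (intro set_integrable_remove_jacobian[OF K(1) KV, where h = "\<lambda>x. indicat_real (T ` K) x *\<^sub>R h x"])
  moreover have "set_integrable lborel K (\<lambda>z. indicat_real (T ` K) (T z) *\<^sub>R h (T z)) = set_integrable lborel K (\<lambda>z. h (T z))"
    by (rule set_integrable_cong[OF refl refl]) simp
  ultimately show ?thesis by (simp only:)
qed

text \<open>
  Up to the horizontal faces of \<open>P\<close>: a function that is integrable on all of \<open>N\<close> is integrable after flattening on
  sets that reach the faces. The even reflection needs this.
\<close>

lemma set_integrable_strip:
  fixes h :: "'a \<times> real \<Rightarrow> 'c::euclidean_space"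
  assumes h: "set_integrable lborel N h" and h0: "\<And>x. x \<notin> N \<Longrightarrow> h x = 0"
    and C: "compact C" "C \<subseteq> {y. x0 + y \<in> V}"
  shows "set_integrable lborel (C \<times> {-(\<delta>0 / 2)..\<delta>0 / 2}) (\<lambda>z. h (T z))"
proof -
  let ?K = "C \<times> {-(\<delta>0 / 2)..\<delta>0 / 2}"
  let ?f = "\<lambda>z. (dl (x0 + fst z) / \<delta>0) *\<^sub>R h (T z)"
  have K: "compact ?K" by (intro compact_Times C compact_Icc)
  have KV: "?K \<subseteq> {z. x0 + fst z \<in> V}" using C(2) by auto
  have mK: "?K \<in> sets borel" "P \<in> sets borel" using borel_compact[OF K] open_P by auto
  have "set_integrable lborel (?K \<inter> P) ?f"
    by (rule set_integrable_subset[OF integral_flatten(1)[OF h]]) (use mK in auto)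
  moreover have "indicat_real (?K \<inter> P) z *\<^sub>R ?f z = indicat_real ?K z *\<^sub>R ?f z" for z
  proof (cases "z \<in> ?K \<and> z \<notin> P")
    case True
    then have "x0 + fst z \<in> V" "\<not> \<bar>snd z\<bar> < \<delta>0 / 2" using KV by (auto simp: P_def)
    then have "h (T z) = 0" using T_in_iff h0 by blast
    then show ?thesis by simp
  qed (auto simp: indicator_def)
  ultimately have "set_integrable lborel ?K ?f" by (simp only: set_integrable_def)
  then show ?thesis by (rule set_integrable_remove_jacobian[OF K KV])
qed

lemma set_integrable_pull:
  assumes K: "compact K" "K \<subseteq> {z. x0 + fst z \<in> V}" and G: "set_integrable lborel K (\<lambda>z. G (T z))"
  shows "set_integrable lborel K (pull G)"
proof -
  note G1 = set_integrable_bounded_linear[OF bounded_linear_fst G]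
  note G2 = set_integrable_bounded_linear[OF bounded_linear_snd G]
  have c1: "continuous_on K (\<lambda>z. Dlo (x0 + fst z) + (snd z / \<delta>0 + 1 / 2) *\<^sub>R Ddl (x0 + fst z))"
    using \<delta>0 by (intro continuous_intros continuous_on_subset[OF cont_comp(1) K(2)] cont_Dlo cont_Ddl) auto
  have c2: "continuous_on K (\<lambda>z. dl (x0 + fst z) / \<delta>0)"
    using \<delta>0 by (intro continuous_intros continuous_on_subset[OF cont_comp(1) K(2)] cont_dl) auto
  show ?thesis
    unfolding pull_def
    by (intro set_integrable_Pair set_integral_add(1) G1
      set_integrable_bilinear_continuous_compact[OF bounded_bilinear.flip[OF bounded_bilinear_scaleR] G2 K(1)]
      set_integrable_mult_continuous_compact[OF G2 K(1)] c1 c2) auto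
qed

text \<open>
  Let \<open>f\<close> be a test function on \<open>P\<close>. Substituting \<open>x = T z\<close> in the integral of \<open>u (T z) \<partial>\<^sub>b f(z)\<close> gives the integral of
  \<open>u\<close> against \<open>(\<delta>0 / dl) (\<partial>\<^sub>b f) \<circ> F\<close> on \<open>N\<close>. This function is not a partial derivative, but it is the divergence
  of a \<open>C\<^sup>1\<close> vector field with compact support in \<open>N\<close>, the Piola transform of \<open>f b\<close>, that is
  \<open>(\<delta>0 / dl) (f \<circ> F) DT b\<close>. So the definition of the weak gradient can be applied to the components of
  the field. For the vertical direction the field is \<open>f \<circ> F\<close> times the vertical unit vector. For a
  horizontal direction \<open>b'\<close> it has the component \<open>ps = (\<delta>0 / dl) (f \<circ> F)\<close> in direction \<open>b'\<close> and the vertical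
  component \<open>ps W\<close>, where \<open>W\<close> is the vertical velocity of \<open>T\<close> in direction \<open>b'\<close>. Here \<open>W\<close> contains the gradients
  of \<open>lo\<close> and \<open>dl\<close>, which must therefore be \<open>C\<^sup>1\<close>.
\<close>

lemma weak_gradient_flatten:
  assumes w: "weak_gradient N u G"
    and C2: "\<And>b. b \<in> Basis \<Longrightarrow> \<exists>D. C1_grad (\<lambda>x. Dlo x \<bullet> b) D V"
      "\<And>b. b \<in> Basis \<Longrightarrow> \<exists>D. C1_grad (\<lambda>x. Ddl x \<bullet> b) D V"
  shows "weak_gradient P (\<lambda>z. u (T z)) (pull G)"
proof (rule weak_gradientI[OF open_P])
  fix K assume K: "compact K" "K \<subseteq> P"
  have KK: "compact (T ` K)" "T ` K \<subseteq> N"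
    using K T_in by (auto intro!: compact_continuous_image continuous_on_subset[OF cont_T] simp: P_def)
  then have i: "set_integrable lborel (T ` K) u" "set_integrable lborel (T ` K) G"
    using w unfolding weak_gradient_def by auto
  have G: "set_integrable lborel K (\<lambda>z. G (T z))"
    by (rule set_integrable_T[OF K i(2)])
  have KV: "K \<subseteq> {z. x0 + fst z \<in> V}" using K(2) by (auto simp: P_def)
  have "set_integrable lborel K (pull G)" by (rule set_integrable_pull[OF K(1) KV G])
  with set_integrable_T[OF K i(1)]
  show "set_integrable lborel K (\<lambda>z. u (T z)) \<and> set_integrable lborel K (pull G)" by simp
next
  fix f :: "'a \<times> real \<Rightarrow> real" and D K and b :: "'a \<times> real"
  assume f: "C1_grad f D UNIV" and K: "compact K" "K \<subseteq> P" and f0: "\<And>x. x \<notin> K \<Longrightarrow> f x = 0"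
    and D0: "\<And>x. x \<notin> K \<Longrightarrow> D x = 0" and b: "b \<in> Basis"
  have KK: "compact (T ` K)" "T ` K \<subseteq> N"
    using K T_in by (auto intro!: compact_continuous_image continuous_on_subset[OF cont_T] simp: P_def)
  then have i: "set_integrable lborel (T ` K) u" "set_integrable lborel (T ` K) G"
    using w unfolding weak_gradient_def by auto
  have off: "F x \<notin> K" if "x \<in> N - T ` K" for x
    using that TF[of x] by (metis DiffD1 DiffD2 imageI)
  define q where "q x = (snd x - lo (fst x)) * inverse (dl (fst x))" for x
  have NV: "N \<subseteq> {x. fst x \<in> V}" by (auto simp: N_def)
  note L = C1_grad_subset[OF C1_grad_fst NV]
  define i where "i x = inverse (dl (fst x))" for x :: "'a \<times> real"
  define Di where "Di x = - (inverse (dl (fst x)) ^ 2) *\<^sub>R (Ddl (fst x), 0::real)" for x :: "'a \<times> real"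
  have Ci: "C1_grad i Di N" unfolding i_def Di_def
    by (rule C1_grad_inverse[OF L[OF dl]]) (use dl_pos in \<open>force simp: N_def\<close>)
  define Dq where "Dq x = (snd x - lo (fst x)) *\<^sub>R Di x + i x *\<^sub>R ((0, 1) - (Dlo (fst x), 0))" for x
  have Cq: "C1_grad q Dq N" unfolding q_def Dq_def i_def[symmetric]
    by (rule C1_grad_mult[OF C1_grad_diff[OF C1_grad_snd L[OF lo]] Ci])
  define Ds where "Ds x = \<delta>0 *\<^sub>R (Dq x - 0) + (q x - 1 / 2) *\<^sub>R 0" for x
  have Cs: "C1_grad s Ds N" unfolding s_def Ds_def q_def[symmetric]
    by (rule C1_grad_mult[OF C1_grad_const C1_grad_diff[OF Cq C1_grad_const]])
  define DfF where "DfF x = (fst (D (F x)), 0) + snd (D (F x)) *\<^sub>R Ds x" for x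
  have CfF: "C1_grad (\<lambda>x. f (F x)) DfF N" unfolding DfF_def F_def
    by (rule C1_grad_compose_shift_fst[OF f Cs])
  have off': "f (F x) = 0" "D (F x) = 0" if "x \<in> N - T ` K" for x using off[OF that] f0 D0 by auto
  have NK: "continuous_on (T ` K) g" if "C1_grad g Dg N" for g :: "'a \<times> real \<Rightarrow> real" and Dg
    using C1_grad_continuous[OF that] KK(2) by (rule continuous_on_subset)
  have NKD: "continuous_on (T ` K) (\<lambda>x. Dg x \<bullet> v)" if "C1_grad g Dg N" for g :: "'a \<times> real \<Rightarrow> real" and Dg v
    using continuous_on_subset[OF C1_grad_continuous_D[OF that] KK(2)] by (intro continuous_intros)
  have snd_eq: "snd y = y \<bullet> (0, 1)" for y :: "'a \<times> real" by (simp add: inner_prod_def)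
  have TI: "i (T z) = inverse (dl (x0 + fst z))" for z by (simp add: i_def T_def)
  have Tq: "q (T z) = snd z / \<delta>0 + 1 / 2" if "z \<in> P" for z
    using that dl_pos[of "x0 + fst z"] by (auto simp: q_def T_def P_def)
  have fstT: "fst (T z) = x0 + fst z" for z by (simp add: T_def)
  have dlp: "dl (x0 + fst z) > 0" if "z \<in> P" for z using that dl_pos by (auto simp: P_def)
  have dln: "dl (x0 + fst z) \<noteq> 0" if "z \<in> P" for z using dlp[OF that] by simp
  have \<delta>n: "\<delta>0 \<noteq> 0" and mP: "P \<in> sets lborel" using \<delta>0 open_P by auto
  show "(LBINT z:P. u (T z) * (D z \<bullet> b)) = - (LBINT z:P. (pull G z \<bullet> b) * f z)"
  proof (cases "snd b = 0")
    case False
    then have b: "b = (0, 1)" using b by (auto simp: Basis_prod_def)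
    have test: "(LBINT x:N. u x * (DfF x \<bullet> (0, 1))) = - (LBINT x:N. (G x \<bullet> (0, 1)) * f (F x))"
      by (rule weak_gradient_test[OF w open_N CfF KK]) (use off' b in \<open>auto simp: Basis_prod_def\<close>)
    have DfF0: "DfF x = 0" if "x \<in> N - T ` K" for x using off'[OF that] by (simp add: DfF_def zero_prod_def)
    have e1: "snd (DfF x) = snd (D (F x)) * (\<delta>0 * i x)" for x
      by (simp add: DfF_def Ds_def Dq_def Di_def inner_add_left)
    have i1: "set_integrable lborel N (\<lambda>x. (DfF x \<bullet> (0, 1)) * u x)"
      by (rule set_integrable_mult_continuous_compact[OF i(1) KK NKD[OF CfF]]) (simp add: DfF0)
    have i2: "set_integrable lborel N (\<lambda>x. f (F x) * snd (G x))"
      by (rule set_integrable_mult_continuous_compact[OF set_integrable_bounded_linear[OF bounded_linear_snd i(2)] KK NK[OF CfF] off'(1)])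
    have "(LBINT z:P. u (T z) * (D z \<bullet> b)) = (LBINT z:P. (dl (x0 + fst z) / \<delta>0) *\<^sub>R ((DfF (T z) \<bullet> (0, 1)) * u (T z)))"
      by (rule set_lebesgue_integral_cong[OF mP]) (simp add: e1 FT TI b inner_prod_def dln \<delta>n del: split_paired_All)
    also have "\<dots> = (LBINT x:N. (DfF x \<bullet> (0, 1)) * u x)" by (rule integral_flatten(2)[OF i1, symmetric])
    also have "\<dots> = - (LBINT x:N. f (F x) * snd (G x))"
      using test by (simp add: mult.commute inner_prod_def)
    also have "\<dots> = - (LBINT z:P. (dl (x0 + fst z) / \<delta>0) *\<^sub>R (f (F (T z)) * snd (G (T z))))"
      by (simp add: integral_flatten(2)[OF i2])
    also have "\<dots> = - (LBINT z:P. (pull G z \<bullet> b) * f z)"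
      by (intro arg_cong[where f=uminus] set_lebesgue_integral_cong[OF mP]) (simp add: pull_def FT b del: split_paired_All)
    finally show ?thesis .
  next
    case True
    then obtain b' where b: "b = (b', 0)" and b': "b' \<in> Basis" using b by (auto simp: Basis_prod_def)
    obtain D1 where D1: "C1_grad (\<lambda>x. Dlo x \<bullet> b') D1 V" using C2(1)[OF b'] by auto
    obtain D2 where D2: "C1_grad (\<lambda>x. Ddl x \<bullet> b') D2 V" using C2(2)[OF b'] by auto
    \<comment> \<open>\<open>q\<close> is the relative height of a point in \<open>N\<close>, so this is the derivative of \<open>lo + q dl\<close> in direction
      \<open>b'\<close> at fixed \<open>q\<close>\<close>
    define W where "W x = Dlo (fst x) \<bullet> b' + (Ddl (fst x) \<bullet> b') * q x" for x
    define DW where "DW x = (D1 (fst x), 0) + ((Ddl (fst x) \<bullet> b') *\<^sub>R Dq x + q x *\<^sub>R (D2 (fst x), 0))" for x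
    have CW: "C1_grad W DW N" unfolding W_def DW_def
      by (rule C1_grad_add[OF L[OF D1] C1_grad_mult[OF L[OF D2] Cq]])
    define ps where "ps x = (\<delta>0 * i x) * f (F x)" for x
    define Dps where "Dps x = (\<delta>0 * i x) *\<^sub>R DfF x + f (F x) *\<^sub>R (\<delta>0 *\<^sub>R Di x + i x *\<^sub>R 0)" for x
    have Cps: "C1_grad ps Dps N" unfolding ps_def Dps_def
      by (rule C1_grad_mult[OF C1_grad_mult[OF C1_grad_const Ci] CfF])
    define Dch where "Dch x = ps x *\<^sub>R DW x + W x *\<^sub>R Dps x" for x
    have Cch: "C1_grad (\<lambda>x. ps x * W x) Dch N" unfolding Dch_def by (rule C1_grad_mult[OF Cps CW])
    have ps0: "ps x = 0" if "x \<in> N - T ` K" for x using off'[OF that] by (simp add: ps_def)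
    have B1: "(b', 0) \<in> (Basis :: ('a \<times> real) set)" and B2: "(0, 1) \<in> (Basis :: ('a \<times> real) set)"
      using b' by (auto simp: Basis_prod_def)
    have test1: "(LBINT x:N. u x * (Dps x \<bullet> (b', 0))) = - (LBINT x:N. (G x \<bullet> (b', 0)) * ps x)"
      by (rule weak_gradient_test[OF w open_N Cps KK ps0 B1])
    have test2: "(LBINT x:N. u x * (Dch x \<bullet> (0, 1))) = - (LBINT x:N. (G x \<bullet> (0, 1)) * (ps x * W x))"
      by (rule weak_gradient_test[OF w open_N Cch KK _ B2]) (simp add: ps0)
    have Dps0: "Dps x = 0" "Dch x = 0" if "x \<in> N - T ` K" for x
      using C1_grad_extend_zero(2)[OF open_N Cps compact_imp_closed[OF KK(1)] KK(2) ps0 that]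
        ps0[OF that] by (auto simp: Dch_def)
    have qd: "q x = (snd x - lo (fst x)) * i x" for x by (simp add: q_def i_def)
    \<comment> \<open>the divergence of the Piola transform: the terms with derivatives of the coefficients cancel\<close>
    have sum: "fst (Dps x) \<bullet> b' + snd (Dch x) = (\<delta>0 * i x) * (fst (D (F x)) \<bullet> b')" for x
    proof -
      have Did: "Di x = - (i x ^ 2) *\<^sub>R (Ddl (fst x), 0)" by (simp add: Di_def i_def)
      show ?thesis
        unfolding Dch_def Dps_def DW_def ps_def DfF_def Ds_def Dq_def W_def Did qd
        by (simp add: inner_add_left inner_diff_left inner_prod_def) (simp add: algebra_simps power2_eq_square)
    qed
    have i1: "set_integrable lborel N (\<lambda>x. (Dps x \<bullet> (b', 0)) * u x)"
      by (rule set_integrable_mult_continuous_compact[OF i(1) KK NKD[OF Cps]]) (simp add: Dps0)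
    have i2: "set_integrable lborel N (\<lambda>x. (Dch x \<bullet> (0, 1)) * u x)"
      by (rule set_integrable_mult_continuous_compact[OF i(1) KK NKD[OF Cch]]) (simp add: Dps0)
    have i3: "set_integrable lborel N (\<lambda>x. ps x * (G x \<bullet> (b', 0)))"
      by (rule set_integrable_mult_continuous_compact[OF set_integrable_bounded_linear[OF bounded_linear_inner_left i(2)] KK NK[OF Cps] ps0])
    have i4: "set_integrable lborel N (\<lambda>x. (ps x * W x) * (G x \<bullet> (0, 1)))"
      by (rule set_integrable_mult_continuous_compact[OF set_integrable_bounded_linear[OF bounded_linear_inner_left i(2)] KK NK[OF Cch]]) (simp add: ps0)
    note i12 = set_integral_add[OF i1 i2]
    note i34 = set_integral_add[OF i3 i4]
    have "(LBINT z:P. u (T z) * (D z \<bullet> b)) = (LBINT z:P. (dl (x0 + fst z) / \<delta>0) *\<^sub>R ((Dps (T z) \<bullet> (b', 0)) * u (T z) + (Dch (T z) \<bullet> (0, 1)) * u (T z)))"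
      by (rule set_lebesgue_integral_cong[OF mP]) (simp add: sum distrib_right[symmetric] inner_prod_def FT TI b dln \<delta>n del: split_paired_All)
    also have "\<dots> = (LBINT x:N. (Dps x \<bullet> (b', 0)) * u x + (Dch x \<bullet> (0, 1)) * u x)" by (rule integral_flatten(2)[OF i12(1), symmetric])
    also have "\<dots> = - (LBINT x:N. ps x * (G x \<bullet> (b', 0)) + (ps x * W x) * (G x \<bullet> (0, 1)))"
      using test1 test2 unfolding i12(2) i34(2) by (simp add: mult.commute)
    also have "\<dots> = - (LBINT z:P. (dl (x0 + fst z) / \<delta>0) *\<^sub>R (ps (T z) * (G (T z) \<bullet> (b', 0)) + (ps (T z) * W (T z)) * (G (T z) \<bullet> (0, 1))))"
      by (simp add: integral_flatten(2)[OF i34(1)])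
    also have "\<dots> = - (LBINT z:P. (pull G z \<bullet> b) * f z)"
    proof (intro arg_cong[where f=uminus] set_lebesgue_integral_cong)
      show "P \<in> sets lborel" using open_P by auto
      show "\<forall>z. z \<in> P \<longrightarrow> (dl (x0 + fst z) / \<delta>0) *\<^sub>R (ps (T z) * (G (T z) \<bullet> (b', 0)) + (ps (T z) * W (T z)) * (G (T z) \<bullet> (0, 1)))
         = (pull G z \<bullet> b) * f z"
      proof (intro allI impI)
        fix z assume z: "z \<in> P"
        have "dl (x0 + fst z) / \<delta>0 * ps (T z) = f z"
          using dlp[OF z] \<delta>0 by (simp add: ps_def TI FT[OF z])
        moreover have "pull G z \<bullet> b = G (T z) \<bullet> (b', 0) + W (T z) * (G (T z) \<bullet> (0, 1))"
          by (simp add: pull_def b W_def Tq[OF z] inner_prod_def inner_add_left fstT algebra_simps)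
        ultimately show "(dl (x0 + fst z) / \<delta>0) *\<^sub>R (ps (T z) * (G (T z) \<bullet> (b', 0)) + (ps (T z) * W (T z)) * (G (T z) \<bullet> (0, 1)))
         = (pull G z \<bullet> b) * f z"
          by (simp add: distrib_left mult.assoc[symmetric]) (simp add: algebra_simps)
      qed
    qed
    finally show ?thesis .
  qed
qed

end

section \<open>Even reflection and periodic extension\<close>

text \<open>
  With \<open>\<sigma> = 1\<close> a vertical translation, with \<open>\<sigma> = -1\<close> a reflection in a horizontal plane: these maps carry the
  layer \<open>|z\<^sub>d| < a\<close> onto the cells of the periodic reflection.
\<close>

definition shear :: "real \<Rightarrow> real \<Rightarrow> 'a \<times> real \<Rightarrow> 'a \<times> real" where
  "shear c \<sigma> z = (fst z, c + \<sigma> * snd z)"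

lemma fst_shear [simp]: "fst (shear c \<sigma> z) = fst z" and snd_shear [simp]: "snd (shear c \<sigma> z) = c + \<sigma> * snd z"
  by (auto simp: shear_def)

lemma continuous_on_shear: "continuous_on S (shear c \<sigma> :: 'a::euclidean_space \<times> real \<Rightarrow> _)"
  unfolding shear_def by (intro continuous_intros)

lemma measurable_shear [measurable]: "(shear c \<sigma> :: 'a::euclidean_space \<times> real \<Rightarrow> _) \<in> borel \<rightarrow>\<^sub>M borel"
  by (rule borel_measurable_continuous_onI[OF continuous_on_shear])

lemma lborel_distr_shear:
  assumes "\<bar>\<sigma>\<bar> = 1"
  shows "distr lborel borel (shear c \<sigma>) = (lborel :: ('a::euclidean_space \<times> real) measure)"
proof (rule measure_eqI)
  fix X assume "X \<in> sets (distr lborel borel (shear c \<sigma>) :: ('a \<times> real) measure)"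
  then have [measurable]: "X \<in> sets borel" by simp
  have Pair: "(\<lambda>t. (x, t)) \<in> borel \<rightarrow>\<^sub>M borel" for x :: 'a
    by (auto intro!: borel_measurable_continuous_onI continuous_intros)
  have [measurable]: "shear c \<sigma> -` X \<in> sets borel" by (rule measurable_sets_borel[OF measurable_shear]) simp
  have "emeasure (distr lborel borel (shear c \<sigma>)) X = (\<integral>\<^sup>+z. indicator X (shear c \<sigma> z) \<partial>lborel)"
    by (subst emeasure_distr) (auto simp: nn_integral_indicator[symmetric] indicator_def simp del: nn_integral_indicator intro!: nn_integral_cong)
  also have "\<dots> = (\<integral>\<^sup>+x. \<integral>\<^sup>+t. indicator X (x, c + \<sigma> * t) \<partial>lborel \<partial>lborel)"
    using nn_integral_lborel_prod_real[OF measurable_compose[OF measurable_shear borel_measurable_indicator], of X c \<sigma>]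
    by (simp add: shear_def)
  also have "\<dots> = (\<integral>\<^sup>+x. \<integral>\<^sup>+t. indicator X (x, t) \<partial>lborel \<partial>lborel)"
  proof (rule nn_integral_cong)
    fix x :: 'a
    have "(\<lambda>t. indicator X (x, t) :: ennreal) \<in> borel_measurable borel"
      by (rule measurable_compose[OF Pair]) measurable
    from nn_integral_real_affine[OF this, of \<sigma> c] assms
    show "(\<integral>\<^sup>+t. indicator X (x, c + \<sigma> * t) \<partial>lborel) = (\<integral>\<^sup>+t. indicator X (x, t) \<partial>lborel)" by auto
  qed
  also have "\<dots> = emeasure lborel X"
    by (subst nn_integral_lborel_prod_real[symmetric]) auto
  finally show "emeasure (distr lborel borel (shear c \<sigma>)) X = emeasure lborel X" .
qed simp

lemma integrable_shear:
  fixes f :: "'a::euclidean_space \<times> real \<Rightarrow> 'b::euclidean_space"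
  assumes "\<bar>\<sigma>\<bar> = 1" "integrable lborel f"
  shows "integrable lborel (\<lambda>z. f (shear c \<sigma> z))"
    and "integral\<^sup>L lborel (\<lambda>z. f (shear c \<sigma> z)) = integral\<^sup>L lborel f"
proof -
  have m: "f \<in> borel_measurable borel" using assms(2) by auto
  have s: "shear c \<sigma> \<in> lborel \<rightarrow>\<^sub>M (borel :: ('a \<times> real) measure)" by simp
  show "integrable lborel (\<lambda>z. f (shear c \<sigma> z))"
    using integrable_distr_eq[OF s m] assms(2) by (simp add: lborel_distr_shear[OF assms(1)])
  show "integral\<^sup>L lborel (\<lambda>z. f (shear c \<sigma> z)) = integral\<^sup>L lborel f"
    using integral_distr[OF s m] by (simp add: lborel_distr_shear[OF assms(1)])
qed

text \<open>
  The derivative of \<open>fold_strip \<delta>\<close> away from the seams.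
\<close>

definition fold_sign :: "real \<Rightarrow> real \<Rightarrow> real" where
  "fold_sign \<delta> t = (if t - 2 * \<delta> * of_int \<lfloor>(t + \<delta> / 2) / (2 * \<delta>)\<rfloor> \<le> \<delta> / 2 then 1 else -1)"

text \<open>
  The cells of the folding of width \<open>2 a\<close> are indexed by pairs \<open>(i, \<sigma>)\<close>: \<open>i\<close> counts the periods, of length
  \<open>4 a\<close>, and \<open>\<sigma>\<close> tells whether the cell is a translate of the fundamental layer or a mirror image. The cell of
  \<open>(i, \<sigma>)\<close> is the set of all \<open>fold_cell a (i, \<sigma>) + \<sigma> s\<close> with \<open>|s| < a\<close>.
\<close>

definition fold_cell :: "real \<Rightarrow> int \<times> real \<Rightarrow> real" where
  "fold_cell a j = 4 * a * of_int (fst j) + (1 - snd j) * a"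

definition fold_index :: "real \<Rightarrow> real \<Rightarrow> int \<times> real" where
  "fold_index a t = (\<lfloor>(t + a) / (4 * a)\<rfloor>, fold_sign (2 * a) t)"

lemma fold_index_snd: "snd (fold_index a t) = fold_sign (2 * a) t" "fold_sign \<delta> t \<in> {1, -1}"
  by (auto simp: fold_index_def fold_sign_def)

lemma fold_strip_eq:
  assumes "a > 0"
  shows "t = fold_cell a (fold_index a t) + fold_sign (2 * a) t * fold_strip (2 * a) t"
    "\<bar>fold_strip (2 * a) t\<bar> \<le> a"
proof -
  define i where "i = \<lfloor>(t + a) / (4 * a)\<rfloor>"
  have i: "of_int i \<le> (t + a) / (4 * a)" "(t + a) / (4 * a) < of_int i + 1" unfolding i_def by linarith+
  have i': "4 * a * of_int i \<le> t + a" "t + a < 4 * a * of_int i + 4 * a"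
    using i assms by (simp_all add: field_simps)
  have e: "\<lfloor>(t + 2 * a / 2) / (2 * (2 * a))\<rfloor> = i" by (simp add: i_def)
  show "t = fold_cell a (fold_index a t) + fold_sign (2 * a) t * fold_strip (2 * a) t"
    unfolding fold_cell_def fold_index_def fold_sign_def fold_strip_def Let_def e i_def[symmetric] by auto
  show "\<bar>fold_strip (2 * a) t\<bar> \<le> a"
    using i' unfolding fold_strip_def Let_def e by auto
qed

lemma fold_strip_cell:
  assumes a: "a > 0" and s: "\<bar>s\<bar> < a" and \<sigma>: "\<sigma> \<in> {1, -1}"
  shows "fold_index a (fold_cell a (i, \<sigma>) + \<sigma> * s) = (i, \<sigma>)"
    "fold_strip (2 * a) (fold_cell a (i, \<sigma>) + \<sigma> * s) = s"
    "fold_sign (2 * a) (fold_cell a (i, \<sigma>) + \<sigma> * s) = \<sigma>"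
proof -
  define t where "t = fold_cell a (i, \<sigma>) + \<sigma> * s"
  have t: "t = 4 * a * of_int i + (1 - \<sigma>) * a + \<sigma> * s" by (simp add: t_def fold_cell_def)
  have i: "\<lfloor>(t + a) / (4 * a)\<rfloor> = i"
  proof (rule floor_unique)
    show "of_int i \<le> (t + a) / (4 * a)" "(t + a) / (4 * a) < of_int i + 1"
      using a s \<sigma> unfolding t by (auto simp: pos_le_divide_eq pos_divide_less_eq algebra_simps)
  qed
  then have e: "\<lfloor>(t + 2 * a / 2) / (2 * (2 * a))\<rfloor> = i" by simp
  have sg: "fold_sign (2 * a) t = \<sigma>"
    using a s \<sigma> unfolding fold_sign_def e unfolding t by auto
  moreover have "fold_strip (2 * a) t = s"
    using a s \<sigma> unfolding fold_strip_def Let_def e unfolding t by auto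
  moreover have "fold_index a t = (i, \<sigma>)" using i sg by (simp add: fold_index_def)
  ultimately show "fold_index a (fold_cell a (i, \<sigma>) + \<sigma> * s) = (i, \<sigma>)"
    "fold_strip (2 * a) (fold_cell a (i, \<sigma>) + \<sigma> * s) = s"
    "fold_sign (2 * a) (fold_cell a (i, \<sigma>) + \<sigma> * s) = \<sigma>" by (auto simp: t_def)
qed

definition fold_range :: "int \<Rightarrow> (int \<times> real) set" where
  "fold_range M = {- M..M} \<times> {1, -1}"

lemma finite_fold_range [simp]: "finite (fold_range M)" by (simp add: fold_range_def)

lemma fold_range_snd: "j \<in> fold_range M \<Longrightarrow> snd j \<in> {1, -1}" "j \<in> fold_range M \<Longrightarrow> \<bar>snd j\<bar> = 1"
  by (auto simp: fold_range_def)

lemma fold_index_in_range: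
  assumes a: "a > 0" and t: "\<bar>t\<bar> \<le> 4 * a * of_int M"
  shows "fold_index a t \<in> fold_range M"
proof -
  have "- (4 * a * of_int M) \<le> t + a" "t + a < 4 * a * of_int M + 4 * a" using t a by linarith+
  then have "of_int (- M) \<le> (t + a) / (4 * a)" "(t + a) / (4 * a) < of_int M + 1"
    using a by (simp_all add: pos_le_divide_eq pos_divide_less_eq algebra_simps)
  then have "- M \<le> \<lfloor>(t + a) / (4 * a)\<rfloor>" "\<lfloor>(t + a) / (4 * a)\<rfloor> \<le> M" by (simp_all add: le_floor_iff floor_le_iff)
  then show ?thesis using fold_index_snd(2)[of "2 * a" t] by (auto simp: fold_index_def fold_range_def)
qed

lemma card_fold_range: "M \<ge> 0 \<Longrightarrow> real (card (fold_range M)) = 4 * of_int M + 2"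
  by (simp add: fold_range_def card_cartesian_product)

text \<open>
  Integration cell by cell. Since \<open>h\<close> vanishes on the seams, it is the sum of its restrictions to the
  open cells, and each of them is a measure preserving copy of a function on the fundamental layer.
\<close>

lemma fold_integral:
  fixes h :: "'a::euclidean_space \<times> real \<Rightarrow> 'b::euclidean_space"
  assumes a: "a > 0"
    and h0: "\<And>z. \<bar>fold_strip (2 * a) (snd z)\<bar> = a \<or> fold_index a (snd z) \<notin> fold_range M \<Longrightarrow> h z = 0"
    and int: "\<And>j. j \<in> fold_range M \<Longrightarrow> integrable lborel (\<lambda>z. if \<bar>snd z\<bar> < a then h (shear (fold_cell a j) (snd j) z) else 0)"
  shows "integrable lborel h"
    "integral\<^sup>L lborel h = (\<Sum>j\<in>fold_range M. integral\<^sup>L lborel (\<lambda>z. if \<bar>snd z\<bar> < a then h (shear (fold_cell a j) (snd j) z) else 0))"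
proof -
  let ?f = "\<lambda>j z. if \<bar>snd z\<bar> < a then h (shear (fold_cell a j) (snd j) z) else 0"
  let ?S = "\<lambda>j. shear (- (snd j * fold_cell a j)) (snd j)"
  have inv: "shear (fold_cell a j) (snd j) (?S j z) = z" if "j \<in> fold_range M" for j and z :: "'a \<times> real"
    using fold_range_snd[OF that] by (auto simp: shear_def algebra_simps prod_eq_iff)
  have eq: "h z = (\<Sum>j\<in>fold_range M. ?f j (?S j z))" for z
  proof -
    let ?j = "fold_index a (snd z)"
    have "(\<Sum>j\<in>fold_range M. ?f j (?S j z)) = (\<Sum>j\<in>fold_range M. if j = ?j then h z else 0)"
    proof (rule sum.cong[OF refl])
      fix j assume j: "j \<in> fold_range M"
      define s where "s = snd (?S j z)"
      have z: "snd z = fold_cell a j + snd j * s"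
      proof -
        have "snd z = snd (shear (fold_cell a j) (snd j) (?S j z))" by (simp only: inv[OF j])
        then show ?thesis unfolding snd_shear[of "fold_cell a j" "snd j" "?S j z"] s_def .
      qed
      have e: "?f j (?S j z) = (if \<bar>s\<bar> < a then h z else 0)" by (simp only: s_def inv[OF j])
      show "?f j (?S j z) = (if j = ?j then h z else 0)"
      proof (cases "\<bar>s\<bar> < a")
        case True
        have "?j = (fst j, snd j)" unfolding z using fold_strip_cell(1)[OF a True fold_range_snd(1)[OF j], of "fst j"] by simp
        with e True show ?thesis by simp
      next
        case False
        have "h z = 0" if "j = ?j"
        proof (rule h0)
          have sg: "fold_sign (2 * a) (snd z) = snd j" unfolding that fold_index_snd(1) ..
          have "snd j * s = snd j * fold_strip (2 * a) (snd z)"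
            using trans[OF z[symmetric] fold_strip_eq(1)[OF a, of "snd z"]]
            unfolding that[symmetric] sg by simp
          then have "s = fold_strip (2 * a) (snd z)" using fold_range_snd[OF j] by auto
          with False fold_strip_eq(2)[OF a, of "snd z"] show "\<bar>fold_strip (2 * a) (snd z)\<bar> = a \<or> ?j \<notin> fold_range M" by auto
        qed
        then show ?thesis using e False by auto
      qed
    qed
    also have "\<dots> = h z" using h0[of z] by simp
    finally show ?thesis by simp
  qed
  define g where "g j z = ?f j (?S j z)" for j z
  have i: "integrable lborel (g j)" "integral\<^sup>L lborel (g j) = integral\<^sup>L lborel (?f j)" if j: "j \<in> fold_range M" for j
    unfolding g_def
    by (rule integrable_shear(1)[OF fold_range_snd(2)[OF j] int[OF j], where c = "- (snd j * fold_cell a j)"],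
        rule integrable_shear(2)[OF fold_range_snd(2)[OF j] int[OF j], where c = "- (snd j * fold_cell a j)"])
  have eq': "h = (\<lambda>z. \<Sum>j\<in>fold_range M. g j z)" unfolding g_def by (rule ext) (rule eq)
  show "integrable lborel h"
    unfolding eq' by (rule Bochner_Integration.integrable_sum) (rule i(1))
  have "integral\<^sup>L lborel h = (\<Sum>j\<in>fold_range M. integral\<^sup>L lborel (g j))"
    unfolding eq' by (rule Bochner_Integration.integral_sum) (rule i(1))
  also have "\<dots> = (\<Sum>j\<in>fold_range M. integral\<^sup>L lborel (?f j))"
    by (rule sum.cong[OF refl]) (rule i(2))
  finally show "integral\<^sup>L lborel h = (\<Sum>j\<in>fold_range M. integral\<^sup>L lborel (?f j))" .
qed

text \<open>
  The sum of \<open>f\<close> over the preimages of a point of the layer under the folding, weighted by \<open>\<tau>\<close>. Integrating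
  a folded function against \<open>f\<close> amounts to integrating over the layer against this sum, with \<open>\<tau>\<close> constant or
  \<open>\<tau> \<sigma> = \<sigma>\<close> according to the parity of the folded function.
\<close>

definition fold_sum :: "(int \<times> real) set \<Rightarrow> real \<Rightarrow> (real \<Rightarrow> real) \<Rightarrow> ('a \<times> real \<Rightarrow> real) \<Rightarrow> 'a \<times> real \<Rightarrow> real" where
  "fold_sum J a \<tau> f z = (\<Sum>j\<in>J. \<tau> (snd j) * f (shear (fold_cell a j) (snd j) z))"

lemma C1_grad_shear:
  fixes f :: "'a::euclidean_space \<times> real \<Rightarrow> real"
  assumes "C1_grad f D UNIV"
  shows "C1_grad (\<lambda>z. f (shear c \<sigma> z)) (\<lambda>z. (fst (D (shear c \<sigma> z)), \<sigma> * snd (D (shear c \<sigma> z)))) S"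
proof -
  have s: "C1_grad (\<lambda>x :: 'a \<times> real. c + \<sigma> * snd x) (\<lambda>x. 0 + (\<sigma> *\<^sub>R (0, 1) + snd x *\<^sub>R 0)) S"
    by (intro C1_grad_add C1_grad_mult C1_grad_const C1_grad_snd)
  from C1_grad_compose_shift_fst[OF assms s, of 0] show ?thesis
    by (simp add: shear_def[abs_def] mult.commute)
qed

lemma C1_grad_sum:
  assumes "\<And>j. j \<in> J \<Longrightarrow> C1_grad (f j) (D j) S"
  shows "C1_grad (\<lambda>x. \<Sum>j\<in>J. f j x) (\<lambda>x. \<Sum>j\<in>J. D j x) S"
  using assms by (induction J rule: infinite_finite_induct) (auto intro: C1_grad_add C1_grad_const)

lemma C1_grad_fold_sum:
  fixes f :: "'a::euclidean_space \<times> real \<Rightarrow> real"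
  assumes "C1_grad f D UNIV"
  shows "C1_grad (fold_sum J a \<tau> f)
    (\<lambda>z. \<Sum>j\<in>J. \<tau> (snd j) *\<^sub>R (fst (D (shear (fold_cell a j) (snd j) z)), snd j * snd (D (shear (fold_cell a j) (snd j) z)))) S"
proof -
  have "C1_grad (fold_sum J a \<tau> f)
    (\<lambda>z. \<Sum>j\<in>J. \<tau> (snd j) *\<^sub>R (fst (D (shear (fold_cell a j) (snd j) z)), snd j * snd (D (shear (fold_cell a j) (snd j) z)))
       + f (shear (fold_cell a j) (snd j) z) *\<^sub>R 0) S"
    unfolding fold_sum_def[abs_def]
    by (intro C1_grad_sum C1_grad_mult C1_grad_const C1_grad_shear assms)
  then show ?thesis by simp
qed

lemma compact_support_bounded:
  assumes "compact K" "continuous_on K D" "\<And>x. x \<notin> K \<Longrightarrow> D x = 0"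
  obtains B where "B > 0" "\<And>x. norm (D x) \<le> B"
proof -
  have "bounded (D ` K)" using assms compact_continuous_image compact_imp_bounded by blast
  then obtain B where B: "\<And>x. x \<in> K \<Longrightarrow> norm (D x) \<le> B" by (metis bounded_iff image_eqI)
  have "norm (D x) \<le> max 1 B" for x using B[of x] assms(3)[of x] by (cases "x \<in> K") auto
  then show ?thesis by (intro that[of "max 1 B"]) auto
qed

lemma C1_grad_lipschitz:
  assumes "C1_grad f D UNIV" "\<And>x. norm (D x) \<le> B"
  shows "\<bar>f x - f y\<bar> \<le> B * norm (x - y)"
proof -
  have "norm (f x - f y) \<le> B * norm (x - y)"
  proof (rule differentiable_bound[of UNIV f "\<lambda>x h. D x \<bullet> h"])
    show "onorm (\<lambda>h. D x \<bullet> h) \<le> B" for x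
    proof (rule onorm_le)
      fix h
      have "norm (D x \<bullet> h) \<le> norm (D x) * norm h" using Cauchy_Schwarz_ineq2 by simp
      also have "\<dots> \<le> B * norm h" using assms(2) by (intro mult_right_mono) auto
      finally show "norm (D x \<bullet> h) \<le> B * norm h" .
    qed
  qed (use C1_gradD[OF assms(1)] in auto)
  then show ?thesis by simp
qed

text \<open>
  The odd sum vanishes on both faces of the layer: a point of a seam belongs to two adjacent cells
  with opposite signs, and the terms that are left over at the two ends are zero because \<open>f\<close> has bounded
  support.
\<close>

lemma fold_sum_boundary:
  fixes f :: "'a::euclidean_space \<times> real \<Rightarrow> real"
  assumes f0: "\<And>z. \<bar>snd z\<bar> > L \<Longrightarrow> f z = 0" and M: "4 * a * of_int M > L" and a: "a > 0" and M0: "M \<ge> 0"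
  shows "fold_sum (fold_range M) a (\<lambda>\<sigma>. \<sigma>) f (x, a) = 0" "fold_sum (fold_range M) a (\<lambda>\<sigma>. \<sigma>) f (x, - a) = 0"
proof -
  have e: "fold_sum (fold_range M) a (\<lambda>\<sigma>. \<sigma>) f (x, s) = (\<Sum>i\<in>{-M..M}. f (x, 4 * a * of_int i + s) - f (x, 4 * a * of_int i + 2 * a - s))" for s
    unfolding fold_sum_def fold_range_def
    by (subst sum.cartesian_product[symmetric, of "\<lambda>i \<sigma>. \<sigma> * f (shear (fold_cell a (i, \<sigma>)) \<sigma> (x, s))", simplified case_prod_unfold, simplified])
      (simp add: shear_def fold_cell_def algebra_simps)
  show "fold_sum (fold_range M) a (\<lambda>\<sigma>. \<sigma>) f (x, a) = 0"
    unfolding e by (simp add: algebra_simps)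
  define p where "p i = f (x, 4 * a * of_int i - a)" for i :: int
  have p0: "p i = 0" if "i \<le> - M \<or> i \<ge> M + 1" for i
  proof -
    have "\<bar>4 * a * of_int i - a\<bar> > L"
    proof (cases "i \<le> - M")
      case True
      then have "4 * a * of_int i \<le> 4 * a * of_int (- M)" using a by (intro mult_left_mono) (auto simp del: of_int_minus)
      then show ?thesis using M a by simp
    next
      case False
      then have "4 * a * of_int (M + 1) \<le> 4 * a * of_int i" using a that by (intro mult_left_mono) (auto simp del: of_int_add)
      then show ?thesis using M a by (simp add: distrib_left)
    qed
    then show ?thesis by (auto simp: p_def intro: f0)
  qed
  have "(\<Sum>i\<in>{-M..M}. p (i + 1)) = sum p ((\<lambda>i. i + 1) ` {-M..M})"
    by (subst sum.reindex) (auto simp: inj_on_def)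
  also have "(\<lambda>i. i + 1) ` {-M..M} = {-M + 1..M + 1}" by simp
  also have "sum p {-M + 1..M + 1} = sum p {-M + 1..M}"
    by (rule sum.mono_neutral_right) (auto intro: p0)
  also have "sum p {-M + 1..M} = sum p {-M..M}"
    by (rule sum.mono_neutral_left) (auto intro: p0)
  finally have "(\<Sum>i\<in>{-M..M}. p i - p (i + 1)) = 0" by (simp add: sum_subtractf)
  moreover have "fold_sum (fold_range M) a (\<lambda>\<sigma>. \<sigma>) f (x, - a) = (\<Sum>i\<in>{-M..M}. p i - p (i + 1))"
    unfolding e p_def by (intro sum.cong) (auto simp: algebra_simps)
  ultimately show "fold_sum (fold_range M) a (\<lambda>\<sigma>. \<sigma>) f (x, - a) = 0" by simp
qed

text \<open>
  The cutoff near the faces of the layer \<open>|s| < a\<close> is \<open>layer_cut (n (a\<^sup>2 - s\<^sup>2))\<close>. It vanishes near the faces and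
  increases to 1 as \<open>n\<close> tends to infinity. What matters is that \<open>y layer_cut' y\<close> stays bounded and tends
  to 0 as \<open>y\<close> tends to infinity; so does the derivative of the cutoff times any function that
  vanishes to first order at the faces.
\<close>

definition layer_cut :: "real \<Rightarrow> real" where "layer_cut y = max 0 (1 - inverse y) ^ 2"

definition layer_cut' :: "real \<Rightarrow> real" where "layer_cut' y = 2 * max 0 (1 - inverse y) * (inverse y) ^ 2"

lemma layer_cut_deriv:
  assumes "y > 0"
  shows "(layer_cut has_real_derivative layer_cut' y) (at y)"
proof -
  have "((\<lambda>y. 1 - inverse y) has_real_derivative (inverse y) ^ 2) (at y)"
    using assms by (auto intro!: derivative_eq_intros simp: power2_eq_square)
  from DERIV_chain2[OF has_real_derivative_pos_part_power[of 2] this]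
  show ?thesis unfolding layer_cut_def layer_cut'_def by simp
qed

lemma layer_cut'_cont: "continuous_on {0<..} layer_cut'"
  unfolding layer_cut'_def by (intro continuous_intros) auto

lemma layer_cut_bounds: "y > 0 \<Longrightarrow> 0 \<le> layer_cut y" "y > 0 \<Longrightarrow> layer_cut y \<le> 1"
  "0 < y \<Longrightarrow> y \<le> 1 \<Longrightarrow> layer_cut y = 0"
  by (auto simp: layer_cut_def max_def power_le_one field_simps)

lemma layer_cut'_bounds:
  assumes "y > 0"
  shows "0 \<le> layer_cut' y" "layer_cut' y * y \<le> 2" "layer_cut' y * y \<le> 2 / y"
proof -
  show "0 \<le> layer_cut' y" using assms by (auto simp: layer_cut'_def)
  have 1: "layer_cut' y * y = 2 * max 0 (1 - inverse y) * inverse y"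
    using assms by (simp add: layer_cut'_def power2_eq_square)
  have "max 0 (1 - inverse y) \<le> 1" using assms by auto
  then have "2 * max 0 (1 - inverse y) * inverse y \<le> 2 * 1 * inverse y"
    using assms by (intro mult_right_mono mult_left_mono) auto
  then show 2: "layer_cut' y * y \<le> 2 / y" unfolding 1 by (simp add: divide_inverse)
  show "layer_cut' y * y \<le> 2"
  proof (cases "y \<le> 1")
    case True
    then have "max 0 (1 - inverse y) = 0" using assms by (auto simp: max_def field_simps)
    then show ?thesis unfolding 1 by simp
  next
    case False
    then have "2 / y \<le> 2" by (simp add: field_simps)
    with 2 show ?thesis by linarith
  qed
qed

lemma layer_cut_lim:
  assumes q: "q > 0"
  shows "(\<lambda>n. layer_cut (real (Suc n) * q)) \<longlonglongrightarrow> 1"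
    "(\<lambda>n. layer_cut' (real (Suc n) * q) * (real (Suc n) * q)) \<longlonglongrightarrow> 0"
proof -
  have i: "(\<lambda>n. inverse (real (Suc n) * q)) \<longlonglongrightarrow> 0"
    using tendsto_mult_right[OF LIMSEQ_inverse_real_of_nat, of "inverse q"] by (simp add: inverse_mult_distrib mult.commute del: of_nat_Suc)
  have "(\<lambda>n. max 0 (1 - inverse (real (Suc n) * q)) ^ 2) \<longlonglongrightarrow> max 0 (1 - 0) ^ 2"
    by (intro tendsto_intros i)
  then show "(\<lambda>n. layer_cut (real (Suc n) * q)) \<longlonglongrightarrow> 1" by (simp add: layer_cut_def)
  show "(\<lambda>n. layer_cut' (real (Suc n) * q) * (real (Suc n) * q)) \<longlonglongrightarrow> 0"
  proof (rule tendsto_sandwich[OF _ _ tendsto_const])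
    show "\<forall>\<^sub>F n in sequentially. 0 \<le> layer_cut' (real (Suc n) * q) * (real (Suc n) * q)"
      using layer_cut'_bounds(1) q by (intro always_eventually allI mult_nonneg_nonneg) auto
    show "\<forall>\<^sub>F n in sequentially. layer_cut' (real (Suc n) * q) * (real (Suc n) * q) \<le> 2 * inverse (real (Suc n) * q)"
      using layer_cut'_bounds(3)[of "real (Suc _) * q"] q by (intro always_eventually allI) (simp add: divide_inverse del: of_nat_Suc)
    show "(\<lambda>n. 2 * inverse (real (Suc n) * q)) \<longlonglongrightarrow> 0" using tendsto_mult_left[OF i, of 2] by simp
  qed
qed

lemma set_integral_dominated_convergence_kernel:
  fixes e :: "'a::euclidean_space \<Rightarrow> real"
  assumes e: "set_integrable lborel K e" and P: "open P" and E: "\<And>n. continuous_on P (E n)" "continuous_on P E'"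
    and B: "\<And>n z. z \<in> P \<Longrightarrow> \<bar>E n z\<bar> \<le> B" and E0: "\<And>n z. z \<in> P \<Longrightarrow> z \<notin> K \<Longrightarrow> E n z = 0"
    and lim: "\<And>z. z \<in> P \<Longrightarrow> (\<lambda>n. E n z) \<longlonglongrightarrow> E' z"
  shows "(\<lambda>n. LBINT z:P. e z * E n z) \<longlonglongrightarrow> (LBINT z:P. e z * E' z)"
proof -
  have E0': "E' z = 0" if "z \<in> P" "z \<notin> K" for z
    using LIMSEQ_unique[OF lim[OF that(1)], of 0] by (simp add: E0[OF that])
  have mP: "P \<in> sets borel" using P by auto
  have m: "(\<lambda>z. indicat_real P z *\<^sub>R (e z * X z)) \<in> borel_measurable lborel"
    if X: "continuous_on P X" "\<And>z. z \<in> P \<Longrightarrow> z \<notin> K \<Longrightarrow> X z = 0" for X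
  proof -
    have "(\<lambda>z. indicat_real P z *\<^sub>R X z) \<in> borel_measurable borel"
      by (rule borel_measurable_continuous_on_indicator[OF mP X(1)])
    moreover have "(\<lambda>z. indicat_real K z *\<^sub>R e z) \<in> borel_measurable lborel"
      using e by (auto simp: set_integrable_def)
    ultimately have "(\<lambda>z. (indicat_real P z *\<^sub>R X z) * (indicat_real K z *\<^sub>R e z)) \<in> borel_measurable lborel"
      by (intro borel_measurable_times) auto
    also have "(\<lambda>z. (indicat_real P z *\<^sub>R X z) * (indicat_real K z *\<^sub>R e z)) = (\<lambda>z. indicat_real P z *\<^sub>R (e z * X z))"
      using X(2) by (auto simp: indicator_def fun_eq_iff)
    finally show ?thesis .
  qed
  show ?thesis unfolding set_lebesgue_integral_def
  proof (rule integral_dominated_convergence[where w = "\<lambda>z. \<bar>B\<bar> * norm (indicat_real K z *\<^sub>R e z)"])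
    show "integrable lborel (\<lambda>z. \<bar>B\<bar> * norm (indicat_real K z *\<^sub>R e z))"
      using e unfolding set_integrable_def by (intro integrable_mult_right integrable_norm)
    show "AE z in lborel. (\<lambda>n. indicat_real P z *\<^sub>R (e z * E n z)) \<longlonglongrightarrow> indicat_real P z *\<^sub>R (e z * E' z)"
    proof (rule AE_I2)
      fix z show "(\<lambda>n. indicat_real P z *\<^sub>R (e z * E n z)) \<longlonglongrightarrow> indicat_real P z *\<^sub>R (e z * E' z)"
        using lim[of z] by (cases "z \<in> P") (auto intro!: tendsto_intros)
    qed
    fix n
    show "AE z in lborel. norm (indicat_real P z *\<^sub>R (e z * E n z)) \<le> \<bar>B\<bar> * norm (indicat_real K z *\<^sub>R e z)"
    proof (rule AE_I2)
      fix z
      show "norm (indicat_real P z *\<^sub>R (e z * E n z)) \<le> \<bar>B\<bar> * norm (indicat_real K z *\<^sub>R e z)"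
      proof (cases "z \<in> P \<and> z \<in> K")
        case True
        then have "\<bar>e z\<bar> * \<bar>E n z\<bar> \<le> \<bar>e z\<bar> * \<bar>B\<bar>" using B[of z n] by (intro mult_left_mono) auto
        with True show ?thesis by (simp add: abs_mult mult.commute)
      next
        case False
        then show ?thesis using E0[of z n] by (auto simp: indicator_def)
      qed
    qed
  qed (use m E E0 E0' in auto)
qed

text \<open>
  The fundamental layer has half thickness \<open>a\<close>, so the period of the extension is \<open>4 a\<close>.
\<close>

locale folding =
  fixes Q :: "'a::euclidean_space set" and a :: real
  assumes Q: "open Q" and a: "a > 0"
begin

definition strip where "strip = {z :: 'a \<times> real. fst z \<in> Q \<and> \<bar>snd z\<bar> < a}"

definition cylinder where "cylinder = {z :: 'a \<times> real. fst z \<in> Q}"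

lemma open_strip: "open strip" and open_cylinder: "open cylinder"
proof -
  have "strip = Q \<times> {-a<..<a}" by (auto simp: strip_def)
  then show "open strip" using Q by (auto intro: open_Times)
  have "cylinder = Q \<times> UNIV" by (auto simp: cylinder_def)
  then show "open cylinder" using Q by (auto intro: open_Times)
qed

lemma fold_range_covers:
  assumes "compact (K :: ('a \<times> real) set)"
  obtains M :: int and L where "M \<ge> 0" "4 * a * of_int M > L" "\<And>z. z \<in> K \<Longrightarrow> \<bar>snd z\<bar> \<le> L"
    "\<And>z. z \<in> K \<Longrightarrow> fold_index a (snd z) \<in> fold_range M"
proof -
  have "bounded (snd ` K)" using assms by (intro compact_imp_bounded compact_continuous_image continuous_intros)
  then obtain L0 where "\<And>z. z \<in> K \<Longrightarrow> \<bar>snd z\<bar> \<le> L0" by (metis bounded_iff image_eqI real_norm_def)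
  then have L: "\<And>z. z \<in> K \<Longrightarrow> \<bar>snd z\<bar> \<le> max 0 L0" by force
  define M where "M = \<lceil>max 0 L0 / (4 * a)\<rceil> + 1"
  have "max 0 L0 / (4 * a) < of_int M" unfolding M_def by linarith
  then have M: "max 0 L0 < 4 * a * of_int M" using a by (simp add: pos_divide_less_eq mult.commute)
  have "0 \<le> max 0 L0 / (4 * a)" using a by simp
  then have M0: "M \<ge> 0" unfolding M_def by linarith
  have "fold_index a t \<in> fold_range M" if "\<bar>t\<bar> \<le> max 0 L0" for t
    by (rule fold_index_in_range[OF a]) (use that M in linarith)
  then show ?thesis using that[OF M0 M L] L by blast
qed

lemma shear_fold:
  assumes "j \<in> fold_range M" "\<bar>snd z\<bar> < a"
  shows "fold_strip (2 * a) (snd (shear (fold_cell a j) (snd j) z)) = snd z"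
    "fold_sign (2 * a) (snd (shear (fold_cell a j) (snd j) z)) = snd j"
  using fold_strip_cell(2,3)[OF a assms(2) fold_range_snd(1)[OF assms(1)], of "fst j"] by simp_all

text \<open>
  The symmetrisation of the test function: both a folded function (\<open>\<tau>\<close> constant) and a folded
  vertical derivative (\<open>\<tau> \<sigma> = \<sigma>\<close>) are tested over the whole cylinder by testing over one layer.
\<close>

lemma integral_fold_kernel:
  fixes e k :: "'a \<times> real \<Rightarrow> real"
  assumes e0: "\<And>z. \<bar>snd z\<bar> \<ge> a \<Longrightarrow> e z = 0"
    and e: "\<And>C. compact C \<Longrightarrow> C \<subseteq> Q \<Longrightarrow> set_integrable lborel (C \<times> {-a..a}) e"
    and k: "continuous_on UNIV k" and K: "compact K" "K \<subseteq> cylinder" and k0: "\<And>z. z \<notin> K \<Longrightarrow> k z = 0"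
    and M: "\<And>z. z \<in> K \<Longrightarrow> fold_index a (snd z) \<in> fold_range M"
  shows "(LBINT z:cylinder. (\<tau> (fold_sign (2 * a) (snd z)) * e (fst z, fold_strip (2 * a) (snd z))) * k z)
    = (LBINT z:strip. e z * fold_sum (fold_range M) a \<tau> k z)"
proof -
  define C where "C = fst ` K"
  have C: "compact C" "C \<subseteq> Q" using K by (auto simp: C_def cylinder_def intro!: compact_continuous_image continuous_intros)
  have KC: "fst z \<in> C" if "z \<in> K" for z using that by (auto simp: C_def)
  define h where "h z = indicat_real cylinder z *\<^sub>R ((\<tau> (fold_sign (2 * a) (snd z)) * e (fst z, fold_strip (2 * a) (snd z))) * k z)" for z
  define f where "f j z = indicat_real strip z *\<^sub>R (e z * (\<tau> (snd j) * k (shear (fold_cell a j) (snd j) z)))" for j z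
  have fh: "(if \<bar>snd z\<bar> < a then h (shear (fold_cell a j) (snd j) z) else 0) = f j z" if j: "j \<in> fold_range M" for j z
  proof (cases "\<bar>snd z\<bar> < a")
    case True
    then show ?thesis using shear_fold[OF j True] 
      by (auto simp: h_def f_def cylinder_def strip_def indicator_def simp del: snd_shear)
  next
    case False
    then show ?thesis by (auto simp: f_def strip_def)
  qed
  have fi: "integrable lborel (f j)" if j: "j \<in> fold_range M" for j
  proof -
    have "set_integrable lborel (C \<times> {-a..a}) (\<lambda>z. (\<tau> (snd j) * k (shear (fold_cell a j) (snd j) z)) * e z)"
      by (rule set_integrable_mult_continuous_compact[OF e[OF C] compact_Times[OF C(1) compact_Icc] order_refl])
        (auto intro!: continuous_intros continuous_on_compose2[OF k continuous_on_shear])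
    moreover have "indicat_real (C \<times> {-a..a}) z *\<^sub>R ((\<tau> (snd j) * k (shear (fold_cell a j) (snd j) z)) * e z) = f j z" for z
    proof (cases "fst z \<in> C \<and> \<bar>snd z\<bar> < a")
      case True
      then show ?thesis using C(2) by (cases z) (auto simp: f_def strip_def indicator_def)
    next
      case False
      then have "k (shear (fold_cell a j) (snd j) z) = 0 \<or> e z = 0"
        using k0[of "shear (fold_cell a j) (snd j) z"] KC[of "shear (fold_cell a j) (snd j) z"] e0[of z] by auto
      then show ?thesis by (auto simp: f_def)
    qed
    ultimately show ?thesis by (simp add: set_integrable_def)
  qed
  have h0: "h z = 0" if "\<bar>fold_strip (2 * a) (snd z)\<bar> = a \<or> fold_index a (snd z) \<notin> fold_range M" for z
    using that e0[of "(fst z, fold_strip (2 * a) (snd z))"] M[of z] k0[of z] by (auto simp: h_def)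
  have "(LBINT z:cylinder. (\<tau> (fold_sign (2 * a) (snd z)) * e (fst z, fold_strip (2 * a) (snd z))) * k z) = integral\<^sup>L lborel h"
    by (simp add: set_lebesgue_integral_def h_def[abs_def])
  also have "\<dots> = (\<Sum>j\<in>fold_range M. integral\<^sup>L lborel (\<lambda>z. if \<bar>snd z\<bar> < a then h (shear (fold_cell a j) (snd j) z) else 0))"
    by (rule fold_integral(2)[OF a h0]) (auto simp only: fh fi)
  also have "\<dots> = (\<Sum>j\<in>fold_range M. integral\<^sup>L lborel (f j))"
    by (rule sum.cong[OF refl]) (simp only: fh)
  also have "\<dots> = integral\<^sup>L lborel (\<lambda>z. \<Sum>j\<in>fold_range M. f j z)"
    by (rule Bochner_Integration.integral_sum[symmetric]) (rule fi)
  also have "\<dots> = (LBINT z:strip. e z * fold_sum (fold_range M) a \<tau> k z)"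
    unfolding set_lebesgue_integral_def f_def fold_sum_def by (simp only: sum_distrib_left scaleR_sum_right)
  finally show ?thesis .
qed

lemma set_integrable_fold:
  fixes H :: "'a \<times> real \<Rightarrow> 'b::euclidean_space"
  assumes H0: "\<And>z. \<bar>snd z\<bar> \<ge> a \<Longrightarrow> H z = 0"
    and H: "\<And>C. compact C \<Longrightarrow> C \<subseteq> Q \<Longrightarrow> set_integrable lborel (C \<times> {-a..a}) H"
    and l: "\<And>\<sigma>. bounded_linear (l \<sigma> :: 'b \<Rightarrow> 'c::euclidean_space)"
    and K: "compact K" "K \<subseteq> cylinder"
  shows "set_integrable lborel K (\<lambda>z. l (fold_sign (2 * a) (snd z)) (H (fst z, fold_strip (2 * a) (snd z))))"
proof -
  define C where "C = fst ` K"
  have C: "compact C" "C \<subseteq> Q" using K by (auto simp: C_def cylinder_def intro!: compact_continuous_image continuous_intros)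
  obtain M L where M: "M \<ge> 0" "\<And>z. z \<in> K \<Longrightarrow> fold_index a (snd z) \<in> fold_range M"
    using fold_range_covers[OF K(1)] by metis
  have l0: "l \<sigma> 0 = 0" for \<sigma> using l by (rule linear_simps)
  define h where "h z = indicat_real K z *\<^sub>R (l (fold_sign (2 * a) (snd z)) (H (fst z, fold_strip (2 * a) (snd z))))" for z
  have "integrable lborel h"
  proof (rule fold_integral(1)[OF a])
    show "h z = 0" if "\<bar>fold_strip (2 * a) (snd z)\<bar> = a \<or> fold_index a (snd z) \<notin> fold_range M" for z
      using that H0[of "(fst z, fold_strip (2 * a) (snd z))"] M(2)[of z] by (auto simp: h_def l0 indicator_def)
    fix j assume j: "j \<in> fold_range M"
    define A where "A = (C \<times> {-a..a}) \<inter> (shear (fold_cell a j) (snd j) -` K)"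
    have mA: "A \<in> sets borel" unfolding A_def
      by (intro sets.Int measurable_sets_borel[OF measurable_shear] borel_compact compact_Times C K) simp
    have "set_integrable lborel A (\<lambda>z. l (snd j) (H z))"
      by (rule set_integrable_subset[OF set_integrable_bounded_linear[OF l H[OF C]]]) (use mA in \<open>auto simp: A_def\<close>)
    moreover have "indicat_real A z *\<^sub>R l (snd j) (H z) = (if \<bar>snd z\<bar> < a then h (shear (fold_cell a j) (snd j) z) else 0)" for z
    proof (cases "\<bar>snd z\<bar> < a")
      case True
      have "z \<in> A \<longleftrightarrow> shear (fold_cell a j) (snd j) z \<in> K"
      proof -
        have "fst z \<in> C" if "shear (fold_cell a j) (snd j) z \<in> K" using that unfolding C_def by (metis fst_shear image_eqI)
        then show ?thesis using True by (cases z) (auto simp: A_def)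
      qed
      with True shear_fold[OF j True] show ?thesis by (auto simp: h_def indicator_def simp del: snd_shear)
    next
      case False
      then show ?thesis using H0[of z] by (auto simp: l0)
    qed
    ultimately show "integrable lborel (\<lambda>z. if \<bar>snd z\<bar> < a then h (shear (fold_cell a j) (snd j) z) else 0)"
      by (simp add: set_integrable_def)
  qed
  then show ?thesis by (simp add: set_integrable_def h_def[abs_def])
qed

text \<open>
  Folding the test function \<open>f\<close> gives \<open>\<Phi>\<close>, which is \<open>C\<^sup>1\<close> on the layer but in general does not vanish near the faces. It is
  multiplied by the cutoff \<open>\<eta> n\<close>. For a horizontal direction the cutoff is not differentiated. For the vertical
  direction the folding has odd weights, so \<open>\<Phi>\<close> vanishes on the faces and is bounded by a multiple of the distance to
  them; then the product of \<open>\<Phi>\<close> with the derivative of the cutoff is bounded and tends to 0 pointwise. In both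
  cases dominated convergence removes the cutoff. Even reflection is essential here: for the vertical
  direction it is what makes the weights odd.

  The values of \<open>v\<close> and \<open>H\<close> off the open layer are set to 0. This affects the folded functions on the
  seams only, which are null sets.
\<close>

lemma weak_gradient_fold:
  fixes v :: "'a \<times> real \<Rightarrow> real" and H :: "'a \<times> real \<Rightarrow> 'a \<times> real"
  assumes w: "weak_gradient strip v H"
    and v0: "\<And>z. \<bar>snd z\<bar> \<ge> a \<Longrightarrow> v z = 0" and H0: "\<And>z. \<bar>snd z\<bar> \<ge> a \<Longrightarrow> H z = 0"
    and vi: "\<And>C. compact C \<Longrightarrow> C \<subseteq> Q \<Longrightarrow> set_integrable lborel (C \<times> {-a..a}) v"
    and Hi: "\<And>C. compact C \<Longrightarrow> C \<subseteq> Q \<Longrightarrow> set_integrable lborel (C \<times> {-a..a}) H"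
  shows "weak_gradient cylinder (\<lambda>z. v (fst z, fold_strip (2 * a) (snd z)))
    (\<lambda>z. let y = H (fst z, fold_strip (2 * a) (snd z)) in (fst y, fold_sign (2 * a) (snd z) * snd y))"
proof (rule weak_gradientI[OF open_cylinder])
  fix K :: "('a \<times> real) set" assume K: "compact K" "K \<subseteq> cylinder"
  have "set_integrable lborel K (\<lambda>z. v (fst z, fold_strip (2 * a) (snd z)))"
    using set_integrable_fold[where l = "\<lambda>_ x. x", OF v0 vi bounded_linear_ident K] .
  moreover have l: "bounded_linear (\<lambda>y :: 'a \<times> real. (fst y, \<sigma> * snd y))" for \<sigma>
    by (intro bounded_linear_Pair bounded_linear_fst bounded_linear_mult_right[THEN bounded_linear_compose] bounded_linear_snd)
  have "set_integrable lborel K (\<lambda>z. let y = H (fst z, fold_strip (2 * a) (snd z)) in (fst y, fold_sign (2 * a) (snd z) * snd y))"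
    using set_integrable_fold[where l = "\<lambda>\<sigma> y. (fst y, \<sigma> * snd y)", OF H0 Hi l K] by (simp add: Let_def)
  ultimately show "set_integrable lborel K (\<lambda>z. v (fst z, fold_strip (2 * a) (snd z))) \<and>
     set_integrable lborel K (\<lambda>z. let y = H (fst z, fold_strip (2 * a) (snd z)) in (fst y, fold_sign (2 * a) (snd z) * snd y))"
    by simp
next
  fix f :: "'a \<times> real \<Rightarrow> real" and D K and b :: "'a \<times> real"
  assume f: "C1_grad f D UNIV" and K: "compact K" "K \<subseteq> cylinder" and f0: "\<And>x. x \<notin> K \<Longrightarrow> f x = 0"
    and D0: "\<And>x. x \<notin> K \<Longrightarrow> D x = 0" and b: "b \<in> Basis"
  obtain M L where M: "M \<ge> 0" "4 * a * of_int M > L" and L: "\<And>z. z \<in> K \<Longrightarrow> \<bar>snd z\<bar> \<le> L"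
    and MK: "\<And>z. z \<in> K \<Longrightarrow> fold_index a (snd z) \<in> fold_range M"
    using fold_range_covers[OF K(1)] by metis
  define C where "C = fst ` K"
  have C: "compact C" "C \<subseteq> Q" using K by (auto simp: C_def cylinder_def intro!: compact_continuous_image continuous_intros)
  have KC: "shear c \<sigma> z \<notin> K" if "fst z \<notin> C" for z c \<sigma> using that unfolding C_def by (metis fst_shear image_eqI)
  have sb: "snd b = 0 \<or> b = (0, 1)" and sb': "fst b = 0 \<or> snd b = 0" using b by (auto simp: Basis_prod_def)
  define \<tau> :: "real \<Rightarrow> real" where "\<tau> = (if snd b = 0 then (\<lambda>\<sigma>. 1) else (\<lambda>\<sigma>. \<sigma>))"
  have \<tau>1: "\<bar>\<tau> (snd j)\<bar> = 1" if "j \<in> fold_range M" for j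
    using fold_range_snd[OF that] by (auto simp: \<tau>_def)
  let ?J = "fold_range M"
  let ?S = "\<lambda>j. shear (fold_cell a j) (snd j) :: 'a \<times> real \<Rightarrow> _"
  have cD: "continuous_on UNIV D" by (rule C1_grad_continuous_D[OF f])
  obtain B where B: "B > 0" "\<And>x. norm (D x) \<le> B"
    using compact_support_bounded[OF K(1) continuous_on_subset[OF cD] D0] by auto
  obtain Bf where Bf: "Bf > 0" "\<And>x. \<bar>f x\<bar> \<le> Bf"
    using compact_support_bounded[OF K(1) continuous_on_subset[OF C1_grad_continuous[OF f]] f0] by auto
  \<comment> \<open>the derivative of the folded test function in direction \<open>b\<close>\<close>
  define A where "A = fold_sum ?J a (\<lambda>_. 1) (\<lambda>z. D z \<bullet> b)"
  define \<Phi> where "\<Phi> = fold_sum ?J a \<tau> f"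
  define D\<Phi> where "D\<Phi> z = (\<Sum>j\<in>?J. \<tau> (snd j) *\<^sub>R (fst (D (?S j z)), snd j * snd (D (?S j z))))" for z
  have C\<Phi>: "C1_grad \<Phi> D\<Phi> S" for S unfolding \<Phi>_def D\<Phi>_def by (rule C1_grad_fold_sum[OF f])
  have D\<Phi>b: "D\<Phi> z \<bullet> b = A z" for z
    unfolding D\<Phi>_def A_def fold_sum_def inner_sum_left
  proof (rule sum.cong[OF refl])
    fix j assume "j \<in> ?J"
    then have "snd j * snd j = 1" using fold_range_snd(1)[of j M] by auto
    then show "(\<tau> (snd j) *\<^sub>R (fst (D (?S j z)), snd j * snd (D (?S j z)))) \<bullet> b = 1 * (D (?S j z) \<bullet> b)"
      using sb by (cases b) (auto simp: \<tau>_def inner_prod_def mult.assoc[symmetric])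
  qed
  define c where "c = real (card ?J)"
  have Abound: "\<bar>A z\<bar> \<le> c * B" for z
  proof -
    have "\<bar>A z\<bar> \<le> (\<Sum>j\<in>?J. \<bar>1 * (D (?S j z) \<bullet> b)\<bar>)" unfolding A_def fold_sum_def by (rule sum_abs)
    also have "\<dots> \<le> (\<Sum>j\<in>?J. B)"
    proof (rule sum_mono)
      fix j
      have "\<bar>D (?S j z) \<bullet> b\<bar> \<le> norm (D (?S j z)) * norm b" by (rule Cauchy_Schwarz_ineq2)
      then show "\<bar>1 * (D (?S j z) \<bullet> b)\<bar> \<le> B" using B(2)[of "?S j z"] b by simp
    qed
    finally show ?thesis by (simp add: c_def)
  qed
  have \<Phi>bound: "\<bar>\<Phi> z\<bar> \<le> c * Bf" for z
  proof -
    have "\<bar>\<Phi> z\<bar> \<le> (\<Sum>j\<in>?J. \<bar>\<tau> (snd j) * f (?S j z)\<bar>)" unfolding \<Phi>_def fold_sum_def by (rule sum_abs)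
    also have "\<dots> \<le> (\<Sum>j\<in>?J. Bf)" by (rule sum_mono) (simp add: abs_mult \<tau>1 Bf)
    finally show ?thesis by (simp add: c_def)
  qed
  have D\<Phi>bound: "norm (D\<Phi> z) \<le> c * B" for z
  proof -
    have "norm (D\<Phi> z) \<le> (\<Sum>j\<in>?J. norm (\<tau> (snd j) *\<^sub>R (fst (D (?S j z)), snd j * snd (D (?S j z)))))" unfolding D\<Phi>_def by (rule norm_sum)
    also have "\<dots> \<le> (\<Sum>j\<in>?J. B)"
    proof (rule sum_mono)
      fix j assume j: "j \<in> ?J"
      have "norm (fst (D (?S j z)), snd j * snd (D (?S j z))) = norm (D (?S j z))"
        using fold_range_snd(2)[OF j] by (simp add: norm_prod_def norm_mult abs_mult)
      then show "norm (\<tau> (snd j) *\<^sub>R (fst (D (?S j z)), snd j * snd (D (?S j z)))) \<le> B"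
        using B(2)[of "?S j z"] unfolding norm_scaleR \<tau>1[OF j] by simp
    qed
    finally show ?thesis by (simp add: c_def)
  qed
  have \<Phi>edge: "\<bar>\<Phi> z\<bar> \<le> c * B * (a - \<bar>snd z\<bar>)" if nb: "snd b \<noteq> 0" and za: "\<bar>snd z\<bar> < a" for z
  proof -
    have fL: "f z = 0" if "\<bar>snd z\<bar> > L" for z using f0[of z] L[of z] that by force
    define e where "e = (if snd z \<ge> 0 then a else - a)"
    have "\<tau> = (\<lambda>\<sigma>. \<sigma>)" using nb by (simp add: \<tau>_def)
    then have "\<Phi> (fst z, e) = 0"
      using fold_sum_boundary[where f = f and L = L, OF _ M(2) a M(1)] fL by (simp add: \<Phi>_def e_def)
    then have "\<bar>\<Phi> z\<bar> \<le> c * B * norm (z - (fst z, e))"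
      using C1_grad_lipschitz[OF C\<Phi> D\<Phi>bound, of z "(fst z, e)"] by simp
    also have "norm (z - (fst z, e)) = a - \<bar>snd z\<bar>"
      using za by (cases z) (auto simp: e_def norm_prod_def abs_if)
    finally show ?thesis .
  qed
  \<comment> \<open>a smooth substitute for the distance to the faces\<close>
  define q where "q z = a * a - snd z * snd z" for z :: "'a \<times> real"
  define Dq :: "'a \<times> real \<Rightarrow> 'a \<times> real" where "Dq z = 0 - (snd z *\<^sub>R (0, 1) + snd z *\<^sub>R (0, 1))" for z :: "'a \<times> real"
  have Cq: "C1_grad q Dq S" for S unfolding q_def Dq_def
    by (rule C1_grad_diff[OF C1_grad_const C1_grad_mult[OF C1_grad_snd C1_grad_snd]])
  have qpos: "q z > 0" if "z \<in> strip" for z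
  proof -
    have "\<bar>snd z\<bar> * \<bar>snd z\<bar> < a * a" using that by (intro mult_strict_mono') (auto simp: strip_def)
    then show ?thesis by (simp add: q_def)
  qed
  define \<eta> where "\<eta> n z = layer_cut (real (Suc n) * q z)" for n z
  define D\<eta> where "D\<eta> n z = layer_cut' (real (Suc n) * q z) *\<^sub>R (real (Suc n) *\<^sub>R Dq z + q z *\<^sub>R 0)" for n z
  have C\<eta>: "C1_grad (\<eta> n) (D\<eta> n) strip" for n
    unfolding \<eta>_def D\<eta>_def
    by (rule C1_grad_compose_real[OF C1_grad_mult[OF C1_grad_const Cq] _ layer_cut_deriv layer_cut'_cont])
      (use qpos in \<open>auto simp del: of_nat_Suc\<close>)
  note C\<eta>\<Phi> = C1_grad_mult[OF C\<eta> C\<Phi>]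
  define X where "X n z = D\<eta> n z \<bullet> b" for n z
  have X: "X n z = - 2 * snd b * snd z * (layer_cut' (real (Suc n) * q z) * real (Suc n))" for n z
    by (simp add: X_def D\<eta>_def Dq_def inner_prod_def)
  have off: "A z = 0" "\<Phi> z = 0" if "fst z \<notin> C" for z
    using KC[OF that] D0 f0 by (auto simp: A_def \<Phi>_def fold_sum_def)
  \<comment> \<open>the derivative of \<open>\<eta> n \<Phi>\<close> in direction \<open>b\<close>\<close>
  define E where "E n z = \<eta> n z * A z + \<Phi> z * X n z" for n z
  have Eeq: "(\<eta> n z *\<^sub>R D\<Phi> z + \<Phi> z *\<^sub>R D\<eta> n z) \<bullet> b = E n z" for n z
    by (simp add: E_def X_def inner_add_left D\<Phi>b)
  have \<Phi>X: "\<bar>\<Phi> z * X n z\<bar> \<le> 2 * (c * B) * (layer_cut' (real (Suc n) * q z) * (real (Suc n) * q z))" if z: "z \<in> strip" for n z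
  proof (cases "snd b = 0")
    case True
    then show ?thesis using layer_cut'_bounds(1)[of "real (Suc n) * q z"] qpos[OF z] B(1)
      by (auto simp: X c_def intro!: mult_nonneg_nonneg simp del: of_nat_Suc)
  next
    case False
    then have b1: "snd b = 1" using sb by auto
    have za: "\<bar>snd z\<bar> < a" using z by (simp add: strip_def)
    let ?l = "layer_cut' (real (Suc n) * q z) * real (Suc n)"
    have l: "?l \<ge> 0" using layer_cut'_bounds(1)[of "real (Suc n) * q z"] qpos[OF z] by (simp del: of_nat_Suc)
    have "\<bar>\<Phi> z\<bar> * \<bar>snd z\<bar> \<le> (c * B * (a - \<bar>snd z\<bar>)) * (a + \<bar>snd z\<bar>)"
      using \<Phi>edge[OF False za] a by (intro mult_mono) auto
    also have "\<dots> = c * B * q z" by (simp add: q_def algebra_simps)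
    finally have "\<bar>\<Phi> z\<bar> * \<bar>snd z\<bar> * (2 * ?l) \<le> c * B * q z * (2 * ?l)" using l by (intro mult_right_mono) auto
    moreover have "\<bar>\<Phi> z * X n z\<bar> = \<bar>\<Phi> z\<bar> * \<bar>snd z\<bar> * (2 * ?l)"
      using layer_cut'_bounds(1)[of "real (Suc n) * q z"] qpos[OF z]
      unfolding X b1 by (simp add: abs_mult del: of_nat_Suc)
    ultimately show ?thesis by (simp add: algebra_simps del: of_nat_Suc)
  qed
  have \<eta>01: "\<bar>\<eta> n z\<bar> \<le> 1" if "z \<in> strip" for n z
    using layer_cut_bounds(1,2)[of "real (Suc n) * q z"] qpos[OF that] by (simp add: \<eta>_def del: of_nat_Suc)
  have cA: "continuous_on strip A"
    using C1_grad_continuous_D[OF C\<Phi>, of strip] unfolding D\<Phi>b[symmetric] by (intro continuous_intros)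
  have c\<eta>: "continuous_on strip (\<eta> n)" for n by (rule C1_grad_continuous[OF C\<eta>])
  have cX: "continuous_on strip (X n)" for n
    unfolding X_def using C1_grad_continuous_D[OF C\<eta>] by (intro continuous_intros)
  have c\<Phi>: "continuous_on strip \<Phi>" by (rule C1_grad_continuous[OF C\<Phi>])
  have \<eta>lim: "(\<lambda>n. \<eta> n z) \<longlonglongrightarrow> 1" if "z \<in> strip" for z
    unfolding \<eta>_def by (rule layer_cut_lim(1)[OF qpos[OF that]])
  have lim1: "(\<lambda>n. LBINT z:strip. v z * E n z) \<longlonglongrightarrow> (LBINT z:strip. v z * A z)"
  proof (rule set_integral_dominated_convergence_kernel[OF vi[OF C] open_strip])
    show "continuous_on strip (E n)" for n unfolding E_def by (intro continuous_intros c\<eta> cA cX c\<Phi>)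
    show "\<bar>E n z\<bar> \<le> c * B + 4 * (c * B)" if z: "z \<in> strip" for n z
    proof -
      have "\<bar>\<eta> n z * A z\<bar> \<le> 1 * (c * B)" unfolding abs_mult by (intro mult_mono \<eta>01 z Abound) auto
      moreover have "\<bar>\<Phi> z * X n z\<bar> \<le> 2 * (c * B) * 2"
        using \<Phi>X[OF z, of n] by (rule order_trans) (intro mult_left_mono layer_cut'_bounds(2), use qpos[OF z] B(1) in \<open>auto simp: c_def\<close>)
      ultimately show ?thesis unfolding E_def by linarith
    qed
    show "E n z = 0" if "z \<in> strip" "z \<notin> C \<times> {-a..a}" for n z
    proof -
      have "fst z \<notin> C" using that by (cases z) (auto simp: strip_def)
      then show ?thesis using off by (simp add: E_def)
    qed
    show "(\<lambda>n. E n z) \<longlonglongrightarrow> A z" if z: "z \<in> strip" for z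
    proof -
      have "(\<lambda>n. 2 * (c * B) * (layer_cut' (real (Suc n) * q z) * (real (Suc n) * q z))) \<longlonglongrightarrow> 2 * (c * B) * 0"
        by (intro tendsto_mult_left layer_cut_lim(2) qpos z)
      then have "(\<lambda>n. 2 * (c * B) * (layer_cut' (real (Suc n) * q z) * (real (Suc n) * q z))) \<longlonglongrightarrow> 0" by simp
      then have "(\<lambda>n. \<Phi> z * X n z) \<longlonglongrightarrow> 0"
        by (rule Lim_null_comparison[rotated]) (use \<Phi>X[OF z] in auto)
      then have "(\<lambda>n. \<eta> n z * A z + \<Phi> z * X n z) \<longlonglongrightarrow> 1 * A z + 0"
        by (intro tendsto_intros \<eta>lim z)
      then show ?thesis by (simp add: E_def)
    qed
  qed (rule cA)
  have lim2: "(\<lambda>n. LBINT z:strip. (H z \<bullet> b) * (\<eta> n z * \<Phi> z)) \<longlonglongrightarrow> (LBINT z:strip. (H z \<bullet> b) * \<Phi> z)"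
  proof (rule set_integral_dominated_convergence_kernel[OF set_integrable_bounded_linear[OF bounded_linear_inner_left Hi[OF C]] open_strip])
    show "continuous_on strip (\<lambda>z. \<eta> n z * \<Phi> z)" for n by (intro continuous_intros c\<eta> c\<Phi>)
    show "\<bar>\<eta> n z * \<Phi> z\<bar> \<le> 1 * (c * Bf)" if z: "z \<in> strip" for n z
      unfolding abs_mult by (intro mult_mono \<eta>01 z \<Phi>bound) auto
    show "\<eta> n z * \<Phi> z = 0" if "z \<in> strip" "z \<notin> C \<times> {-a..a}" for n z
    proof -
      have "fst z \<notin> C" using that by (cases z) (auto simp: strip_def)
      then show ?thesis using off by simp
    qed
    show "(\<lambda>n. \<eta> n z * \<Phi> z) \<longlonglongrightarrow> \<Phi> z" if z: "z \<in> strip" for z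
      using tendsto_mult[OF \<eta>lim[OF z] tendsto_const[of "\<Phi> z"]] by simp
  qed (rule c\<Phi>)
  \<comment> \<open>the product \<open>\<eta> n \<Phi>\<close> has compact support in the layer, so it is an admissible test function\<close>
  have eqn: "(LBINT z:strip. v z * E n z) = - (LBINT z:strip. (H z \<bullet> b) * (\<eta> n z * \<Phi> z))" for n
  proof -
    define Kn where "Kn = C \<times> ({-a..a} \<inter> {s. s * s \<le> a * a - 1 / real (Suc n)})"
    have "closed {s. s * s \<le> a * a - 1 / real (Suc n)}"
      by (intro closed_Collect_le continuous_intros)
    then have Kn: "compact Kn" unfolding Kn_def
      by (intro compact_Times C compact_Int_closed compact_Icc)
    have Kns: "Kn \<subseteq> strip"
    proof
      fix z assume z: "z \<in> Kn"
      then have "snd z * snd z < a * a" by (auto simp: Kn_def intro: le_less_trans)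
      then have "\<bar>snd z\<bar> < a" using a by (metis abs_of_pos power2_eq_square real_sqrt_abs real_sqrt_less_iff)
      then show "z \<in> strip" using z C(2) by (auto simp: Kn_def strip_def)
    qed
    have z0: "\<eta> n z * \<Phi> z = 0" if z: "z \<in> strip - Kn" for z
    proof (cases "fst z \<in> C")
      case False then show ?thesis using off by simp
    next
      case True
      then have "\<not> snd z * snd z \<le> a * a - 1 / real (Suc n)" using z by (cases z) (auto simp: Kn_def strip_def)
      then have "q z < 1 / real (Suc n)" unfolding q_def by linarith
      then have "real (Suc n) * q z \<le> 1" by (simp add: field_simps del: of_nat_Suc)
      then have "\<eta> n z = 0" using layer_cut_bounds(3)[of "real (Suc n) * q z"] qpos[of z] z by (simp add: \<eta>_def del: of_nat_Suc)
      then show ?thesis by simp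
    qed
    from weak_gradient_test[OF w open_strip C\<eta>\<Phi> Kn Kns z0 b] show ?thesis
      by (simp only: Eeq)
  qed
  have main: "(LBINT z:strip. v z * A z) = - (LBINT z:strip. (H z \<bullet> b) * \<Phi> z)"
    using LIMSEQ_unique[OF lim1] tendsto_minus[OF lim2] unfolding eqn by auto
  have "(LBINT z:cylinder. v (fst z, fold_strip (2 * a) (snd z)) * (D z \<bullet> b)) = (LBINT z:strip. v z * A z)"
    using integral_fold_kernel[OF v0 vi _ K _ MK, of "\<lambda>z. D z \<bullet> b" "\<lambda>_. 1"] cD D0
    by (simp add: A_def continuous_intros)
  also have "\<dots> = - (LBINT z:strip. (H z \<bullet> b) * \<Phi> z)" by (rule main)
  also have "(LBINT z:strip. (H z \<bullet> b) * \<Phi> z) = (LBINT z:cylinder. (\<tau> (fold_sign (2 * a) (snd z)) * (H (fst z, fold_strip (2 * a) (snd z)) \<bullet> b)) * f z)"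
    unfolding \<Phi>_def
    by (rule integral_fold_kernel[symmetric, OF _ set_integrable_bounded_linear[OF bounded_linear_inner_left Hi] C1_grad_continuous[OF f] K f0 MK])
      (auto simp: H0)
  also have "\<dots> = (LBINT z:cylinder. ((let y = H (fst z, fold_strip (2 * a) (snd z)) in (fst y, fold_sign (2 * a) (snd z) * snd y)) \<bullet> b) * f z)"
    by (intro arg_cong2[where f = "set_lebesgue_integral lborel"] refl ext) 
      (use sb sb' in \<open>auto simp: \<tau>_def Let_def inner_prod_def\<close>)
  finally show "(LBINT z:cylinder. v (fst z, fold_strip (2 * a) (snd z)) * (D z \<bullet> b)) =
    - (LBINT z:cylinder. ((let y = H (fst z, fold_strip (2 * a) (snd z)) in (fst y, fold_sign (2 * a) (snd z) * snd y)) \<bullet> b) * f z)" .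
qed

end

section \<open>Cutting off Sobolev functions\<close>

lemma integrable_lborel_translate:
  fixes f :: "'a::euclidean_space \<Rightarrow> 'b::euclidean_space"
  assumes "integrable lborel f"
  shows "integrable lborel (\<lambda>x. f (c + x))" "integral\<^sup>L lborel (\<lambda>x. f (c + x)) = integral\<^sup>L lborel f"
proof -
  have m: "f \<in> borel_measurable borel" using assms by auto
  have s: "(+) c \<in> lborel \<rightarrow>\<^sub>M borel" by simp
  show "integrable lborel (\<lambda>x. f (c + x))"
    using integrable_distr_eq[OF s m] assms by (simp add: lborel_distr_plus)
  show "integral\<^sup>L lborel (\<lambda>x. f (c + x)) = integral\<^sup>L lborel f"
    using integral_distr[OF s m] by (simp add: lborel_distr_plus)
qed

text \<open>
  The difference quotients have integral 0 by translation invariance, and they are dominated by the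
  Lipschitz bound on a compact set. In particular constants have weak gradient 0, which allows a
  constant to be subtracted from a Sobolev function.
\<close>

lemma integral_derivative_compact_support:
  fixes f :: "'a::euclidean_space \<Rightarrow> real"
  assumes f: "C1_grad f D UNIV" and K: "compact K" and f0: "\<And>x. x \<notin> K \<Longrightarrow> f x = 0" 
    and D0: "\<And>x. x \<notin> K \<Longrightarrow> D x = 0"
  shows "integral\<^sup>L lborel (\<lambda>x. D x \<bullet> b) = 0"
proof -
  obtain B where B: "B > 0" "\<And>x. norm (D x) \<le> B"
    using compact_support_bounded[OF K continuous_on_subset[OF C1_grad_continuous_D[OF f]] D0] by auto
  define K' where "K' = (\<lambda>(x, t). x - t *\<^sub>R b) ` (K \<times> {0..1})"
  have K': "compact K'" unfolding K'_def
    by (intro compact_continuous_image compact_Times K compact_Icc) (auto simp: case_prod_unfold intro!: continuous_intros)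
  have cf: "continuous_on UNIV f" by (rule C1_grad_continuous[OF f])
  have "set_integrable lborel K f"
    unfolding set_integrable_def by (rule borel_integrable_compact[OF K continuous_on_subset[OF cf]]) auto
  moreover have "(\<lambda>x. indicat_real K x *\<^sub>R f x) = f" using f0 by (auto simp: indicator_def fun_eq_iff)
  ultimately have fi: "integrable lborel f" by (simp add: set_integrable_def)
  define t where "t n = 1 / real (Suc n)" for n
  have t: "t n > 0" "t n \<le> 1" for n by (auto simp: t_def)
  have tl: "t \<longlonglongrightarrow> 0" unfolding t_def using LIMSEQ_inverse_real_of_nat by (simp add: inverse_eq_divide)
  have i0: "integral\<^sup>L lborel (\<lambda>x. (f (t n *\<^sub>R b + x) - f x) / t n) = 0" for n
    using integrable_lborel_translate[OF fi, of "t n *\<^sub>R b"] fi by simp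
  have "(\<lambda>n. integral\<^sup>L lborel (\<lambda>x. (f (t n *\<^sub>R b + x) - f x) / t n)) \<longlonglongrightarrow> integral\<^sup>L lborel (\<lambda>x. D x \<bullet> b)"
  proof (rule integral_dominated_convergence[where w = "\<lambda>x. (B * norm b) * indicat_real (K \<union> K') x"])
    show "(\<lambda>x. D x \<bullet> b) \<in> borel_measurable lborel"
      using borel_measurable_continuous_onI[OF C1_grad_continuous_D[OF f]] by simp
    have mf: "f \<in> borel_measurable borel" by (rule borel_measurable_continuous_onI[OF cf])
    then show "(\<lambda>x. (f (t n *\<^sub>R b + x) - f x) / t n) \<in> borel_measurable lborel" for n by simp
    have "compact (K \<union> K')" using K K' by auto
    then show "integrable lborel (\<lambda>x. (B * norm b) * indicat_real (K \<union> K') x)"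
      using emeasure_bounded_finite[OF compact_imp_bounded[OF \<open>compact (K \<union> K')\<close>]]
      by (intro integrable_mult_right integrable_real_indicator) (simp_all add: borel_compact)
    show "AE x in lborel. (\<lambda>n. (f (t n *\<^sub>R b + x) - f x) / t n) \<longlonglongrightarrow> D x \<bullet> b"
    proof (rule AE_I2)
      fix x
      have "((\<lambda>s. s *\<^sub>R b + x) has_derivative (\<lambda>s. s *\<^sub>R b)) (at 0)"
        by (auto intro!: derivative_eq_intros)
      then have "((\<lambda>s. f (s *\<^sub>R b + x)) has_derivative (\<lambda>s. D (0 *\<^sub>R b + x) \<bullet> (s *\<^sub>R b))) (at 0)"
        by (rule has_derivative_compose) (rule C1_gradD[OF f], simp)
      then have "((\<lambda>s. f (s *\<^sub>R b + x)) has_real_derivative (D x \<bullet> b)) (at 0)"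
        by (simp add: has_field_derivative_def mult_commute_abs)
      then have l: "((\<lambda>s. (f (s *\<^sub>R b + x) - f x) / s) \<longlongrightarrow> D x \<bullet> b) (at 0)"
        by (simp add: DERIV_def)
      have "filterlim t (at 0) sequentially"
        using tl t(1) by (auto simp: filterlim_at intro!: always_eventually less_imp_neq[symmetric])
      from filterlim_compose[OF l this] show "(\<lambda>n. (f (t n *\<^sub>R b + x) - f x) / t n) \<longlonglongrightarrow> D x \<bullet> b" .
    qed
    show "AE x in lborel. norm ((f (t n *\<^sub>R b + x) - f x) / t n) \<le> (B * norm b) * indicat_real (K \<union> K') x" for n
    proof (rule AE_I2)
      fix x
      show "norm ((f (t n *\<^sub>R b + x) - f x) / t n) \<le> (B * norm b) * indicat_real (K \<union> K') x"
      proof (cases "x \<in> K \<union> K'")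
        case True
        have "\<bar>f (t n *\<^sub>R b + x) - f x\<bar> \<le> B * norm (t n *\<^sub>R b)"
          using C1_grad_lipschitz[OF f B(2), of "t n *\<^sub>R b + x" x] by simp
        then show ?thesis using True t[of n] by (simp add: field_simps)
      next
        case False
        have "t n *\<^sub>R b + x \<notin> K"
        proof
          assume "t n *\<^sub>R b + x \<in> K"
          then have "(\<lambda>(x, t). x - t *\<^sub>R b) (t n *\<^sub>R b + x, t n) \<in> K'" unfolding K'_def by (rule imageI[OF SigmaI]) (use t[of n] in auto)
          then show False using False by simp
        qed
        then show ?thesis using f0 False by simp
      qed
    qed
  qed
  then show ?thesis unfolding i0 using LIMSEQ_unique tendsto_const by blast
qed

lemma powr_add_le:
  fixes x y p :: real
  assumes "x \<ge> 0" "y \<ge> 0" "p > 0"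
  shows "(x + y) powr p \<le> 2 powr p * (x powr p + y powr p)"
proof -
  have "(x + y) powr p \<le> (2 * max x y) powr p" using assms by (intro powr_mono2) auto
  also have "\<dots> = 2 powr p * max x y powr p" by (rule powr_mult)
  also have "max x y powr p \<le> x powr p + y powr p" by (auto simp: max_def)
  finally show ?thesis by simp
qed

lemma Lp_on_eq:
  assumes "p > 0"
  shows "Lp_on p S f \<longleftrightarrow> (\<lambda>x. indicator S x *\<^sub>R f x) \<in> borel_measurable lborel \<and>
    integrable lborel (\<lambda>x. norm (indicator S x *\<^sub>R f x) powr p)"
proof -
  have "(\<lambda>x. indicat_real S x *\<^sub>R norm (f x) powr p) = (\<lambda>x. norm (indicator S x *\<^sub>R f x) powr p)"
    using assms by (auto simp: indicator_def fun_eq_iff)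
  then show ?thesis unfolding Lp_on_def set_borel_measurable_def set_integrable_def by simp
qed

lemma Lp_on_add:
  assumes p: "p > 0" and f: "Lp_on p S f" and g: "Lp_on p S g"
  shows "Lp_on p S (\<lambda>x. f x + g x)"
  unfolding Lp_on_eq[OF p]
proof
  let ?f = "\<lambda>x. indicator S x *\<^sub>R f x" and ?g = "\<lambda>x. indicator S x *\<^sub>R g x"
  have m: "?f \<in> borel_measurable lborel" "?g \<in> borel_measurable lborel" using f g by (auto simp: Lp_on_eq[OF p])
  have e: "(\<lambda>x. indicator S x *\<^sub>R (f x + g x)) = (\<lambda>x. ?f x + ?g x)" by (simp add: scaleR_add_right)
  show "(\<lambda>x. indicator S x *\<^sub>R (f x + g x)) \<in> borel_measurable lborel" unfolding e using m by simp
  have "integrable lborel (\<lambda>x. norm (?f x + ?g x) powr p)"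
  proof (rule Bochner_Integration.integrable_bound)
    show "integrable lborel (\<lambda>x. 2 powr p * (norm (?f x) powr p + norm (?g x) powr p))"
      using f g by (auto simp: Lp_on_eq[OF p] simp del: norm_scaleR)
    show "(\<lambda>x. norm (?f x + ?g x) powr p) \<in> borel_measurable lborel" using m by measurable
    show "AE x in lborel. norm (norm (?f x + ?g x) powr p) \<le> norm (2 powr p * (norm (?f x) powr p + norm (?g x) powr p))"
    proof (rule AE_I2)
      fix x
      have "norm (?f x + ?g x) powr p \<le> (norm (?f x) + norm (?g x)) powr p"
        using p by (intro powr_mono2 norm_triangle_ineq) auto
      also have "\<dots> \<le> 2 powr p * (norm (?f x) powr p + norm (?g x) powr p)" by (rule powr_add_le) (use p in auto)
      finally show "norm (norm (?f x + ?g x) powr p) \<le> norm (2 powr p * (norm (?f x) powr p + norm (?g x) powr p))" by simp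
    qed
  qed
  then show "integrable lborel (\<lambda>x. norm (indicator S x *\<^sub>R (f x + g x)) powr p)" by (simp add: scaleR_add_right)
qed

lemma Lp_on_bilinear_bounded:
  fixes pr :: "'d::euclidean_space \<Rightarrow> 'c::euclidean_space \<Rightarrow> 'e::euclidean_space" and c :: "'b::euclidean_space \<Rightarrow> 'd"
  assumes pr: "bounded_bilinear pr" and p: "p > 0" and f: "Lp_on p S f"
    and c: "continuous_on UNIV c" and B: "\<And>x. norm (c x) \<le> B"
  shows "Lp_on p S (\<lambda>x. pr (c x) (f x))"
  unfolding Lp_on_eq[OF p]
proof
  interpret pr: bounded_bilinear pr by (rule pr)
  obtain C where C: "C > 0" "\<And>a b. norm (pr a b) \<le> norm a * norm b * C"
    using pr.pos_bounded by blast
  let ?f = "\<lambda>x. indicator S x *\<^sub>R f x"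
  have m: "?f \<in> borel_measurable lborel" using f by (auto simp: Lp_on_eq[OF p])
  have e: "(\<lambda>x. indicator S x *\<^sub>R pr (c x) (f x)) = (\<lambda>x. pr (c x) (?f x))" by (simp add: pr.scaleR_right)
  have H: "continuous_on UNIV (\<lambda>x. pr (fst x) (snd x))" by (intro pr.continuous_on continuous_intros)
  have mc: "c \<in> borel_measurable lborel" using borel_measurable_continuous_onI[OF c] by simp
  have me: "(\<lambda>x. pr (c x) (?f x)) \<in> borel_measurable lborel"
    by (rule borel_measurable_continuous_Pair[where H = pr, OF mc m H])
  then show "(\<lambda>x. indicator S x *\<^sub>R pr (c x) (f x)) \<in> borel_measurable lborel" unfolding e .
  have "integrable lborel (\<lambda>x. norm (pr (c x) (?f x)) powr p)"
  proof (rule Bochner_Integration.integrable_bound)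
    show "integrable lborel (\<lambda>x. (\<bar>B\<bar> * C) powr p * norm (?f x) powr p)"
      using f by (auto simp: Lp_on_eq[OF p] simp del: norm_scaleR)
    show "(\<lambda>x. norm (pr (c x) (?f x)) powr p) \<in> borel_measurable lborel" using me by measurable
    show "AE x in lborel. norm (norm (pr (c x) (?f x)) powr p) \<le> norm ((\<bar>B\<bar> * C) powr p * norm (?f x) powr p)"
    proof (rule AE_I2)
      fix x
      have "norm (pr (c x) (?f x)) \<le> norm (c x) * norm (?f x) * C" by (rule C(2))
      also have "\<dots> \<le> \<bar>B\<bar> * norm (?f x) * C" using B[of x] C(1) by (intro mult_right_mono) auto
      finally have "norm (pr (c x) (?f x)) \<le> (\<bar>B\<bar> * C) * norm (?f x)" by (simp add: mult_ac)
      then have "norm (pr (c x) (?f x)) powr p \<le> ((\<bar>B\<bar> * C) * norm (?f x)) powr p" using p by (intro powr_mono2) auto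
      also have "\<dots> = (\<bar>B\<bar> * C) powr p * norm (?f x) powr p" by (rule powr_mult)
      finally show "norm (norm (pr (c x) (?f x)) powr p) \<le> norm ((\<bar>B\<bar> * C) powr p * norm (?f x) powr p)" by simp
    qed
  qed
  then show "integrable lborel (\<lambda>x. norm (indicator S x *\<^sub>R pr (c x) (f x)) powr p)" by (simp only: fun_cong[OF e])
qed

lemma Lp_on_const:
  assumes p: "p > 0" and S: "S \<in> sets borel" "emeasure lborel S < \<infinity>"
  shows "Lp_on p S (\<lambda>x. c)"
proof -
  have "integrable lborel (\<lambda>x. norm c powr p * indicat_real S x)"
    using S by (intro integrable_mult_right integrable_real_indicator) auto
  moreover have "(\<lambda>x. norm (indicator S x *\<^sub>R c) powr p) = (\<lambda>x. norm c powr p * indicat_real S x)"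
    using p by (auto simp: indicator_def fun_eq_iff)
  ultimately show ?thesis unfolding Lp_on_eq[OF p] using S by auto
qed

text \<open>
  The product rule. To test \<open>(u - c) \<eta>\<close> with \<open>f\<close> is to test \<open>u - c\<close> with \<open>\<eta> f\<close>, up to a term in which \<open>\<eta>\<close> is
  differentiated.
\<close>

lemma W1p_cutoff:
  fixes u \<eta> :: "'b::euclidean_space \<Rightarrow> real"
  assumes p: "p > 0" and S: "open S" "emeasure lborel S < \<infinity>" and w: "W1p p S u G"
    and \<eta>: "C1_grad \<eta> D\<eta> UNIV" and B: "\<And>x. \<bar>\<eta> x\<bar> \<le> B" "\<And>x. norm (D\<eta> x) \<le> B"
  shows "W1p p S (\<lambda>x. (u x - c) * \<eta> x) (\<lambda>x. \<eta> x *\<^sub>R G x + (u x - c) *\<^sub>R D\<eta> x)"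
proof -
  have u: "Lp_on p S u" and G: "Lp_on p S G" and wg: "weak_gradient S u G" using w by (auto simp: W1p_def)
  have mS: "S \<in> sets borel" using S by auto
  have c\<eta>: "continuous_on UNIV \<eta>" and cD: "continuous_on UNIV D\<eta>"
    using C1_grad_continuous[OF \<eta>] C1_grad_continuous_D[OF \<eta>] by auto
  have uc: "Lp_on p S (\<lambda>x. u x - c)"
    using Lp_on_add[OF p u Lp_on_const[OF p mS S(2), of "-c"]] by simp
  have 1: "Lp_on p S (\<lambda>x. (u x - c) * \<eta> x)"
    using Lp_on_bilinear_bounded[OF bounded_bilinear_mult p uc c\<eta>, of B] B by (simp add: mult.commute)
  have 2: "Lp_on p S (\<lambda>x. \<eta> x *\<^sub>R G x + (u x - c) *\<^sub>R D\<eta> x)"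
    by (intro Lp_on_add[OF p] Lp_on_bilinear_bounded[OF bounded_bilinear_scaleR p G c\<eta>, of B]
        Lp_on_bilinear_bounded[OF bounded_bilinear.flip[OF bounded_bilinear_scaleR] p uc cD, of B]) (use B in auto)
  have 3: "weak_gradient S (\<lambda>x. (u x - c) * \<eta> x) (\<lambda>x. \<eta> x *\<^sub>R G x + (u x - c) *\<^sub>R D\<eta> x)"
  proof (rule weak_gradientI[OF S(1)])
    fix K assume K: "compact K" "K \<subseteq> S"
    have ui: "set_integrable lborel K u" "set_integrable lborel K G" using wg K by (auto simp: weak_gradient_def)
    have ci: "set_integrable lborel K (\<lambda>x. c)"
      unfolding set_integrable_def by (rule borel_integrable_compact[OF K(1)]) auto
    note uci = set_integral_diff(1)[OF ui(1) ci]
    have "set_integrable lborel K (\<lambda>x. \<eta> x * (u x - c))"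
      by (rule set_integrable_mult_continuous_compact[OF uci K(1) order_refl continuous_on_subset[OF c\<eta>]]) auto
    moreover have "set_integrable lborel K (\<lambda>x. \<eta> x *\<^sub>R G x + (u x - c) *\<^sub>R D\<eta> x)"
      by (intro set_integral_add(1) set_integrable_scaleR_continuous_compact[OF ui(2) K(1) order_refl continuous_on_subset[OF c\<eta>]]
        set_integrable_bilinear_continuous_compact[OF bounded_bilinear.flip[OF bounded_bilinear_scaleR] uci K(1) order_refl continuous_on_subset[OF cD]]) auto
    ultimately show "set_integrable lborel K (\<lambda>x. (u x - c) * \<eta> x) \<and>
        set_integrable lborel K (\<lambda>x. \<eta> x *\<^sub>R G x + (u x - c) *\<^sub>R D\<eta> x)"
      by (simp add: mult.commute)
  next
    fix f :: "'b \<Rightarrow> real" and D K b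
    assume f: "C1_grad f D UNIV" and K: "compact K" "K \<subseteq> S" and f0: "\<And>x. x \<notin> K \<Longrightarrow> f x = 0"
      and D0: "\<And>x. x \<notin> K \<Longrightarrow> D x = 0" and b: "(b :: 'b) \<in> Basis"
    have ui: "set_integrable lborel K u" "set_integrable lborel K G" using wg K by (auto simp: weak_gradient_def)
    have ci: "set_integrable lborel K (\<lambda>x. c)"
      unfolding set_integrable_def by (rule borel_integrable_compact[OF K(1)]) auto
    note uci = set_integral_diff(1)[OF ui(1) ci]
    define E where "E x = \<eta> x *\<^sub>R D x + f x *\<^sub>R D\<eta> x" for x
    have E: "C1_grad (\<lambda>x. \<eta> x * f x) E T" for T
      unfolding E_def by (rule C1_grad_subset[OF C1_grad_mult[OF \<eta> f]]) auto
    have E0: "E x = 0" if "x \<notin> K" for x using f0[OF that] D0[OF that] by (simp add: E_def)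
    have cE: "continuous_on T (\<lambda>x. E x \<bullet> b)" for T
      using C1_grad_continuous_D[OF E, of T] by (intro continuous_intros)
    have t: "(LBINT x:S. u x * (E x \<bullet> b)) = - (LBINT x:S. (G x \<bullet> b) * (\<eta> x * f x))"
      by (rule weak_gradient_test[OF wg S(1) E K _ b]) (simp add: f0)
    have "integral\<^sup>L lborel (\<lambda>x. E x \<bullet> b) = 0"
      by (rule integral_derivative_compact_support[OF E K(1) _ E0]) (simp add: f0)
    moreover have "(\<lambda>x. indicat_real S x *\<^sub>R (E x \<bullet> b)) = (\<lambda>x. E x \<bullet> b)"
    proof
      fix x show "indicat_real S x *\<^sub>R (E x \<bullet> b) = E x \<bullet> b" using E0[of x] K(2) by (cases "x \<in> K") auto
    qed
    ultimately have z: "(LBINT x:S. E x \<bullet> b) = 0" by (simp add: set_lebesgue_integral_def)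
    have i1: "set_integrable lborel S (\<lambda>x. (E x \<bullet> b) * u x)"
      by (rule set_integrable_mult_continuous_compact[OF ui(1) K cE]) (simp add: E0)
    have i2: "set_integrable lborel S (\<lambda>x. (E x \<bullet> b) * c)"
      by (rule set_integrable_mult_continuous_compact[OF ci K cE]) (simp add: E0)
    have i3: "set_integrable lborel S (\<lambda>x. (f x * (D\<eta> x \<bullet> b)) * (u x - c))"
      by (rule set_integrable_mult_continuous_compact[OF uci K])
        (auto simp: f0 intro!: continuous_intros C1_grad_continuous_D[OF C1_grad_subset[OF \<eta>]] C1_grad_continuous[OF C1_grad_subset[OF f]])
    have i4: "set_integrable lborel S (\<lambda>x. (\<eta> x * f x) * (G x \<bullet> b))"
      by (rule set_integrable_mult_continuous_compact[OF set_integrable_bounded_linear[OF bounded_linear_inner_left ui(2)] K C1_grad_continuous[OF E]])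
        (auto simp: f0)
    have "(LBINT x:S. (u x - c) * \<eta> x * (D x \<bullet> b)) = (LBINT x:S. ((E x \<bullet> b) * u x - (E x \<bullet> b) * c) - (f x * (D\<eta> x \<bullet> b)) * (u x - c))"
      by (rule set_lebesgue_integral_cong) (use mS in \<open>auto simp: E_def inner_add_left algebra_simps\<close>)
    also have "\<dots> = (LBINT x:S. (E x \<bullet> b) * u x) - (LBINT x:S. (E x \<bullet> b) * c) - (LBINT x:S. (f x * (D\<eta> x \<bullet> b)) * (u x - c))"
      using i1 i2 i3 by (simp add: set_integral_diff)
    also have "\<dots> = - (LBINT x:S. (\<eta> x * f x) * (G x \<bullet> b)) - (LBINT x:S. (f x * (D\<eta> x \<bullet> b)) * (u x - c))"
      using t z by (simp add: mult.commute)
    also have "\<dots> = - (LBINT x:S. (\<eta> x * f x) * (G x \<bullet> b) + (f x * (D\<eta> x \<bullet> b)) * (u x - c))"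
      using i3 i4 by (simp add: set_integral_add)
    also have "\<dots> = - (LBINT x:S. ((\<eta> x *\<^sub>R G x + (u x - c) *\<^sub>R D\<eta> x) \<bullet> b) * f x)"
      by (intro arg_cong[where f = uminus] set_lebesgue_integral_cong) (use mS in \<open>auto simp: inner_add_left algebra_simps\<close>)
    finally show "(LBINT x:S. (u x - c) * \<eta> x * (D x \<bullet> b)) = - (LBINT x:S. ((\<eta> x *\<^sub>R G x + (u x - c) *\<^sub>R D\<eta> x) \<bullet> b) * f x)" .
  qed
  show ?thesis unfolding W1p_def using 1 2 3 by simp
qed

section \<open>The Caccioppoli inequality\<close>

text \<open>
  The cutoff depends on \<open>x'\<close> only, so it need not vanish on the upper and lower faces of the neck.
\<close>

definition bump :: "'a::euclidean_space \<Rightarrow> real \<Rightarrow> 'a \<times> real \<Rightarrow> real" where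
  "bump c \<rho> x = max 0 (1 - (norm (fst x - c) / \<rho>)\<^sup>2)"

text \<open>
  Young's inequality with the exponents \<open>p\<close> and \<open>p / (p - 1)\<close>. The power \<open>t\<^sup>n\<close> on the right needs
  \<open>(n - 1) p / (p - 1) \<ge> n\<close>, which is \<open>n \<ge> p\<close>.
\<close>

lemma caccioppoli_young:
  fixes X A t p :: real
  assumes p: "p > 1" and n: "real n \<ge> p" "n \<ge> 1" and X: "X \<ge> 0" and A: "A \<ge> 0" and t: "0 \<le> t" "t \<le> 1"
  shows "X powr (p - 1) * (A * t ^ (n - 1)) \<le> (p - 1) / p * (X powr p * t ^ n) + A powr p / p"
proof (cases "t = 0")
  case True
  have "n \<noteq> 1" using n p by auto
  then have z: "X powr (p - 1) * (A * t ^ (n - 1)) = 0" using True n by (simp add: power_0_left)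
  show ?thesis unfolding z using p t by (intro add_nonneg_nonneg mult_nonneg_nonneg divide_nonneg_nonneg) auto
next
  case False
  then have t0: "t > 0" using t by simp
  define q where "q = p / (p - 1)"
  have q: "q > 1" "1 / p + 1 / q = 1" using p by (auto simp: q_def field_simps)
  let ?b = "X powr (p - 1) * t ^ (n - 1)"
  have "A * ?b \<le> A powr p / p + ?b powr q / q"
    by (rule Youngs_inequality) (use p q A X t in auto)
  also have "?b powr q = (X powr (p - 1)) powr q * (t ^ (n - 1)) powr q" by (rule powr_mult)
  also have "(X powr (p - 1)) powr q = X powr p" using p by (simp add: powr_powr q_def)
  also have "(t ^ (n - 1)) powr q = t powr (real (n - 1) * q)"
    using t0 by (simp add: powr_realpow[symmetric] powr_powr)
  also have "X powr p * t powr (real (n - 1) * q) / q \<le> X powr p * t ^ n / q"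
  proof (intro divide_right_mono mult_left_mono)
    have "real n \<le> real (n - 1) * q"
    proof -
      have "real n * (p - 1) \<le> (real n - 1) * p" using n by (simp add: algebra_simps)
      then show ?thesis using p n by (simp add: q_def field_simps of_nat_diff)
    qed
    then have "t powr (real (n - 1) * q) \<le> t powr real n" using t0 t by (intro powr_mono') auto
    then show "t powr (real (n - 1) * q) \<le> t ^ n" using t0 by (simp add: powr_realpow)
  qed (use q in auto)
  finally have "A * ?b \<le> A powr p / p + X powr p * t ^ n / q" by simp
  moreover have "X powr p * t ^ n / q = (p - 1) / p * (X powr p * t ^ n)" using p by (simp add: q_def)
  moreover have "X powr (p - 1) * (A * t ^ (n - 1)) = A * ?b" by (simp only: mult_ac)
  ultimately show ?thesis by linarith
qed

lemma bump_gradient: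
  fixes c :: "'a::euclidean_space"
  assumes \<rho>: "\<rho> > 0" and n: "n \<ge> 2"
  obtains D where "C1_grad (\<lambda>x. bump c \<rho> x ^ n) D UNIV"
    "\<And>x. norm (D x) \<le> (2 * real n / \<rho>) * bump c \<rho> x ^ (n - 1)"
proof -
  define s where "s x = 1 - (1 / \<rho>\<^sup>2) * ((fst x - c) \<bullet> (fst x - c))" for x :: "'a \<times> real"
  define Ds where "Ds x = (- (2 / \<rho>\<^sup>2) *\<^sub>R (fst x - c), 0::real)" for x :: "'a \<times> real"
  have Cs: "C1_grad s Ds UNIV"
    unfolding C1_grad_def
  proof (intro conjI ballI)
    fix x :: "'a \<times> real"
    have "((\<lambda>x. (fst x - c) \<bullet> (fst x - c)) has_derivative (\<lambda>h. (fst x - c) \<bullet> fst h + fst h \<bullet> (fst x - c))) (at x)"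
      by (auto intro!: derivative_eq_intros)
    from has_derivative_diff[OF has_derivative_const[of 1] has_derivative_mult_right[OF this, of "1 / \<rho>\<^sup>2"]]
    show "(s has_derivative (\<lambda>h. Ds x \<bullet> h)) (at x)"
      by (simp add: s_def[abs_def] Ds_def inner_prod_def inner_commute)
    show "continuous_on UNIV Ds" unfolding Ds_def by (intro continuous_intros)
  qed
  have bs: "bump c \<rho> x = max 0 (s x)" for x
    by (simp add: bump_def s_def power_divide power2_norm_eq_inner)
  define D where "D x = (real n * max 0 (s x) ^ (n - 1)) *\<^sub>R Ds x" for x
  have "C1_grad (\<lambda>x. max 0 (s x) ^ n) D UNIV" unfolding D_def
    by (rule C1_grad_compose_real[OF Cs UNIV_I has_real_derivative_pos_part_power[OF n]])
      (intro continuous_intros)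
  moreover have "norm (D x) \<le> (2 * real n / \<rho>) * bump c \<rho> x ^ (n - 1)" for x
  proof (cases "s x > 0")
    case True
    have "(norm (fst x - c))\<^sup>2 < \<rho>\<^sup>2"
      using True \<rho> by (simp add: s_def power2_norm_eq_inner field_simps)
    then have "norm (fst x - c) < \<rho>" using \<rho> by (simp add: power2_less_imp_less)
    then have "2 / \<rho>\<^sup>2 * norm (fst x - c) \<le> 2 / \<rho>\<^sup>2 * \<rho>" using \<rho> by (intro mult_left_mono) auto
    also have "\<dots> = 2 / \<rho>" using \<rho> by (simp add: power2_eq_square)
    finally have "norm (Ds x) \<le> 2 / \<rho>" using \<rho> by (simp add: Ds_def)
    then have "real n * max 0 (s x) ^ (n - 1) * norm (Ds x) \<le> real n * max 0 (s x) ^ (n - 1) * (2 / \<rho>)"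
      by (intro mult_left_mono) auto
    then show ?thesis by (simp add: D_def bs abs_mult mult_ac)
  next
    case False
    then have z: "max 0 (s x) ^ (n - 1) = 0" using n by (simp add: power_0_left max_def)
    show ?thesis unfolding D_def bs z by simp
  qed
  ultimately show ?thesis using that by (simp add: bs)
qed

lemma bump_bounds: "0 \<le> bump c \<rho> x" "bump c \<rho> x \<le> 1"
  by (auto simp: bump_def)

lemma bump_zero: "\<rho> > 0 \<Longrightarrow> norm (fst x - c) \<ge> \<rho> \<Longrightarrow> bump c \<rho> x = 0"
  using power_mono[of 1 "norm (fst x - c) / \<rho>" 2] by (simp add: bump_def)

lemma bump_half: "\<rho> > 0 \<Longrightarrow> norm (fst x - c) \<le> \<rho> / 2 \<Longrightarrow> bump c \<rho> x \<ge> 3 / 4"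
proof -
  assume "\<rho> > 0" "norm (fst x - c) \<le> \<rho> / 2"
  then have "(norm (fst x - c) / \<rho>)\<^sup>2 \<le> (1 / 2)\<^sup>2" by (intro power_mono) (auto simp: field_simps)
  moreover have "(1 / 2 :: real)\<^sup>2 = 1 / 4" by (simp add: power2_eq_square)
  ultimately show ?thesis unfolding bump_def by (intro max.coboundedI2) linarith
qed

text \<open>
  Test the equation with \<open>(u - c) bump\<^sup>n\<close>, whose gradient is \<open>H\<close>. In the integrand \<open>F\<close> of the equation the term with
  the derivative of the cutoff is absorbed by Young's inequality, so that pointwise
  \<open>|G|\<^sup>p bump\<^sup>n / p \<le> F + A\<^sup>p / p\<close> on the smaller neck, with \<open>A = 2 n M / \<rho>\<close>, and \<open>F\<close> has integral 0.
\<close>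

lemma caccioppoli:
  fixes u :: "'a::euclidean_space \<times> real \<Rightarrow> real"
  assumes p: "p > 1" and n: "real n \<ge> p" "n \<ge> 2" and sol: "p_laplace_solution p R0 g \<epsilon> u G"
    and S: "open (neck g \<epsilon> 0 (2 * R0))" "emeasure lborel (neck g \<epsilon> 0 (2 * R0)) < \<infinity>"
    and \<rho>: "\<rho> > 0" "norm x0 + \<rho> < 2 * R0"
    and uO: "AE x in lborel. x \<in> neck g \<epsilon> x0 \<rho> \<longrightarrow> \<bar>u x - c\<bar> \<le> M" and M: "M \<ge> 0"
    and nO: "open (neck g \<epsilon> x0 \<rho>)"
  shows "(LBINT x:neck g \<epsilon> 0 (2 * R0). norm (G x) powr p * bump x0 \<rho> x ^ n)
       \<le> (2 * real n * M / \<rho>) powr p * measure lborel (neck g \<epsilon> x0 \<rho>)"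
    and "set_integrable lborel (neck g \<epsilon> 0 (2 * R0)) (\<lambda>x. norm (G x) powr p * bump x0 \<rho> x ^ n)"
proof -
  let ?S = "neck g \<epsilon> 0 (2 * R0)" and ?N = "neck g \<epsilon> x0 \<rho>"
  let ?t = "bump x0 \<rho>"
  define A where "A = 2 * real n * M / \<rho>"
  have A0: "A \<ge> 0" using M \<rho> by (simp add: A_def)
  have mS: "?S \<in> sets borel" and mN: "?N \<in> sets borel" using S nO by auto
  have sub: "?N \<subseteq> ?S"
  proof
    fix x assume x: "x \<in> ?N"
    have "norm (fst x) \<le> norm (fst x - x0) + norm x0" using norm_triangle_sub[of "fst x" x0] by simp
    with x \<rho> show "x \<in> ?S" by (auto simp: neck_def)
  qed
  have fN: "emeasure lborel ?N < \<infinity>" using emeasure_mono[OF sub, of lborel] S(2) mS by (simp add: le_less_trans)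
  have w: "W1p p ?S u G" and weq: "\<And>\<phi> H. W1p p ?S \<phi> H \<Longrightarrow>
        (\<exists>t<2 * R0. AE x in lborel. x \<in> ?S \<longrightarrow> t \<le> norm (fst x) \<longrightarrow> \<phi> x = 0) \<Longrightarrow>
        (LBINT x:?S. norm (G x) powr (p - 2) * (G x \<bullet> H x)) = 0"
    using sol unfolding p_laplace_solution_def by auto
  obtain D where D: "C1_grad (\<lambda>x. ?t x ^ n) D UNIV" "\<And>x. norm (D x) \<le> (2 * real n / \<rho>) * ?t x ^ (n - 1)"
    using bump_gradient[OF \<rho>(1) n(2)] by metis
  have t1: "?t x ^ k \<le> 1" "0 \<le> ?t x ^ k" for x k using bump_bounds[of x0 \<rho> x] by (auto intro: power_le_one)
  have D0: "norm (D x) \<le> max 1 (2 * real n / \<rho>)" for x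
  proof -
    have "(2 * real n / \<rho>) * ?t x ^ (n - 1) \<le> (2 * real n / \<rho>) * 1" using \<rho> by (intro mult_left_mono t1) auto
    with D(2)[of x] show ?thesis by simp
  qed
  define H where "H x = ?t x ^ n *\<^sub>R G x + (u x - c) *\<^sub>R D x" for x
  have WH: "W1p p ?S (\<lambda>x. (u x - c) * ?t x ^ n) H" unfolding H_def
    by (rule W1p_cutoff[OF _ S w D(1) _ D0]) (use p t1 in \<open>auto intro: max.coboundedI1\<close>)
  have eq0: "(LBINT x:?S. norm (G x) powr (p - 2) * (G x \<bullet> H x)) = 0"
  proof (rule weq[OF WH], intro exI conjI)
    show "norm x0 + \<rho> < 2 * R0" by (rule \<rho>)
    show "AE x in lborel. x \<in> ?S \<longrightarrow> norm x0 + \<rho> \<le> norm (fst x) \<longrightarrow> (u x - c) * ?t x ^ n = 0"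
    proof (intro AE_I2 impI)
      fix x :: "'a \<times> real" assume "norm x0 + \<rho> \<le> norm (fst x)"
      then have "norm (fst x - x0) \<ge> \<rho>" using norm_triangle_sub[of "fst x" x0] by simp
      from bump_zero[OF \<rho>(1) this] show "(u x - c) * ?t x ^ n = 0" using n by simp
    qed
  qed
  have LG: "Lp_on p ?S G" and LH: "Lp_on p ?S H" using w WH by (auto simp: W1p_def)
  let ?I = "\<lambda>x. indicat_real ?S x"
  have p0: "p > 0" using p by simp
  have mG: "(\<lambda>x. ?I x *\<^sub>R G x) \<in> borel_measurable lborel" and mH: "(\<lambda>x. ?I x *\<^sub>R H x) \<in> borel_measurable lborel"
    and iG: "integrable lborel (\<lambda>x. norm (?I x *\<^sub>R G x) powr p)" and iH: "integrable lborel (\<lambda>x. norm (?I x *\<^sub>R H x) powr p)"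
    using LG LH by (auto simp: Lp_on_eq[OF p0] simp del: norm_scaleR)
  have mt: "?t \<in> borel_measurable lborel"
    unfolding bump_def using \<rho>(1) by (auto intro!: borel_measurable_continuous_onI continuous_intros)
  define F where "F x = norm (?I x *\<^sub>R G x) powr (p - 2) * ((?I x *\<^sub>R G x) \<bullet> (?I x *\<^sub>R H x))" for x
  have F_eq: "?I x *\<^sub>R (norm (G x) powr (p - 2) * (G x \<bullet> H x)) = F x" for x
    by (cases "x \<in> ?S") (auto simp: F_def)
  have iF: "integrable lborel F"
  proof (rule Bochner_Integration.integrable_bound)
    show "integrable lborel (\<lambda>x. norm (?I x *\<^sub>R G x) powr p + norm (?I x *\<^sub>R H x) powr p)" using iG iH by (rule Bochner_Integration.integrable_add)
    show "F \<in> borel_measurable lborel" unfolding F_def using mG mH by measurable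
    show "AE x in lborel. norm (F x) \<le> norm (norm (?I x *\<^sub>R G x) powr p + norm (?I x *\<^sub>R H x) powr p)"
    proof (rule AE_I2)
      fix x
      define X where "X = norm (?I x *\<^sub>R G x)"
      define Y where "Y = norm (?I x *\<^sub>R H x)"
      have "norm (F x) \<le> X powr (p - 2) * (X * Y)"
        unfolding F_def X_def Y_def real_norm_def abs_mult abs_of_nonneg[OF powr_ge_zero]
        by (intro mult_left_mono Cauchy_Schwarz_ineq2 powr_ge_zero)
      also have "\<dots> = X powr (p - 1) * (Y * 1 ^ (n - 1))"
        using powr_add[of X "p - 2" 1] by (cases "X = 0") (auto simp: X_def)
      also have "\<dots> \<le> (p - 1) / p * (X powr p * 1 ^ n) + Y powr p / p"
        by (rule caccioppoli_young) (use p n in \<open>auto simp: X_def Y_def\<close>)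
      also have "\<dots> \<le> 1 * X powr p + Y powr p"
        using p mult_right_mono[of 1 p "Y powr p"] by (intro add_mono) (auto simp: field_simps)
      finally show "norm (F x) \<le> norm (X powr p + Y powr p)" by simp
    qed
  qed
  define Z where "Z x = norm (?I x *\<^sub>R G x) powr p * ?t x ^ n" for x
  have Z_eq: "?I x *\<^sub>R (norm (G x) powr p * ?t x ^ n) = Z x" for x
    by (cases "x \<in> ?S") (auto simp: Z_def)
  have iZ: "integrable lborel Z"
  proof (rule Bochner_Integration.integrable_bound[OF iG])
    show "Z \<in> borel_measurable lborel" unfolding Z_def using mG mt by measurable
    show "AE x in lborel. norm (Z x) \<le> norm (norm (?I x *\<^sub>R G x) powr p)"
      using t1 by (intro AE_I2) (auto simp: Z_def abs_mult intro!: mult_left_le)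
  qed
  then show "set_integrable lborel ?S (\<lambda>x. norm (G x) powr p * ?t x ^ n)"
    unfolding set_integrable_def Z_eq .
  have iN: "integrable lborel (\<lambda>x. A powr p / p * indicat_real ?N x)"
    using mN fN by (intro integrable_mult_right integrable_real_indicator) auto
  have pw: "AE x in lborel. Z x / p \<le> F x + A powr p / p * indicat_real ?N x"
    using uO
  proof eventually_elim
    fix x assume ux: "x \<in> ?N \<longrightarrow> \<bar>u x - c\<bar> \<le> M"
    show "Z x / p \<le> F x + A powr p / p * indicat_real ?N x"
    proof (cases "x \<in> ?S")
      case False
      then show ?thesis using p by (simp add: Z_def F_def)
    next
      case xS: True
      define X where "X = norm (G x)"
      have X0: "X \<ge> 0" by (simp add: X_def)
      have XX: "X powr (p - 2) * X\<^sup>2 = X powr p"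
        using powr_add[of X "p - 2" 2] X0 by (cases "X = 0") (auto simp: powr_numeral)
      have F_split: "F x = X powr p * ?t x ^ n + X powr (p - 2) * ((u x - c) * (G x \<bullet> D x))"
        using xS by (simp add: F_def H_def inner_add_right distrib_left X_def[symmetric] power2_norm_eq_inner[symmetric] XX[symmetric] mult_ac)
      show ?thesis
      proof (cases "x \<in> ?N")
        case True
        have "\<bar>X powr (p - 2) * ((u x - c) * (G x \<bullet> D x))\<bar> \<le> X powr (p - 2) * (M * (X * norm (D x)))"
          unfolding abs_mult using ux True M by (intro mult_mono) (auto simp: X_def Cauchy_Schwarz_ineq2)
        also have "\<dots> = X powr (p - 1) * (M * norm (D x))"
          using powr_add[of X "p - 2" 1] X0 by (cases "X = 0") auto
        also have "\<dots> \<le> X powr (p - 1) * (M * ((2 * real n / \<rho>) * ?t x ^ (n - 1)))"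
          using D(2)[of x] M by (intro mult_left_mono) auto
        also have "\<dots> = X powr (p - 1) * (A * ?t x ^ (n - 1))" by (simp add: A_def)
        also have "\<dots> \<le> (p - 1) / p * (X powr p * ?t x ^ n) + A powr p / p"
          by (rule caccioppoli_young) (use p n X0 A0 bump_bounds[of x0 \<rho> x] in auto)
        finally have "F x \<ge> X powr p * ?t x ^ n - ((p - 1) / p * (X powr p * ?t x ^ n) + A powr p / p)"
          unfolding F_split by linarith
        moreover have "X powr p * ?t x ^ n - (p - 1) / p * (X powr p * ?t x ^ n) = Z x / p"
          using xS p by (simp add: Z_def X_def field_simps)
        ultimately show ?thesis using True by simp
      next
        case False
        then have "norm (fst x - x0) \<ge> \<rho>" using xS by (auto simp: neck_def)
        then have t0: "?t x = 0" by (rule bump_zero[OF \<rho>(1)])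
        have "norm (D x) \<le> 0" using D(2)[of x] n t0 by (simp add: power_0_left)
        then have Dz: "D x = 0" by simp
        have tz: "?t x ^ n = 0" using n t0 by simp
        show ?thesis using False unfolding F_split Z_def tz Dz by simp
      qed
    qed
  qed
  have "integral\<^sup>L lborel (\<lambda>x. Z x / p) \<le> integral\<^sup>L lborel (\<lambda>x. F x + A powr p / p * indicat_real ?N x)"
    by (rule integral_mono_AE[OF _ _ pw]) (use iZ iF iN in auto)
  also have "\<dots> = integral\<^sup>L lborel F + A powr p / p * measure lborel ?N"
    using iF iN mN by (subst Bochner_Integration.integral_add) auto
  also have "integral\<^sup>L lborel F = 0"
    using eq0 unfolding set_lebesgue_integral_def F_eq .
  finally have "integral\<^sup>L lborel Z \<le> A powr p * measure lborel ?N"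
    using p by (simp add: field_simps)
  then show "(LBINT x:?S. norm (G x) powr p * ?t x ^ n) \<le> (2 * real n * M / \<rho>) powr p * measure lborel ?N"
    unfolding set_lebesgue_integral_def Z_eq A_def .
qed

section \<open>Campanato's theorem\<close>

lemma le_one_plus_powr: "x \<ge> 0 \<Longrightarrow> p \<ge> 1 \<Longrightarrow> x \<le> 1 + x powr (p::real)"
  using powr_mono[of 1 p x] by (cases "x \<ge> 1") (auto intro: add_increasing2)

lemma set_integrable_of_powr:
  fixes f :: "'b::euclidean_space \<Rightarrow> 'c::euclidean_space"
  assumes m: "f \<in> borel_measurable borel" and B: "B \<in> sets borel" "emeasure lborel B < \<infinity>"
    and i: "set_integrable lborel B (\<lambda>x. norm (f x) powr p)" and p: "p > 1"
  shows "set_integrable lborel B f"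
  unfolding set_integrable_def
proof (rule Bochner_Integration.integrable_bound)
  show "integrable lborel (\<lambda>x. indicat_real B x + indicat_real B x *\<^sub>R norm (f x) powr p)"
    using i B by (intro Bochner_Integration.integrable_add integrable_real_indicator) (auto simp: set_integrable_def)
  show "(\<lambda>x. indicat_real B x *\<^sub>R f x) \<in> borel_measurable lborel" using m B by measurable
  show "AE x in lborel. norm (indicat_real B x *\<^sub>R f x) \<le> norm (indicat_real B x + indicat_real B x *\<^sub>R norm (f x) powr p)"
    using le_one_plus_powr[OF norm_ge_zero, of p] p by (intro AE_I2) (auto simp: indicator_def)
qed

lemma set_integrable_const:
  fixes c :: "'c::euclidean_space"
  assumes "B \<in> sets borel" "emeasure lborel B < \<infinity>"
  shows "set_integrable lborel B (\<lambda>x. c)"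
  unfolding set_integrable_def using assms by (intro integrable_scaleR_left integrable_real_indicator) auto

lemma set_integral_const_lborel:
  fixes c :: "'c::euclidean_space"
  assumes "B \<in> sets borel" "emeasure lborel B < \<infinity>"
  shows "(LBINT x:B. c) = measure lborel B *\<^sub>R c"
  using assms by (subst set_integral_const) auto

text \<open>
  A form of Jensen's inequality.
\<close>

lemma avg_norm_le_Lp_mean:
  fixes f :: "'b::euclidean_space \<Rightarrow> 'c::euclidean_space"
  assumes m: "f \<in> borel_measurable borel" and B: "B \<in> sets borel" "emeasure lborel B < \<infinity>" "measure lborel B > 0"
    and i: "set_integrable lborel B (\<lambda>x. norm (f x) powr p)" and p: "p > 1"
  shows "avg B (\<lambda>x. norm (f x)) \<le> Lp_mean p B f"
proof -
  define V where "V = measure lborel B"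
  define I where "I = avg B (\<lambda>x. norm (f x) powr p)"
  have V: "V > 0" using B by (simp add: V_def)
  have I0: "I \<ge> 0" unfolding I_def avg_def set_lebesgue_integral_def using V by (auto intro!: mult_nonneg_nonneg integral_nonneg_AE)
  have nf: "set_integrable lborel B (\<lambda>x. norm (f x))"
    using set_integrable_of_powr[OF m B(1,2) i p] by (rule set_integrable_norm)
  define q where "q = p / (p - 1)"
  have q: "q > 1" "1 / p + 1 / q = 1" using p by (auto simp: q_def field_simps)
  have L: "avg B (\<lambda>x. norm (f x)) \<le> l * (I / l powr p / p + 1 / q)" if l: "l > 0" for l
  proof -
    have "(LBINT x:B. norm (f x)) \<le> (LBINT x:B. l / l powr p / p * norm (f x) powr p + l / q)"
    proof (rule set_integral_mono[OF nf set_integral_add(1)[OF set_integrable_mult_right[OF i] set_integrable_const[OF B(1,2)]]])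
      fix x
      have "(norm (f x) / l) * 1 \<le> (norm (f x) / l) powr p / p + 1 powr q / q"
        using l p q by (intro Youngs_inequality) auto
      also have "(norm (f x) / l) powr p = norm (f x) powr p / l powr p" by (simp add: powr_divide)
      finally have "norm (f x) \<le> l * (norm (f x) powr p / l powr p / p + 1 / q)"
        using l by (simp add: field_simps)
      then show "norm (f x) \<le> l / l powr p / p * norm (f x) powr p + l / q" by (simp add: algebra_simps)
    qed
    also have "\<dots> = l / l powr p / p * (V * I) + V * (l / q)"
      using V by (subst set_integral_add(2)[OF set_integrable_mult_right[OF i] set_integrable_const[OF B(1,2)]])
        (simp add: set_integral_const_lborel[OF B(1,2)] V_def[symmetric] I_def avg_def)
    finally have "(LBINT x:B. norm (f x)) / V \<le> (l / l powr p / p * (V * I) + V * (l / q)) / V"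
      using V by (intro divide_right_mono) auto
    also have "\<dots> = l * (I / l powr p / p + 1 / q)" using V by (simp add: field_simps)
    finally show ?thesis using V by (simp add: avg_def V_def[symmetric])
  qed
  show ?thesis
  proof (cases "I = 0")
    case True
    have "avg B (\<lambda>x. norm (f x)) \<le> 0 + e" if "e > 0" for e
      using L[of "e * q"] that q True by simp
    then have "avg B (\<lambda>x. norm (f x)) \<le> 0" by (rule field_le_epsilon)
    then show ?thesis by (simp add: Lp_mean_def I_def[symmetric] True)
  next
    case False
    then have "I > 0" using I0 by simp
    then have "(I powr (1 / p)) powr p = I" using p by (simp add: powr_powr)
    then show ?thesis using L[of "I powr (1 / p)"] \<open>I > 0\<close> q by (simp add: Lp_mean_def I_def[symmetric])
  qed
qed

lemma avg_norm_le:
  fixes f :: "'b::euclidean_space \<Rightarrow> 'c::euclidean_space"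
  assumes "measure lborel B > 0"
  shows "norm (avg B f) \<le> avg B (\<lambda>x. norm (f x))"
proof -
  have "norm (set_lebesgue_integral lborel B f) \<le> (LBINT x:B. norm (f x))"
    unfolding set_lebesgue_integral_def using integral_norm_bound[of lborel "\<lambda>x. indicat_real B x *\<^sub>R f x"] by simp
  then show ?thesis using assms by (simp add: avg_def divide_right_mono)
qed

lemma avg_diff_const:
  fixes f :: "'b::euclidean_space \<Rightarrow> 'c::euclidean_space"
  assumes "set_integrable lborel B f" "B \<in> sets borel" "emeasure lborel B < \<infinity>" "measure lborel B > 0"
  shows "avg B (\<lambda>x. f x - c) = avg B f - c"
  using assms by (simp add: avg_def set_integral_diff(2)[OF assms(1) set_integrable_const] set_integral_const_lborel scaleR_diff_right)

lemma ball_measure: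
  fixes x :: "'b::euclidean_space"
  assumes "r > 0"
  shows "ball x r \<in> sets borel" "emeasure lborel (ball x r) < \<infinity>" "measure lborel (ball x r) > 0"
    "measure lborel (ball x r) = unit_ball_vol (real DIM('b)) * r ^ DIM('b)"
  using assms content_ball[of r x] content_ball_pos[of r x] emeasure_lborel_ball_finite[of x r] by auto

lemma Lp_mean_nonneg: "Lp_mean p B f \<ge> 0" by (simp add: Lp_mean_def)

lemma avg_cong:
  assumes "B \<in> sets lborel" "\<And>x. x \<in> B \<Longrightarrow> f x = g x"
  shows "avg B f = avg B g"
  unfolding avg_def using assms set_lebesgue_integral_cong[of B lborel f g] by auto

lemma mean_osc_cong:
  assumes "B \<in> sets lborel" "\<And>x. x \<in> B \<Longrightarrow> f x = g x"
  shows "mean_osc p B f = mean_osc p B g"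
  unfolding mean_osc_def Lp_mean_def
  by (rule arg_cong[where f = "\<lambda>a. a powr (1 / p)"], rule avg_cong[OF assms(1)]) (simp add: assms(2) avg_cong[OF assms])

text \<open>
  The centres of the balls range over \<open>ball z r\<close> while the radii go up to \<open>r\<close>, so that the decay starts from the
  same radius at every centre.
\<close>

locale campanato =
  fixes g :: "'a::euclidean_space \<Rightarrow> 'b::euclidean_space" and p \<alpha> C r :: real and z :: 'a
  assumes m: "g \<in> borel_measurable borel" and i: "integrable lborel (\<lambda>x. norm (g x) powr p)" and p: "p > 1"
    and r: "r > 0" and \<alpha>: "\<alpha> > 0" and C: "C \<ge> 0"
    and decay: "\<And>x \<rho>. x \<in> ball z r \<Longrightarrow> 0 < \<rho> \<Longrightarrow> \<rho> \<le> r \<Longrightarrow> 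
      mean_osc p (ball x \<rho>) g \<le> C * (\<rho> / r) powr \<alpha> * mean_osc p (ball x r) g"
begin

definition "rk k = r / 2 ^ k"

definition "A k x = avg (ball x (rk k)) g"

lemma rk: "rk k > 0" "rk k \<le> r" "rk (Suc k) = rk k / 2"
  using r by (auto simp: rk_def field_simps)

lemma ip: "B \<in> sets borel \<Longrightarrow> set_integrable lborel B (\<lambda>x. norm (g x) powr p)"
  using integrable_mult_indicator[OF _ i] unfolding set_integrable_def by simp

lemma ig: "0 < \<rho> \<Longrightarrow> set_integrable lborel (ball x \<rho>) g"
  using ball_measure by (intro set_integrable_of_powr[OF m _ _ ip p]) auto

lemma powr_diff_integrable:
  assumes \<rho>: "0 < \<rho>"
  shows "set_integrable lborel (ball x \<rho>) (\<lambda>y. norm (g y - c) powr p)"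
    and "avg (ball x \<rho>) (\<lambda>y. norm (g y - c) powr p) \<le> 2 powr p * (avg (ball x \<rho>) (\<lambda>y. norm (g y) powr p) + norm c powr p)"
proof -
  let ?B = "ball x \<rho>"
  note B = ball_measure[OF \<rho>, of x]
  have j: "set_integrable lborel ?B (\<lambda>y. 2 powr p * (norm (g y) powr p + norm c powr p))"
    by (intro set_integrable_mult_right set_integral_add(1) ip set_integrable_const B(1,2))
  have le: "norm (g y - c) powr p \<le> 2 powr p * (norm (g y) powr p + norm c powr p)" for y
  proof -
    have "norm (g y - c) powr p \<le> (norm (g y) + norm c) powr p" using p by (intro powr_mono2 norm_triangle_ineq4) auto
    also have "\<dots> \<le> 2 powr p * (norm (g y) powr p + norm c powr p)" by (rule powr_add_le) (use p in auto)
    finally show ?thesis .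
  qed
  show k: "set_integrable lborel ?B (\<lambda>y. norm (g y - c) powr p)"
  proof (rule set_integrable_bound[OF j])
    show "set_borel_measurable lborel ?B (\<lambda>y. norm (g y - c) powr p)"
      unfolding set_borel_measurable_def using m B(1) by measurable
    show "AE y in lborel. y \<in> ?B \<longrightarrow> norm (norm (g y - c) powr p) \<le> norm (2 powr p * (norm (g y) powr p + norm c powr p))"
      using le by (intro AE_I2) auto
  qed
  have "(LBINT y:?B. norm (g y - c) powr p) \<le> (LBINT y:?B. 2 powr p * (norm (g y) powr p + norm c powr p))"
    by (rule set_integral_mono[OF k j]) (rule le)
  also have "\<dots> = 2 powr p * ((LBINT y:?B. norm (g y) powr p) + measure lborel ?B * norm c powr p)"
    by (simp add: set_integral_add(2)[OF ip[OF B(1)] set_integrable_const[OF B(1,2)]] set_integral_const_lborel[OF B(1,2)])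
  finally have "(LBINT y:?B. norm (g y - c) powr p) / measure lborel ?B \<le>
     2 powr p * ((LBINT y:?B. norm (g y) powr p) + measure lborel ?B * norm c powr p) / measure lborel ?B"
    using B(3) by (intro divide_right_mono) auto
  also have "\<dots> = 2 powr p * ((LBINT y:?B. norm (g y) powr p) / measure lborel ?B + norm c powr p)"
    using B(3) by (simp add: field_simps)
  finally show "avg ?B (\<lambda>y. norm (g y - c) powr p) \<le> 2 powr p * (avg ?B (\<lambda>y. norm (g y) powr p) + norm c powr p)"
    by (simp add: avg_def)
qed

lemma mean_osc_bound:
  obtains W where "W \<ge> 0" "\<And>x. mean_osc p (ball x r) g \<le> W"
proof -
  define V where "V = unit_ball_vol (real DIM('a)) * r ^ DIM('a)"
  define I where "I = integral\<^sup>L lborel (\<lambda>x. norm (g x) powr p)"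
  have V: "V > 0" using ball_measure(3,4)[OF r, of 0] by (simp add: V_def)
  have "mean_osc p (ball x r) g \<le> (2 powr p * (I / V + I / V)) powr (1 / p)" for x
  proof -
    let ?B = "ball x r"
    note B = ball_measure[OF r, of x]
    have "(LBINT y:?B. norm (g y) powr p) \<le> I"
      unfolding I_def set_lebesgue_integral_def
      by (rule integral_mono[OF ip[OF B(1), unfolded set_integrable_def] i]) (auto simp: indicator_def)
    then have a: "avg ?B (\<lambda>y. norm (g y) powr p) \<le> I / V"
      using V B(4) by (simp add: avg_def V_def divide_right_mono)
    have "norm (avg ?B g) \<le> Lp_mean p ?B g"
      using avg_norm_le[OF B(3), of g] avg_norm_le_Lp_mean[OF m B(1,2,3) ip[OF B(1)] p] by linarith
    then have "norm (avg ?B g) powr p \<le> Lp_mean p ?B g powr p" using p by (intro powr_mono2) auto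
    also have "\<dots> = avg ?B (\<lambda>y. norm (g y) powr p)"
    proof -
      have "avg ?B (\<lambda>y. norm (g y) powr p) \<ge> 0" unfolding avg_def set_lebesgue_integral_def
        by (auto intro!: mult_nonneg_nonneg integral_nonneg_AE)
      then show ?thesis using p by (simp add: Lp_mean_def powr_powr)
    qed
    finally have "norm (avg ?B g) powr p \<le> I / V" using a by simp
    with a have "2 powr p * (avg ?B (\<lambda>y. norm (g y) powr p) + norm (avg ?B g) powr p) \<le> 2 powr p * (I / V + I / V)"
      by (intro mult_left_mono add_mono) auto
    with powr_diff_integrable(2)[OF r, of x "avg ?B g"]
    have "avg ?B (\<lambda>y. norm (g y - avg ?B g) powr p) \<le> 2 powr p * (I / V + I / V)" by linarith
    moreover have "avg ?B (\<lambda>y. norm (g y - avg ?B g) powr p) \<ge> 0" unfolding avg_def set_lebesgue_integral_def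
      by (auto intro!: mult_nonneg_nonneg integral_nonneg_AE)
    ultimately show ?thesis using p unfolding mean_osc_def Lp_mean_def by (intro powr_mono2) auto
  qed
  then show ?thesis by (rule that[rotated]) simp
qed

lemma avg_deviation:
  obtains W where "W \<ge> 0"
    "\<And>x k. x \<in> ball z r \<Longrightarrow> avg (ball x (rk k)) (\<lambda>y. norm (g y - A k x)) \<le> W * (1 / 2 powr \<alpha>) ^ k"
proof -
  obtain W where W: "W \<ge> 0" "\<And>x. mean_osc p (ball x r) g \<le> W" using mean_osc_bound by metis
  have "avg (ball x (rk k)) (\<lambda>y. norm (g y - A k x)) \<le> C * W * (1 / 2 powr \<alpha>) ^ k" if x: "x \<in> ball z r" for x k
  proof -
    note B = ball_measure[OF rk(1)[of k], of x]
    have "avg (ball x (rk k)) (\<lambda>y. norm (g y - A k x)) \<le> mean_osc p (ball x (rk k)) g"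
      unfolding mean_osc_def A_def[symmetric]
      by (rule avg_norm_le_Lp_mean[OF _ B(1,2,3) powr_diff_integrable(1)[OF rk(1)] p]) (use m in measurable)
    also have "\<dots> \<le> C * (rk k / r) powr \<alpha> * mean_osc p (ball x r) g" by (rule decay[OF x rk(1,2)])
    also have "\<dots> \<le> C * (rk k / r) powr \<alpha> * W" using C by (intro mult_left_mono W) auto
    also have "(rk k / r) powr \<alpha> = (1 / 2 powr \<alpha>) ^ k"
    proof -
      have "rk k / r = 1 / 2 powr real k" using r by (simp add: rk_def powr_realpow)
      then have "(rk k / r) powr \<alpha> = 1 / 2 powr (\<alpha> * real k)" by (simp add: powr_divide powr_powr mult.commute)
      also have "\<dots> = (1 / 2 powr \<alpha>) ^ k" by (simp add: powr_powr[symmetric] powr_realpow power_one_over)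
      finally show ?thesis .
    qed
    finally show ?thesis by (simp add: mult_ac)
  qed
  then show ?thesis using that[of "C * W"] C W by auto
qed

text \<open>
  The ball of radius \<open>r / 2\<^bsup>k+1\<^esup>\<close> fills a fixed fraction of the ball of radius \<open>r / 2\<^sup>k\<close>, so the difference
  of the two averages is controlled by the mean deviation over the larger ball. Hence the \<open>A k\<close> form a uniform
  Cauchy sequence.
\<close>

lemma A_step:
  obtains W where "W \<ge> 0" "\<And>x k. x \<in> ball z r \<Longrightarrow> norm (A (Suc k) x - A k x) \<le> W * (1 / 2 powr \<alpha>) ^ k"
proof -
  obtain W where W: "W \<ge> 0"
    "\<And>x k. x \<in> ball z r \<Longrightarrow> avg (ball x (rk k)) (\<lambda>y. norm (g y - A k x)) \<le> W * (1 / 2 powr \<alpha>) ^ k"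
    using avg_deviation by metis
  have "norm (A (Suc k) x - A k x) \<le> (2 ^ DIM('a) * W) * (1 / 2 powr \<alpha>) ^ k" if x: "x \<in> ball z r" for x k
  proof -
    let ?b = "ball x (rk (Suc k))" and ?B = "ball x (rk k)"
    note b = ball_measure[OF rk(1)[of "Suc k"], of x] and B = ball_measure[OF rk(1)[of k], of x]
    have i1: "set_integrable lborel ?B (\<lambda>y. norm (g y - A k x))"
      by (intro set_integrable_norm set_integral_diff(1) ig rk set_integrable_const B)
    have sub: "?b \<subseteq> ?B" using rk(1)[of k] by (intro subset_ball) (simp add: rk(3))
    have i2: "set_integrable lborel ?b (\<lambda>y. norm (g y - A k x))"
      by (rule set_integrable_subset[OF i1 _ sub]) simp
    have mb: "measure lborel ?B = 2 ^ DIM('a) * measure lborel ?b"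
      unfolding B(4) b(4) by (simp add: rk(3) power_divide)
    have "A (Suc k) x - A k x = avg ?b (\<lambda>y. g y - A k x)"
      unfolding A_def[of "Suc k"] by (rule avg_diff_const[symmetric, OF ig[OF rk(1)] b(1,2,3)])
    then have "norm (A (Suc k) x - A k x) \<le> avg ?b (\<lambda>y. norm (g y - A k x))"
      using avg_norm_le[OF b(3)] by simp
    also have "\<dots> \<le> (1 / measure lborel ?b) * (LBINT y:?B. norm (g y - A k x))"
      unfolding avg_def real_scaleR_def using b(3) unfolding set_lebesgue_integral_def
      by (intro mult_left_mono integral_mono[OF i2[unfolded set_integrable_def] i1[unfolded set_integrable_def]])
        (use sub in \<open>auto simp: indicator_def\<close>)
    also have "\<dots> = 2 ^ DIM('a) * avg ?B (\<lambda>y. norm (g y - A k x))"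
      by (simp add: avg_def mb)
    also have "\<dots> \<le> 2 ^ DIM('a) * (W * (1 / 2 powr \<alpha>) ^ k)" by (intro mult_left_mono W(2) x) auto
    finally show ?thesis by simp
  qed
  then show ?thesis using that[of "2 ^ DIM('a) * W"] W(1) by auto
qed

text \<open>
  Dominated convergence: when the centre moves, the indicator functions of the balls converge off
  the sphere, which is a null set.
\<close>

lemma continuous_A: "continuous_on UNIV (A k)"
proof -
  have "continuous_on UNIV (\<lambda>x. set_lebesgue_integral lborel (ball x (rk k)) g)"
  proof (rule continuous_at_imp_continuous_on, intro ballI)
    fix x
    show "isCont (\<lambda>x. set_lebesgue_integral lborel (ball x (rk k)) g) x"
      unfolding continuous_at_sequentially
    proof (intro allI impI)
      fix X assume X: "X \<longlonglongrightarrow> x"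
      then have "bounded (range X)" by (rule convergent_imp_bounded)
      then obtain R0 where R0: "\<And>n. norm (X n) \<le> R0" by (auto simp: bounded_iff)
      define R where "R = \<bar>R0\<bar> + rk k"
      have R: "R > 0" using rk(1)[of k] by (simp add: R_def)
      have "sphere x (rk k) \<in> null_sets lebesgue" using negligible_sphere[of x "rk k"] by (simp add: negligible_iff_null_sets)
      then have ns: "sphere x (rk k) \<in> null_sets lborel" by (simp add: null_sets_completion_iff)
      have "(\<lambda>n. integral\<^sup>L lborel (\<lambda>y. indicat_real (ball (X n) (rk k)) y *\<^sub>R g y)) \<longlonglongrightarrow> integral\<^sup>L lborel (\<lambda>y. indicat_real (ball x (rk k)) y *\<^sub>R g y)"
      proof (rule integral_dominated_convergence[where w = "\<lambda>y. norm (indicat_real (ball 0 R) y *\<^sub>R g y)"])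
        show "integrable lborel (\<lambda>y. norm (indicat_real (ball 0 R) y *\<^sub>R g y))"
          using ig[OF R, of 0] unfolding set_integrable_def by (rule integrable_norm)
        show "AE y in lborel. (\<lambda>n. indicat_real (ball (X n) (rk k)) y *\<^sub>R g y) \<longlonglongrightarrow> indicat_real (ball x (rk k)) y *\<^sub>R g y"
          using AE_not_in[OF ns]
        proof eventually_elim
          fix y assume y: "y \<notin> sphere x (rk k)"
          have dl: "(\<lambda>n. dist (X n) y) \<longlonglongrightarrow> dist x y" by (intro tendsto_intros X)
          have "eventually (\<lambda>n. indicat_real (ball (X n) (rk k)) y *\<^sub>R g y = indicat_real (ball x (rk k)) y *\<^sub>R g y) sequentially"
          proof (cases "dist x y < rk k")
            case True
            show ?thesis using order_tendstoD(2)[OF dl True] by eventually_elim (use True in \<open>simp add: indicator_def\<close>)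
          next
            case False
            then have gt: "dist x y > rk k" using y by auto
            show ?thesis using order_tendstoD(1)[OF dl gt] by eventually_elim (use False in \<open>simp add: indicator_def\<close>)
          qed
          then show "(\<lambda>n. indicat_real (ball (X n) (rk k)) y *\<^sub>R g y) \<longlonglongrightarrow> indicat_real (ball x (rk k)) y *\<^sub>R g y"
            by (rule tendsto_eventually)
        qed
        show "AE y in lborel. norm (indicat_real (ball (X n) (rk k)) y *\<^sub>R g y) \<le> norm (indicat_real (ball 0 R) y *\<^sub>R g y)" for n
        proof (rule AE_I2)
          fix y
          have "ball (X n) (rk k) \<subseteq> ball 0 R"
          proof
            fix w assume "w \<in> ball (X n) (rk k)"
            then show "w \<in> ball 0 R" using R0[of n] norm_triangle_sub[of w "X n"] by (simp add: R_def dist_norm norm_minus_commute)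
          qed
          then show "norm (indicat_real (ball (X n) (rk k)) y *\<^sub>R g y) \<le> norm (indicat_real (ball 0 R) y *\<^sub>R g y)"
            by (auto simp: indicator_def)
        qed
      qed (use m in \<open>auto intro!: borel_measurable_scaleR borel_measurable_indicator\<close>)
      then show "((\<lambda>x. set_lebesgue_integral lborel (ball x (rk k)) g) \<circ> X) \<longlonglongrightarrow> set_lebesgue_integral lborel (ball x (rk k)) g"
        by (simp add: o_def set_lebesgue_integral_def)
    qed
  qed
  then have "continuous_on UNIV (\<lambda>x. (1 / (unit_ball_vol (real DIM('a)) * rk k ^ DIM('a))) *\<^sub>R set_lebesgue_integral lborel (ball x (rk k)) g)"
    by (rule continuous_on_scaleR[OF continuous_on_const])
  moreover have "A k = (\<lambda>x. (1 / (unit_ball_vol (real DIM('a)) * rk k ^ DIM('a))) *\<^sub>R set_lebesgue_integral lborel (ball x (rk k)) g)"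
    unfolding A_def avg_def ball_measure(4)[OF rk(1)] ..
  ultimately show ?thesis by simp
qed

lemma uniform_limit_A:
  obtains Du where "uniform_limit (ball z r) A Du sequentially" "continuous_on (ball z r) Du"
proof -
  obtain W where W: "W \<ge> 0" "\<And>x k. x \<in> ball z r \<Longrightarrow> norm (A (Suc k) x - A k x) \<le> W * (1 / 2 powr \<alpha>) ^ k"
    using A_step by metis
  have "2 powr \<alpha> > 2 powr 0" using \<alpha> by (intro powr_less_mono) auto
  then have "norm (1 / 2 powr \<alpha>) < 1" by simp
  then have "summable (\<lambda>k. W * (1 / 2 powr \<alpha>) ^ k)" by (intro summable_mult summable_geometric)
  then have u: "uniform_limit (ball z r) (\<lambda>n x. \<Sum>i<n. A (Suc i) x - A i x) (\<lambda>x. \<Sum>i. A (Suc i) x - A i x) sequentially"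
    by (rule Weierstrass_m_test[rotated]) (rule W(2))
  define Du where "Du x = A 0 x + (\<Sum>i. A (Suc i) x - A i x)" for x
  have "uniform_limit (ball z r) (\<lambda>n x. A 0 x + (\<Sum>i<n. A (Suc i) x - A i x)) Du sequentially"
    unfolding Du_def by (intro uniform_limit_add uniform_limit_const u)
  moreover have "(\<lambda>n x. A 0 x + (\<Sum>i<n. A (Suc i) x - A i x)) = A"
  proof (intro ext)
    fix n x show "A 0 x + (\<Sum>i<n. A (Suc i) x - A i x) = A n x"
      by (subst sum_lessThan_telescope[of "\<lambda>i. A i x"]) simp
  qed
  ultimately have l: "uniform_limit (ball z r) A Du sequentially" by simp
  have "continuous_on (ball z r) Du"
    by (rule uniform_limit_theorem[OF _ l])
      (auto intro!: always_eventually continuous_on_subset[OF continuous_A])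
  with l show ?thesis by (rule that)
qed

text \<open>
  Let \<open>h k y\<close> be the average of \<open>|g y - A k x|\<close> over the centres \<open>x\<close> within distance \<open>r / 2\<^sup>k\<close> of \<open>y\<close>. By Fubini the
  integral of \<open>h k\<close> is at most that of the average of \<open>|g - A k x|\<close> over the ball around \<open>x\<close>, which decays
  geometrically. So \<open>liminf h k y = 0\<close> for almost all \<open>y\<close> by Fatou's lemma. On the other hand \<open>A k x\<close> is close to
  \<open>Du x\<close> and hence to \<open>Du y\<close>, and \<open>h k y\<close> stays away from 0 if \<open>Du y\<close> differs from \<open>g y\<close>.
\<close>

lemma AE_limit:
  assumes Du: "uniform_limit (ball z r) A Du sequentially" "continuous_on (ball z r) Du"
  shows "AE y in lborel. y \<in> ball z r \<longrightarrow> Du y = g y"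
proof -
  let ?B = "ball z r"
  define V where "V k = unit_ball_vol (real DIM('a)) * rk k ^ DIM('a)" for k
  have V: "V k > 0" "measure lborel (ball x (rk k)) = V k" for x :: 'a and k
    using ball_measure(3,4)[OF rk(1)[of k], of x] by (auto simp: V_def)
  define Q where "Q k x y = (if x \<in> ?B \<and> dist x y < rk k then norm (g y - A k x) / V k else 0)" for k x y
  have Q0: "Q k x y \<ge> 0" for k x y using V(1)[of k] by (simp add: Q_def)
  have mA: "A k \<in> borel_measurable borel" for k by (rule borel_measurable_continuous_onI[OF continuous_A])
  have mQ: "(\<lambda>(x, y). ennreal (Q k x y)) \<in> borel_measurable (lborel \<Otimes>\<^sub>M lborel)" for k
  proof -
    have o: "open {w :: 'a \<times> 'a. fst w \<in> ?B \<and> dist (fst w) (snd w) < rk k}"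
    proof -
      have "open {w :: 'a \<times> 'a. fst w \<in> ?B}" using open_vimage_fst[OF open_ball] by (simp add: vimage_def)
      moreover have "open {w :: 'a \<times> 'a. dist (fst w) (snd w) < rk k}" by (intro open_Collect_less continuous_intros)
      ultimately show ?thesis by (simp add: Collect_conj_eq open_Int)
    qed
    have [measurable]: "g \<in> borel_measurable borel" "A k \<in> borel_measurable borel" using m mA by auto
    have mset: "{w :: 'a \<times> 'a. fst w \<in> ?B \<and> dist (fst w) (snd w) < rk k} \<in> sets (borel \<Otimes>\<^sub>M borel)"
      using borel_open[OF o] by (simp only: borel_prod)
    have "(\<lambda>w. indicat_real {w. fst w \<in> ?B \<and> dist (fst w) (snd w) < rk k} w * (norm (g (snd w) - A k (fst w)) / V k)) \<in> borel_measurable (borel \<Otimes>\<^sub>M borel)"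
      by (intro borel_measurable_times borel_measurable_indicator mset) measurable
    then have "(\<lambda>w. Q k (fst w) (snd w)) \<in> borel_measurable (borel \<Otimes>\<^sub>M borel)"
      by (rule measurable_cong[THEN iffD1, rotated]) (auto simp: Q_def)
    then have "(\<lambda>w. ennreal (Q k (fst w) (snd w))) \<in> borel_measurable (borel \<Otimes>\<^sub>M borel)" by measurable
    then show ?thesis by (simp add: case_prod_unfold lborel_prod borel_prod)
  qed
  define h where "h k y = (\<integral>\<^sup>+x. ennreal (Q k x y) \<partial>lborel)" for k y
  have mh: "h k \<in> borel_measurable lborel" for k
    unfolding h_def by (rule lborel.borel_measurable_nn_integral) (use measurable_pair_swap[OF mQ[of k]] in \<open>simp add: case_prod_unfold\<close>)
  obtain W where W: "W \<ge> 0" "\<And>x k. x \<in> ?B \<Longrightarrow> avg (ball x (rk k)) (\<lambda>y. norm (g y - A k x)) \<le> W * (1 / 2 powr \<alpha>) ^ k"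
    using avg_deviation by metis
  have hint: "(\<integral>\<^sup>+y. h k y \<partial>lborel) \<le> ennreal (W * (1 / 2 powr \<alpha>) ^ k * measure lborel ?B)" for k
  proof -
    have "(\<integral>\<^sup>+y. h k y \<partial>lborel) = (\<integral>\<^sup>+x. \<integral>\<^sup>+y. ennreal (Q k x y) \<partial>lborel \<partial>lborel)"
      unfolding h_def by (rule lborel_pair.Fubini'[OF mQ])
    also have "\<dots> \<le> (\<integral>\<^sup>+x. ennreal (W * (1 / 2 powr \<alpha>) ^ k) * indicator ?B x \<partial>lborel)"
    proof (rule nn_integral_mono)
      fix x
      show "(\<integral>\<^sup>+y. ennreal (Q k x y) \<partial>lborel) \<le> ennreal (W * (1 / 2 powr \<alpha>) ^ k) * indicator ?B x"
      proof (cases "x \<in> ?B")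
        case False then show ?thesis by (simp add: Q_def)
      next
        case True
        note B = ball_measure[OF rk(1)[of k], of x]
        have i1: "set_integrable lborel (ball x (rk k)) (\<lambda>y. norm (g y - A k x))"
          by (intro set_integrable_norm set_integral_diff(1) ig rk set_integrable_const B)
        have e: "Q k x y = (1 / V k) * (indicat_real (ball x (rk k)) y *\<^sub>R norm (g y - A k x))" for y
          using True by (simp add: Q_def indicator_def)
        have "(\<integral>\<^sup>+y. ennreal (Q k x y) \<partial>lborel) = ennreal (integral\<^sup>L lborel (\<lambda>y. Q k x y))"
        proof (rule nn_integral_eq_integral)
          show "integrable lborel (Q k x)"
            unfolding e[abs_def] using i1 unfolding set_integrable_def by (rule integrable_mult_right)
        qed (use Q0 in auto)
        also have "integral\<^sup>L lborel (\<lambda>y. Q k x y) = avg (ball x (rk k)) (\<lambda>y. norm (g y - A k x))"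
          unfolding e avg_def V(2) set_lebesgue_integral_def by simp
        finally show ?thesis using True W(2)[OF True, of k] by (simp add: ennreal_leI)
      qed
    qed
    also have "\<dots> = ennreal (W * (1 / 2 powr \<alpha>) ^ k) * emeasure lborel ?B"
      by (rule nn_integral_cmult_indicator) simp
    also have "\<dots> = ennreal (W * (1 / 2 powr \<alpha>) ^ k * measure lborel ?B)"
      using ball_measure(2)[OF r, of z] W(1) by (subst emeasure_eq_ennreal_measure) (auto simp: ennreal_mult)
    finally show ?thesis .
  qed
  have "2 powr \<alpha> > 2 powr 0" using \<alpha> by (intro powr_less_mono) auto
  then have "norm (1 / 2 powr \<alpha>) < 1" by simp
  then have "(\<lambda>k. W * (1 / 2 powr \<alpha>) ^ k * measure lborel ?B) \<longlonglongrightarrow> W * 0 * measure lborel ?B"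
    by (intro tendsto_intros LIMSEQ_power_zero)
  then have "(\<lambda>k. ennreal (W * (1 / 2 powr \<alpha>) ^ k * measure lborel ?B)) \<longlonglongrightarrow> ennreal 0"
    by (intro tendsto_ennrealI) simp
  then have l: "liminf (\<lambda>k. ennreal (W * (1 / 2 powr \<alpha>) ^ k * measure lborel ?B)) = 0"
    by (intro lim_imp_Liminf) auto
  have "liminf (\<lambda>k. \<integral>\<^sup>+y. h k y \<partial>lborel) \<le> liminf (\<lambda>k. ennreal (W * (1 / 2 powr \<alpha>) ^ k * measure lborel ?B))"
    by (rule Liminf_mono, rule always_eventually, rule allI, rule hint)
  then have "liminf (\<lambda>k. \<integral>\<^sup>+y. h k y \<partial>lborel) \<le> 0"
    unfolding l .
  then have "(\<integral>\<^sup>+y. liminf (\<lambda>k. h k y) \<partial>lborel) = 0"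
    using nn_integral_liminf[of h lborel, OF mh] by simp
  then have "AE y in lborel. liminf (\<lambda>k. h k y) = 0"
    by (subst (asm) nn_integral_0_iff_AE) (use mh in \<open>auto intro!: borel_measurable_liminf\<close>)
  then show ?thesis
  proof eventually_elim
    fix y assume l0: "liminf (\<lambda>k. h k y) = 0"
    show "y \<in> ?B \<longrightarrow> Du y = g y"
    proof (intro impI, rule ccontr)
      assume y: "y \<in> ?B" and ne: "Du y \<noteq> g y"
      define s where "s = norm (g y - Du y)"
      have s: "s > 0" using ne by (simp add: s_def)
      have "isCont Du y" using Du(2) y by (simp add: continuous_on_eq_continuous_at)
      then obtain d where d: "d > 0" "\<And>x. dist x y < d \<Longrightarrow> dist (Du x) (Du y) < s / 4"
        unfolding continuous_at_eps_delta using s by (metis zero_less_divide_iff zero_less_numeral)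
      obtain d' where d': "d' > 0" "ball y d' \<subseteq> ?B" by (rule openE[OF open_ball y])
      have "(\<lambda>k. r * (1 / 2) ^ k) \<longlonglongrightarrow> r * 0" by (intro tendsto_intros LIMSEQ_power_zero) simp
      moreover have "rk = (\<lambda>k. r * (1 / 2) ^ k)" by (simp add: rk_def fun_eq_iff power_divide)
      ultimately have "rk \<longlonglongrightarrow> 0" by simp
      then have ev1: "eventually (\<lambda>k. rk k < min d d') sequentially"
        using d d' by (intro order_tendstoD(2)) auto
      have ev2: "eventually (\<lambda>k. \<forall>x\<in>?B. dist (A k x) (Du x) < s / 4) sequentially"
        using uniform_limitD[OF Du(1), of "s / 4"] s by simp
      have "eventually (\<lambda>k. ennreal (s / 2) \<le> h k y) sequentially"
        using ev1 ev2
      proof eventually_elim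
        fix k assume k: "rk k < min d d'" "\<forall>x\<in>?B. dist (A k x) (Du x) < s / 4"
        have "ennreal (s / 2) = (\<integral>\<^sup>+x. ennreal (s / 2 / V k) * indicator (ball y (rk k)) x \<partial>lborel)"
        proof -
          have "emeasure lborel (ball y (rk k)) = ennreal (V k)"
            using ball_measure(2)[OF rk(1)[of k], of y] V(2)[of y k] by (subst emeasure_eq_ennreal_measure) auto
          then show ?thesis
            using V(1)[of k] s by (subst nn_integral_cmult_indicator) (auto simp: ennreal_mult[symmetric])
        qed
        also have "\<dots> \<le> h k y"
          unfolding h_def
        proof (rule nn_integral_mono)
          fix x
          show "ennreal (s / 2 / V k) * indicator (ball y (rk k)) x \<le> ennreal (Q k x y)"
          proof (cases "x \<in> ball y (rk k)")
            case True
            then have xy: "dist x y < rk k" by (simp add: dist_commute)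
            then have "x \<in> ball y d'" using k(1) by (simp add: dist_commute)
            then have xB: "x \<in> ?B" using d'(2) by blast
            have "dist (Du x) (Du y) < s / 4" using d(2) xy k(1) by auto
            moreover have "dist (A k x) (Du x) < s / 4" using k(2) xB by auto
            ultimately have "dist (A k x) (Du y) < s / 2" using dist_triangle[of "A k x" "Du y" "Du x"] by linarith
            moreover have "s \<le> norm (g y - A k x) + dist (A k x) (Du y)"
              unfolding s_def using norm_triangle_ineq[of "g y - A k x" "A k x - Du y"] by (simp add: dist_norm)
            ultimately have "s / 2 \<le> norm (g y - A k x)" by linarith
            then have "s / 2 / V k \<le> norm (g y - A k x) / V k" using V(1)[of k] by (intro divide_right_mono) auto
            then have "s / 2 / V k \<le> Q k x y" using xy xB by (simp add: Q_def)
            then show ?thesis using True by (simp add: ennreal_leI)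
          qed simp
        qed
        finally show "ennreal (s / 2) \<le> h k y" .
      qed
      then have "ennreal (s / 2) \<le> liminf (\<lambda>k. h k y)" by (rule Liminf_bounded)
      then show False using l0 s by simp
    qed
  qed
qed

end

text \<open>
  Cover \<open>S\<close> by balls on which the local statement applies. The radii are powers of 1/2, so that the local limits
  are limits of subsequences of one and the same sequence \<open>A\<close> and therefore agree; countably many balls suffice
  for the statement about null sets.
\<close>

lemma campanato_continuous_representative:
  fixes G :: "'b::euclidean_space \<Rightarrow> 'c::euclidean_space"
  assumes S: "open S" "S \<subseteq> N" and N: "open N" and p: "p > 1" and G: "Lp_on p N G" and \<alpha>: "\<alpha> > 0" and C: "C \<ge> 0"
    and decay: "\<And>x r \<rho>. x \<in> S \<Longrightarrow> ball x r \<subseteq> N \<Longrightarrow> 0 < \<rho> \<Longrightarrow> \<rho> \<le> r \<Longrightarrow>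
      mean_osc p (ball x \<rho>) G \<le> C * (\<rho> / r) powr \<alpha> * mean_osc p (ball x r) G"
  obtains Du where "continuous_on S Du" "AE x in lborel. x \<in> S \<longrightarrow> Du x = G x"
proof -
  define g where "g x = indicat_real N x *\<^sub>R G x" for x
  have p0: "p > 0" using p by simp
  have g: "g \<in> borel_measurable borel" "integrable lborel (\<lambda>x. norm (g x) powr p)"
    using G unfolding Lp_on_eq[OF p0] g_def by auto
  define A where "A k x = avg (ball x (1 / 2 ^ k)) g" for k x
  define Du where "Du x = lim (\<lambda>k. A k x)" for x
  have loc: "\<exists>U. open U \<and> z \<in> U \<and> U \<subseteq> S \<and> continuous_on U Du \<and> (AE x in lborel. x \<in> U \<longrightarrow> Du x = g x)" if z: "z \<in> S" for z
  proof -
    obtain d where d: "d > 0" "ball z d \<subseteq> S" using S(1) z open_contains_ball by meson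
    obtain j where j: "(1 / 2 :: real) ^ j < d / 2" using real_arch_pow_inv[of "d / 2" "1 / 2"] d by auto
    define r :: real where "r = 1 / 2 ^ j"
    have rr: "r > 0" "2 * r < d" using j by (auto simp: r_def power_one_over)
    have sub: "ball x r \<subseteq> ball z d" if "x \<in> ball z r" for x
    proof
      fix y assume "y \<in> ball x r"
      then show "y \<in> ball z d" using that rr dist_triangle[of z y x] by auto
    qed
    interpret campanato g p \<alpha> C r z
    proof
      fix x \<rho> :: 'b and \<rho>' :: real assume x: "x \<in> ball z r" and \<rho>: "0 < \<rho>'" "\<rho>' \<le> r"
      have s: "ball x r \<subseteq> N" using sub[OF x] d S by auto
      have "x \<in> S" using centre_in_ball[of x r] sub[OF x] rr(1) d(2) by blast
      then have "mean_osc p (ball x \<rho>') G \<le> C * (\<rho>' / r) powr \<alpha> * mean_osc p (ball x r) G" by (rule decay[OF _ s \<rho>])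
      moreover have "mean_osc p (ball x r) G = mean_osc p (ball x r) g"
        by (rule mean_osc_cong) (use s in \<open>auto simp: g_def indicator_def\<close>)
      moreover have "mean_osc p (ball x \<rho>') G = mean_osc p (ball x \<rho>') g"
        by (rule mean_osc_cong) (use s \<rho> in \<open>auto simp: g_def indicator_def subset_iff\<close>)
      ultimately show "mean_osc p (ball x \<rho>') g \<le> C * (\<rho>' / r) powr \<alpha> * mean_osc p (ball x r) g" by simp
    qed (use g p rr \<alpha> C in auto)
    obtain D where D: "uniform_limit (ball z r) (\<lambda>k x. avg (ball x (rk k)) g) D sequentially" "continuous_on (ball z r) D"
      using uniform_limit_A unfolding A_def[abs_def] by metis
    have DDu: "Du x = D x" if x: "x \<in> ball z r" for x
    proof -
      have "(\<lambda>k. avg (ball x (rk k)) g) \<longlonglongrightarrow> D x" using tendsto_uniform_limitI[OF D(1) x] .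
      moreover have "rk k = 1 / 2 ^ (k + j)" for k unfolding rk_def unfolding r_def by (simp add: power_add mult.commute)
      ultimately have "(\<lambda>k. avg (ball x (1 / 2 ^ (k + j))) g) \<longlonglongrightarrow> D x" by simp
      then have "(\<lambda>k. avg (ball x (1 / 2 ^ k)) g) \<longlonglongrightarrow> D x"
        by (rule LIMSEQ_offset)
      then show ?thesis unfolding Du_def \<open>A \<equiv> \<lambda>k x. avg (ball x (1 / 2 ^ k)) g\<close> by (rule limI)
    qed
    have "AE y in lborel. y \<in> ball z r \<longrightarrow> D y = g y"
      by (rule AE_limit[unfolded A_def[abs_def], OF D])
    then have "AE y in lborel. y \<in> ball z r \<longrightarrow> Du y = g y" by eventually_elim (auto simp: DDu)
    moreover have "continuous_on (ball z r) Du" by (rule continuous_on_eq[OF D(2)]) (simp add: DDu)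
    moreover have "ball z r \<subseteq> S" by (rule order_trans[OF subset_ball d(2)]) (use rr in linarith)
    ultimately show ?thesis using rr(1) by (intro exI[of _ "ball z r"]) auto
  qed
  then obtain U where U: "\<And>z. z \<in> S \<Longrightarrow> open (U z) \<and> z \<in> U z \<and> U z \<subseteq> S \<and> continuous_on (U z) Du \<and> (AE x in lborel. x \<in> U z \<longrightarrow> Du x = g x)"
    by metis
  have cont: "continuous_on S Du"
  proof (rule continuous_at_imp_continuous_on, intro ballI)
    fix z assume z: "z \<in> S"
    show "isCont Du z" using U[OF z] continuous_on_eq_continuous_at by blast
  qed
  obtain F where F: "F \<subseteq> U ` S" "countable F" "\<Union>F = \<Union>(U ` S)"
    using Lindelof[of "U ` S"] U by auto
  have "AE x in lborel. \<forall>T\<in>F. x \<in> T \<longrightarrow> Du x = g x"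
    by (subst AE_ball_countable[OF F(2)]) (use F(1) U in auto)
  then have "AE x in lborel. x \<in> S \<longrightarrow> Du x = G x"
  proof eventually_elim
    fix x assume *: "\<forall>T\<in>F. x \<in> T \<longrightarrow> Du x = g x"
    show "x \<in> S \<longrightarrow> Du x = G x"
    proof
      assume x: "x \<in> S"
      then have "x \<in> \<Union>F" using F(3) U[OF x] by blast
      with * have "Du x = g x" by auto
      then show "Du x = G x" using x S(2) by (auto simp: g_def)
    qed
  qed
  with cont show ?thesis by (rule that)
qed

lemma avg_ball_tendsto:
  fixes f :: "'b::euclidean_space \<Rightarrow> 'c::euclidean_space"
  assumes S: "open S" "x \<in> S" and Du: "continuous_on S Du" and ae: "AE y in lborel. y \<in> S \<longrightarrow> Du y = f y"
    and m: "set_borel_measurable lborel S f"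
    and r: "\<And>k. r k > 0" "r \<longlonglongrightarrow> 0"
  shows "(\<lambda>k. avg (ball x (r k)) f) \<longlonglongrightarrow> Du x"
proof (rule LIMSEQ_I)
  fix e :: real assume e: "e > 0"
  have "isCont Du x" using Du S by (simp add: continuous_on_eq_continuous_at)
  then obtain d where d: "d > 0" "\<And>y. dist y x < d \<Longrightarrow> dist (Du y) (Du x) < e / 2"
    unfolding continuous_at_eps_delta using e by (metis zero_less_divide_iff zero_less_numeral)
  obtain d' where d': "d' > 0" "cball x d' \<subseteq> S" using S open_contains_cball by meson
  obtain K where K: "\<And>k. k \<ge> K \<Longrightarrow> r k < min d d'"
    using order_tendstoD(2)[OF r(2), of "min d d'"] d d' unfolding eventually_sequentially by auto
  show "\<exists>no. \<forall>k\<ge>no. norm (avg (ball x (r k)) f - Du x) < e"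
  proof (intro exI allI impI)
    fix k assume k: "k \<ge> K"
    let ?B = "ball x (r k)"
    note B = ball_measure[OF r(1)[of k], of x]
    have BS: "?B \<subseteq> S" using K[OF k] d'(2) by (auto simp: subset_iff)
    have cb: "cball x (r k) \<subseteq> S" using K[OF k] d'(2) by (auto simp: subset_iff)
    have "set_integrable lborel (cball x (r k)) Du"
      unfolding set_integrable_def by (rule borel_integrable_compact[OF compact_cball continuous_on_subset[OF Du cb]])
    then have i: "set_integrable lborel ?B Du" by (rule set_integrable_subset) auto
    have mf: "set_borel_measurable lborel ?B f"
    proof -
      have "(\<lambda>y. indicat_real ?B y *\<^sub>R (indicat_real S y *\<^sub>R f y)) \<in> borel_measurable lborel"
        by (rule borel_measurable_scaleR[OF _ m[unfolded set_borel_measurable_def]]) (auto intro!: borel_measurable_indicator)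
      moreover have "(\<lambda>y. indicat_real ?B y *\<^sub>R (indicat_real S y *\<^sub>R f y)) = (\<lambda>y. indicat_real ?B y *\<^sub>R f y)"
        using BS by (auto simp: indicator_def fun_eq_iff)
      ultimately show ?thesis by (simp add: set_borel_measurable_def)
    qed
    have "(LBINT y:?B. f y) = (LBINT y:?B. Du y)"
      unfolding set_lebesgue_integral_def
    proof (rule integral_cong_AE)
      show "AE y in lborel. indicat_real ?B y *\<^sub>R f y = indicat_real ?B y *\<^sub>R Du y"
        using ae by eventually_elim (use BS in \<open>auto simp: indicator_def\<close>)
    qed (use mf i in \<open>auto simp: set_borel_measurable_def set_integrable_def\<close>)
    then have "avg ?B f - Du x = avg ?B (\<lambda>y. Du y - Du x)"
      by (simp add: avg_diff_const[OF i B(1,2,3)]) (simp add: avg_def)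
    then have "norm (avg ?B f - Du x) \<le> avg ?B (\<lambda>y. norm (Du y - Du x))" using avg_norm_le[OF B(3)] by simp
    also have "\<dots> \<le> avg ?B (\<lambda>y. e / 2)"
    proof -
      have "(LBINT y:?B. norm (Du y - Du x)) \<le> (LBINT y:?B. e / 2)"
        by (rule set_integral_mono)
          (use d(2) K[OF k] in \<open>auto simp: dist_norm norm_minus_commute intro!: set_integrable_norm set_integral_diff(1) i set_integrable_const B less_imp_le\<close>)
      then show ?thesis unfolding avg_def real_scaleR_def by (rule mult_left_mono) simp
    qed
    also have "\<dots> = e / 2" using B(3) by (simp add: avg_def set_integral_const_lborel[OF B(1,2)])
    finally show "norm (avg (ball x (r k)) f - Du x) < e" using e by simp
  qed
qed

section \<open>Geometry of the neck\<close>

lemma grad_inner_Basis: "b \<in> Basis \<Longrightarrow> grad f x \<bullet> b = frechet_derivative f (at x) b"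
  by (simp add: grad_def inner_sum_left inner_Basis if_distrib sum.delta cong: if_cong)

lemma Ck_on_two_C1_grad_partial:
  assumes f: "Ck_on k S f" "k \<ge> 2" and b: "b \<in> Basis"
  shows "C1_grad (\<lambda>x. grad f x \<bullet> b) (grad (iter_partial [b] f)) S"
proof -
  have e: "(\<lambda>x. grad f x \<bullet> b) = iter_partial [b] f" using b by (simp add: grad_inner_Basis)
  have "\<forall>bs\<in>multi_indices (Suc 0). \<forall>x\<in>S. iter_partial bs f differentiable (at x)"
    using f(1)[unfolded Ck_on_def, rule_format, of "Suc 0"] f(2) by simp
  then have d: "\<And>x. x \<in> S \<Longrightarrow> iter_partial [b] f differentiable (at x)"
    using b by (auto simp: multi_indices_Suc0 simp del: iter_partial.simps)
  have "\<forall>bs\<in>multi_indices 2. continuous_on S (iter_partial bs f)"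
    using f(1)[unfolded Ck_on_def, rule_format, of 2] f(2) by simp
  moreover have "[b', b] \<in> multi_indices 2" if "b' \<in> Basis" for b' using that b by (simp add: multi_indices_def)
  ultimately have "continuous_on S (\<lambda>x. frechet_derivative (iter_partial [b] f) (at x) b')" if "b' \<in> Basis" for b'
    using that by fastforce
  then have "continuous_on S (grad (iter_partial [b] f))"
    unfolding grad_def by (intro continuous_intros) auto
  with d show ?thesis unfolding e by (auto simp: C1_grad_def has_derivative_grad simp del: iter_partial.simps)
qed

lemma powr_root_cancel:
  fixes a r :: real
  assumes "a > 0" "r \<noteq> 0"
  shows "(a powr (-1 / r)) powr r = inverse a" "(a powr (1 / r)) powr r = a" "(a powr r) powr (1 / r) = a"
proof -
  have e: "-1 / r * r = -1" "1 / r * r = 1" "r * (1 / r) = 1" using assms by auto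
  show "(a powr (-1 / r)) powr r = inverse a" "(a powr (1 / r)) powr r = a" "(a powr r) powr (1 / r) = a"
    unfolding powr_powr e using assms by (simp_all add: powr_minus)
qed

text \<open>
  Provides the index \<open>j1\<close> of estimate (d).
\<close>

lemma geometric_last_index:
  fixes q K b :: real
  assumes "0 < q" "q < 1" "b > 0" "K * q ^ i \<ge> b"
  obtains j where "j \<ge> i" "K * q ^ j \<ge> b" "K * q ^ (j + 1) < b"
proof -
  have "(\<lambda>n. K * q ^ n) \<longlonglongrightarrow> K * 0" by (intro tendsto_intros LIMSEQ_power_zero) (use assms in auto)
  then have "eventually (\<lambda>n. K * q ^ n < b) sequentially" using assms by (intro order_tendstoD(2)) auto
  then obtain n where n: "K * q ^ (i + n) < b" unfolding eventually_sequentially by (metis le_add2)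
  define l where "l = (LEAST n. K * q ^ (i + n) < b)"
  have l: "K * q ^ (i + l) < b" unfolding l_def by (rule LeastI[of _ n]) (rule n)
  have "l \<noteq> 0" using l assms(4) by (metis add_0_right not_le)
  then obtain l' where l': "l = Suc l'" by (cases l) auto
  have "\<not> K * q ^ (i + l') < b" using not_less_Least[of l' "\<lambda>n. K * q ^ (i + n) < b"] l' by (simp add: l_def)
  with l l' show ?thesis by (intro that[of "i + l'"]) auto
qed

text \<open>
  The bounds on \<open>c = ct0 m \<kappa>1 \<kappa>3\<close> that make the scale \<open>c \<delta>\<^bsup>1/m\<^esup>\<close> small: the third one comes from the summand
  \<open>4\<^bsup>m+1\<^esup>\<close> in its definition and controls the variation of the thickness, the fourth one keeps the
  scale below \<open>R0\<close>.
\<close>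

lemma ct0_bounds:
  assumes m: "m \<ge> 2" and \<kappa>: "\<kappa>1 > 0" "\<kappa>3 > 0"
  shows "ct0 m \<kappa>1 \<kappa>3 > 0" "ct0 m \<kappa>1 \<kappa>3 \<le> \<kappa>1 powr (-1 / m)"
    "\<kappa>3 * ct0 m \<kappa>1 \<kappa>3 \<le> \<kappa>1 powr (1 - 1 / m) * 2 powr (-(m + 1))"
    "ct0 m \<kappa>1 \<kappa>3 powr m * \<kappa>3 \<le> 1 / 3"
proof -
  define c where "c = (51840 + 4 powr (m + 1)) powr (-1 / 2 :: real)"
  define y where "y = \<kappa>1 * \<kappa>3 powr (-1) * c"
  have base: "51840 + 4 powr (m + 1) > (0::real)" by (simp add: add_pos_nonneg)
  have c0: "c > 0" using base by (simp add: c_def)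
  have "c \<le> (4 powr (m + 1)) powr (-1 / 2)" unfolding c_def by (rule powr_mono2') auto
  also have "\<dots> = (2 powr 2) powr ((m + 1) * (-1 / 2))" by (simp add: powr_powr)
  also have "\<dots> = 2 powr (2 * ((m + 1) * (-1 / 2)))" by (rule powr_powr)
  also have "2 * ((m + 1) * (-1 / 2)) = -(m + 1)" by (simp add: field_simps)
  finally have c1: "c \<le> 2 powr (-(m + 1))" .
  also have "\<dots> \<le> 2 powr (-3)" using m by (intro powr_mono) auto
  also have "\<dots> \<le> (1/3 :: real)" by (simp add: powr_minus powr_numeral)
  finally have c3: "c \<le> 1 / 3" .
  have y0: "y > 0" using \<kappa> c0 by (simp add: y_def)
  have ct: "ct0 m \<kappa>1 \<kappa>3 = \<kappa>1 powr (-1 / m) * min 1 y" by (simp add: ct0_def y_def c_def)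
  show "ct0 m \<kappa>1 \<kappa>3 > 0" using \<kappa> y0 by (simp add: ct)
  show "ct0 m \<kappa>1 \<kappa>3 \<le> \<kappa>1 powr (-1 / m)" unfolding ct using mult_left_mono[of "min 1 y" 1 "\<kappa>1 powr (-1 / m)"] by simp
  have "\<kappa>3 * ct0 m \<kappa>1 \<kappa>3 \<le> \<kappa>3 * (\<kappa>1 powr (-1 / m) * y)"
    unfolding ct using \<kappa> by (intro mult_left_mono) auto
  also have "\<dots> = (\<kappa>1 powr (-1 / m) * \<kappa>1 powr 1) * c" using \<kappa> by (simp add: y_def powr_minus field_simps)
  also have "\<kappa>1 powr (-1 / m) * \<kappa>1 powr 1 = \<kappa>1 powr (1 - 1 / m)" by (subst powr_add[symmetric]) simp
  also have "\<kappa>1 powr (1 - 1 / m) * c \<le> \<kappa>1 powr (1 - 1 / m) * 2 powr (-(m + 1))" using c1 by (intro mult_left_mono) auto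
  finally show "\<kappa>3 * ct0 m \<kappa>1 \<kappa>3 \<le> \<kappa>1 powr (1 - 1 / m) * 2 powr (-(m + 1))" .
  have "ct0 m \<kappa>1 \<kappa>3 powr m = (\<kappa>1 powr (-1 / m)) powr m * min 1 y powr m" unfolding ct by (rule powr_mult)
  also have "(\<kappa>1 powr (-1 / m)) powr m = inverse \<kappa>1" using m \<kappa> by (intro powr_root_cancel) auto
  also have "inverse \<kappa>1 * min 1 y powr m \<le> inverse \<kappa>1 * y"
  proof (rule mult_left_mono)
    have "min 1 y powr m \<le> min 1 y powr 1" using y0 m by (intro powr_mono') auto
    then show "min 1 y powr m \<le> y" using y0 by simp
  qed (use \<kappa> in simp)
  finally have "ct0 m \<kappa>1 \<kappa>3 powr m * \<kappa>3 \<le> inverse \<kappa>1 * y * \<kappa>3" using \<kappa> by (intro mult_right_mono) auto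
  also have "\<dots> = c" using \<kappa> by (simp add: y_def powr_minus)
  finally show "ct0 m \<kappa>1 \<kappa>3 powr m * \<kappa>3 \<le> 1 / 3" using c3 by simp
qed

text \<open>
  The bound on \<open>R0\<close> makes the two graphs flat: by (H2), their slopes are at most 1.
\<close>

lemma R02_slope:
  assumes m: "m \<ge> 2" and \<kappa>: "\<kappa>3 > 0" and R0: "R0 > 0" "R0 \<le> R02 d m \<kappa>2 \<kappa>3 \<kappa>4"
  shows "\<kappa>3 * (2 * R0) powr (m - 1) \<le> 1"
proof -
  have "R0 \<le> 2 powr (- (2 * m + 1) / (2 * m - 1)) * \<kappa>3 powr (-1 / (m - 1))"
    using R0(2) by (simp add: R02_def)
  then have "2 * R0 \<le> (2 powr 1 * 2 powr (- (2 * m + 1) / (2 * m - 1))) * \<kappa>3 powr (-1 / (m - 1))" by simp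
  also have "2 powr 1 * 2 powr (- (2 * m + 1) / (2 * m - 1)) = (2::real) powr (1 + - (2 * m + 1) / (2 * m - 1))"
    by (rule powr_add[symmetric])
  also have "1 + - (2 * m + 1) / (2 * m - 1) = - 2 / (2 * m - 1)" using m by (simp add: field_simps)
  also have "2 powr (- 2 / (2 * m - 1)) * \<kappa>3 powr (-1 / (m - 1)) \<le> 2 powr 0 * \<kappa>3 powr (-1 / (m - 1))"
    using m by (intro mult_right_mono powr_mono) auto
  finally have "2 * R0 \<le> \<kappa>3 powr (-1 / (m - 1))" by simp
  then have "(2 * R0) powr (m - 1) \<le> (\<kappa>3 powr (-1 / (m - 1))) powr (m - 1)"
    using m R0 by (intro powr_mono2) auto
  also have "\<dots> = inverse \<kappa>3" using m \<kappa> by (intro powr_root_cancel) auto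
  finally show ?thesis using \<kappa> by (simp add: field_simps)
qed

lemma C1_grad_bound_on_ball:
  fixes f :: "'a::euclidean_space \<Rightarrow> real"
  assumes f: "C1_grad f D V" and V: "convex V" and x: "x \<in> V" "norm x \<le> s" and y: "y \<in> V" "norm y \<le> s"
    and B: "\<And>x. x \<in> V \<Longrightarrow> norm x \<le> s \<Longrightarrow> norm (D x) \<le> B"
  shows "\<bar>f x - f y\<bar> \<le> B * norm (x - y)"
proof -
  have "norm (f x - f y) \<le> B * norm (x - y)"
  proof (rule differentiable_bound[of "V \<inter> cball 0 s" f "\<lambda>x h. D x \<bullet> h"])
    show "convex (V \<inter> cball 0 s)" using V by (intro convex_Int) auto
    show "(f has_derivative (\<lambda>h. D x \<bullet> h)) (at x within V \<inter> cball 0 s)" if "x \<in> V \<inter> cball 0 s" for x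
      using C1_gradD[OF f] that by (auto intro: has_derivative_at_withinI)
    show "onorm (\<lambda>h. D x \<bullet> h) \<le> B" if "x \<in> V \<inter> cball 0 s" for x
    proof (rule onorm_le)
      fix h
      have "norm (D x \<bullet> h) \<le> norm (D x) * norm h" using Cauchy_Schwarz_ineq2 by simp
      also have "\<dots> \<le> B * norm h" using B[of x] that by (intro mult_right_mono) auto
      finally show "norm (D x \<bullet> h) \<le> B * norm h" .
    qed
  qed (use x y in auto)
  then show ?thesis by simp
qed

locale neck_geometry =
  fixes m \<kappa>1 \<kappa>2 \<kappa>3 \<kappa>4 R0 :: real and g :: "'a::euclidean_space geometry"
  assumes m: "m \<ge> 2" and \<kappa>: "\<kappa>1 > 0" "\<kappa>2 > 0" "\<kappa>3 > 0" "\<kappa>4 > 0" and R0: "R0 > 0"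
    and adm: "admissible m \<kappa>1 \<kappa>2 \<kappa>3 \<kappa>4 R0 g" and slope: "\<kappa>3 * (2 * R0) powr (m - 1) \<le> 1"
begin

abbreviation "V \<equiv> ball (0::'a) (2 * R0)"

lemma Ck: "Ck_on (nat \<lfloor>m\<rfloor>) V (h1 g)" "Ck_on (nat \<lfloor>m\<rfloor>) V (h2 g)" "nat \<lfloor>m\<rfloor> \<ge> 2"
  using adm m unfolding admissible_def by (auto simp: le_nat_iff le_floor_iff)

lemma C1: "C1_grad (h1 g) (grad (h1 g)) V" "C1_grad (h2 g) (grad (h2 g)) V"
  using Ck by (auto intro!: Ck_on_one_C1_grad)

lemma grad_bound: "x \<in> V \<Longrightarrow> norm (grad (h1 g) x) \<le> \<kappa>3 * norm x powr (m - 1)"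
  "x \<in> V \<Longrightarrow> norm (grad (h2 g) x) \<le> \<kappa>3 * norm x powr (m - 1)"
  using adm unfolding admissible_def by auto

lemma gap: "x \<in> V \<Longrightarrow> \<kappa>1 * norm x powr m \<le> h1 g x - h2 g x" "x \<in> V \<Longrightarrow> h1 g x - h2 g x \<le> \<kappa>2 * norm x powr m"
  using adm unfolding admissible_def by auto

lemma powr_le_slope:
  assumes "0 \<le> s" "s \<le> 2 * R0"
  shows "\<kappa>3 * s powr (m - 1) \<le> 1"
proof -
  have "\<kappa>3 * s powr (m - 1) \<le> \<kappa>3 * (2 * R0) powr (m - 1)"
    using assms m \<kappa> by (intro mult_left_mono powr_mono2) auto
  with slope show ?thesis by simp
qed

lemma grad_le_1: "x \<in> V \<Longrightarrow> norm (grad (h1 g) x) \<le> 1" "x \<in> V \<Longrightarrow> norm (grad (h2 g) x) \<le> 1"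
  using grad_bound[of x] powr_le_slope[of "norm x"] by (auto intro: order_trans)

lemma h_zero: "h1 g 0 = 0" "h2 g 0 = 0"
proof -
  have f: "0 \<in> frontier (incl1 g)" "0 \<in> frontier (incl2 g)" using adm unfolding admissible_def by auto
  have c: "(0 :: 'a \<times> real) \<in> cyl (2 * R0)" using R0 by (simp add: cyl_def)
  have "frontier (incl1 g) \<inter> cyl (2 * R0) = {x \<in> cyl (2 * R0). snd x = h1 g (fst x)}"
    "frontier (incl2 g) \<inter> cyl (2 * R0) = {x \<in> cyl (2 * R0). snd x = h2 g (fst x)}"
    using adm unfolding admissible_def by auto
  then have "0 \<in> {x \<in> cyl (2 * R0). snd x = h1 g (fst x)}" "0 \<in> {x \<in> cyl (2 * R0). snd x = h2 g (fst x)}"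
    using f c by blast+
  then show "h1 g 0 = 0" "h2 g 0 = 0" by simp_all
qed

lemma h_lipschitz:
  assumes "x \<in> V" "norm x \<le> s" "y \<in> V" "norm y \<le> s"
  shows "\<bar>h1 g x - h1 g y\<bar> \<le> \<kappa>3 * s powr (m - 1) * norm (x - y)"
    "\<bar>h2 g x - h2 g y\<bar> \<le> \<kappa>3 * s powr (m - 1) * norm (x - y)"
proof -
  have "\<kappa>3 * norm x powr (m - 1) \<le> \<kappa>3 * s powr (m - 1)" if "norm x \<le> s" for x :: 'a
    using that m \<kappa> by (intro mult_left_mono powr_mono2) auto
  then show "\<bar>h1 g x - h1 g y\<bar> \<le> \<kappa>3 * s powr (m - 1) * norm (x - y)"
    "\<bar>h2 g x - h2 g y\<bar> \<le> \<kappa>3 * s powr (m - 1) * norm (x - y)"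
    using grad_bound
    by (intro C1_grad_bound_on_ball[OF C1(1) convex_ball assms] C1_grad_bound_on_ball[OF C1(2) convex_ball assms], force intro: order_trans)+
qed

lemma h_bound:
  assumes "x \<in> V"
  shows "\<bar>h1 g x\<bar> \<le> \<kappa>3 * norm x powr m" "\<bar>h2 g x\<bar> \<le> \<kappa>3 * norm x powr m"
    "\<bar>h1 g x\<bar> \<le> norm x" "\<bar>h2 g x\<bar> \<le> norm x"
proof -
  have 0: "0 \<in> V" using R0 by simp
  have e: "norm x powr (m - 1) * norm x = norm x powr m"
    using powr_add[of "norm x" "m - 1" 1] by (cases "x = 0") auto
  have 1: "\<bar>h1 g x\<bar> \<le> \<kappa>3 * norm x powr (m - 1) * norm x" "\<bar>h2 g x\<bar> \<le> \<kappa>3 * norm x powr (m - 1) * norm x"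
    using h_lipschitz[OF assms order_refl 0] h_zero by auto
  then show "\<bar>h1 g x\<bar> \<le> \<kappa>3 * norm x powr m" "\<bar>h2 g x\<bar> \<le> \<kappa>3 * norm x powr m"
    by (auto simp: e mult.assoc)
  have "\<kappa>3 * norm x powr (m - 1) * norm x \<le> 1 * norm x"
    using assms by (intro mult_right_mono powr_le_slope) auto
  with 1 show "\<bar>h1 g x\<bar> \<le> norm x" "\<bar>h2 g x\<bar> \<le> norm x" by auto
qed

lemma delta_bounds:
  assumes "x \<in> V"
  shows "delta g \<epsilon> x \<ge> \<epsilon> + \<kappa>1 * norm x powr m" "delta g \<epsilon> x \<le> \<epsilon> + \<kappa>2 * norm x powr m"
    "delta g \<epsilon> x \<le> \<epsilon> + 2 * \<kappa>3 * norm x powr m" "\<epsilon> > 0 \<Longrightarrow> delta g \<epsilon> x > 0"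
proof -
  show 1: "delta g \<epsilon> x \<ge> \<epsilon> + \<kappa>1 * norm x powr m" and "delta g \<epsilon> x \<le> \<epsilon> + \<kappa>2 * norm x powr m"
    using gap[OF assms] by (auto simp: delta_def)
  show "delta g \<epsilon> x \<le> \<epsilon> + 2 * \<kappa>3 * norm x powr m" using h_bound[OF assms] by (auto simp: delta_def abs_le_iff)
  have "\<kappa>1 * norm x powr m \<ge> 0" using \<kappa> by simp
  then show "\<epsilon> > 0 \<Longrightarrow> delta g \<epsilon> x > 0" using 1 by linarith
qed

lemma C1_lower: "C1_grad (lower g \<epsilon>) (grad (h2 g)) V"
  using C1_grad_add[OF C1_grad_const[of "- \<epsilon> / 2"] C1(2)] unfolding lower_def by simp

lemma C1_delta: "C1_grad (delta g \<epsilon>) (\<lambda>x. grad (h1 g) x - grad (h2 g) x) V"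
  using C1_grad_diff[OF C1_grad_add[OF C1_grad_const[of \<epsilon>] C1(1)] C1(2)] unfolding delta_def by simp

lemma C2_lower: "b \<in> Basis \<Longrightarrow> \<exists>D. C1_grad (\<lambda>x. grad (h2 g) x \<bullet> b) D V"
  using Ck_on_two_C1_grad_partial[OF Ck(2,3)] by blast

lemma C2_delta: "b \<in> Basis \<Longrightarrow> \<exists>D. C1_grad (\<lambda>x. (grad (h1 g) x - grad (h2 g) x) \<bullet> b) D V"
  using C1_grad_diff[OF Ck_on_two_C1_grad_partial[OF Ck(1,3)] Ck_on_two_C1_grad_partial[OF Ck(2,3)]]
  by (auto simp: inner_diff_left)

lemma flattening:
  assumes "W \<subseteq> V" "open W" "\<epsilon> > 0" "\<delta> > 0"
  shows "flattening W (lower g \<epsilon>) (delta g \<epsilon>) (grad (h2 g)) (\<lambda>x. grad (h1 g) x - grad (h2 g) x) \<delta>"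
  using assms C1_grad_subset[OF C1_lower] C1_grad_subset[OF C1_delta] delta_bounds(4)
  by unfold_locales auto

lemma neck_eq: "neck g \<epsilon> x0 t = {x. fst x \<in> ball x0 t \<and> lower g \<epsilon> (fst x) < snd x \<and> snd x < lower g \<epsilon> (fst x) + delta g \<epsilon> (fst x)}"
  by (auto simp: neck_def lower_def upper_def delta_def dist_norm norm_minus_commute)

lemma open_neck:
  assumes "ball x0 t \<subseteq> V" "\<epsilon> > 0"
  shows "open (neck g \<epsilon> x0 t)"
  using flattening.open_N[OF flattening[OF assms(1) open_ball assms(2) zero_less_one]]
  unfolding flattening.N_def[OF flattening[OF assms(1) open_ball assms(2) zero_less_one]] neck_eq by simp

lemma bounded_neck:
  assumes "ball x0 t \<subseteq> V" "\<epsilon> > 0"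
  shows "bounded (neck g \<epsilon> x0 t)" "emeasure lborel (neck g \<epsilon> x0 t) < \<infinity>"
proof -
  have "neck g \<epsilon> x0 t \<subseteq> ball 0 (2 * R0) \<times> {-(\<epsilon> + 2 * R0) .. \<epsilon> + 2 * R0}"
  proof
    fix x assume x: "x \<in> neck g \<epsilon> x0 t"
    then have xV: "fst x \<in> V" using assms(1) by (auto simp: neck_eq)
    have "\<bar>h1 g (fst x)\<bar> \<le> 2 * R0" "\<bar>h2 g (fst x)\<bar> \<le> 2 * R0" using h_bound(3,4)[OF xV] xV by auto
    then show "x \<in> ball 0 (2 * R0) \<times> {-(\<epsilon> + 2 * R0) .. \<epsilon> + 2 * R0}"
      using x xV assms(2) by (cases x) (auto simp: neck_def lower_def upper_def)
  qed
  moreover have "bounded (V \<times> {-(\<epsilon> + 2 * R0) .. \<epsilon> + 2 * R0})" by (intro bounded_Times) auto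
  ultimately show b: "bounded (neck g \<epsilon> x0 t)" by (rule bounded_subset[rotated])
  show "emeasure lborel (neck g \<epsilon> x0 t) < \<infinity>" by (rule emeasure_bounded_finite[OF b])
qed

text \<open>
  A point of the neck that lay in the closure of an inclusion could be joined by a vertical segment
  to a point outside of that inclusion, on the other side of the plane separating the inclusions. The segment
  would meet the boundary of the inclusion within the cylinder, where it is the given graph, and the
  segment stays on one side of that graph.
\<close>

lemma neck_subset_Omega:
  assumes \<epsilon>: "0 < \<epsilon>" "\<epsilon> < R0"
  shows "neck g \<epsilon> 0 R0 \<subseteq> Omega g \<epsilon>"
proof
  fix x assume x: "x \<in> neck g \<epsilon> 0 R0"
  obtain x' t where xt: "x = (x', t)" by (cases x)
  have x': "norm x' < R0" and t: "lower g \<epsilon> x' < t" "t < upper g \<epsilon> x'" using x by (auto simp: neck_def xt)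
  have xV: "x' \<in> V" using x' R0 by simp
  have hb: "\<bar>h1 g x'\<bar> \<le> R0" "\<bar>h2 g x'\<bar> \<le> R0" using h_bound(3,4)[OF xV] x' by auto
  note A = adm[unfolded admissible_def]
  have fr1: "frontier (incl1 g) \<inter> cyl (2 * R0) = {x \<in> cyl (2 * R0). snd x = h1 g (fst x)}"
    and fr2: "frontier (incl2 g) \<inter> cyl (2 * R0) = {x \<in> cyl (2 * R0). snd x = h2 g (fst x)}"
    and cD: "cyl (2 * R0) \<subseteq> dom_D g"
    and s1: "incl1 g \<subseteq> {x. snd x > 0}" and s2: "incl2 g \<subseteq> {x. snd x < 0}" using A by auto
  have on1: "snd w = h1 g (fst w)" if "w \<in> frontier (incl1 g)" "w \<in> cyl (2 * R0)" for w using fr1 that by blast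
  have on2: "snd w = h2 g (fst w)" if "w \<in> frontier (incl2 g)" "w \<in> cyl (2 * R0)" for w using fr2 that by blast
  have "x \<in> cyl (2 * R0)" using x' t hb \<epsilon> R0 by (auto simp: cyl_def xt lower_def upper_def)
  then have xD: "x \<in> dom_D g" using cD by auto
  have seg: "connected (closed_segment (x', a) (x', b))" for a b :: real by (rule connected_segment)
  have segx: "fst w = x' \<and> min a b \<le> snd w \<and> snd w \<le> max a b" if "w \<in> closed_segment (x', a) (x', b)" for w and a b :: real
  proof -
    have "\<exists>u. 0 \<le> u \<and> u \<le> 1 \<and> w = (1 - u) *\<^sub>R (x', a) + u *\<^sub>R (x', b)"
      using that by (simp only: in_segment(1))
    then obtain u where u: "0 \<le> u" "u \<le> 1" "w = (1 - u) *\<^sub>R (x', a) + u *\<^sub>R (x', b)" by (elim exE conjE)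
    have w: "fst w = x'" "snd w = (1 - u) * a + u * b"
    proof -
      have "fst w = (1 - u) *\<^sub>R x' + u *\<^sub>R x'" "snd w = (1 - u) * a + u * b" unfolding u(3) by simp_all
      then show "fst w = x'" "snd w = (1 - u) * a + u * b" by (simp_all only: scaleR_left_distrib[symmetric]) simp
    qed
    have c: "(1 - u) * r + u * r = r" for r by (simp add: algebra_simps)
    have "(1 - u) * min a b + u * min a b \<le> (1 - u) * a + u * b" "(1 - u) * a + u * b \<le> (1 - u) * max a b + u * max a b"
      using u by (intro add_mono mult_left_mono; simp)+
    then show ?thesis unfolding w c by simp
  qed
  have n1: "(x', t - \<epsilon> / 2) \<notin> closure (incl1 g)"
  proof
    assume c: "(x', t - \<epsilon> / 2) \<in> closure (incl1 g)"
    have inc: "(x', t - \<epsilon> / 2) \<in> cyl (2 * R0)" using x' t hb \<epsilon> R0 by (auto simp: cyl_def lower_def upper_def)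
    have lt: "t - \<epsilon> / 2 < h1 g x'" using t by (simp add: upper_def)
    then have "(x', t - \<epsilon> / 2) \<notin> frontier (incl1 g)" using on1[OF _ inc] by fastforce
    then have i: "(x', t - \<epsilon> / 2) \<in> incl1 g" using c unfolding frontier_def by (meson DiffI interior_subset subsetD)
    then have pos: "t - \<epsilon> / 2 > 0" using s1 by auto
    let ?S = "closed_segment (x', - R0) (x', t - \<epsilon> / 2)"
    have "(x', - R0) \<notin> incl1 g" using s1 R0 by auto
    then have "?S \<inter> frontier (incl1 g) \<noteq> {}"
      using i by (intro connected_Int_frontier[OF seg]) auto
    then obtain w where w: "w \<in> ?S" "w \<in> frontier (incl1 g)" by auto
    have ws: "fst w = x'" "- R0 \<le> snd w" "snd w \<le> t - \<epsilon> / 2" using segx[OF w(1)] pos R0 by auto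
    then have "w \<in> cyl (2 * R0)" using x' hb lt R0 by (auto simp: cyl_def)
    then have "snd w = h1 g x'" using on1[OF w(2)] ws by simp
    then show False using ws lt by simp
  qed
  have n2: "(x', t + \<epsilon> / 2) \<notin> closure (incl2 g)"
  proof
    assume c: "(x', t + \<epsilon> / 2) \<in> closure (incl2 g)"
    have inc: "(x', t + \<epsilon> / 2) \<in> cyl (2 * R0)" using x' t hb \<epsilon> R0 by (auto simp: cyl_def lower_def upper_def)
    have lt: "t + \<epsilon> / 2 > h2 g x'" using t by (simp add: lower_def)
    then have "(x', t + \<epsilon> / 2) \<notin> frontier (incl2 g)" using on2[OF _ inc] by fastforce
    then have i: "(x', t + \<epsilon> / 2) \<in> incl2 g" using c unfolding frontier_def by (meson DiffI interior_subset subsetD)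
    then have neg: "t + \<epsilon> / 2 < 0" using s2 by auto
    let ?S = "closed_segment (x', R0) (x', t + \<epsilon> / 2)"
    have "(x', R0) \<notin> incl2 g" using s2 R0 by auto
    then have "?S \<inter> frontier (incl2 g) \<noteq> {}"
      using i by (intro connected_Int_frontier[OF seg]) auto
    then obtain w where w: "w \<in> ?S" "w \<in> frontier (incl2 g)" by auto
    have ws: "fst w = x'" "snd w \<le> R0" "t + \<epsilon> / 2 \<le> snd w" using segx[OF w(1)] neg R0 by auto
    then have "w \<in> cyl (2 * R0)" using x' hb lt R0 by (auto simp: cyl_def)
    then have "snd w = h2 g x'" using on2[OF w(2)] ws by simp
    then show False using ws lt by simp
  qed
  have cl1: "closure (D1 g \<epsilon>) = (\<lambda>x. x + (0, \<epsilon> / 2)) ` closure (incl1 g)"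
    unfolding D1_def using closure_translation[of "(0, \<epsilon> / 2)" "incl1 g"] by (simp add: add.commute)
  have cl2: "closure (D2 g \<epsilon>) = (\<lambda>x. x + (0, - \<epsilon> / 2)) ` closure (incl2 g)"
    unfolding D2_def using closure_translation[of "(0, - \<epsilon> / 2)" "incl2 g"] by (simp add: add.commute)
  have "x \<notin> closure (D1 g \<epsilon>)"
  proof
    assume "x \<in> closure (D1 g \<epsilon>)"
    then obtain y where "y \<in> closure (incl1 g)" "x = y + (0, \<epsilon> / 2)" unfolding cl1 by auto
    then have "(x', t - \<epsilon> / 2) \<in> closure (incl1 g)" by (cases y) (auto simp: xt)
    with n1 show False by simp
  qed
  moreover have "x \<notin> closure (D2 g \<epsilon>)"
  proof
    assume "x \<in> closure (D2 g \<epsilon>)"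
    then obtain y where "y \<in> closure (incl2 g)" "x = y + (0, - \<epsilon> / 2)" unfolding cl2 by auto
    then have "(x', t + \<epsilon> / 2) \<in> closure (incl2 g)" by (cases y) (auto simp: xt)
    with n2 show False by simp
  qed
  ultimately show "x \<in> Omega g \<epsilon>" using xD by (simp add: Omega_def)
qed

lemma open_Omega: "open (Omega g \<epsilon>)"
proof -
  have "bounded_C11_domain (dom_D g)" using adm unfolding admissible_def by blast
  then have "open (dom_D g)" unfolding bounded_C11_domain_def by blast
  then show ?thesis unfolding Omega_def by (intro open_Diff closed_closure)
qed

abbreviation "ct \<equiv> ct0 m \<kappa>1 \<kappa>3"

lemmas ct = ct0_bounds[OF m \<kappa>(1,3)]

definition rho where "rho \<epsilon> x0 = ct / 3 * delta g \<epsilon> x0 powr (1 / m)"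

text \<open>
  By the lower bound in (H1).
\<close>

lemma norm_le_delta:
  assumes "x0 \<in> V" "\<epsilon> > 0"
  shows "norm x0 \<le> \<kappa>1 powr (-1 / m) * delta g \<epsilon> x0 powr (1 / m)"
proof -
  have "norm x0 powr m \<le> delta g \<epsilon> x0 / \<kappa>1"
    using delta_bounds(1)[OF assms(1), of \<epsilon>] assms(2) \<kappa> by (simp add: field_simps)
  then have "(norm x0 powr m) powr (1 / m) \<le> (delta g \<epsilon> x0 / \<kappa>1) powr (1 / m)" using m by (intro powr_mono2) auto
  also have "\<dots> = \<kappa>1 powr (-1 / m) * delta g \<epsilon> x0 powr (1 / m)"
  proof -
    have "\<kappa>1 powr (-1 / m) = 1 / \<kappa>1 powr (1 / m)" using powr_minus_divide[of \<kappa>1 "1 / m"] by simp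
    then show ?thesis by (simp add: powr_divide)
  qed
  finally show ?thesis using m powr_root_cancel(3)[of "norm x0" m] by (cases "x0 = 0") simp_all
qed

lemma rho_pos: "x0 \<in> V \<Longrightarrow> \<epsilon> > 0 \<Longrightarrow> rho \<epsilon> x0 > 0"
  using delta_bounds(4)[of x0 \<epsilon>] ct(1) by (auto simp: rho_def intro!: mult_pos_pos)

text \<open>
  Points within distance \<open>rho\<close> of \<open>x0\<close> have norm at most \<open>s = 4/3 (\<delta>/\<kappa>1)\<^bsup>1/m\<^esup>\<close>, where the slopes are at most
  \<open>\<kappa>3 s\<^bsup>m-1\<^esup>\<close>. So the thickness changes by at most \<open>2 \<kappa>3 s\<^bsup>m-1\<^esup> rho\<close>, which scales like \<open>\<delta>\<close>, and the smallness of
  \<open>\<kappa>3 ct\<close> gives the factor.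
\<close>

lemma delta_comparable:
  assumes x0: "x0 \<in> V" and \<epsilon>: "\<epsilon> > 0" and x: "x \<in> V" "norm (x - x0) \<le> rho \<epsilon> x0"
  shows "\<bar>delta g \<epsilon> x - delta g \<epsilon> x0\<bar> \<le> delta g \<epsilon> x0 / 2"
proof -
  define \<delta> where "\<delta> = delta g \<epsilon> x0"
  have \<delta>: "\<delta> > 0" using delta_bounds(4)[OF x0 \<epsilon>] by (simp add: \<delta>_def)
  define w where "w = \<kappa>1 powr (-1 / m) * \<delta> powr (1 / m)"
  define s where "s = 4 / 3 * w"
  have w0: "w > 0" using \<kappa> \<delta> by (simp add: w_def)
  have n0: "norm x0 \<le> w" using norm_le_delta[OF x0 \<epsilon>] by (simp add: w_def \<delta>_def)
  have "ct * \<delta> powr (1 / m) \<le> w" unfolding w_def using ct(2) by (intro mult_right_mono) auto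
  then have r: "rho \<epsilon> x0 \<le> w / 3" by (simp add: rho_def \<delta>_def)
  have s0: "norm x0 \<le> s" using n0 w0 by (simp add: s_def)
  have s1: "norm x \<le> s" using norm_triangle_sub[of x x0] x(2) n0 r by (simp add: s_def)
  have "\<bar>delta g \<epsilon> x - \<delta>\<bar> \<le> \<bar>h1 g x - h1 g x0\<bar> + \<bar>h2 g x - h2 g x0\<bar>"
    by (simp add: delta_def \<delta>_def)
  also have "\<dots> \<le> 2 * (\<kappa>3 * s powr (m - 1) * norm (x - x0))"
    using h_lipschitz[OF x(1) s1 x0 s0] by linarith
  also have "\<dots> \<le> 2 * (\<kappa>3 * s powr (m - 1) * rho \<epsilon> x0)"
    using x(2) \<kappa> by (intro mult_left_mono) auto
  also have "\<dots> = (2 / 3) * s powr (m - 1) * (\<kappa>3 * ct) * \<delta> powr (1 / m)"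
    by (simp add: rho_def \<delta>_def)
  also have "\<dots> \<le> (2 / 3) * s powr (m - 1) * (\<kappa>1 powr (1 - 1 / m) * 2 powr (-(m + 1))) * \<delta> powr (1 / m)"
    by (intro mult_right_mono mult_left_mono ct(3)) auto
  also have "s powr (m - 1) = (4 / 3) powr (m - 1) * (\<kappa>1 powr (- (1 - 1 / m)) * \<delta> powr (1 - 1 / m))"
  proof -
    have "s powr (m - 1) = (4 / 3) powr (m - 1) * ((\<kappa>1 powr (-1 / m)) powr (m - 1) * (\<delta> powr (1 / m)) powr (m - 1))"
      unfolding s_def w_def by (simp only: powr_mult)
    moreover have "-1 / m * (m - 1) = - (1 - 1 / m)" "1 / m * (m - 1) = 1 - 1 / m" using m by (auto simp: field_simps)
    ultimately show ?thesis by (simp only: powr_powr)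
  qed
  also have "(2 / 3) * ((4 / 3) powr (m - 1) * (\<kappa>1 powr (- (1 - 1 / m)) * \<delta> powr (1 - 1 / m))) * (\<kappa>1 powr (1 - 1 / m) * 2 powr (-(m + 1))) * \<delta> powr (1 / m)
     = (2 / 3) * ((4 / 3) powr (m - 1) * 2 powr (-(m + 1))) * (\<kappa>1 powr (- (1 - 1 / m)) * \<kappa>1 powr (1 - 1 / m)) * (\<delta> powr (1 - 1 / m) * \<delta> powr (1 / m))"
    by (simp only: mult_ac)
  also have "\<delta> powr (1 - 1 / m) * \<delta> powr (1 / m) = \<delta>" using \<delta> by (simp flip: powr_add)
  also have "\<kappa>1 powr (- (1 - 1 / m)) * \<kappa>1 powr (1 - 1 / m) = 1" using \<kappa> by (simp flip: powr_add)
  also have "(4 / 3) powr (m - 1) * 2 powr (-(m + 1)) \<le> (1 / 4 :: real)"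
  proof -
    have "(4 / 3) powr (m - 1) \<le> (2 :: real) powr (m - 1)" using m by (intro powr_mono2) auto
    then have "(4 / 3) powr (m - 1) * 2 powr (-(m + 1)) \<le> (2 :: real) powr (m - 1) * 2 powr (-(m + 1))"
      by (intro mult_right_mono) auto
    also have "\<dots> = 2 powr (-2)" by (simp flip: powr_add)
    also have "\<dots> = 1 / 4" by (simp add: powr_minus powr_numeral)
    finally show ?thesis .
  qed
  finally have "\<bar>delta g \<epsilon> x - \<delta>\<bar> \<le> 2 / 3 * (1 / 4) * 1 * \<delta>" using \<delta> by simp
  also have "\<dots> \<le> \<delta> / 2" using \<delta> by simp
  finally show ?thesis by (simp add: \<delta>_def)
qed

lemma rho_le:
  assumes x0: "norm x0 < R0" and \<epsilon>: "\<epsilon> > 0" "\<epsilon> \<le> \<kappa>3 * R0 powr m"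
  shows "rho \<epsilon> x0 \<le> R0 / 3"
proof -
  define \<delta> where "\<delta> = delta g \<epsilon> x0"
  have x0V: "x0 \<in> V" using x0 R0 by simp
  have \<delta>: "\<delta> > 0" using delta_bounds(4)[OF x0V \<epsilon>(1)] by (simp add: \<delta>_def)
  have "\<delta> \<le> \<epsilon> + 2 * \<kappa>3 * norm x0 powr m" unfolding \<delta>_def by (rule delta_bounds(3)[OF x0V])
  also have "2 * \<kappa>3 * norm x0 powr m \<le> 2 * \<kappa>3 * R0 powr m" using x0 m \<kappa> by (intro mult_left_mono powr_mono2) auto
  finally have \<delta>le: "\<delta> \<le> 3 * (\<kappa>3 * R0 powr m)" using \<epsilon> by simp
  have "(ct * \<delta> powr (1 / m)) powr m = ct powr m * (\<delta> powr (1 / m)) powr m" by (rule powr_mult)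
  also have "(\<delta> powr (1 / m)) powr m = \<delta>" using m \<delta> by (intro powr_root_cancel) auto
  also have "ct powr m * \<delta> \<le> ct powr m * (3 * (\<kappa>3 * R0 powr m))" using \<delta>le by (intro mult_left_mono) auto
  also have "\<dots> = 3 * R0 powr m * (ct powr m * \<kappa>3)" by (simp only: mult_ac)
  also have "\<dots> \<le> 3 * R0 powr m * (1 / 3)" by (intro mult_left_mono ct(4)) auto
  finally have "(ct * \<delta> powr (1 / m)) powr m \<le> R0 powr m" by simp
  then have "((ct * \<delta> powr (1 / m)) powr m) powr (1 / m) \<le> (R0 powr m) powr (1 / m)"
    by (rule powr_mono2[rotated 2]) (use m in auto)
  moreover have "ct * \<delta> powr (1 / m) > 0" using ct(1) \<delta> by (intro mult_pos_pos) auto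
  ultimately have "ct * \<delta> powr (1 / m) \<le> R0"
    using m R0 powr_root_cancel(3)[of R0 m] powr_root_cancel(3)[of "ct * \<delta> powr (1 / m)" m] by simp
  then show ?thesis by (simp add: rho_def \<delta>_def)
qed

text \<open>
  Rewriting the claim as \<open>\<delta>\<^bsup>1 - 1/m\<^esup> \<le> 2 Y\<close>, one needs \<open>\<delta> \<le> 2 Y\<^bsup>m/(m-1)\<^esup>\<close>. By (H1), \<open>\<delta>\<close> is at most \<open>\<epsilon> + \<kappa>2 R0\<^sup>m\<close>,
  and both terms are at most \<open>Y\<^bsup>m/(m-1)\<^esup>\<close>. This is where the condition \<open>R\<^sub>0 \<le> R\<^bsub>0,3\<^esub>\<close> enters, with
  \<open>q = \<mu>\<^sub>0\<^sup>j\<close> for \<open>j = j\<^sub>0\<close>.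
\<close>

lemma first_scale_large:
  assumes x0: "norm x0 < R0" and q: "q > 0"
    and Y: "Y = 12 / 13 * ct * q" and R0Y: "R0 \<le> Y powr (1 / (m - 1)) * \<kappa>2 powr (-1 / m)"
    and \<epsilon>: "\<epsilon> > 0" "\<epsilon> \<le> Y powr (m / (m - 1))"
  shows "delta g \<epsilon> x0 / 24 \<le> ct / 13 * q * delta g \<epsilon> x0 powr (1 / m)"
proof -
  define \<delta> where "\<delta> = delta g \<epsilon> x0"
  have x0V: "x0 \<in> V" using x0 R0 by simp
  have \<delta>: "\<delta> > 0" using delta_bounds(4)[OF x0V \<epsilon>(1)] by (simp add: \<delta>_def)
  have Y0: "Y > 0" using ct(1) q by (simp add: Y)
  have "\<kappa>2 * R0 powr m \<le> \<kappa>2 * (Y powr (1 / (m - 1)) * \<kappa>2 powr (-1 / m)) powr m"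
    using R0Y R0 m \<kappa> by (intro mult_left_mono powr_mono2) auto
  also have "\<dots> = \<kappa>2 * ((Y powr (1 / (m - 1))) powr m * (\<kappa>2 powr (-1 / m)) powr m)" by (simp only: powr_mult)
  also have "(\<kappa>2 powr (-1 / m)) powr m = inverse \<kappa>2" using m \<kappa> by (intro powr_root_cancel) auto
  also have "\<kappa>2 * ((Y powr (1 / (m - 1))) powr m * inverse \<kappa>2) = Y powr (m / (m - 1))" using \<kappa> by (simp add: powr_powr)
  finally have a: "\<kappa>2 * R0 powr m \<le> Y powr (m / (m - 1))" .
  have "\<delta> \<le> \<epsilon> + \<kappa>2 * norm x0 powr m" unfolding \<delta>_def by (rule delta_bounds(2)[OF x0V])
  also have "\<kappa>2 * norm x0 powr m \<le> \<kappa>2 * R0 powr m" using x0 m \<kappa> by (intro mult_left_mono powr_mono2) auto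
  finally have "\<delta> \<le> 2 * Y powr (m / (m - 1))" using a \<epsilon> by linarith
  then have "\<delta> powr ((m - 1) / m) \<le> (2 * Y powr (m / (m - 1))) powr ((m - 1) / m)" using \<delta> m by (intro powr_mono2) auto
  also have "\<dots> = 2 powr ((m - 1) / m) * (Y powr (m / (m - 1))) powr ((m - 1) / m)" by (rule powr_mult)
  also have "(Y powr (m / (m - 1))) powr ((m - 1) / m) = Y" using m Y0 by (simp add: powr_powr)
  also have "2 powr ((m - 1) / m) * Y \<le> 2 powr 1 * Y" using m Y0 by (intro mult_right_mono powr_mono) (auto simp: field_simps)
  finally have "\<delta> powr ((m - 1) / m) \<le> 2 * Y" by simp
  then have "\<delta> powr ((m - 1) / m) * \<delta> powr (1 / m) \<le> 2 * Y * \<delta> powr (1 / m)" by (intro mult_right_mono) auto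
  moreover have "(m - 1) / m + 1 / m = 1" using m by (simp add: field_simps)
  then have "\<delta> powr ((m - 1) / m) * \<delta> powr (1 / m) = \<delta>" using \<delta> by (simp flip: powr_add)
  ultimately show ?thesis by (simp add: Y \<delta>_def)
qed

lemma delta_powr_le:
  assumes "x0 \<in> V" "\<epsilon> > 0"
  shows "delta g \<epsilon> x0 powr (-1 / m) \<le> min 1 \<kappa>1 powr (-1 / m) * (\<epsilon> + norm x0 powr m) powr (-1 / m)"
proof -
  have p: "\<epsilon> + norm x0 powr m > 0" using assms by (simp add: add_pos_nonneg)
  have "min 1 \<kappa>1 * (\<epsilon> + norm x0 powr m) \<le> 1 * \<epsilon> + \<kappa>1 * norm x0 powr m"
    unfolding distrib_left using assms \<kappa> by (intro add_mono mult_right_mono) auto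
  also have "\<dots> \<le> delta g \<epsilon> x0" using delta_bounds(1)[OF assms(1), of \<epsilon>] by simp
  finally have "delta g \<epsilon> x0 powr (-1 / m) \<le> (min 1 \<kappa>1 * (\<epsilon> + norm x0 powr m)) powr (-1 / m)"
    using p \<kappa> m by (intro powr_mono2') auto
  also have "\<dots> = min 1 \<kappa>1 powr (-1 / m) * (\<epsilon> + norm x0 powr m) powr (-1 / m)" by (rule powr_mult)
  finally show ?thesis .
qed

lemma measure_neck_le:
  assumes x0: "x0 \<in> V" and \<epsilon>: "\<epsilon> > 0" and b: "ball x0 (rho \<epsilon> x0) \<subseteq> V"
  shows "measure lborel (neck g \<epsilon> x0 (rho \<epsilon> x0))
    \<le> 2 * delta g \<epsilon> x0 * (unit_ball_vol (real DIM('a)) * rho \<epsilon> x0 ^ DIM('a))"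
proof -
  let ?\<rho> = "rho \<epsilon> x0" and ?\<delta> = "delta g \<epsilon> x0"
  have \<delta>: "?\<delta> > 0" by (rule delta_bounds(4)[OF x0 \<epsilon>])
  have \<rho>: "?\<rho> > 0" by (rule rho_pos[OF x0 \<epsilon>])
  have mN: "neck g \<epsilon> x0 ?\<rho> \<in> sets borel" using open_neck[OF b \<epsilon>] by auto
  have "emeasure lborel (neck g \<epsilon> x0 ?\<rho>) = (\<integral>\<^sup>+x. indicator (neck g \<epsilon> x0 ?\<rho>) x \<partial>lborel)"
    using mN by (subst nn_integral_indicator) auto
  also have "\<dots> = (\<integral>\<^sup>+x. \<integral>\<^sup>+t. indicator (neck g \<epsilon> x0 ?\<rho>) (x, t) \<partial>lborel \<partial>lborel)"
    using mN by (intro nn_integral_lborel_prod_real) auto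
  also have "\<dots> \<le> (\<integral>\<^sup>+x. ennreal (2 * ?\<delta>) * indicator (ball x0 ?\<rho>) x \<partial>lborel)"
  proof (rule nn_integral_mono)
    fix x
    show "(\<integral>\<^sup>+t. indicator (neck g \<epsilon> x0 ?\<rho>) (x, t) \<partial>lborel) \<le> ennreal (2 * ?\<delta>) * indicator (ball x0 ?\<rho>) x"
    proof (cases "x \<in> ball x0 ?\<rho>")
      case True
      then have xV: "x \<in> V" using b by auto
      have "\<bar>delta g \<epsilon> x - ?\<delta>\<bar> \<le> ?\<delta> / 2"
        using True by (intro delta_comparable[OF x0 \<epsilon> xV]) (simp add: dist_norm norm_minus_commute)
      then have d: "delta g \<epsilon> x \<le> 2 * ?\<delta>" using \<delta> by linarith
      have "(\<integral>\<^sup>+t. indicator (neck g \<epsilon> x0 ?\<rho>) (x, t) \<partial>lborel) = (\<integral>\<^sup>+t. indicator {lower g \<epsilon> x<..<lower g \<epsilon> x + delta g \<epsilon> x} t \<partial>lborel)"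
        using True by (intro nn_integral_cong) (auto simp: neck_eq indicator_def)
      also have "\<dots> = ennreal (delta g \<epsilon> x)" using delta_bounds(4)[OF xV \<epsilon>] by simp
      finally show ?thesis using d True by (simp add: ennreal_leI)
    next
      case False
      then have "indicator (neck g \<epsilon> x0 ?\<rho>) (x, t) = (0::ennreal)" for t by (auto simp: neck_eq)
      then show ?thesis by simp
    qed
  qed
  also have "\<dots> = ennreal (2 * ?\<delta>) * emeasure lborel (ball x0 ?\<rho>)" by (rule nn_integral_cmult_indicator) simp
  also have "\<dots> = ennreal (2 * ?\<delta> * (unit_ball_vol (real DIM('a)) * ?\<rho> ^ DIM('a)))"
    using ball_measure(2,4)[OF \<rho>, of x0] \<delta> \<rho>
    by (subst emeasure_eq_ennreal_measure) (auto simp: ennreal_mult)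
  finally have "emeasure lborel (neck g \<epsilon> x0 ?\<rho>) \<le> ennreal (2 * ?\<delta> * (unit_ball_vol (real DIM('a)) * ?\<rho> ^ DIM('a)))" .
  then show ?thesis using \<delta> \<rho> unfolding measure_def by (intro enn2real_leI) auto
qed

end

section \<open>The gradient of the extended solution\<close>

context neck_geometry
begin

text \<open>
  The gradient exists by \<open>weak_gradient_flatten\<close> and \<open>weak_gradient_fold\<close>. For the bound, the ball of
  radius \<open>R\<close> is cut into the cells of the reflection. At most \<open>14 R / \<delta>\<close> of them are met, because \<open>R\<close> is
  not small compared to \<open>\<delta>\<close>. On each of them the folded gradient has the norm of \<open>H\<close>, which is at most \<open>6 |G|\<close> because
  slopes are at most 1 and thicknesses at most double; the factor 2 bounds the inverse of the Jacobian
  determinant of the flattening, and \<open>(4/3)\<^sup>n\<close> compares \<open>|G|\<^sup>p\<close> with \<open>|G|\<^sup>p bump\<^sup>n\<close> for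
  \<open>|x' - x0| < R \<le> rho/2\<close>, where the cutoff is at least 3/4. The Caccioppoli inequality bounds the rest.

  That \<open>u\<close> and \<open>G\<close> vanish off the neck makes them Borel functions on the whole space, and makes the flattened
  functions vanish off the open layer as \<open>weak_gradient_fold\<close> requires.
\<close>

lemma extended_gradient:
  assumes p: "p > 1" and \<epsilon>: "\<epsilon> > 0" "\<epsilon> \<le> \<kappa>3 * R0 powr m" and x0: "norm x0 < R0"
    and sol: "p_laplace_solution p R0 g \<epsilon> u G"
    and u0: "\<And>x. x \<notin> neck g \<epsilon> 0 (2 * R0) \<Longrightarrow> u x = 0"
    and G0: "\<And>x. x \<notin> neck g \<epsilon> 0 (2 * R0) \<Longrightarrow> G x = 0"
  obtains Gt where "is_grad_u_tilde R0 g \<epsilon> x0 u Gt"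
    "\<And>R n M c. R > 0 \<Longrightarrow> R \<le> rho \<epsilon> x0 / 2 \<Longrightarrow> 13 * delta g \<epsilon> x0 / 24 \<le> R \<Longrightarrow> real n \<ge> p \<Longrightarrow> n \<ge> 2 \<Longrightarrow> M \<ge> 0 \<Longrightarrow>
      (AE x in lborel. x \<in> neck g \<epsilon> x0 (rho \<epsilon> x0) \<longrightarrow> \<bar>u x - c\<bar> \<le> M) \<Longrightarrow>
      (LBINT z:ball 0 R. norm (Gt z) powr p) \<le> 14 * (R / delta g \<epsilon> x0) * (2 * 6 powr p * (4 / 3) ^ n *
         ((2 * real n * M / rho \<epsilon> x0) powr p * measure lborel (neck g \<epsilon> x0 (rho \<epsilon> x0))))"
proof -
  define \<delta> where "\<delta> = delta g \<epsilon> x0"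
  have x0V: "x0 \<in> V" using x0 R0 by simp
  have \<delta>: "\<delta> > 0" using delta_bounds(4)[OF x0V \<epsilon>(1)] by (simp add: \<delta>_def)
  define Q where "Q = {y. x0 + y \<in> V}"
  have Q: "open Q" unfolding Q_def
    using open_vimage[OF open_ball, of "\<lambda>y. x0 + y" 0 "2 * R0"] by (simp add: vimage_def continuous_intros)
  interpret fl: flattening V "lower g \<epsilon>" "delta g \<epsilon>" "grad (h2 g)" "\<lambda>x. grad (h1 g) x - grad (h2 g) x" x0 \<delta>
    using flattening[OF order_refl open_ball \<epsilon>(1) \<delta>] .
  interpret fo: folding Q "\<delta> / 2"
    by unfold_locales (use Q \<delta> in auto)
  have N: "fl.N = neck g \<epsilon> 0 (2 * R0)" unfolding fl.N_def neck_eq by simp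
  have P: "fo.strip = fl.P" unfolding fo.strip_def fl.P_def by (auto simp: Q_def)
  have P_iff: "z \<in> fl.P \<longleftrightarrow> x0 + fst z \<in> V \<and> \<bar>snd z\<bar> < \<delta> / 2" for z unfolding fl.P_def by simp
  have fstT: "fst (fl.T z) = x0 + fst z" for z unfolding fl.T_def by simp
  have cyl: "fo.cylinder = {z. norm (x0 + fst z) < 2 * R0}" unfolding fo.cylinder_def by (auto simp: Q_def)
  have W: "W1p p fl.N u G" using sol unfolding N p_laplace_solution_def by auto
  then have Lu: "Lp_on p fl.N u" and LG: "Lp_on p fl.N G" and wg: "weak_gradient fl.N u G" by (auto simp: W1p_def)
  have p0: "p > 0" using p by simp
  have VV: "ball (0::'a) (2 * R0) \<subseteq> V" by simp
  have mN: "fl.N \<in> sets borel" "emeasure lborel fl.N < \<infinity>" using fl.open_N bounded_neck(2)[OF VV \<epsilon>(1)] by (auto simp: N)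
  have bu: "u \<in> borel_measurable borel" and bG: "G \<in> borel_measurable borel"
  proof -
    have "(\<lambda>x. indicat_real fl.N x *\<^sub>R u x) = u" "(\<lambda>x. indicat_real fl.N x *\<^sub>R G x) = G"
      using u0 G0 by (auto simp: indicator_def fun_eq_iff N)
    with Lu LG show "u \<in> borel_measurable borel" "G \<in> borel_measurable borel" unfolding Lp_on_eq[OF p0] by simp_all
  qed
  have iu: "set_integrable lborel fl.N u" and iG: "set_integrable lborel fl.N G"
    using Lu LG by (auto intro!: set_integrable_of_powr[OF bu mN _ p] set_integrable_of_powr[OF bG mN _ p] simp: Lp_on_def)
  have off: "fl.T z \<notin> fl.N" if "\<bar>snd z\<bar> \<ge> \<delta> / 2 \<or> x0 + fst z \<notin> V" for z
  proof (cases "x0 + fst z \<in> V")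
    case True then show ?thesis using that fl.T_in_iff[OF True] by auto
  next
    case False then show ?thesis by (auto simp: fl.N_def fl.T_def)
  qed
  define v where "v z = u (fl.T z)" for z
  define H where "H = fl.pull G"
  have vz: "v z = 0" if "\<bar>snd z\<bar> \<ge> \<delta> / 2" for z using off[of z] u0 that by (auto simp: v_def N)
  have Hz: "H z = 0" if "\<bar>snd z\<bar> \<ge> \<delta> / 2 \<or> x0 + fst z \<notin> V" for z
    using off[OF that] G0 by (simp add: H_def fl.pull_def N zero_prod_def)
  have Qeq: "Q = {y. x0 + y \<in> V}" by (simp add: Q_def)
  have vi: "set_integrable lborel (C \<times> {-(\<delta> / 2)..\<delta> / 2}) v" if "compact C" "C \<subseteq> Q" for C
    unfolding v_def by (rule fl.set_integrable_strip[OF iu u0[folded N] that[unfolded Qeq]])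
  have Hi: "set_integrable lborel (C \<times> {-(\<delta> / 2)..\<delta> / 2}) H" if C: "compact C" "C \<subseteq> Q" for C
    unfolding H_def
    by (rule fl.set_integrable_pull[OF compact_Times[OF C(1) compact_Icc] _ fl.set_integrable_strip[OF iG G0[folded N] C[unfolded Qeq]]])
      (use C(2) Qeq in auto)
  have wv: "weak_gradient fo.strip v H"
    unfolding P v_def H_def by (rule fl.weak_gradient_flatten[OF wg C2_lower C2_delta])
  have \<delta>2: "2 * (\<delta> / 2) = \<delta>" by simp
  define Gt where "Gt z = (let y = H (fst z, fold_strip \<delta> (snd z)) in (fst y, fold_sign \<delta> (snd z) * snd y))" for z
  have wGt: "weak_gradient fo.cylinder (\<lambda>z. v (fst z, fold_strip \<delta> (snd z))) Gt"
    using fo.weak_gradient_fold[OF wv vz _ vi Hi] Hz unfolding Gt_def \<delta>2 by simp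
  have ut: "u_tilde g \<epsilon> x0 u = (\<lambda>z. v (fst z, fold_strip \<delta> (snd z)))"
    unfolding u_tilde_def v_def fl.T_def unflatten_def Let_def \<delta>_def[symmetric] by (rule ext) simp
  have isg: "is_grad_u_tilde R0 g \<epsilon> x0 u Gt"
    unfolding is_grad_u_tilde_def ut using wGt unfolding cyl .
  show ?thesis
  proof (rule that[OF isg])
    fix R M c :: real and n :: nat
    assume R: "R > 0" "R \<le> rho \<epsilon> x0 / 2" "13 * delta g \<epsilon> x0 / 24 \<le> R" and n: "real n \<ge> p" "n \<ge> 2" and M: "M \<ge> 0"
      and ae: "AE x in lborel. x \<in> neck g \<epsilon> x0 (rho \<epsilon> x0) \<longrightarrow> \<bar>u x - c\<bar> \<le> M"
    let ?\<rho> = "rho \<epsilon> x0"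
    have \<rho>: "?\<rho> > 0" "?\<rho> \<le> R0 / 3" using rho_pos[OF x0V \<epsilon>(1)] rho_le[OF x0 \<epsilon>] by auto
    have inV: "x \<in> V" if "norm (x - x0) \<le> ?\<rho>" for x
      using that norm_triangle_sub[of x x0] x0 \<rho> R0 by simp
    have bV: "ball x0 ?\<rho> \<subseteq> V" using inV by (auto simp: dist_norm norm_minus_commute)
    have dc: "\<bar>delta g \<epsilon> x - \<delta>\<bar> \<le> \<delta> / 2" if "norm (x - x0) \<le> ?\<rho>" for x
      unfolding \<delta>_def by (rule delta_comparable[OF x0V \<epsilon>(1) inV[OF that] that])
    define A where "A = (2 * real n * M / ?\<rho>) powr p * measure lborel (neck g \<epsilon> x0 ?\<rho>)"
    have cac: "(LBINT x:fl.N. norm (G x) powr p * bump x0 ?\<rho> x ^ n) \<le> A"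
      and caci: "set_integrable lborel fl.N (\<lambda>x. norm (G x) powr p * bump x0 ?\<rho> x ^ n)"
      unfolding A_def N
      using caccioppoli[OF p n sol fl.open_N[unfolded N] mN(2)[unfolded N] \<rho>(1) _ ae M open_neck[OF bV \<epsilon>(1)]] \<rho>(2) x0 R0 by auto
    \<comment> \<open>only the part of the neck with \<open>|x' - x0| < R\<close> is seen by the ball of radius \<open>R\<close>\<close>
    define B where "B = {z :: 'a \<times> real. norm (fst z) < R}"
    have mB: "B \<in> sets borel" unfolding B_def by (intro borel_open open_Collect_less continuous_intros)
    define k where "k x = indicat_real {x. norm (fst x - x0) < R} x * norm (G x) powr p" for x :: "'a \<times> real"
    have mk: "{x :: 'a \<times> real. norm (fst x - x0) < R} \<in> sets borel" by (intro borel_open open_Collect_less continuous_intros)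
    have ik: "set_integrable lborel fl.N k"
    proof (rule set_integrable_bound)
      show "set_integrable lborel fl.N (\<lambda>x. norm (G x) powr p)" using LG by (simp add: Lp_on_def)
      show "set_borel_measurable lborel fl.N k" unfolding set_borel_measurable_def k_def using bG mk mN by measurable
    qed (auto simp: k_def indicator_def)
    have kle: "(LBINT x:fl.N. k x) \<le> (4 / 3) ^ n * A"
    proof -
      have "(LBINT x:fl.N. k x) \<le> (LBINT x:fl.N. (4 / 3) ^ n * (norm (G x) powr p * bump x0 ?\<rho> x ^ n))"
      proof (rule set_integral_mono[OF ik set_integrable_mult_right[OF caci]])
        fix x
        show "k x \<le> (4 / 3) ^ n * (norm (G x) powr p * bump x0 ?\<rho> x ^ n)"
        proof (cases "norm (fst x - x0) < R")
          case True
          then have "bump x0 ?\<rho> x \<ge> 3 / 4" using R \<rho> by (intro bump_half) auto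
          then have "(3 / 4) ^ n \<le> bump x0 ?\<rho> x ^ n" by (intro power_mono) auto
          then have "(4 / 3) ^ n * (3 / 4) ^ n \<le> (4 / 3) ^ n * bump x0 ?\<rho> x ^ n" by (intro mult_left_mono) auto
          then have "1 \<le> (4 / 3) ^ n * bump x0 ?\<rho> x ^ n" by (simp flip: power_mult_distrib)
          then have "norm (G x) powr p * 1 \<le> norm (G x) powr p * ((4 / 3) ^ n * bump x0 ?\<rho> x ^ n)" by (intro mult_left_mono) auto
          then show ?thesis using True by (simp add: k_def mult_ac)
        next
          case False
          then show ?thesis using bump_bounds(1)[of x0 ?\<rho> x] by (simp add: k_def)
        qed
      qed
      also have "\<dots> \<le> (4 / 3) ^ n * A" using cac by simp
      finally show ?thesis .
    qed
    \<comment> \<open>\<open>e2\<close> has the bound \<open>6\<^sup>p |G|\<^sup>p\<close> together with the Jacobian determinant, so that its integral is one over the neck\<close>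
    define e where "e z = indicat_real fl.P z *\<^sub>R (indicat_real B z * norm (H z) powr p)" for z
    define e2 where "e2 z = indicat_real fl.P z *\<^sub>R ((2 * 6 powr p) * ((delta g \<epsilon> (x0 + fst z) / \<delta>) *\<^sub>R k (fl.T z)))" for z
    have ie2: "integrable lborel e2"
      using set_integrable_mult_right[OF fl.integral_flatten(1)[OF ik]] unfolding e2_def set_integrable_def .
    have e2int: "integral\<^sup>L lborel e2 \<le> 2 * 6 powr p * ((4 / 3) ^ n * A)"
    proof -
      have "integral\<^sup>L lborel e2 = 2 * 6 powr p * (LBINT x:fl.N. k x)"
        unfolding fl.integral_flatten(2)[OF ik] set_integral_mult_right[symmetric]
        by (simp only: e2_def[abs_def] set_lebesgue_integral_def)
      then show ?thesis using mult_left_mono[OF kle, of "2 * 6 powr p"] by simp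
    qed
    have ele: "0 \<le> e z" "e z \<le> e2 z" for z
    proof -
      show "0 \<le> e z" by (simp add: e_def)
      show "e z \<le> e2 z"
      proof (cases "z \<in> fl.P \<and> z \<in> B")
        case True
        let ?x = "x0 + fst z" and ?y = "G (fl.T z)"
        have xr: "norm (?x - x0) \<le> ?\<rho>" using True R \<rho> by (simp add: B_def)
        have zP: "\<bar>snd z\<bar> < \<delta> / 2" using True by (simp add: P_iff)
        then have sz: "\<bar>snd z / \<delta> + 1 / 2\<bar> \<le> 1" using \<delta> by (auto simp: abs_le_iff field_simps)
        have gh: "norm (grad (h1 g) ?x) \<le> 1" "norm (grad (h2 g) ?x) \<le> 1" using grad_le_1[OF inV[OF xr]] by auto
        have d: "delta g \<epsilon> ?x \<le> 2 * \<delta>" "\<delta> / 2 \<le> delta g \<epsilon> ?x" using dc[OF xr] \<delta> by linarith+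
        have y: "norm (fst ?y) \<le> norm ?y" "\<bar>snd ?y\<bar> \<le> norm ?y" using norm_fst_le[of "fst ?y" "snd ?y"] norm_snd_le[of "snd ?y" "fst ?y"] by auto
        have "norm (grad (h1 g) ?x - grad (h2 g) ?x) \<le> 2" using gh norm_triangle_ineq4[of "grad (h1 g) ?x" "grad (h2 g) ?x"] by linarith
        then have "\<bar>snd z / \<delta> + 1 / 2\<bar> * norm (grad (h1 g) ?x - grad (h2 g) ?x) \<le> 1 * 2"
          using sz by (intro mult_mono) auto
        then have "norm (grad (h2 g) ?x + (snd z / \<delta> + 1 / 2) *\<^sub>R (grad (h1 g) ?x - grad (h2 g) ?x)) \<le> 1 + 1 * (1 + 1)"
          using gh by (intro norm_triangle_le add_mono) auto
        then have "\<bar>snd ?y\<bar> * norm (grad (h2 g) ?x + (snd z / \<delta> + 1 / 2) *\<^sub>R (grad (h1 g) ?x - grad (h2 g) ?x)) \<le> norm ?y * 3"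
          using y(2) by (intro mult_mono) auto
        then have h1: "norm (fst (H z)) \<le> norm ?y + norm ?y * 3"
          unfolding H_def fl.pull_def fst_conv using y(1) by (intro norm_triangle_le add_mono) auto
        have "delta g \<epsilon> ?x / \<delta> \<le> 2" "delta g \<epsilon> ?x / \<delta> \<ge> 0" using d \<delta> by (auto simp: field_simps)
        then have "\<bar>delta g \<epsilon> ?x / \<delta>\<bar> * \<bar>snd ?y\<bar> \<le> 2 * norm ?y" using y(2) by (intro mult_mono) auto
        then have h2: "\<bar>snd (H z)\<bar> \<le> 2 * norm ?y" unfolding H_def fl.pull_def snd_conv abs_mult .
        have "norm (H z) \<le> norm (fst (H z)) + norm (snd (H z))" using norm_Pair_le[of "fst (H z)" "snd (H z)"] by simp
        then have "norm (H z) \<le> 6 * norm ?y" using h1 h2 by simp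
        then have "norm (H z) powr p \<le> (6 * norm ?y) powr p" using p by (intro powr_mono2) auto
        also have "\<dots> = 6 powr p * norm ?y powr p" by (rule powr_mult)
        also have "\<dots> \<le> (2 * 6 powr p) * ((delta g \<epsilon> ?x / \<delta>) * norm ?y powr p)"
        proof -
          have "1 \<le> 2 * (delta g \<epsilon> ?x / \<delta>)" using d \<delta> by (simp add: field_simps)
          then have "1 * (6 powr p * norm ?y powr p) \<le> 2 * (delta g \<epsilon> ?x / \<delta>) * (6 powr p * norm ?y powr p)"
            by (intro mult_right_mono) auto
          then show ?thesis by (simp add: mult_ac)
        qed
        also have "norm ?y powr p = k (fl.T z)" using True by (simp add: k_def fstT B_def)
        finally show ?thesis using True by (simp add: e_def e2_def)
      next
        case False
        have "0 \<le> e2 z"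
        proof (cases "z \<in> fl.P")
          case True
          then have "delta g \<epsilon> (x0 + fst z) > 0" using delta_bounds(4)[OF _ \<epsilon>(1)] by (simp add: P_iff)
          then show ?thesis using \<delta> by (auto simp: e2_def k_def)
        qed (simp add: e2_def)
        then show ?thesis using False by (auto simp: e_def)
      qed
    qed
    \<comment> \<open>the cells with index in \<open>fold_range J\<close> cover the ball\<close>
    define J :: int where "J = \<lceil>R / (2 * \<delta>)\<rceil>"
    have J: "R \<le> 4 * (\<delta> / 2) * of_int J" "J \<ge> 0" "of_int J \<le> R / (2 * \<delta>) + 1"
    proof -
      have "R / (2 * \<delta>) \<le> of_int J" unfolding J_def by linarith
      then show "R \<le> 4 * (\<delta> / 2) * of_int J" using \<delta> by (simp add: field_simps)
      have "0 \<le> R / (2 * \<delta>)" using R \<delta> by simp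
      then show "J \<ge> 0" unfolding J_def by linarith
      show "of_int J \<le> R / (2 * \<delta>) + 1" unfolding J_def by linarith
    qed
    have \<delta>R: "13 * \<delta> / 24 \<le> R" using R(3) by (simp add: \<delta>_def)
    have cardJ: "real (card (fold_range J)) \<le> 14 * (R / \<delta>)"
    proof -
      have "6 \<le> 12 * (R / \<delta>)" using \<delta>R \<delta> by (simp add: field_simps)
      then show ?thesis using J(3) unfolding card_fold_range[OF J(2)] by simp
    qed
    have BV: "cball (0 :: 'a \<times> real) R \<subseteq> fo.cylinder"
    proof
      fix z :: "'a \<times> real" assume "z \<in> cball 0 R"
      then have "norm (fst z) \<le> R" using norm_fst_le[of "fst z" "snd z"] by simp
      then show "z \<in> fo.cylinder" unfolding cyl using norm_triangle_ineq[of x0 "fst z"] x0 R \<rho> R0 by simp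
    qed
    have "set_integrable lborel (cball 0 R) Gt"
      using wGt compact_cball[of "0 :: 'a \<times> real" R] BV unfolding weak_gradient_def by blast
    then have "set_integrable lborel (ball 0 R) Gt" by (rule set_integrable_subset) auto
    then have mGt: "(\<lambda>z. indicat_real (ball 0 R) z *\<^sub>R Gt z) \<in> borel_measurable borel" by (simp add: set_integrable_def)
    define h where "h z = norm (indicat_real (ball 0 R) z *\<^sub>R Gt z) powr p" for z
    have mh: "h \<in> borel_measurable borel" unfolding h_def using mGt by measurable
    have hcell: "0 \<le> (if \<bar>snd z\<bar> < \<delta> / 2 then h (shear (fold_cell (\<delta> / 2) j) (snd j) z) else 0)"
      "(if \<bar>snd z\<bar> < \<delta> / 2 then h (shear (fold_cell (\<delta> / 2) j) (snd j) z) else 0) \<le> e2 z" if j: "j \<in> fold_range J" for j z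
    proof -
      show "0 \<le> (if \<bar>snd z\<bar> < \<delta> / 2 then h (shear (fold_cell (\<delta> / 2) j) (snd j) z) else 0)" by (simp add: h_def)
      show "(if \<bar>snd z\<bar> < \<delta> / 2 then h (shear (fold_cell (\<delta> / 2) j) (snd j) z) else 0) \<le> e2 z"
      proof (cases "\<bar>snd z\<bar> < \<delta> / 2 \<and> shear (fold_cell (\<delta> / 2) j) (snd j) z \<in> ball 0 R")
        case True
        let ?w = "shear (fold_cell (\<delta> / 2) j) (snd j) z"
        have f: "fold_strip \<delta> (snd ?w) = snd z" "fold_sign \<delta> (snd ?w) = snd j"
          using fo.shear_fold[OF j, of z] True unfolding \<delta>2 by (simp_all del: snd_shear)
        have "norm (Gt ?w) = norm (H z)"
          using fold_range_snd(2)[OF j] unfolding Gt_def f Let_def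
          by (cases "H z") (simp add: norm_prod_def norm_mult abs_mult)
        then have hw: "h ?w = norm (H z) powr p" using True by (simp add: h_def)
        have "norm (fst z) \<le> norm ?w" using norm_fst_le[of "fst z" "fold_cell (\<delta> / 2) j + snd j * snd z"] by (simp add: shear_def)
        then have zB: "z \<in> B" using True by (simp add: B_def)
        have "x0 + fst z \<in> V" using zB inV[of "x0 + fst z"] R \<rho> by (simp add: B_def)
        then have "z \<in> fl.P" using True by (simp add: P_iff)
        then have "e z = norm (H z) powr p" using zB by (simp add: e_def)
        then show ?thesis using hw True ele(2)[of z] by simp
      next
        case False
        then show ?thesis using order_trans[OF ele(1) ele(2), of z] p by (auto simp: h_def)
      qed
    qed
    have hint: "integrable lborel (\<lambda>z. if \<bar>snd z\<bar> < \<delta> / 2 then h (shear (fold_cell (\<delta> / 2) j) (snd j) z) else 0)" if j: "j \<in> fold_range J" for j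
    proof (rule Bochner_Integration.integrable_bound[OF ie2])
      have "{z :: 'a \<times> real. \<bar>snd z\<bar> < \<delta> / 2} \<in> sets borel" by (intro borel_open open_Collect_less continuous_intros)
      then have "(\<lambda>z. indicat_real {z. \<bar>snd z\<bar> < \<delta> / 2} z * h (shear (fold_cell (\<delta> / 2) j) (snd j) z)) \<in> borel_measurable borel"
        by (intro borel_measurable_times borel_measurable_indicator measurable_compose[OF measurable_shear mh])
      also have "(\<lambda>z. indicat_real {z. \<bar>snd z\<bar> < \<delta> / 2} z * h (shear (fold_cell (\<delta> / 2) j) (snd j) z)) =
          (\<lambda>z. if \<bar>snd z\<bar> < \<delta> / 2 then h (shear (fold_cell (\<delta> / 2) j) (snd j) z) else 0)" by (auto simp: indicator_def fun_eq_iff)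
      finally show "(\<lambda>z. if \<bar>snd z\<bar> < \<delta> / 2 then h (shear (fold_cell (\<delta> / 2) j) (snd j) z) else 0) \<in> borel_measurable lborel" by simp
      show "AE z in lborel. norm (if \<bar>snd z\<bar> < \<delta> / 2 then h (shear (fold_cell (\<delta> / 2) j) (snd j) z) else 0) \<le> norm (e2 z)"
        using hcell[OF j] by (intro AE_I2) (simp only: real_norm_def abs_of_nonneg, meson abs_ge_self order_trans)
    qed
    have h0: "h z = 0" if "\<bar>fold_strip (2 * (\<delta> / 2)) (snd z)\<bar> = \<delta> / 2 \<or> fold_index (\<delta> / 2) (snd z) \<notin> fold_range J" for z
      using that
    proof
      assume "\<bar>fold_strip (2 * (\<delta> / 2)) (snd z)\<bar> = \<delta> / 2"
      then have "H (fst z, fold_strip \<delta> (snd z)) = 0" by (intro Hz) simp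
      then show "h z = 0" using p by (simp add: h_def Gt_def Let_def flip: zero_prod_def)
    next
      assume "fold_index (\<delta> / 2) (snd z) \<notin> fold_range J"
      then have "\<not> \<bar>snd z\<bar> \<le> 4 * (\<delta> / 2) * of_int J" using fold_index_in_range[of "\<delta> / 2" "snd z" J] \<delta> by auto
      then have "R < norm z" using J(1) norm_snd_le[of "snd z" "fst z"] by simp
      then show "h z = 0" using p by (simp add: h_def)
    qed
    have "(LBINT z:ball 0 R. norm (Gt z) powr p) = integral\<^sup>L lborel h"
      unfolding set_lebesgue_integral_def h_def by (rule Bochner_Integration.integral_cong) (use p in \<open>auto simp: indicator_def\<close>)
    also have "\<dots> = (\<Sum>j\<in>fold_range J. integral\<^sup>L lborel (\<lambda>z. if \<bar>snd z\<bar> < \<delta> / 2 then h (shear (fold_cell (\<delta> / 2) j) (snd j) z) else 0))"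
      by (rule fold_integral(2)[OF _ h0 hint]) (use \<delta> in auto)
    also have "\<dots> \<le> (\<Sum>j\<in>fold_range J. 2 * 6 powr p * ((4 / 3) ^ n * A))"
    proof (rule sum_mono)
      fix j assume j: "j \<in> fold_range J"
      show "integral\<^sup>L lborel (\<lambda>z. if \<bar>snd z\<bar> < \<delta> / 2 then h (shear (fold_cell (\<delta> / 2) j) (snd j) z) else 0) \<le> 2 * 6 powr p * ((4 / 3) ^ n * A)"
        by (rule order_trans[OF integral_mono[OF hint[OF j] ie2 hcell(2)[OF j]] e2int])
    qed
    also have "\<dots> = real (card (fold_range J)) * (2 * 6 powr p * ((4 / 3) ^ n * A))" by simp
    also have "\<dots> \<le> 14 * (R / \<delta>) * (2 * 6 powr p * ((4 / 3) ^ n * A))"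
      by (intro mult_right_mono cardJ) (auto simp: A_def)
    finally show "(LBINT z:ball 0 R. norm (Gt z) powr p) \<le> 14 * (R / delta g \<epsilon> x0) * (2 * 6 powr p * (4 / 3) ^ n *
         ((2 * real n * M / rho \<epsilon> x0) powr p * measure lborel (neck g \<epsilon> x0 (rho \<epsilon> x0))))"
      by (simp add: A_def \<delta>_def mult.assoc)
  qed
qed

end

section \<open>Iterating the mean oscillation estimate\<close>

text \<open>
  The inner sums \<open>a k\<close> satisfy \<open>a (k + 1) = \<beta> a k + q\<^sup>k\<close> with \<open>\<beta> \<le> 1/2\<close>, so twice the geometric series bounds their
  sum. The extra term \<open>a j\<close> makes the induction work.
\<close>

lemma double_geometric_sum:
  fixes \<beta> q :: real
  assumes \<beta>: "0 \<le> \<beta>" "\<beta> \<le> 1 / 2" and q: "0 < q" "q < 1" and j: "i0 \<le> j"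
  shows "(\<Sum>k=i0+1..j. \<Sum>i=i0..k-1. \<beta> ^ (k - 1 - i) * q ^ i) \<le> 2 * q ^ i0 / (1 - q)"
proof -
  define a where "a k = (\<Sum>i=i0..<k. \<beta> ^ (k - 1 - i) * q ^ i)" for k
  have rec: "a (Suc k) = \<beta> * a k + q ^ k" if "i0 \<le> k" for k
  proof -
    have "a (Suc k) = (\<Sum>i=i0..<k. \<beta> ^ (k - i) * q ^ i) + q ^ k"
      using that by (simp add: a_def)
    also have "(\<Sum>i=i0..<k. \<beta> ^ (k - i) * q ^ i) = (\<Sum>i=i0..<k. \<beta> * (\<beta> ^ (k - 1 - i) * q ^ i))"
    proof (rule sum.cong[OF refl])
      fix i assume "i \<in> {i0..<k}"
      then have "k - i = Suc (k - 1 - i)" by auto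
      then show "\<beta> ^ (k - i) * q ^ i = \<beta> * (\<beta> ^ (k - 1 - i) * q ^ i)" by simp
    qed
    finally show ?thesis by (simp add: a_def sum_distrib_left)
  qed
  have a0: "a k \<ge> 0" for k unfolding a_def using \<beta> q by (intro sum_nonneg mult_nonneg_nonneg) auto
  have "(\<Sum>k=i0+1..j. a k) + a j \<le> 2 * (q ^ i0 - q ^ j) / (1 - q)" using j
  proof (induction j rule: dec_induct)
    case base
    then show ?case by (simp add: a_def)
  next
    case (step n)
    have "(\<Sum>k=i0+1..Suc n. a k) + a (Suc n) = (\<Sum>k=i0+1..n. a k) + 2 * (\<beta> * a n + q ^ n)"
      using step rec[of n] by simp
    also have "\<dots> \<le> (\<Sum>k=i0+1..n. a k) + a n + 2 * q ^ n"
      using mult_right_mono[OF \<beta>(2) a0[of n]] by simp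
    also have "\<dots> \<le> 2 * (q ^ i0 - q ^ n) / (1 - q) + 2 * q ^ n" using step by simp
    also have "\<dots> = 2 * (q ^ i0 - q ^ Suc n) / (1 - q)" using q by (simp add: field_simps)
    finally show ?case .
  qed
  also have "\<dots> \<le> 2 * q ^ i0 / (1 - q)" using q by (intro divide_right_mono) auto
  finally have "(\<Sum>k=i0+1..j. a k) \<le> 2 * q ^ i0 / (1 - q)" using a0[of j] by linarith
  moreover have "(\<Sum>k=i0+1..j. \<Sum>i=i0..k-1. \<beta> ^ (k - 1 - i) * q ^ i) = (\<Sum>k=i0+1..j. a k)"
    unfolding a_def by (intro sum.cong refl) auto
  ultimately show ?thesis by simp
qed

text \<open>
  By induction on \<open>j\<close>: if all earlier \<open>T i\<close> are at most \<open>B = (2 D + 1) M\<close>, then \<open>E S \<le> B/2\<close> by the smallness assumption,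
  and \<open>D M + B/2 \<le> B\<close>. The recursion says nothing about \<open>T (i0 + 1)\<close>, which has to be bounded separately.
\<close>

lemma iteration_bound:
  fixes T :: "nat \<Rightarrow> real" and \<beta> q D E M :: real and i0 :: nat
  defines "S \<equiv> \<lambda>j. \<Sum>k=i0+1..j. \<Sum>i=i0..k-1. \<beta> ^ (k - 1 - i) * q ^ i * T i"
  assumes \<beta>: "0 \<le> \<beta>" "\<beta> \<le> 1 / 2" and q: "0 < q" "q < 1" and D: "D \<ge> 0" and E: "E \<ge> 0"
    and small: "2 * E * q ^ i0 / (1 - q) \<le> 1 / 2"
    and step: "\<And>j. j > i0 \<Longrightarrow> T (j + 1) \<le> D * T i0 + E * S j"
    and T0: "T i0 \<le> M" "T (i0 + 1) \<le> M" and M: "M \<ge> 0"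
  shows "j \<ge> i0 \<Longrightarrow> T j \<le> (2 * D + 1) * M" "j \<ge> i0 \<Longrightarrow> S j \<le> (2 * D + 1) * M * (2 * q ^ i0 / (1 - q))"
proof -
  define B where "B = (2 * D + 1) * M"
  have B: "B \<ge> M" "B \<ge> 0" "2 * D * M \<le> B" using D M by (auto simp: B_def algebra_simps)
  have SB: "S j \<le> B * (2 * q ^ i0 / (1 - q))" if j: "j \<ge> i0" and le: "\<And>i. i0 \<le> i \<Longrightarrow> i < j \<Longrightarrow> T i \<le> B" for j
  proof -
    have "S j \<le> (\<Sum>k=i0+1..j. \<Sum>i=i0..k-1. \<beta> ^ (k - 1 - i) * q ^ i * B)"
      unfolding S_def using \<beta> q le by (intro sum_mono mult_left_mono) auto
    also have "\<dots> = B * (\<Sum>k=i0+1..j. \<Sum>i=i0..k-1. \<beta> ^ (k - 1 - i) * q ^ i)"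
      by (simp add: sum_distrib_left mult.commute)
    also have "\<dots> \<le> B * (2 * q ^ i0 / (1 - q))" by (intro mult_left_mono double_geometric_sum \<beta> q j B)
    finally show ?thesis .
  qed
  have TB: "T j \<le> B" if "j \<ge> i0" for j
    using that
  proof (induction j rule: less_induct)
    case (less j)
    consider "j = i0" | "j = i0 + 1" | l where "j = l + 1" "l > i0"
    proof -
      assume a: "j = i0 \<Longrightarrow> thesis" "j = i0 + 1 \<Longrightarrow> thesis" "\<And>l. j = l + 1 \<Longrightarrow> l > i0 \<Longrightarrow> thesis"
      show thesis
      proof (cases "j \<le> i0 + 1")
        case True then show ?thesis using a(1,2) less.prems by linarith
      next
        case False then show ?thesis using a(3)[of "j - 1"] by auto
      qed
    qed
    then show ?case
    proof cases
      case 1 then show ?thesis using T0 B by simp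
    next
      case 2 then show ?thesis using T0 B by simp
    next
      case 3
      have "S l \<le> B * (2 * q ^ i0 / (1 - q))" using 3 less.IH by (intro SB) auto
      then have "E * S l \<le> E * (B * (2 * q ^ i0 / (1 - q)))" using E by (rule mult_left_mono)
      also have "\<dots> = B * (2 * E * q ^ i0 / (1 - q))" by simp
      also have "\<dots> \<le> B * (1 / 2)" using B small by (intro mult_left_mono) auto
      finally have "E * S l \<le> B / 2" by simp
      moreover have "D * T i0 \<le> D * M" using T0 D by (intro mult_left_mono) auto
      ultimately show ?thesis using step[of l] 3 B by simp
    qed
  qed
  show "j \<ge> i0 \<Longrightarrow> T j \<le> (2 * D + 1) * M" using TB by (simp add: B_def)
  show "j \<ge> i0 \<Longrightarrow> S j \<le> (2 * D + 1) * M * (2 * q ^ i0 / (1 - q))" using SB TB by (simp add: B_def)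
qed

text \<open>
  The last claim is the absorption condition. By the definition of \<open>j0\<close> the exponent \<open>s = j0 \<theta> - 6 d / p\<close> is
  positive, the numerator is a multiple of \<open>\<mu>\<^sup>s\<close>, and the third entry in the minimum defining \<open>mu_star\<close> is
  chosen such that it is small enough. There \<open>\<mu> \<le> 1/6\<close> is used to replace \<open>\<mu>\<^sup>\<theta>\<close> by \<open>6\<^bsup>-\<theta>\<^esup>\<close> in the
  denominator.
\<close>

lemma mu0_bounds:
  fixes K :: osc_consts and d :: nat and p :: real
  assumes K: "0 < al K" "al K < 1" "C0 K > 1" "C1 K > 0" "Ct1 K > 0" "Cb1 K > 1" "Cb2 K > 0"
    and p: "p > 1" and d: "d \<ge> 2"
  defines "\<mu> \<equiv> mu0 d p K" and "\<theta> \<equiv> theta p"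
  shows "0 < \<mu>" "\<mu> \<le> 2 / 3 * mu_min K" "\<mu> \<le> 1 / 6" "Cb1 K * \<mu> powr al K \<le> 1 / 2"
    "0 < \<theta>" "\<mu> powr \<theta> < 1" "j0 d p \<ge> 2"
    "2 * (Cb2 K * \<mu> powr (-6 * real d / p)) * (\<mu> powr \<theta>) ^ j0 d p / (1 - \<mu> powr \<theta>) \<le> 1 / 2"
proof -
  define s where "s = real (j0 d p) * \<theta> - 6 * real d / p"
  show \<theta>0: "0 < \<theta>" using p by (simp add: \<theta>_def theta_def)
  have mp: "min p 2 > 0" using p by auto
  have "real (j0 d p) > 6 * real d / min p 2"
  proof -
    have "6 * real d / min p 2 \<ge> 0" using mp by simp
    then have "real (nat \<lfloor>6 * real d / min p 2\<rfloor>) = of_int \<lfloor>6 * real d / min p 2\<rfloor>" by simp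
    then show ?thesis unfolding j0_def by simp linarith
  qed
  moreover have "6 * real d / min p 2 \<ge> 6"
  proof -
    have "6 * min p 2 \<le> 6 * real d" using d by (auto simp: min_def)
    then show ?thesis using mp by (simp add: pos_le_divide_eq)
  qed
  ultimately have j0: "real (j0 d p) > 6 * real d / min p 2" "real (j0 d p) > 6" by auto
  then show "j0 d p \<ge> 2" by linarith
  have "\<theta> = min p 2 / p" using p by (auto simp: \<theta>_def theta_def min_def field_simps)
  then have "6 * real d / min p 2 * \<theta> = 6 * real d / p" using mp by simp
  moreover have "6 * real d / min p 2 * \<theta> < real (j0 d p) * \<theta>" using j0 \<theta>0 by (intro mult_strict_right_mono) auto
  ultimately have s0: "s > 0" by (simp add: s_def)
  have six: "6 powr (- \<theta>) < (1::real)" using \<theta>0 powr_less_mono[of "- \<theta>" 0 "6::real"] by simp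
  define X where "X = (1 - 6 powr (- \<theta>)) / (4 * Cb2 K)"
  have X0: "X > 0" using six K by (simp add: X_def)
  have ms: "mu_star d p K = Min {2 / 3 * mu_min K, (2 * Cb1 K) powr (-1 / al K), X powr (1 / s), ((Cb1 K - 1) / (4 * Cb1 K * Cb2 K)) powr (1 / s)}"
    by (simp add: mu_star_def X_def s_def \<theta>_def Let_def)
  have mm: "mu_min K > 0" using K by (simp add: mu_min_def)
  have ms0: "mu_star d p K > 0" unfolding ms using mm K X0 by simp
  have \<mu>ms: "\<mu> \<le> mu_star d p K" by (simp add: \<mu>_def mu0_def)
  show \<mu>0: "0 < \<mu>" using ms0 K by (simp add: \<mu>_def mu0_def)
  have b: "\<mu> \<le> 2 / 3 * mu_min K" "\<mu> \<le> (2 * Cb1 K) powr (-1 / al K)" "\<mu> \<le> X powr (1 / s)"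
    using \<mu>ms unfolding ms by simp_all
  show "\<mu> \<le> 2 / 3 * mu_min K" by (rule b(1))
  have "mu_min K \<le> 1 / 4" by (simp add: mu_min_def)
  then show \<mu>6: "\<mu> \<le> 1 / 6" using b(1) by simp
  have "\<mu> powr al K \<le> ((2 * Cb1 K) powr (-1 / al K)) powr al K" using b(2) K \<mu>0 by (intro powr_mono2) auto
  also have "\<dots> = inverse (2 * Cb1 K)" using K by (intro powr_root_cancel) auto
  finally show "Cb1 K * \<mu> powr al K \<le> 1 / 2" using K by (simp add: field_simps)
  have "\<mu> powr \<theta> \<le> (1 / 6) powr \<theta>" using \<mu>6 \<mu>0 \<theta>0 by (intro powr_mono2) auto
  also have "(1 / 6) powr \<theta> = (6::real) powr (- \<theta>)" by (simp add: powr_divide powr_minus_divide)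
  finally have q: "\<mu> powr \<theta> \<le> 6 powr (- \<theta>)" .
  with six show q1: "\<mu> powr \<theta> < 1" by simp
  have "\<mu> powr s \<le> (X powr (1 / s)) powr s" using b(3) \<mu>0 s0 by (intro powr_mono2) auto
  also have "\<dots> = X" using X0 s0 by (intro powr_root_cancel) auto
  finally have \<mu>s: "\<mu> powr s \<le> X" .
  have "Cb2 K * \<mu> powr (-6 * real d / p) * (\<mu> powr \<theta>) ^ j0 d p = Cb2 K * \<mu> powr s"
  proof -
    have "(\<mu> powr \<theta>) ^ j0 d p = \<mu> powr (\<theta> * real (j0 d p))" using \<mu>0 by (simp add: powr_powr[symmetric] powr_realpow)
    then have "\<mu> powr (-6 * real d / p) * (\<mu> powr \<theta>) ^ j0 d p = \<mu> powr s"
      by (simp add: powr_add[symmetric] s_def algebra_simps)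
    then show ?thesis by simp
  qed
  also have "\<dots> \<le> Cb2 K * X" using \<mu>s K by (intro mult_left_mono) auto
  also have "\<dots> = (1 - 6 powr (- \<theta>)) / 4" using K by (simp add: X_def)
  also have "\<dots> \<le> (1 - \<mu> powr \<theta>) / 4" using q by simp
  finally have "2 * (Cb2 K * \<mu> powr (-6 * real d / p)) * (\<mu> powr \<theta>) ^ j0 d p \<le> (1 - \<mu> powr \<theta>) * (1 / 2)" by simp
  then show "2 * (Cb2 K * \<mu> powr (-6 * real d / p)) * (\<mu> powr \<theta>) ^ j0 d p / (1 - \<mu> powr \<theta>) \<le> 1 / 2"
    using q1 by (simp add: pos_divide_le_eq)
qed

text \<open>
  An infinite oscillation makes the gradient bound trivial; otherwise the Caccioppoli inequality
  applies with the constant \<open>c\<close>.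
\<close>

lemma osc_on_cases:
  fixes u :: "'b::euclidean_space \<Rightarrow> real"
  assumes S: "S \<in> sets borel" "emeasure lborel S > 0"
  shows "osc_on S u = \<infinity> \<or> (\<exists>M c. osc_on S u = ereal M \<and> M \<ge> 0 \<and> (AE x in lborel. x \<in> S \<longrightarrow> \<bar>u x - c\<bar> \<le> M))"
proof -
  define a where "a = esssup (restrict_space lborel S) (\<lambda>x. ereal (u x))"
  define b where "b = esssup (restrict_space lborel S) (\<lambda>x. - ereal (u x))"
  have osc: "osc_on S u = a - (- b)" by (simp add: osc_on_def a_def b_def)
  have AES: "(AE x in restrict_space lborel S. Q x) \<longleftrightarrow> (AE x in lborel. x \<in> S \<longrightarrow> Q x)" for Q
    using S by (subst AE_restrict_space_iff) auto
  have ua: "AE x in lborel. x \<in> S \<longrightarrow> ereal (u x) \<le> a"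
    using esssup_AE[of "\<lambda>x. ereal (u x)" "restrict_space lborel S"] unfolding AES a_def[symmetric] .
  have ub: "AE x in lborel. x \<in> S \<longrightarrow> - ereal (u x) \<le> b"
    using esssup_AE[of "\<lambda>x. - ereal (u x)" "restrict_space lborel S"] unfolding AES b_def[symmetric] .
  have nF: False if "AE x in lborel. x \<notin> S"
    using that S by (subst (asm) AE_iff_measurable[of S]) auto
  have a': "a \<noteq> - \<infinity>"
  proof
    assume "a = - \<infinity>"
    then have "AE x in lborel. x \<notin> S" using ua by (auto elim!: eventually_mono)
    then show False by (rule nF)
  qed
  have b': "b \<noteq> - \<infinity>"
  proof
    assume "b = - \<infinity>"
    then have "AE x in lborel. x \<notin> S" using ub by (auto elim!: eventually_mono)
    then show False by (rule nF)
  qed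
  show ?thesis
  proof (cases "a = \<infinity> \<or> b = \<infinity>")
    case True
    then have "osc_on S u = \<infinity>" unfolding osc using a' b' by (cases a; cases b) auto
    then show ?thesis ..
  next
    case False
    then obtain x y where xy: "a = ereal x" "b = ereal y" using a' b' by (cases a; cases b) auto
    have ae: "AE z in lborel. z \<in> S \<longrightarrow> \<bar>u z - (- y)\<bar> \<le> x + y"
      using ua ub by eventually_elim (auto simp: xy)
    have "x + y \<ge> 0"
    proof (rule ccontr)
      assume "\<not> x + y \<ge> 0"
      then have "AE z in lborel. z \<notin> S" using ae by (auto elim!: eventually_mono)
      then show False by (rule nF)
    qed
    with ae show ?thesis unfolding osc xy by (intro disjI2 exI[of _ "x + y"] exI[of _ "- y"]) auto
  qed
qed

text \<open>
  The equation is about the values in the neck only; so a solution can be set to 0 elsewhere, as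
  \<open>extended_gradient\<close> requires.
\<close>

lemma p_laplace_solution_cong:
  assumes sol: "p_laplace_solution p R0 g \<epsilon> u G"
    and u: "\<And>x. x \<in> neck g \<epsilon> 0 (2 * R0) \<Longrightarrow> u' x = u x" and G: "\<And>x. x \<in> neck g \<epsilon> 0 (2 * R0) \<Longrightarrow> G' x = G x"
  shows "p_laplace_solution p R0 g \<epsilon> u' G'"
proof -
  let ?S = "neck g \<epsilon> 0 (2 * R0)"
  have si: "set_integrable lborel K f \<longleftrightarrow> set_integrable lborel K f'" if "K \<subseteq> ?S" "\<And>x. x \<in> ?S \<Longrightarrow> f x = f' x" for K and f f' :: "_ \<Rightarrow> 'c::euclidean_space"
    using that by (intro set_integrable_cong refl) auto
  have li: "set_lebesgue_integral lborel ?S f = set_lebesgue_integral lborel ?S f'" if "\<And>x. x \<in> ?S \<Longrightarrow> f x = f' x" for f f' :: "_ \<Rightarrow> real"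
    unfolding set_lebesgue_integral_def
  proof (rule Bochner_Integration.integral_cong[OF refl])
    fix x show "indicat_real ?S x *\<^sub>R f x = indicat_real ?S x *\<^sub>R f' x" by (cases "x \<in> ?S") (simp_all add: that)
  qed
  have bm: "set_borel_measurable lborel ?S f \<longleftrightarrow> set_borel_measurable lborel ?S f'" if "\<And>x. x \<in> ?S \<Longrightarrow> f x = f' x" for f f' :: "_ \<Rightarrow> 'c::euclidean_space"
  proof -
    have "(\<lambda>x. indicat_real ?S x *\<^sub>R f x) = (\<lambda>x. indicat_real ?S x *\<^sub>R f' x)"
    proof
      fix x show "indicat_real ?S x *\<^sub>R f x = indicat_real ?S x *\<^sub>R f' x" by (cases "x \<in> ?S") (simp_all add: that)
    qed
    then show ?thesis unfolding set_borel_measurable_def by (simp only:)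
  qed
  have W: "W1p p ?S u G" using sol by (simp add: p_laplace_solution_def)
  have "Lp_on p ?S u'" "Lp_on p ?S G'"
    using W u G bm[of u' u] bm[of G' G] si[of ?S "\<lambda>x. norm (u' x) powr p" "\<lambda>x. norm (u x) powr p"]
      si[of ?S "\<lambda>x. norm (G' x) powr p" "\<lambda>x. norm (G x) powr p"]
    by (simp_all add: W1p_def Lp_on_def)
  moreover have "weak_gradient ?S u' G'"
  proof -
    have w: "weak_gradient ?S u G" using W by (simp add: W1p_def)
    have 1: "set_integrable lborel K u' \<and> set_integrable lborel K G'" if "compact K \<and> K \<subseteq> ?S" for K
      using w that si[of K u' u] si[of K G' G] u G unfolding weak_gradient_def by blast
    have 2: "(LBINT x:?S. u' x * frechet_derivative \<phi> (at x) b) = (LBINT x:?S. u x * frechet_derivative \<phi> (at x) b)"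
      "(LBINT x:?S. (G' x \<bullet> b) * \<phi> x) = (LBINT x:?S. (G x \<bullet> b) * \<phi> x)" for \<phi> b
      by (rule li; simp add: u G)+
    show ?thesis using w 1 unfolding weak_gradient_def 2 by blast
  qed
  ultimately have W': "W1p p ?S u' G'" by (simp add: W1p_def)
  have eq: "(LBINT x:?S. norm (G' x) powr (p - 2) * (G' x \<bullet> H x)) = (LBINT x:?S. norm (G x) powr (p - 2) * (G x \<bullet> H x))" for H
    by (rule li) (simp add: G)
  show ?thesis unfolding p_laplace_solution_def eq
    by (rule conjI[OF W' conjunct2[OF sol[unfolded p_laplace_solution_def]]])
qed

text \<open>
  Estimate (d) in the form in which \<open>iteration_bound\<close> consumes it. The oscillations \<open>\<phi> k\<close> are nonnegative and
  are dropped.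
\<close>

lemma estimate_d_apply:
  fixes g :: "'a::euclidean_space geometry" and m p \<kappa>1 \<kappa>3 \<mu> \<epsilon> :: real and x0 :: "'a \<times> real"
    and j1 i0 j :: nat and G Gt :: "'a \<times> real \<Rightarrow> 'a \<times> real"
  defines "\<delta>0 \<equiv> delta g \<epsilon> (fst x0)" and "d \<equiv> real DIM('a \<times> real)"
  defines "r \<equiv> rad m \<kappa>1 \<kappa>3 \<mu> \<delta>0"
  defines "T \<equiv> \<lambda>k. if k \<le> j1 then Lp_mean p (ball 0 (13 * r k)) Gt else Lp_mean p (Omega_ball g \<epsilon> x0 (3 * r k)) G"
    and "\<omega> \<equiv> \<lambda>k. if k \<le> j1 then avg (ball 0 (13 * r k)) Gt else avg (Omega_ball g \<epsilon> x0 (r k)) G"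
  assumes e: "estimate_d K m p \<kappa>1 \<kappa>3 R0 g \<epsilon> u G" and x0: "x0 \<in> neck g \<epsilon> 0 R0"
    and Gt: "is_grad_u_tilde R0 g \<epsilon> (fst x0) u Gt" and \<mu>: "0 < \<mu>" "\<mu> \<le> 2 / 3 * mu_min K"
    and j: "r j1 \<ge> \<delta>0 / 24" "\<delta>0 / 24 > r (j1 + 1)" "i0 \<le> j1" "i0 < j"
  shows "norm (\<omega> j) \<le> \<mu> powr (-5 * d / p) * (Cdim K * T i0 + Cb2 K *
      (\<Sum>k=i0+1..j. \<Sum>i=i0..k-1. (Cb1 K * \<mu> powr al K) ^ (k - 1 - i) * (\<mu> powr theta p) ^ i * T i))"
    "T (j + 1) \<le> Cdim K * \<mu> powr (-6 * d / p) * T i0 + Cb2 K * \<mu> powr (-6 * d / p) *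
      (\<Sum>k=i0+1..j. \<Sum>i=i0..k-1. (Cb1 K * \<mu> powr al K) ^ (k - 1 - i) * (\<mu> powr theta p) ^ i * T i)"
proof -
  define \<phi> where "\<phi> k = (if k \<le> j1 then mean_osc p (ball 0 (13 * r k)) Gt else mean_osc p (Omega_ball g \<epsilon> x0 (r k)) G)" for k
  have q: "(\<mu> powr theta p) ^ i = \<mu> powr (real i * theta p)" for i
    using \<mu>(1) powr_realpow[of "\<mu> powr theta p" i] by (simp add: powr_powr mult.commute)
  have \<mu>': "\<mu> \<in> {0<..2 / 3 * mu_min K}" using \<mu> by simp
  have raw: "norm (\<omega> j) + (\<Sum>k=i0..j. \<phi> k) \<le> \<mu> powr (-5 * d / p) * (Cdim K * T i0 + Cb2 K *
      (\<Sum>k=i0+1..j. \<Sum>i=i0..k-1. (Cb1 K * \<mu> powr al K) ^ (k - 1 - i) * \<mu> powr (real i * theta p) * T i)) \<and>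
    T (j + 1) \<le> Cdim K * \<mu> powr (-6 * d / p) * T i0 + Cb2 K * \<mu> powr (-6 * d / p) *
      (\<Sum>k=i0+1..j. \<Sum>i=i0..k-1. (Cb1 K * \<mu> powr al K) ^ (k - 1 - i) * \<mu> powr (real i * theta p) * T i)"
  proof -
    note inst = spec[OF spec[OF spec[OF bspec[OF mp[OF spec[OF bspec[OF e[unfolded estimate_d_def] x0]] Gt] \<mu>']]],
      of j1 i0 j, unfolded Let_def]
    show ?thesis
      unfolding T_def \<omega>_def \<phi>_def r_def \<delta>0_def d_def
      by (rule mp[OF inst]) (intro conjI j[unfolded r_def \<delta>0_def])
  qed
  have "(\<Sum>k=i0..j. \<phi> k) \<ge> 0"
    unfolding \<phi>_def mean_osc_def by (intro sum_nonneg) (auto simp: Lp_mean_nonneg)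
  with raw show "norm (\<omega> j) \<le> \<mu> powr (-5 * d / p) * (Cdim K * T i0 + Cb2 K *
      (\<Sum>k=i0+1..j. \<Sum>i=i0..k-1. (Cb1 K * \<mu> powr al K) ^ (k - 1 - i) * (\<mu> powr theta p) ^ i * T i))"
    unfolding q by linarith
  from raw show "T (j + 1) \<le> Cdim K * \<mu> powr (-6 * d / p) * T i0 + Cb2 K * \<mu> powr (-6 * d / p) *
      (\<Sum>k=i0+1..j. \<Sum>i=i0..k-1. (Cb1 K * \<mu> powr al K) ^ (k - 1 - i) * (\<mu> powr theta p) ^ i * T i)"
    unfolding q by blast
qed

section \<open>The gradient bound\<close>

definition cutoff_exponent :: "real \<Rightarrow> nat" where
  "cutoff_exponent p = nat \<lceil>p\<rceil> + 2"

text \<open>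
  This and \<open>sup_const\<close> are what the estimates produce. They involve \<open>d\<close>, \<open>p\<close> and the constants of the oscillation
  estimates, but nothing else about the geometry or the solution.
\<close>

definition first_scale_const :: "nat \<Rightarrow> real \<Rightarrow> osc_consts \<Rightarrow> real" where
  "first_scale_const d p K = (56 * 6 powr p * (4 / 3) ^ cutoff_exponent p * (unit_ball_vol (real (d - 1)) / unit_ball_vol (real d))
      * (1 / mu0 d p K ^ j0 d p) ^ (d - 1)) powr (1 / p) * (2 * real (cutoff_exponent p))"

definition sup_const :: "nat \<Rightarrow> real \<Rightarrow> osc_consts \<Rightarrow> real" where
  "sup_const d p K = (let \<mu> = mu0 d p K; q = \<mu> powr theta p; D = Cdim K * \<mu> powr (-6 * real d / p);
      E = Cb2 K * \<mu> powr (-6 * real d / p); M = D + E + 1 in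
    \<mu> powr (-5 * real d / p) * (Cdim K * M + Cb2 K * ((2 * D + 1) * M * (2 * q ^ j0 d p / (1 - q)))))"

context neck_geometry
begin

text \<open>
  The powers of \<open>\<delta>\<close> cancel: the number of cells is of order \<open>R/\<delta>\<close> and the volume of the neck of order \<open>\<delta> \<rho>\<^bsup>d-1\<^esup>\<close>, so the
  average over a ball of radius \<open>R\<close> is a multiple of \<open>(\<rho>/R)\<^bsup>d-1\<^esup> (M/\<rho>)\<^sup>p\<close>, and \<open>\<rho>/R\<close> is bounded.
\<close>

lemma first_scale_bound:
  fixes K :: osc_consts
  assumes p: "p > 1" and \<epsilon>: "\<epsilon> > 0" and x0: "x0 \<in> V" and bV: "ball x0 (rho \<epsilon> x0) \<subseteq> V"
    and R: "R > 0" and \<rho>R: "rho \<epsilon> x0 \<le> R * (1 / mu0 DIM('a \<times> real) p K ^ j0 DIM('a \<times> real) p)" and M: "M \<ge> 0"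
    and I: "(LBINT z:ball 0 R. norm (Gt z) powr p) \<le> 14 * (R / delta g \<epsilon> x0) * (2 * 6 powr p * (4 / 3) ^ cutoff_exponent p *
         ((2 * real (cutoff_exponent p) * M / rho \<epsilon> x0) powr p * measure lborel (neck g \<epsilon> x0 (rho \<epsilon> x0))))"
  shows "Lp_mean p (ball (0::'a \<times> real) R) Gt \<le> first_scale_const DIM('a \<times> real) p K * (M / rho \<epsilon> x0)"
proof -
  let ?d = "DIM('a \<times> real)" and ?\<rho> = "rho \<epsilon> x0" and ?n = "cutoff_exponent p" and ?\<delta> = "delta g \<epsilon> x0" and ?D = "DIM('a)"
  define w where "w = unit_ball_vol (real ?D)"
  define w' where "w' = unit_ball_vol (real ?d)"
  define y where "y = 1 / mu0 ?d p K ^ j0 ?d p"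
  define A where "A = 2 * real ?n * M / ?\<rho>"
  have w: "w > 0" "w' > 0" by (auto simp: w_def w'_def)
  have \<delta>: "?\<delta> > 0" by (rule delta_bounds(4)[OF x0 \<epsilon>])
  have \<rho>: "?\<rho> > 0" by (rule rho_pos[OF x0 \<epsilon>])
  have d: "?d = Suc ?D" by simp
  have A0: "A \<ge> 0" using M \<rho> by (simp add: A_def)
  have vol: "measure lborel (ball (0 :: 'a \<times> real) R) = w' * R ^ Suc ?D"
    using ball_measure(4)[OF R, of "0 :: 'a \<times> real"] by (simp add: w'_def)
  have vol0: "w' * R ^ Suc ?D > 0" using w R by simp
  have "14 * (R / ?\<delta>) * (2 * 6 powr p * (4 / 3) ^ ?n * (A powr p * measure lborel (neck g \<epsilon> x0 ?\<rho>)))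
      \<le> 14 * (R / ?\<delta>) * (2 * 6 powr p * (4 / 3) ^ ?n * (A powr p * (2 * ?\<delta> * (w * ?\<rho> ^ ?D))))"
    unfolding w_def using R \<delta> by (intro mult_left_mono measure_neck_le x0 \<epsilon> bV) auto
  also have "\<dots> = 56 * 6 powr p * (4 / 3) ^ ?n * w * ?\<rho> ^ ?D * R * A powr p" using \<delta> by (simp add: field_simps)
  also have "\<dots> \<le> 56 * 6 powr p * (4 / 3) ^ ?n * w * (R * y) ^ ?D * R * A powr p"
    using \<rho>R \<rho> w R by (intro mult_right_mono mult_left_mono power_mono) (auto simp: y_def)
  finally have "(LBINT z:ball 0 R. norm (Gt z) powr p) \<le> 56 * 6 powr p * (4 / 3) ^ ?n * w * (R * y) ^ ?D * R * A powr p"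
    using I by (simp add: A_def)
  then have "(LBINT z:ball 0 R. norm (Gt z) powr p) / (w' * R ^ Suc ?D)
    \<le> 56 * 6 powr p * (4 / 3) ^ ?n * w * (R * y) ^ ?D * R * A powr p / (w' * R ^ Suc ?D)"
    using vol0 by (intro divide_right_mono) auto
  also have "\<dots> = 56 * 6 powr p * (4 / 3) ^ ?n * (w / w') * y ^ ?D * A powr p"
    using R w by (simp add: power_mult_distrib field_simps)
  finally have a: "avg (ball 0 R) (\<lambda>z. norm (Gt z) powr p) \<le> 56 * 6 powr p * (4 / 3) ^ ?n * (w / w') * y ^ ?D * A powr p"
    unfolding avg_def vol by simp
  have a0: "avg (ball 0 R) (\<lambda>z. norm (Gt z) powr p) \<ge> 0"
    unfolding avg_def set_lebesgue_integral_def by (auto intro!: mult_nonneg_nonneg integral_nonneg_AE)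
  have "Lp_mean p (ball 0 R) Gt \<le> (56 * 6 powr p * (4 / 3) ^ ?n * (w / w') * y ^ ?D * A powr p) powr (1 / p)"
    unfolding Lp_mean_def using a a0 p by (intro powr_mono2) auto
  also have "\<dots> = (56 * 6 powr p * (4 / 3) ^ ?n * (w / w') * y ^ ?D) powr (1 / p) * (A powr p) powr (1 / p)"
    by (rule powr_mult)
  also have "(A powr p) powr (1 / p) = A" using A0 p by (cases "A = 0") (simp_all add: powr_root_cancel(3))
  finally show ?thesis by (simp add: first_scale_const_def A_def w_def w'_def y_def)
qed

text \<open>
  Estimate (d) is used twice. Starting at \<open>j0\<close> it gives a recursion for the \<open>T j\<close> with \<open>j \<ge> j0 + 2\<close>; the bound for
  \<open>T (j0 + 1)\<close> comes from starting at \<open>j0 - 1\<close>. The scales \<open>j0 - 1\<close> and \<open>j0\<close> are bounded by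
  \<open>first_scale_bound\<close>.
\<close>

lemma gradient_bound:
  fixes K :: osc_consts and Du :: "'a \<times> real \<Rightarrow> 'a \<times> real"
  defines "d \<equiv> DIM('a \<times> real)"
  assumes p: "p > 1" and K: "0 < al K" "al K < 1" "C0 K > 1" "C1 K > 0" "Ct1 K > 0" "Cb1 K > 1" "Cb2 K > 0" "Cdim K > 0"
    and \<epsilon>: "\<epsilon> > 0" "\<epsilon> \<le> \<kappa>3 * R0 powr m" "\<epsilon> < R0" "\<epsilon> \<le> (12 / 13 * ct * mu0 d p K ^ j0 d p) powr (m / (m - 1))"
    and R03: "R0 \<le> R03 d m p \<kappa>1 \<kappa>2 \<kappa>3 K"
    and x: "x \<in> neck g \<epsilon> 0 R0"
    and sol: "p_laplace_solution p R0 g \<epsilon> u G"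
    and u0: "\<And>x. x \<notin> neck g \<epsilon> 0 (2 * R0) \<Longrightarrow> u x = 0"
    and G0: "\<And>x. x \<notin> neck g \<epsilon> 0 (2 * R0) \<Longrightarrow> G x = 0"
    and e: "estimate_d K m p \<kappa>1 \<kappa>3 R0 g \<epsilon> u G"
    and Du: "continuous_on (neck g \<epsilon> 0 R0) Du" "AE y in lborel. y \<in> neck g \<epsilon> 0 R0 \<longrightarrow> Du y = G y"
    and M: "M \<ge> 0" and ae: "AE y in lborel. y \<in> neck g \<epsilon> (fst x) (rho \<epsilon> (fst x)) \<longrightarrow> \<bar>u y - c\<bar> \<le> M"
  shows "norm (Du x) \<le> sup_const d p K * (first_scale_const d p K * (M / rho \<epsilon> (fst x)))"
proof -
  let ?x = "fst x"
  define \<mu> where "\<mu> = mu0 d p K"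
  define J where "J = j0 d p"
  define \<delta> where "\<delta> = delta g \<epsilon> ?x"
  define \<rho> where "\<rho> = rho \<epsilon> ?x"
  have xR: "norm ?x < R0" using x by (simp add: neck_def)
  have xV: "?x \<in> V" using xR R0 by simp
  have \<delta>0: "\<delta> > 0" unfolding \<delta>_def by (rule delta_bounds(4)[OF xV \<epsilon>(1)])
  have \<rho>0: "\<rho> > 0" "\<rho> \<le> R0 / 3" unfolding \<rho>_def using rho_pos[OF xV \<epsilon>(1)] rho_le[OF xR \<epsilon>(1,2)] by auto
  have d2: "d \<ge> 2" by (simp add: d_def Suc_le_eq)
  note mu = mu0_bounds[OF K(1-7) p d2, folded \<mu>_def J_def]
  have bV: "ball ?x (rho \<epsilon> ?x) \<subseteq> V"
  proof
    fix y assume "y \<in> ball ?x (rho \<epsilon> ?x)"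
    then show "y \<in> V" using norm_triangle_sub[of y ?x] xR \<rho>0 R0 by (simp add: \<rho>_def dist_norm norm_minus_commute)
  qed
  define r where "r = rad m \<kappa>1 \<kappa>3 \<mu> \<delta>"
  have r: "r j = ct / 13 * \<delta> powr (1 / m) * \<mu> ^ j" for j by (simp add: r_def rad_def)
  have r13: "13 * r j = 3 * \<rho> * \<mu> ^ j" for j by (simp add: r \<rho>_def rho_def \<delta>_def)
  have muJ: "\<mu> ^ J > 0" using mu(1) by simp
  have rJ: "r J \<ge> \<delta> / 24"
    using first_scale_large[OF xR muJ refl _ \<epsilon>(1)] R03 \<epsilon>(4)
    unfolding R03_def r \<mu>_def J_def \<delta>_def by (simp add: mult_ac)
  have \<mu>1: "\<mu> < 1" using mu(3) by simp
  obtain j1 where j1: "j1 \<ge> J" "r j1 \<ge> \<delta> / 24" "r (j1 + 1) < \<delta> / 24"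
    using geometric_last_index[OF mu(1) \<mu>1, of "\<delta> / 24" "ct / 13 * \<delta> powr (1 / m)" J] rJ \<delta>0 unfolding r by auto
  obtain Gt where Gt: "is_grad_u_tilde R0 g \<epsilon> ?x u Gt"
    and GtI: "\<And>R n M c. R > 0 \<Longrightarrow> R \<le> rho \<epsilon> ?x / 2 \<Longrightarrow> 13 * delta g \<epsilon> ?x / 24 \<le> R \<Longrightarrow> real n \<ge> p \<Longrightarrow> n \<ge> 2 \<Longrightarrow> M \<ge> 0 \<Longrightarrow>
      (AE y in lborel. y \<in> neck g \<epsilon> ?x (rho \<epsilon> ?x) \<longrightarrow> \<bar>u y - c\<bar> \<le> M) \<Longrightarrow>
      (LBINT z:ball 0 R. norm (Gt z) powr p) \<le> 14 * (R / delta g \<epsilon> ?x) * (2 * 6 powr p * (4 / 3) ^ n *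
         ((2 * real n * M / rho \<epsilon> ?x) powr p * measure lborel (neck g \<epsilon> ?x (rho \<epsilon> ?x))))"
  proof (rule extended_gradient[OF p \<epsilon>(1,2) xR sol u0 G0], goal_cases)
    case (3 Gt) show ?case by (rule 3(1)[OF 3(2,3)])
  qed
  define Mt where "Mt = first_scale_const d p K * (M / \<rho>)"
  have fs0: "first_scale_const d p K \<ge> 0" by (simp add: first_scale_const_def)
  have Mt0: "Mt \<ge> 0" using fs0 M \<rho>0 by (simp add: Mt_def)
  \<comment> \<open>\<open>\<mu> \<le> 1/6\<close> gives \<open>13 r i = 3 \<rho> \<mu>\<^sup>i \<le> \<rho>/2\<close>, and \<open>i \<le> J\<close> gives \<open>r i \<ge> \<delta>/24\<close>\<close>
  have first: "Lp_mean p (ball 0 (13 * r i)) Gt \<le> Mt" if i: "1 \<le> i" "i \<le> J" for i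
  proof -
    have "\<mu> ^ i \<le> \<mu> ^ 1" using mu(1) \<mu>1 i by (intro power_decreasing) auto
    then have mi: "\<mu> ^ i \<le> 1 / 6" using mu(3) by simp
    have mi0: "\<mu> ^ i > 0" using mu(1) by simp
    have miJ: "\<mu> ^ J \<le> \<mu> ^ i" using mu(1) \<mu>1 i by (intro power_decreasing) auto
    have R0': "13 * r i > 0" unfolding r13 using \<rho>0 mi0 by simp
    have "3 * \<rho> * \<mu> ^ i \<le> 3 * \<rho> * (1 / 6)" using mi \<rho>0 by (intro mult_left_mono) auto
    then have R1: "13 * r i \<le> rho \<epsilon> ?x / 2" unfolding r13 \<rho>_def by simp
    have "r J \<le> r i" unfolding r using miJ ct(1) by (intro mult_left_mono) auto
    then have R2: "13 * delta g \<epsilon> ?x / 24 \<le> 13 * r i" using rJ by (simp add: \<delta>_def)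
    have n: "real (cutoff_exponent p) \<ge> p" "cutoff_exponent p \<ge> 2"
      using real_nat_ceiling_ge[of p] by (auto simp: cutoff_exponent_def)
    have "\<rho> * \<mu> ^ J \<le> \<rho> * \<mu> ^ i * 3" using miJ \<rho>0 mi0 by (simp add: mult_left_mono order_trans[OF mult_left_mono[OF miJ]])
    then have rR: "rho \<epsilon> ?x \<le> 13 * r i * (1 / mu0 d p K ^ j0 d p)"
      unfolding r13 using muJ by (simp add: \<rho>_def[symmetric] \<mu>_def[symmetric] J_def[symmetric] pos_le_divide_eq mult_ac)
    show ?thesis unfolding Mt_def \<rho>_def d_def
      by (rule first_scale_bound[OF p \<epsilon>(1) xV bV R0' rR[unfolded d_def] M GtI[OF R0' R1 R2 n M ae]])
  qed
  define T where "T k = (if k \<le> j1 then Lp_mean p (ball 0 (13 * r k)) Gt else Lp_mean p (Omega_ball g \<epsilon> x (3 * r k)) G)" for k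
  define \<omega> where "\<omega> k = (if k \<le> j1 then avg (ball 0 (13 * r k)) Gt else avg (Omega_ball g \<epsilon> x (r k)) G)" for k
  define \<beta> where "\<beta> = Cb1 K * \<mu> powr al K"
  define q where "q = \<mu> powr theta p"
  define S where "S i0 j = (\<Sum>k=i0+1..j. \<Sum>i=i0..k-1. \<beta> ^ (k - 1 - i) * q ^ i * T i)" for i0 j
  define D where "D = Cdim K * \<mu> powr (-6 * real d / p)"
  define E where "E = Cb2 K * \<mu> powr (-6 * real d / p)"
  have DE: "D \<ge> 0" "E \<ge> 0" using K by (auto simp: D_def E_def)
  have est: "norm (\<omega> j) \<le> \<mu> powr (-5 * real d / p) * (Cdim K * T i0 + Cb2 K * S i0 j)"
      "T (j + 1) \<le> D * T i0 + E * S i0 j" if "i0 \<le> j1" "i0 < j" for i0 j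
    unfolding T_def \<omega>_def S_def \<beta>_def q_def D_def E_def r_def \<delta>_def d_def
    by (rule estimate_d_apply[OF e x Gt mu(1,2) j1(2,3)[unfolded r_def \<delta>_def] that])+
  have J1: "J - 1 + 1 = J" "1 \<le> J - 1" "J - 1 \<le> j1" using mu(7) j1(1) by auto
  have T1: "T (J - 1) \<le> Mt" "T J \<le> Mt" using first[of "J - 1"] first[of J] J1 j1(1) by (auto simp: T_def)
  have T0: "T k \<ge> 0" for k by (simp add: T_def Lp_mean_nonneg)
  have q: "0 < q" "q < 1" using mu(1,6) by (auto simp: q_def)
  have \<beta>: "0 \<le> \<beta>" "\<beta> \<le> 1 / 2" using mu(1,4) K by (auto simp: \<beta>_def)
  have T2: "T (J + 1) \<le> (D + E) * Mt"
  proof -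
    have "S (J - 1) J = q ^ (J - 1) * T (J - 1)"
      unfolding S_def using J1 by (simp add: J1(1))
    also have "\<dots> \<le> 1 * T (J - 1)" using q T0 by (intro mult_right_mono power_le_one) auto
    finally have S1: "S (J - 1) J \<le> Mt" using T1 by simp
    have "T (J + 1) \<le> D * T (J - 1) + E * S (J - 1) J" using est(2)[of "J - 1" J] J1 by simp
    also have "\<dots> \<le> D * Mt + E * Mt" using DE T1 S1 by (intro add_mono mult_left_mono) auto
    finally show ?thesis by (simp add: algebra_simps)
  qed
  define Mm where "Mm = (D + E + 1) * Mt"
  have Mm: "Mt \<le> Mm" "(D + E) * Mt \<le> Mm" "Mm \<ge> 0" using DE Mt0 by (auto simp: Mm_def algebra_simps)
  have small: "2 * E * q ^ J / (1 - q) \<le> 1 / 2" using mu(8) by (simp add: E_def q_def)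
  have SJ: "S J j \<le> (2 * D + 1) * Mm * (2 * q ^ J / (1 - q))" if "j \<ge> J" for j
    unfolding S_def
    by (rule iteration_bound(2)[OF \<beta> q DE small _ _ _ Mm(3) that])
      (use est(2)[of J] j1(1) T1 T2 Mm in \<open>auto simp: S_def\<close>)
  define B where "B = \<mu> powr (-5 * real d / p) * (Cdim K * Mm + Cb2 K * ((2 * D + 1) * Mm * (2 * q ^ J / (1 - q))))"
  have \<omega>B: "norm (\<omega> j) \<le> B" if "j > J" for j
  proof -
    have "norm (\<omega> j) \<le> \<mu> powr (-5 * real d / p) * (Cdim K * T J + Cb2 K * S J j)"
      using est(1)[of J j] j1(1) that by simp
    also have "\<dots> \<le> B" unfolding B_def
      using K T1 Mm SJ[of j] that by (intro mult_left_mono add_mono) auto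
    finally show ?thesis .
  qed
  have "sup_const d p K * Mt = B"
    unfolding sup_const_def Let_def B_def Mm_def D_def E_def q_def \<mu>_def J_def by (simp add: algebra_simps)
  \<comment> \<open>once the ball of radius \<open>r k\<close> around \<open>x\<close> lies in \<open>\<Omega>\<close>, \<open>\<omega> k\<close> is the average of \<open>G\<close> over that ball\<close>
  have oN: "open (neck g \<epsilon> 0 R0)" using R0 \<epsilon>(1) by (intro open_neck) auto
  have r0: "r j > 0" for j unfolding r using ct(1) \<delta>0 mu(1) by simp
  have rl: "r \<longlonglongrightarrow> 0"
  proof -
    have "(\<lambda>j. ct / 13 * \<delta> powr (1 / m) * \<mu> ^ j) \<longlonglongrightarrow> ct / 13 * \<delta> powr (1 / m) * 0"
      by (intro tendsto_intros LIMSEQ_power_zero) (use mu(1) \<mu>1 in auto)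
    then show ?thesis unfolding r[symmetric] by simp
  qed
  have mG: "set_borel_measurable lborel (neck g \<epsilon> 0 R0) G"
  proof -
    have "Lp_on p (neck g \<epsilon> 0 (2 * R0)) G" using sol by (simp add: p_laplace_solution_def W1p_def)
    moreover have "(\<lambda>y. indicat_real (neck g \<epsilon> 0 (2 * R0)) y *\<^sub>R G y) = G"
    proof
      fix y show "indicat_real (neck g \<epsilon> 0 (2 * R0)) y *\<^sub>R G y = G y" using G0[of y] by (cases "y \<in> neck g \<epsilon> 0 (2 * R0)") auto
    qed
    ultimately have "G \<in> borel_measurable lborel" by (simp add: Lp_on_def set_borel_measurable_def)
    then show ?thesis unfolding set_borel_measurable_def using oN by (intro borel_measurable_scaleR borel_measurable_indicator) auto
  qed
  have lim: "(\<lambda>k. avg (ball x (r k)) G) \<longlonglongrightarrow> Du x"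
    by (rule avg_ball_tendsto[OF oN x Du mG r0 rl])
  have xO: "x \<in> Omega g \<epsilon>" using neck_subset_Omega[OF \<epsilon>(1,3)] x by auto
  obtain s where s: "s > 0" "ball x s \<subseteq> Omega g \<epsilon>" using openE[OF open_Omega xO] by blast
  have "eventually (\<lambda>k. r k < s) sequentially" using order_tendstoD(2)[OF rl s(1)] .
  moreover have "eventually (\<lambda>k. k > j1) sequentially" by (rule eventually_gt_at_top)
  ultimately have "eventually (\<lambda>k. norm (avg (ball x (r k)) G) \<le> B) sequentially"
  proof eventually_elim
    fix k assume k: "r k < s" "k > j1"
    have "ball x (r k) \<subseteq> Omega g \<epsilon>" using subset_ball[of "r k" s x] k s by auto
    then have "Omega_ball g \<epsilon> x (r k) = ball x (r k)" by (auto simp: Omega_ball_def)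
    then have "\<omega> k = avg (ball x (r k)) G" using k by (simp add: \<omega>_def)
    then show "norm (avg (ball x (r k)) G) \<le> B" using \<omega>B[of k] k j1(1) by simp
  qed
  then have "norm (Du x) \<le> B"
    by (rule tendsto_upperbound[OF tendsto_norm[OF lim]]) simp
  then show ?thesis using \<open>sup_const d p K * Mt = B\<close> by (simp add: Mt_def \<rho>_def)
qed

end

theorem theorem1p1:
  fixes m p \<kappa>1 \<kappa>3 \<kappa>4 :: real and K :: osc_consts
  assumes "m \<ge> 2" and "p > 1" and "\<kappa>1 > 0" and "\<kappa>3 > 0" and "\<kappa>4 > 0"
    and "oscillation_constants TYPE('a::euclidean_space) m p \<kappa>1 \<kappa>3 \<kappa>4 K"
  shows "\<exists>C>0. \<forall>\<kappa>2>0. \<forall>R0>0. \<forall>g :: 'a geometry.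
     admissible m \<kappa>1 \<kappa>2 \<kappa>3 \<kappa>4 R0 g \<and>
     R0 \<le> Min {R01 m \<kappa>1 \<kappa>2 \<kappa>3,
               R02 DIM('a \<times> real) m \<kappa>2 \<kappa>3 \<kappa>4,
               R03 DIM('a \<times> real) m p \<kappa>1 \<kappa>2 \<kappa>3 K} \<longrightarrow>
     (\<exists>\<epsilon>0>0. \<forall>\<epsilon>. 0 < \<epsilon> \<and> \<epsilon> < \<epsilon>0 \<longrightarrow>
        (\<forall>(u :: 'a \<times> real \<Rightarrow> real) G. p_laplace_solution p R0 g \<epsilon> u G \<longrightarrow>
           (\<exists>Du. continuous_on (neck g \<epsilon> 0 R0) Du \<and>
              (AE x in lborel. x \<in> neck g \<epsilon> 0 R0 \<longrightarrow> Du x = G x) \<and>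
              (\<forall>x\<in>neck g \<epsilon> 0 R0.
                 ereal (norm (Du x))
                   \<le> ereal (C * (\<epsilon> + norm (fst x) powr m) powr (-1 / m))
                     * osc_on (neck g \<epsilon> (fst x) (ct0 m \<kappa>1 \<kappa>3 / 3 * delta g \<epsilon> (fst x) powr (1 / m))) u))))"
proof -
  note m = assms(1) and p = assms(2) and \<kappa>1 = assms(3) and \<kappa>3 = assms(4) and \<kappa>4 = assms(5)
  let ?d = "DIM('a \<times> real)"
  have K: "0 < al K" "al K < 1" "C0 K > 1" "C1 K > 0" "Ct1 K > 0" "Cb1 K > 1" "Cb2 K > 0" "Cdim K > 0"
    using assms(6) unfolding oscillation_constants_def by auto
  define X where "X = sup_const ?d p K * first_scale_const ?d p K * (3 / ct0 m \<kappa>1 \<kappa>3) * min 1 \<kappa>1 powr (-1 / m)"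
  \<comment> \<open>the maximum makes the constant positive, so that it can be multiplied with an infinite oscillation\<close>
  define C where "C = max 1 X"
  have C0: "C > 0" by (simp add: C_def)
  have d2: "?d \<ge> 2" by (simp add: Suc_le_eq)
  note mu = mu0_bounds[OF K(1-7) p d2]
  have ct: "ct0 m \<kappa>1 \<kappa>3 > 0" using ct0_bounds(1)[OF m \<kappa>1 \<kappa>3] .
  show ?thesis
  proof (rule exI[of _ C], intro conjI C0 allI impI)
    fix \<kappa>2 R0 :: real and g :: "'a geometry"
    assume \<kappa>2: "\<kappa>2 > 0" and R0: "R0 > 0"
      and adm: "admissible m \<kappa>1 \<kappa>2 \<kappa>3 \<kappa>4 R0 g \<and> R0 \<le> Min {R01 m \<kappa>1 \<kappa>2 \<kappa>3, R02 ?d m \<kappa>2 \<kappa>3 \<kappa>4, R03 ?d m p \<kappa>1 \<kappa>2 \<kappa>3 K}"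
    have R: "R0 \<le> R01 m \<kappa>1 \<kappa>2 \<kappa>3" "R0 \<le> R02 ?d m \<kappa>2 \<kappa>3 \<kappa>4" "R0 \<le> R03 ?d m p \<kappa>1 \<kappa>2 \<kappa>3 K"
      using adm by auto
    interpret ng: neck_geometry m \<kappa>1 \<kappa>2 \<kappa>3 \<kappa>4 R0 g
      by unfold_locales (use m \<kappa>1 \<kappa>2 \<kappa>3 \<kappa>4 R0 adm R02_slope[OF m \<kappa>3 R0 R(2)] in auto)
    define Y where "Y = 12 / 13 * ct0 m \<kappa>1 \<kappa>3 * mu0 ?d p K ^ j0 ?d p"
    have Y: "Y > 0" using ct mu(1) by (simp add: Y_def)
    have "R03 ?d m p \<kappa>1 \<kappa>2 \<kappa>3 K \<le> R0bar m \<kappa>1 \<kappa>2 \<kappa>3"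
      unfolding R03_def R0bar_def
    proof (intro mult_right_mono powr_mono2)
      have "mu0 ?d p K ^ j0 ?d p \<le> 1" using mu(1,3) by (intro power_le_one) auto
      then show "12 / 13 * ct0 m \<kappa>1 \<kappa>3 * mu0 ?d p K ^ j0 ?d p \<le> 12 / 13 * ct0 m \<kappa>1 \<kappa>3"
        using ct by (simp add: mult_left_le)
    qed (use Y m in \<open>auto simp: Y_def\<close>)
    then have Rb: "R0 \<le> R0bar m \<kappa>1 \<kappa>2 \<kappa>3" using R(3) by simp
    have "\<exists>\<epsilon>1>0. \<forall>\<epsilon>. 0 < \<epsilon> \<and> \<epsilon> < \<epsilon>1 \<longrightarrow> (\<forall>u G. p_laplace_solution p R0 g \<epsilon> u G \<longrightarrow>
        estimate_a K p R0 g \<epsilon> G \<and> estimate_d K m p \<kappa>1 \<kappa>3 R0 g \<epsilon> u G)"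
    proof -
      have "R0 \<le> min (R01 m \<kappa>1 \<kappa>2 \<kappa>3) (R02 ?d m \<kappa>2 \<kappa>3 \<kappa>4)"
        "R0 \<le> min (min (R01 m \<kappa>1 \<kappa>2 \<kappa>3) (R02 ?d m \<kappa>2 \<kappa>3 \<kappa>4)) (R0bar m \<kappa>1 \<kappa>2 \<kappa>3)"
        using R Rb by auto
      moreover have "\<exists>\<epsilon>1>0. \<forall>\<epsilon>. 0 < \<epsilon> \<and> \<epsilon> < \<epsilon>1 \<longrightarrow> (\<forall>u G. p_laplace_solution p R0 g \<epsilon> u G \<longrightarrow>
          (let d = ?d; R12 = min (R01 m \<kappa>1 \<kappa>2 \<kappa>3) (R02 d m \<kappa>2 \<kappa>3 \<kappa>4) in
              estimate_a K p R0 g \<epsilon> G \<and>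
              (R0 \<le> R12 \<longrightarrow> estimate_b K p R0 g \<epsilon> G) \<and>
              (R0 \<le> min R12 (R0bar m \<kappa>1 \<kappa>2 \<kappa>3) \<longrightarrow>
                 estimate_c K m p \<kappa>1 \<kappa>3 R0 g \<epsilon> u \<and> estimate_d K m p \<kappa>1 \<kappa>3 R0 g \<epsilon> u G)))"
        using assms(6) conjunct1[OF adm] \<kappa>2 R0 unfolding oscillation_constants_def by simp
      ultimately show ?thesis unfolding Let_def by (simp, blast)
    qed
    then obtain \<epsilon>1 where \<epsilon>1: "\<epsilon>1 > 0"
      "\<And>\<epsilon> u G. 0 < \<epsilon> \<Longrightarrow> \<epsilon> < \<epsilon>1 \<Longrightarrow> p_laplace_solution p R0 g \<epsilon> u G \<Longrightarrow> estimate_a K p R0 g \<epsilon> G"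
      "\<And>\<epsilon> u G. 0 < \<epsilon> \<Longrightarrow> \<epsilon> < \<epsilon>1 \<Longrightarrow> p_laplace_solution p R0 g \<epsilon> u G \<Longrightarrow> estimate_d K m p \<kappa>1 \<kappa>3 R0 g \<epsilon> u G"
      by blast
    define \<epsilon>0 where "\<epsilon>0 = min (min \<epsilon>1 R0) (min (\<kappa>3 * R0 powr m) (Y powr (m / (m - 1))))"
    have \<epsilon>0: "\<epsilon>0 > 0" using \<epsilon>1(1) R0 \<kappa>3 Y by (simp add: \<epsilon>0_def)
    show "\<exists>\<epsilon>0>0. \<forall>\<epsilon>. 0 < \<epsilon> \<and> \<epsilon> < \<epsilon>0 \<longrightarrow>
        (\<forall>(u :: 'a \<times> real \<Rightarrow> real) G. p_laplace_solution p R0 g \<epsilon> u G \<longrightarrow>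
           (\<exists>Du. continuous_on (neck g \<epsilon> 0 R0) Du \<and>
              (AE x in lborel. x \<in> neck g \<epsilon> 0 R0 \<longrightarrow> Du x = G x) \<and>
              (\<forall>x\<in>neck g \<epsilon> 0 R0.
                 ereal (norm (Du x))
                   \<le> ereal (C * (\<epsilon> + norm (fst x) powr m) powr (-1 / m))
                     * osc_on (neck g \<epsilon> (fst x) (ct0 m \<kappa>1 \<kappa>3 / 3 * delta g \<epsilon> (fst x) powr (1 / m))) u)))"
    proof (intro exI[of _ \<epsilon>0] conjI \<epsilon>0 allI impI)
      fix \<epsilon> :: real and u :: "'a \<times> real \<Rightarrow> real" and G
      assume e: "0 < \<epsilon> \<and> \<epsilon> < \<epsilon>0" and sol: "p_laplace_solution p R0 g \<epsilon> u G"
      then have \<epsilon>: "0 < \<epsilon>" "\<epsilon> < \<epsilon>1" "\<epsilon> < R0" "\<epsilon> \<le> \<kappa>3 * R0 powr m" "\<epsilon> \<le> Y powr (m / (m - 1))"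
        by (auto simp: \<epsilon>0_def)
      let ?N = "neck g \<epsilon> 0 (2 * R0)" and ?S = "neck g \<epsilon> 0 R0"
      have oN: "open ?N" and oS: "open ?S" using R0 \<epsilon>(1) by (auto intro!: ng.open_neck)
      have SN: "?S \<subseteq> ?N" using R0 by (auto simp: neck_def)
      have LG: "Lp_on p ?N G" using sol by (simp add: p_laplace_solution_def W1p_def)
      have ea: "estimate_a K p R0 g \<epsilon> G" by (rule \<epsilon>1(2)[OF \<epsilon>(1,2) sol])
      have C00: "C0 K \<ge> 0" using K(3) by simp
      obtain Du where Du: "continuous_on ?S Du" "AE x in lborel. x \<in> ?S \<longrightarrow> Du x = G x"
      proof (rule campanato_continuous_representative[OF oS SN oN p LG K(1) C00])
        fix x :: "'a \<times> real" and r \<rho> :: real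
        assume "x \<in> ?S" "ball x r \<subseteq> ?N" "0 < \<rho>" "\<rho> \<le> r"
        then show "mean_osc p (ball x \<rho>) G \<le> C0 K * (\<rho> / r) powr al K * mean_osc p (ball x r) G"
          using ea unfolding estimate_a_def by auto
      qed
      define u' where "u' x = (if x \<in> ?N then u x else 0)" for x
      define G' where "G' x = (if x \<in> ?N then G x else 0)" for x
      have sol': "p_laplace_solution p R0 g \<epsilon> u' G'"
        by (rule p_laplace_solution_cong[OF sol]) (auto simp: u'_def G'_def)
      have Du': "AE x in lborel. x \<in> ?S \<longrightarrow> Du x = G' x"
        using Du(2) by eventually_elim (use SN in \<open>auto simp: G'_def\<close>)
      show "\<exists>Du. continuous_on ?S Du \<and> (AE x in lborel. x \<in> ?S \<longrightarrow> Du x = G x) \<and>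
              (\<forall>x\<in>?S. ereal (norm (Du x)) \<le> ereal (C * (\<epsilon> + norm (fst x) powr m) powr (-1 / m))
                     * osc_on (neck g \<epsilon> (fst x) (ct0 m \<kappa>1 \<kappa>3 / 3 * delta g \<epsilon> (fst x) powr (1 / m))) u)"
      proof (intro exI[of _ Du] conjI Du ballI)
        fix x assume x: "x \<in> ?S"
        let ?x = "fst x" and ?A = "(\<epsilon> + norm (fst x) powr m) powr (-1 / m)"
        define \<rho> where "\<rho> = ng.rho \<epsilon> ?x"
        have \<rho>eq: "ct0 m \<kappa>1 \<kappa>3 / 3 * delta g \<epsilon> ?x powr (1 / m) = \<rho>" by (simp add: \<rho>_def ng.rho_def)
        have xR: "norm ?x < R0" using x by (simp add: neck_def)
        have xV: "?x \<in> ball 0 (2 * R0)" using xR R0 by simp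
        have \<rho>: "\<rho> > 0" "\<rho> \<le> R0 / 3" unfolding \<rho>_def using ng.rho_pos[OF xV \<epsilon>(1)] ng.rho_le[OF xR \<epsilon>(1,4)] by auto
        have bV: "ball ?x \<rho> \<subseteq> ball 0 (2 * R0)"
        proof
          fix y assume "y \<in> ball ?x \<rho>"
          then show "y \<in> ball 0 (2 * R0)" using norm_triangle_sub[of y ?x] xR \<rho> R0 by (simp add: dist_norm norm_minus_commute)
        qed
        have on: "open (neck g \<epsilon> ?x \<rho>)" by (rule ng.open_neck[OF bV \<epsilon>(1)])
        have xn: "x \<in> neck g \<epsilon> ?x \<rho>" using x \<rho> by (simp add: neck_def)
        have nN: "neck g \<epsilon> ?x \<rho> \<subseteq> ?N" using bV by (auto simp: neck_def dist_norm norm_minus_commute subset_iff)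
        have pos: "emeasure lborel (neck g \<epsilon> ?x \<rho>) > 0"
        proof -
          obtain s where s: "s > 0" "ball x s \<subseteq> neck g \<epsilon> ?x \<rho>" using openE[OF on xn] by blast
          have "0 < measure lborel (ball x s)" by (rule ball_measure(3)[OF s(1)])
          then have "0 < emeasure lborel (ball x s)" by (simp add: measure_def enn2real_positive_iff)
          also have "\<dots> \<le> emeasure lborel (neck g \<epsilon> ?x \<rho>)" using s(2) on by (intro emeasure_mono) auto
          finally show ?thesis .
        qed
        have A0: "?A > 0" using \<epsilon>(1) by (auto simp: add_pos_nonneg less_imp_neq[symmetric])
        from osc_on_cases[of "neck g \<epsilon> ?x \<rho>" u] on pos
        consider "osc_on (neck g \<epsilon> ?x \<rho>) u = \<infinity>"
          | M c where "osc_on (neck g \<epsilon> ?x \<rho>) u = ereal M" "M \<ge> 0" "AE y in lborel. y \<in> neck g \<epsilon> ?x \<rho> \<longrightarrow> \<bar>u y - c\<bar> \<le> M"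
          by auto
        then have "ereal (norm (Du x)) \<le> ereal (C * ?A) * osc_on (neck g \<epsilon> ?x \<rho>) u"
        proof cases
          case 1
          then show ?thesis using C0 A0 by simp
        next
          case (2 M c)
          have ae: "AE y in lborel. y \<in> neck g \<epsilon> ?x \<rho> \<longrightarrow> \<bar>u' y - c\<bar> \<le> M"
            using 2(3) by eventually_elim (use nN in \<open>auto simp: u'_def\<close>)
          have ed: "estimate_d K m p \<kappa>1 \<kappa>3 R0 g \<epsilon> u' G'" by (rule \<epsilon>1(3)[OF \<epsilon>(1,2) sol'])
          have "norm (Du x) \<le> sup_const ?d p K * (first_scale_const ?d p K * (M / \<rho>))"
            unfolding \<rho>_def
            by (rule ng.gradient_bound[OF p K \<epsilon>(1,4,3) _ R(3) x sol' _ _ ed Du(1) Du' 2(2) ae[unfolded \<rho>_def]])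
              (use \<epsilon>(5) in \<open>auto simp: u'_def G'_def Y_def\<close>)
          also have "\<dots> = sup_const ?d p K * first_scale_const ?d p K * (3 / ct0 m \<kappa>1 \<kappa>3) * M * delta g \<epsilon> ?x powr (-1 / m)"
          proof -
            have "delta g \<epsilon> ?x powr (-1 / m) = 1 / delta g \<epsilon> ?x powr (1 / m)"
              using powr_minus_divide[of "delta g \<epsilon> ?x" "1 / m"] by simp
            then show ?thesis using ct by (simp add: \<rho>eq[symmetric] field_simps)
          qed
          also have "\<dots> \<le> sup_const ?d p K * first_scale_const ?d p K * (3 / ct0 m \<kappa>1 \<kappa>3) * M * (min 1 \<kappa>1 powr (-1 / m) * ?A)"
          proof (rule mult_left_mono[OF ng.delta_powr_le[OF xV \<epsilon>(1)]])
            have "sup_const ?d p K \<ge> 0" unfolding sup_const_def Let_def using K mu(6) by (auto intro!: mult_nonneg_nonneg add_nonneg_nonneg)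
            moreover have "first_scale_const ?d p K \<ge> 0" by (simp add: first_scale_const_def)
            ultimately show "0 \<le> sup_const ?d p K * first_scale_const ?d p K * (3 / ct0 m \<kappa>1 \<kappa>3) * M" using ct 2(2) by simp
          qed
          also have "\<dots> = X * (?A * M)" by (simp add: X_def)
          also have "\<dots> \<le> C * (?A * M)" using A0 2(2) by (intro mult_right_mono) (auto simp: C_def)
          finally show ?thesis using 2(1) by (simp add: mult.assoc)
        qed
        then show "ereal (norm (Du x)) \<le> ereal (C * ?A) * osc_on (neck g \<epsilon> ?x (ct0 m \<kappa>1 \<kappa>3 / 3 * delta g \<epsilon> ?x powr (1 / m))) u"
          unfolding \<rho>eq .
      qed
    qed
  qed
qed

end
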